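(* Let $X'$ be the core of the inverse limit of a tent map $T_s$ with $s\in(\sqrt2,2)$ and let $\varphi_{\mathcal R}=\varphi_L$ be the embedding determined by $L=1^\infty$. In $\varphi_{\mathcal R}(X')$ the arc-component $\mathcal R$ is fully accessible and no other point of $\varphi_{\mathcal R}(X')$ is accessible. There exists one simple dense canal for every $\varphi_{\mathcal R}(X')$.
   Context: Tent inverse limits. For $s\in(\sqrt2,2]$ let $T=T_s\colon[0,1]\to[0,1]$, $T_s(t)=\min\{st,s(1-t)\}$, $c=\frac12$, and $X=\{x=(\pi_i(x))_{i\le0}\in[0,1]^{-\mathbb N_0}: T(\pi_i(x))=\pi_{i+1}(x)\ \forall i<0\}$ with the product topology. The core is $X'=\varprojlim([T^2(c),T(c)],T)\subset X$, an indecomposable continuum; $X=X'\cup\mathcal C$, where $\mathcal C$ is a ray containing the fixed point $(\ldots,0,0)$, and $X=X'$ iff $s=2$. $\mathcal R$ denotes the arc-component (union of all arcs through the point) in $X'$ of the point with two-sided itinerary $\ldots11.11\ldots$. Symbolics. $\#_1(w)$ is the number of ones of a word $w$. The kneading sequence is $\nu=c_1c_2\ldots$, $c_i=0$ if $T^i(c)\in[0,c]$, $c_i=1$ if $T^i(c)\in[c,1]$; if $T^n(c)=c$, $\nu$ is the smaller of $(c_1\ldots c_{n-1}0)^\infty,(c_1\ldots c_{n-1}1)^\infty$ in the parity-lexicographical order: for sequences (or words of equal length) first differing at index $k$, $s\prec t$ iff $s_k<t_k$ and $\#_1(s_1\ldots s_{k-1})$ is even, or $s_k>t_k$ and it is odd.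 A word $a_1\ldots a_n$ is admissible if $c_2\ldots c_{2+n-i}\preceq a_i\ldots a_n\preceq c_1\ldots c_{1+n-i}$ for all $i$. An infinite sequence is admissible if all its finite subwords are; additionally, sequences $0^\infty s_ks_{k+1}\ldots$ with $s_k=1$ and the part from $s_k$ on admissible (and the constant zero sequence) are called admissible; these correspond to points of $\mathcal C$. $X$ is identified with $\Sigma_{adm}/\!\sim$, where $\Sigma_{adm}$ is the set of admissible two-sided sequences $\ldots s_{-1}.s_0s_1\ldots$ and $s\sim t$ iff $s=t$ or they differ at exactly one index $k$ and $s_{k+1}s_{k+2}\ldots=t_{k+1}t_{k+2}\ldots=\nu$; the point $x$ corresponds to the class of $(x_i)$ with $x_i=0$ (resp. $1$) if $\pi_i(x)$ (for $i\le0$) or $T^i(\pi_0(x))$ (for $i>0$) lies in $[0,c]$ (resp. $[c,1]$). Using only sequences all of whose finite subwords are admissible gives $X'$. Left-infinite sequences are written $\overleftarrow s=\ldots s_2s_1$ ($s_j$ being the entry at index $-j$), and the basic arc $A(\overleftarrow s)$ is the set of points of $X$ having a representative with left part $\overleftarrow s$; it is an arc or a point. Embeddings. For an admissible left-infinite $L=\ldots l_2l_1$ put $\psi_L(\overleftarrow s)=\sum_{i\ge1}(-1)^{\#_1(l_i\ldots l_1)-\#_1(s_i\ldots s_1)}3^{-i}+\frac12$. The embedding $\varphi_L\colon X\to\mathbb R^2$ draws each basic arc $A(\overleftarrow s)$ as the horizontal segment $\pi_0(A(\overleftarrow s))\times\{\psi_L(\overleftarrow s)\}$; whenever two $\sim$-identified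 two-sided sequences differ only at an index $k<0$, the corresponding endpoints of the two basic arcs are joined by a semicircle, on the left if $\#_1$ of the word at indices $k+1,\ldots,-1$ is odd and on the right if it is even. $X'$ is embedded by restricting $\varphi_L$. Accessibility and prime ends. For a non-separating continuum $K\subset\mathbb R^2$, $a\in K$ is accessible if some arc $A\subset\mathbb R^2$ has $A\cap K=\{a\}$; an arc-component is fully accessible if all its points are accessible. A crosscut is an arc $Q\subset\mathbb R^2$ meeting $K$ exactly in its endpoints; $B_Q$ is the bounded component of $\mathbb R^2\setminus(K\cup Q)$. A chain is a sequence of pairwise disjoint crosscuts $Q_i$ with $\operatorname{diam}Q_i\to0$ and $B_{Q_{i+1}}\subset B_{Q_i}$; two chains are equivalent if each $B$-set of one contains a $B$-set of the other and conversely; equivalence classes are prime ends. For a prime end $P=[\{R_i\}]$, $\Pi(P)=\{\lim Q_i:\{Q_i\}\in P\text{ convergent}\}$ and $I(P)=\bigcap_i\mathrm{Cl}(B_{R_i})$. A simple dense canal is a prime end $P$ with $\Pi(P)=I(P)=K$ (with $K$ non-degenerate). Here $K=\varphi_{\mathcal R}(X')$. *)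

theory Defs
  imports "HOL-Analysis.Analysis"
begin

section \<open>Tent inverse limits\<close>

definition tent :: "real \<Rightarrow> real \<Rightarrow> real" where
  "tent s t = min (s * t) (s * (1 - t))"

text \<open>A point of the inverse limit is a backward orbit, indexed by \<open>n = -i\<close>: the
  coordinate \<open>\<pi>\<^sub>-\<^sub>n(x)\<close> is \<open>x n\<close>. The topology is the product topology, which is the
  library's topology on the function type \<open>nat \<Rightarrow> real\<close>.\<close>

definition tent_limit :: "real \<Rightarrow> (nat \<Rightarrow> real) set" where
  "tent_limit s = {x. (\<forall>n. x n \<in> {0..1}) \<and> (\<forall>n. tent s (x (Suc n)) = x n)}"

definition tent_core :: "real \<Rightarrow> (nat \<Rightarrow> real) set" where
  "tent_core s =
     {x \<in> tent_limit s. \<forall>n. x n \<in> {tent s (tent s (1/2)) .. tent s (1/2)}}"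

definition coord :: "real \<Rightarrow> (nat \<Rightarrow> real) \<Rightarrow> int \<Rightarrow> real" where
  "coord s x i = (if i \<le> 0 then x (nat (- i)) else (tent s ^^ nat i) (x 0))"


section \<open>Symbolic coding\<close>

text \<open>Symbols are booleans, \<open>True\<close> for 1 and \<open>False\<close> for 0 (so \<open>False < True\<close>); words are
  lists. In the parity-lexicographical order, words are only ever compared with words of equal
  length.\<close>

definition ones :: "bool list \<Rightarrow> nat" where
  "ones w = count_list w True"

definition word_less :: "bool list \<Rightarrow> bool list \<Rightarrow> bool" where
  "word_less u v \<longleftrightarrow> (\<exists>k < min (length u) (length v). take k u = take k v \<and>
     (if even (ones (take k u)) then u ! k < v ! k else v ! k < u ! k))"

definition word_le :: "bool list \<Rightarrow> bool list \<Rightarrow> bool" where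
  "word_le u v \<longleftrightarrow> u = v \<or> word_less u v"

definition seq_less :: "(nat \<Rightarrow> bool) \<Rightarrow> (nat \<Rightarrow> bool) \<Rightarrow> bool" where
  "seq_less u v \<longleftrightarrow> (\<exists>n. word_less (map u [0..<n]) (map v [0..<n]))"

text \<open>The itinerary of the critical point \<open>1/2\<close> with the symbol \<open>b\<close> written whenever the orbit
  returns to \<open>1/2\<close>. If \<open>1/2\<close> has period \<open>n\<close>, this is \<open>(c\<^sub>1\<dots>c\<^sub>n\<^sub>-\<^sub>1b)\<^sup>\<infinity>\<close>; otherwise \<open>b\<close> is irrelevant.\<close>

definition crit_itinerary :: "real \<Rightarrow> bool \<Rightarrow> nat \<Rightarrow> bool" where
  "crit_itinerary s b i =
     (let t = (tent s ^^ i) (1/2) in if t = 1/2 then b else t > 1/2)"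

text \<open>The kneading sequence: \<open>kneading s i\<close> is \<open>c\<^sub>i\<close> for \<open>i \<ge> 1\<close>; the value at \<open>0\<close> has no
  meaning and is never used.\<close>

definition kneading :: "real \<Rightarrow> nat \<Rightarrow> bool" where
  "kneading s =
     (if seq_less (\<lambda>j. crit_itinerary s False (Suc j)) (\<lambda>j. crit_itinerary s True (Suc j))
      then crit_itinerary s False else crit_itinerary s True)"

definition adm_word :: "real \<Rightarrow> bool list \<Rightarrow> bool" where
  "adm_word s w \<longleftrightarrow> (\<forall>i < length w.
     word_le (map (kneading s) [2..<2 + (length w - i)]) (drop i w) \<and>
     word_le (drop i w) (map (kneading s) [1..<1 + (length w - i)]))"

text \<open>The second and third set code the points of the ray that is attached to the core.\<close>

definition adm_sequences :: "real \<Rightarrow> (int \<Rightarrow> bool) set" where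
  "adm_sequences s =
     {a. \<forall>i j. adm_word s (map a [i..j])}
   \<union> {a. \<exists>k. a k \<and> (\<forall>i<k. \<not> a i) \<and> (\<forall>i j. k \<le> i \<longrightarrow> adm_word s (map a [i..j]))}
   \<union> {\<lambda>_. False}"

definition identified_at :: "real \<Rightarrow> int \<Rightarrow> (int \<Rightarrow> bool) \<Rightarrow> (int \<Rightarrow> bool) \<Rightarrow> bool" where
  "identified_at s k a b \<longleftrightarrow> a k \<noteq> b k \<and> (\<forall>i. i \<noteq> k \<longrightarrow> a i = b i) \<and>
     (\<forall>j\<ge>1. a (k + int j) = kneading s j)"

definition represents :: "real \<Rightarrow> (int \<Rightarrow> bool) \<Rightarrow> (nat \<Rightarrow> real) \<Rightarrow> bool" where
  "represents s a x \<longleftrightarrow> x \<in> tent_limit s \<and> a \<in> adm_sequences s \<and>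
     (\<forall>i. if a i then coord s x i \<in> {1/2..1} else coord s x i \<in> {0..1/2})"

text \<open>A left-infinite sequence \<open>\<dots>s\<^sub>2s\<^sub>1\<close> is the function \<open>n \<mapsto> s\<^sub>n\<^sub>+\<^sub>1\<close>; its entry \<open>s\<^sub>j\<close> is at
  index \<open>-j\<close> of a two-sided sequence.\<close>

definition left_part :: "(int \<Rightarrow> bool) \<Rightarrow> nat \<Rightarrow> bool" where
  "left_part a n = a (- int (Suc n))"

definition basic_arc :: "real \<Rightarrow> (nat \<Rightarrow> bool) \<Rightarrow> (nat \<Rightarrow> real) set" where
  "basic_arc s l = {x. \<exists>a. represents s a x \<and> left_part a = l}"

text \<open>The union of all arcs in \<open>S\<close> through \<open>p\<close>.\<close>

definition arc_comp :: "'a::topological_space set \<Rightarrow> 'a \<Rightarrow> 'a set" where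
  "arc_comp S p = \<Union>{path_image g | g. arc g \<and> path_image g \<subseteq> S \<and> p \<in> path_image g}"

definition arc_comp_R :: "real \<Rightarrow> (nat \<Rightarrow> real) set" where
  "arc_comp_R s =
     arc_comp (tent_core s) (THE x. x \<in> tent_core s \<and> represents s (\<lambda>_. True) x)"


section \<open>The planar drawings\<close>

definition psi :: "(nat \<Rightarrow> bool) \<Rightarrow> (nat \<Rightarrow> bool) \<Rightarrow> real" where
  "psi L l = (\<Sum>n. (-1) powi (int (ones (map L [0..<Suc n])) - int (ones (map l [0..<Suc n])))
                   / 3 ^ Suc n) + 1/2"

definition semicircle :: "bool \<Rightarrow> real \<Rightarrow> real \<Rightarrow> real \<Rightarrow> (real \<times> real) set" where
  "semicircle to_left p y z =
     {q \<in> sphere (p, (y + z) / 2) (\<bar>y - z\<bar> / 2). if to_left then fst q \<le> p else p \<le> fst q}"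

text \<open>The part of the plane drawing \<open>\<phi>\<^sub>L\<close> that belongs to a set \<open>Y\<close> of points of the inverse
  limit. Every representative of a point \<open>x\<close> contributes a point of a horizontal segment; if
  two representatives differ at a negative index, then \<open>x\<close> is a common end point of two basic
  arcs, and the whole semicircle joining the two corresponding end points of segments belongs
  to \<open>x\<close>. For \<open>Y\<close> the full inverse limit the first union consists of the segments
  \<open>\<pi>\<^sub>0(A(l)) \<times> {\<psi>\<^sub>L(l)}\<close>.\<close>

definition drawing :: "real \<Rightarrow> (nat \<Rightarrow> bool) \<Rightarrow> (nat \<Rightarrow> real) set \<Rightarrow> (real \<times> real) set" where
  "drawing s L Y =
     (\<Union>l. ((\<lambda>x. x 0) ` (basic_arc s l \<inter> Y)) \<times> {psi L l})
   \<union> \<Union>{semicircle (odd (ones (map a [k + 1..-1]))) (x 0)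
           (psi L (left_part a)) (psi L (left_part b)) | x a b k.
         x \<in> Y \<and> represents s a x \<and> represents s b x \<and> k < 0 \<and> identified_at s k a b}"

definition phi_R :: "real \<Rightarrow> (nat \<Rightarrow> real) set \<Rightarrow> (real \<times> real) set" where
  "phi_R s Y = drawing s (\<lambda>_. True) Y"


section \<open>Accessibility and prime ends\<close>

text \<open>These notions are meant for a non-separating plane continuum \<open>K\<close>.\<close>

definition accessible :: "(real \<times> real) set \<Rightarrow> real \<times> real \<Rightarrow> bool" where
  "accessible K a \<longleftrightarrow> (\<exists>g. arc g \<and> path_image g \<inter> K = {a})"

definition fully_accessible :: "(real \<times> real) set \<Rightarrow> (real \<times> real) set \<Rightarrow> bool" where
  "fully_accessible K A \<longleftrightarrow> (\<forall>a\<in>A. accessible K a)"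

definition crosscut :: "(real \<times> real) set \<Rightarrow> (real \<times> real) set \<Rightarrow> bool" where
  "crosscut K Q \<longleftrightarrow>
     (\<exists>g. arc g \<and> Q = path_image g \<and> Q \<inter> K = {pathstart g, pathfinish g})"

definition cut_domain :: "(real \<times> real) set \<Rightarrow> (real \<times> real) set \<Rightarrow> (real \<times> real) set" where
  "cut_domain K Q = (THE U. U \<in> components (- (K \<union> Q)) \<and> bounded U)"

definition crosscut_chain :: "(real \<times> real) set \<Rightarrow> (nat \<Rightarrow> (real \<times> real) set) \<Rightarrow> bool" where
  "crosscut_chain K Q \<longleftrightarrow> (\<forall>i. crosscut K (Q i)) \<and> disjoint_family Q \<and>
     (\<lambda>i. diameter (Q i)) \<longlonglongrightarrow> 0 \<and>
     (\<forall>i. cut_domain K (Q (Suc i)) \<subseteq> cut_domain K (Q i))"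

definition chain_equiv ::
  "(real \<times> real) set \<Rightarrow> ((nat \<Rightarrow> (real \<times> real) set) \<times> (nat \<Rightarrow> (real \<times> real) set)) set" where
  "chain_equiv K = {(Q, R). crosscut_chain K Q \<and> crosscut_chain K R \<and>
     (\<forall>i. \<exists>j. cut_domain K (R j) \<subseteq> cut_domain K (Q i)) \<and>
     (\<forall>i. \<exists>j. cut_domain K (Q j) \<subseteq> cut_domain K (R i))}"

definition prime_ends :: "(real \<times> real) set \<Rightarrow> (nat \<Rightarrow> (real \<times> real) set) set set" where
  "prime_ends K = {Q. crosscut_chain K Q} // chain_equiv K"

text \<open>Since the diameters in a chain tend to 0, a convergent chain converges to a point.\<close>

definition principal_set :: "(nat \<Rightarrow> (real \<times> real) set) set \<Rightarrow> (real \<times> real) set" where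
  "principal_set P = {a. \<exists>Q\<in>P. \<forall>e>0. \<forall>\<^sub>F i in sequentially. Q i \<subseteq> ball a e}"

text \<open>The intersection does not depend on the chosen representative.\<close>

definition impression ::
  "(real \<times> real) set \<Rightarrow> (nat \<Rightarrow> (real \<times> real) set) set \<Rightarrow> (real \<times> real) set" where
  "impression K P = (let R = (SOME R. R \<in> P) in \<Inter>i. closure (cut_domain K (R i)))"

definition simple_dense_canal ::
  "(real \<times> real) set \<Rightarrow> (nat \<Rightarrow> (real \<times> real) set) set \<Rightarrow> bool" where
  "simple_dense_canal K P \<longleftrightarrow> P \<in> prime_ends K \<and> principal_set P = K \<and> impression K P = K \<and>
     (\<exists>a\<in>K. \<exists>b\<in>K. a \<noteq> b)"

end

theory Submission
  imports Defs
begin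

text \<open>
  The arc component \<open>\<R>\<close> consists of the backward orbits that converge to the fixed point \<open>r\<close>; it is an
  injective image \<open>\<gamma>\<close> of the line, both of its ends and its complement are dense in \<open>K\<close>, and \<open>\<gamma> 0\<close>
  lies at the top of \<open>K\<close>. Near every point of \<open>K\<close> there are arbitrarily short segments that meet \<open>K\<close>
  only in their end points \<open>\<gamma> a\<close> and \<open>\<gamma> b\<close>, where \<open>a < 0 < b\<close>: such segments join neighbouring basic
  arcs whose codes end in \<open>1,0,1,1,\<dots>\<close> and \<open>0,1,0,1,1,\<dots>\<close> after a long common prefix, or the
  corresponding concentric semicircles. Such a cut and \<open>\<gamma>[a, b]\<close> bound a Jordan domain that contains the
  rest of \<open>K\<close>, because \<open>K\<close> accumulates at \<open>\<gamma> 0\<close> from below.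

  Points of \<open>\<gamma>\<close> are accessible from outside these Jordan domains. An arc that ends in a point of \<open>K\<close>
  off \<open>\<gamma>\<close> would have to enter every such domain, but it avoids the cuts that are very short and far from
  it. Points of \<open>K\<close> off \<open>\<gamma>\<close> are vertically accumulated from both sides, so \<open>K\<close> does not separate the plane;
  and nested cuts near the members of a dense sequence form a chain whose principal set and impression
  are \<open>K\<close>. For another canal of this kind, the cuts of either chain eventually separate the cuts of the other one
  from the outside, so the two chains are equivalent.\<close>

section \<open>Jordan curves in the plane\<close>

text \<open>The drawing is treated as a plane set throughout; no homeomorphism from the inverse
  limit is built. \<open>draw x\<close> collects everything drawn for \<open>x\<close>: a single
  point, or a set containing whole semicircles. Hence the arc-length parameter of \<R> cannot
  parametrize its drawing, and \<gamma> is glued from arcs between parameters whose orbits avoid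
  1/2. Disjointness of the sets \<open>draw x\<close> stands in for injectivity of the embedding.
  The choice L = 1^\<infinity> gives the code of the fixed point the maximal height 1. There the two
  sides of a loop can be told apart directly, which is why the cuts have to join parameters of
  opposite sign. The short cuts come from a gap in the symbolics: a code beginning with 0,0 lives
  only over points that are at least s T^3(c), whereas over the interval from T^3(c) to T^4(c) the
  neighbouring codes above and below are realized by orbits of \<R>. That this interval is
  non-empty, like the expansion behind the density statements, rests on s > sqrt 2.\<close>

definition pair_of :: "complex \<Rightarrow> real \<times> real" where
  "pair_of z = (Re z, Im z)"

text \<open>The Jordan curve theorem, Janiszewski's theorem and the theta curve lemma speak about
  \<open>complex\<close>; drawings lie in \<open>real \<times> real\<close>. The two norms agree, so
  \<open>cpx_of\<close> is an isometry and transfers open, connected and bounded sets as well as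
  \<open>inside\<close> and \<open>outside\<close>.\<close>

definition cpx_of :: "real \<times> real \<Rightarrow> complex" where
  "cpx_of p = Complex (fst p) (snd p)"

lemma pair_cpx [simp]: "pair_of (cpx_of p) = p" "cpx_of (pair_of z) = z"
  by (auto simp: pair_of_def cpx_of_def complex_eq_iff)

lemma dist_cpx_of [simp]: "dist (cpx_of p) (cpx_of q) = dist p q"
  by (simp add: cpx_of_def dist_norm cmod_def norm_prod_def)

lemma cont_pair_of: "continuous_on S pair_of"
  unfolding pair_of_def by (intro continuous_intros)

lemma cont_cpx_of: "continuous_on S cpx_of"
  by (rule continuous_onI) (use less_imp_le in \<open>auto intro!: exI\<close>)

lemma inj_cpx_of: "inj_on cpx_of S"
  by (metis inj_onI pair_cpx(1))

lemma image_pair_cpx [simp]: "pair_of ` cpx_of ` S = S" "cpx_of ` pair_of ` U = U"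
  by (simp_all add: image_image)

lemma cpx_of_Compl: "cpx_of ` (- S) = - cpx_of ` S"
  by (metis bij_betw_def bij_image_Compl_eq inj_cpx_of pair_cpx(2) surj_def)

lemma bounded_cpx_of: "bounded (cpx_of ` S) \<longleftrightarrow> bounded S"
  unfolding bounded_any_center[of "cpx_of ` S" "cpx_of 0"] bounded_any_center[of S 0] by simp

lemma open_cpx_of: "open (cpx_of ` S) \<longleftrightarrow> open S"
proof -
  have "open (cpx_of ` S)" if "open S" for S
  proof -
    have "cpx_of ` S = pair_of -` S" by (force intro: image_eqI[of _ cpx_of, OF pair_cpx(2)[symmetric]])
    then show ?thesis
      using continuous_open_preimage[OF cont_pair_of[of UNIV] open_UNIV that] by simp
  qed
  moreover have "open S" if "open (cpx_of ` S)"
    using continuous_open_preimage[OF cont_cpx_of[of UNIV] open_UNIV that]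
    by (simp add: inj_vimage_image_eq[OF inj_cpx_of])
  ultimately show ?thesis by blast
qed

lemma connected_cpx_of: "connected (cpx_of ` S) \<longleftrightarrow> connected S"
  by (metis cont_cpx_of cont_pair_of connected_continuous_image image_pair_cpx(1))

lemma connected_component_cpx_of:
  "connected_component (cpx_of ` S) (cpx_of a) (cpx_of b) \<longleftrightarrow> connected_component S a b"
proof -
  have "connected_component (cpx_of ` S) (cpx_of a) (cpx_of b)" if "connected_component S a b"
    using that unfolding connected_component_def
    by (meson connected_cpx_of image_eqI image_mono)
  moreover have "connected_component S a b" if hyp: "connected_component (cpx_of ` S) (cpx_of a) (cpx_of b)"
  proof -
    obtain U where "connected U" "U \<subseteq> cpx_of ` S" "cpx_of a \<in> U" "cpx_of b \<in> U"
      using hyp unfolding connected_component_def by blast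
    then have "connected (pair_of ` U)" "pair_of ` U \<subseteq> S" "a \<in> pair_of ` U" "b \<in> pair_of ` U"
      by (auto intro: connected_continuous_image[OF cont_pair_of] image_eqI[of _ pair_of, OF pair_cpx(1)[symmetric]])
    then show ?thesis unfolding connected_component_def by blast
  qed
  ultimately show ?thesis by blast
qed

lemma outside_cpx_of: "outside (cpx_of ` S) = cpx_of ` outside S"
proof -
  have eq: "connected_component_set (- cpx_of ` S) (cpx_of x) = cpx_of ` connected_component_set (- S) x" for x
  proof -
    have "y \<in> connected_component_set (- cpx_of ` S) (cpx_of x) \<longleftrightarrow> y \<in> cpx_of ` connected_component_set (- S) x" for y
      using connected_component_cpx_of[of "- S" x "pair_of y"]
      by (metis (no_types, lifting) cpx_of_Compl image_iff mem_Collect_eq pair_cpx)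
    then show ?thesis by blast
  qed
  have "y \<in> outside (cpx_of ` S) \<longleftrightarrow> y \<in> cpx_of ` outside S" for y
  proof -
    have "y \<in> cpx_of ` outside S \<longleftrightarrow> pair_of y \<in> outside S"
      by (metis image_iff pair_cpx)
    then show ?thesis
      using eq[of "pair_of y"] by (simp add: outside bounded_cpx_of)
  qed
  then show ?thesis by blast
qed

lemma inside_cpx_of: "inside (cpx_of ` S) = cpx_of ` inside S"
  by (metis (no_types, lifting) cpx_of_Compl image_Un inside_outside outside_cpx_of)

lemma Jordan_inside_outside_prod:
  fixes c :: "real \<Rightarrow> real \<times> real"
  assumes "simple_path c" "pathfinish c = pathstart c"
  shows "inside (path_image c) \<noteq> {}" "open (inside (path_image c))"
    "connected (inside (path_image c))" "open (outside (path_image c))"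
    "connected (outside (path_image c))" "bounded (inside (path_image c))"
    "\<not> bounded (outside (path_image c))"
    "path_image c \<subseteq> closure (inside (path_image c))" "path_image c \<subseteq> closure (outside (path_image c))"
proof -
  define d where "d = cpx_of \<circ> c"
  have "simple_path d"
    unfolding d_def using assms(1)
    by (metis cont_cpx_of inj_cpx_of simple_path_continuous_image)
  moreover have "pathfinish d = pathstart d"
    using assms(2) by (simp add: d_def pathfinish_def pathstart_def)
  ultimately have J: "inside(path_image d) \<noteq> {} \<and>
          open(inside(path_image d)) \<and>
          connected(inside(path_image d)) \<and>
          outside(path_image d) \<noteq> {} \<and>
          open(outside(path_image d)) \<and>
          connected(outside(path_image d)) \<and>
          bounded(inside(path_image d)) \<and>
          \<not> bounded(outside(path_image d)) \<and>
          inside(path_image d) \<inter> outside(path_image d) = {} \<and>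
          inside(path_image d) \<union> outside(path_image d) =
          - path_image d \<and>
          frontier(inside(path_image d)) = path_image d \<and>
          frontier(outside(path_image d)) = path_image d"
    by (rule Jordan_inside_outside)
  have pd: "path_image d = cpx_of ` path_image c"
    by (simp add: d_def path_image_compose)
  have cl: "pair_of ` closure (cpx_of ` A) \<subseteq> closure A" for A
    using continuous_image_closure_subset[OF cont_pair_of[of UNIV], of "cpx_of ` A"]
    by simp
  note J' = J[unfolded pd inside_cpx_of outside_cpx_of open_cpx_of connected_cpx_of bounded_cpx_of]
  show "inside (path_image c) \<noteq> {}" "open (inside (path_image c))"
    "connected (inside (path_image c))" "open (outside (path_image c))"
    "connected (outside (path_image c))" "bounded (inside (path_image c))"
    "\<not> bounded (outside (path_image c))" using J' by auto
  show "path_image c \<subseteq> closure (inside (path_image c))"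
  proof
    fix x assume "x \<in> path_image c"
    then have "cpx_of x \<in> closure (cpx_of ` inside (path_image c))"
      using J' by (metis DiffD1 frontier_def image_eqI)
    then show "x \<in> closure (inside (path_image c))" using cl by force
  qed
  show "path_image c \<subseteq> closure (outside (path_image c))"
  proof
    fix x assume "x \<in> path_image c"
    then have "cpx_of x \<in> closure (cpx_of ` outside (path_image c))"
      using J' by (metis DiffD1 frontier_def image_eqI)
    then show "x \<in> closure (outside (path_image c))" using cl by force
  qed
qed

lemma Janiszewski_prod:
  fixes a b :: "real \<times> real"
  assumes "compact S" "closed T" and conST: "connected (S \<inter> T)"
    and "connected_component (- S) a b" and "connected_component (- T) a b"
  shows "connected_component (- (S \<union> T)) a b"
proof -
  have 1: "compact (cpx_of ` S)" using assms(1) cont_cpx_of compact_continuous_image by blast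
  have 2: "closed (cpx_of ` T)" using assms(2) by (metis cpx_of_Compl open_Compl open_cpx_of closed_def)
  have 3: "connected (cpx_of ` S \<inter> cpx_of ` T)"
    by (metis conST connected_cpx_of image_Int inj_cpx_of)
  have "connected_component (- (cpx_of ` S \<union> cpx_of ` T)) (cpx_of a) (cpx_of b)"
    by (rule Janiszewski[OF 1 2 3])
       (metis assms(4,5) connected_component_cpx_of cpx_of_Compl)+
  then show ?thesis
    by (metis connected_component_cpx_of cpx_of_Compl image_Un)
qed

lemma split_inside_simple_closed_curve_prod:
  fixes c :: "real \<Rightarrow> real \<times> real"
  assumes sp: "simple_path c1" "simple_path c2" "simple_path c"
    and c1: "pathstart c1 = a" "pathfinish c1 = b"
    and c2: "pathstart c2 = a" "pathfinish c2 = b"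
    and c: "pathstart c = a" "pathfinish c = b"
    and "a \<noteq> b"
    and c1c2: "path_image c1 \<inter> path_image c2 = {a,b}"
    and c1c: "path_image c1 \<inter> path_image c = {a,b}"
    and c2c: "path_image c2 \<inter> path_image c = {a,b}"
    and ne: "path_image c \<inter> inside (path_image c1 \<union> path_image c2) \<noteq> {}"
  shows "inside (path_image c1 \<union> path_image c) \<union> inside (path_image c2 \<union> path_image c) \<union>
           (path_image c - {a,b}) = inside (path_image c1 \<union> path_image c2)"
proof -
  let ?f = cpx_of
  have pi: "path_image (?f \<circ> g) = ?f ` path_image g" for g
    by (simp add: path_image_compose)
  have spc: "simple_path (?f \<circ> g)" if "simple_path g" for g
    using that by (metis cont_cpx_of inj_cpx_of simple_path_continuous_image)
  have inters: "path_image (?f \<circ> g) \<inter> path_image (?f \<circ> h) = {?f a, ?f b}"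
    if "path_image g \<inter> path_image h = {a,b}" for g h
    using that unfolding pi by (metis image_Int image_empty image_insert inj_cpx_of)
  have "inside(path_image (?f \<circ> c1) \<union> path_image (?f \<circ> c)) \<union> inside(path_image (?f \<circ> c2) \<union> path_image (?f \<circ> c)) \<union>
           (path_image (?f \<circ> c) - {?f a,?f b}) = inside(path_image (?f \<circ> c1) \<union> path_image (?f \<circ> c2))"
  proof (rule split_inside_simple_closed_curve[of "?f \<circ> c1" "?f a" "?f b" "?f \<circ> c2" "?f \<circ> c"])
    show "?f a \<noteq> ?f b" using \<open>a \<noteq> b\<close> by (metis pair_cpx(1))
    show "path_image (?f \<circ> c) \<inter> inside (path_image (?f \<circ> c1) \<union> path_image (?f \<circ> c2)) \<noteq> {}"
      using ne unfolding pi by (metis image_Int image_Un image_is_empty inj_cpx_of inside_cpx_of)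
  qed (use sp spc c1 c2 c inters[OF c1c2] inters[OF c1c] inters[OF c2c] in
      \<open>auto simp: pathstart_def pathfinish_def\<close>)
  then have "?f ` (inside (path_image c1 \<union> path_image c) \<union> inside (path_image c2 \<union> path_image c) \<union>
           (path_image c - {a,b})) = ?f ` inside (path_image c1 \<union> path_image c2)"
    unfolding pi by (simp add: image_Un[symmetric] inside_cpx_of) (simp add: image_Un image_set_diff[OF inj_cpx_of])
  then show ?thesis using inj_cpx_of by (metis image_pair_cpx(1))
qed

text \<open>Concatenation over all integers: the cell from n to n + 1 is traversed by
  \<open>g n\<close>. It serves twice, for paths that shrink to a boundary point and for the line
  \<gamma>.\<close>

definition chain_path :: "(int \<Rightarrow> real \<Rightarrow> 'a) \<Rightarrow> real \<Rightarrow> 'a" where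
  "chain_path g u = g \<lfloor>u\<rfloor> (frac u)"

lemma chain_path_on_cell:
  assumes "\<And>n. pathfinish (g n) = pathstart (g (n + 1))" and "u \<in> {of_int n..of_int n + 1}"
  shows "chain_path g u = g n (u - of_int n)"
proof (cases "u = of_int n + 1")
  case True
  then have "\<lfloor>u\<rfloor> = n + 1" "frac u = 0" by (simp_all add: frac_def)
  then show ?thesis
    using assms(1)[of n] True by (simp add: chain_path_def pathfinish_def pathstart_def)
next
  case False
  then have "\<lfloor>u\<rfloor> = n" using assms(2) by (intro floor_unique) auto
  then show ?thesis by (simp add: chain_path_def frac_def)
qed

lemma continuous_chain_path:
  fixes g :: "int \<Rightarrow> real \<Rightarrow> 'a::topological_space"
  assumes path: "\<And>n. path (g n)" and link: "\<And>n. pathfinish (g n) = pathstart (g (n + 1))"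
  shows "continuous_on UNIV (chain_path g)"
proof -
  have cell: "continuous_on {of_int n..of_int n + 1} (chain_path g)" for n
  proof -
    have "continuous_on {of_int n..of_int n + 1} (g n \<circ> (\<lambda>u. u - of_int n))"
      by (intro continuous_on_compose continuous_intros continuous_on_subset[OF path[unfolded path_def]]) auto
    then show ?thesis
      by (rule continuous_on_eq) (simp add: chain_path_on_cell[where g = g, OF link])
  qed
  have "isCont (chain_path g) u" for u
  proof -
    let ?n = "\<lfloor>u\<rfloor>"
    have "continuous_on ({of_int (?n - 1)..of_int (?n - 1) + 1} \<union> {of_int ?n..of_int ?n + 1}) (chain_path g)"
      by (intro continuous_on_closed_Un cell closed_atLeastAtMost)
    then have "continuous_on {of_int ?n - 1<..<of_int ?n + 1} (chain_path g)"
      by (rule continuous_on_subset) auto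
    moreover have "u \<in> {of_int ?n - 1<..<of_int ?n + 1}" by simp linarith
    ultimately show ?thesis
      by (metis continuous_on_eq_continuous_at open_greaterThanLessThan)
  qed
  then show ?thesis by (simp add: continuous_at_imp_continuous_on)
qed

text \<open>Paths to boundary points are obtained by concatenating infinitely many shorter and shorter paths.\<close>

lemma path_to_boundary:
  fixes v :: "'a::real_normed_vector"
  assumes v: "v \<in> closure S" and ulc: "\<And>e. e > 0 \<Longrightarrow> \<exists>d>0. \<forall>x\<in>S \<inter> ball v d. \<forall>y\<in>S \<inter> ball v d.
      path_component (S \<inter> ball v e) x y"
  obtains h where "path h" "pathstart h \<in> S" "pathfinish h = v" "path_image h - {v} \<subseteq> S"
proof -
  have "\<forall>n::nat. \<exists>d>0. \<forall>x\<in>S \<inter> ball v d. \<forall>y\<in>S \<inter> ball v d.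
      path_component (S \<inter> ball v (1 / Suc n)) x y"
    using ulc by simp
  then obtain d where d: "\<And>n::nat. d n > 0"
    and dpc: "\<And>n x y. x \<in> S \<inter> ball v (d n) \<Longrightarrow> y \<in> S \<inter> ball v (d n) \<Longrightarrow> path_component (S \<inter> ball v (1 / Suc n)) x y"
    by metis
  \<comment> \<open>Taking minima places both \<open>x n\<close> and \<open>x (Suc n)\<close> within
    \<open>d n\<close> of \<open>v\<close>, so they can be joined inside the ball of radius 1 / (n +
    1).\<close>
  define \<delta> where "\<delta> n = Min (d ` {..n})" for n
  have \<delta>pos: "\<delta> n > 0" for n using d by (auto simp: \<delta>_def)
  have \<delta>le: "\<delta> n \<le> d n" "\<delta> (Suc n) \<le> d n" for n by (auto simp: \<delta>_def)
  have "\<forall>n. \<exists>x. x \<in> S \<inter> ball v (\<delta> n)"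
    using v \<delta>pos by (metis IntI closure_approachable dist_commute mem_ball)
  then obtain x where x: "\<And>n. x n \<in> S \<inter> ball v (\<delta> n)" by metis
  have "\<forall>n. \<exists>g. path g \<and> path_image g \<subseteq> S \<inter> ball v (1 / Suc n) \<and> pathstart g = x n \<and> pathfinish g = x (Suc n)"
  proof
    fix n
    have "x n \<in> S \<inter> ball v (d n)" "x (Suc n) \<in> S \<inter> ball v (d n)"
      using x[of n] x[of "Suc n"] \<delta>le[of n] by auto
    from dpc[OF this]
    show "\<exists>g. path g \<and> path_image g \<subseteq> S \<inter> ball v (1 / Suc n) \<and> pathstart g = x n \<and> pathfinish g = x (Suc n)"
      unfolding path_component_def by blast
  qed
  then obtain g where g: "\<And>n. path (g n)" "\<And>n. path_image (g n) \<subseteq> S \<inter> ball v (1 / Suc n)"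
    "\<And>n. pathstart (g n) = x n" "\<And>n. pathfinish (g n) = x (Suc n)" by metis
  \<comment> \<open>Constant pieces extend the sequence to the negative integers; \<open>h\<close>
    compresses the half line u \<ge> 0 to [0, 1).\<close>
  define G where "G n = (if n < 0 then (\<lambda>_. x 0) else g (nat n))" for n :: int
  have link: "pathfinish (G n) = pathstart (G (n + 1))" for n
    using g(3,4) by (auto simp: G_def pathfinish_def pathstart_def nat_add_distrib)
  have pathG: "path (G n)" for n
    using g(1) by (auto simp: G_def path_def)
  note contG = continuous_chain_path[of G, OF pathG link]
  define h where "h t = (if t < 1 then chain_path G (1 / (1 - t) - 1) else v)" for t :: real
  have Gin: "chain_path G u \<in> S \<inter> ball v (1 / (of_int \<lfloor>u\<rfloor> + 1))" if "u \<ge> 0" for u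
  proof -
    have "chain_path G u = g (nat \<lfloor>u\<rfloor>) (frac u)" using that by (simp add: chain_path_def G_def)
    moreover have "g (nat \<lfloor>u\<rfloor>) (frac u) \<in> path_image (g (nat \<lfloor>u\<rfloor>))"
      by (auto simp: path_image_def frac_ge_0 frac_lt_1 less_imp_le)
    moreover have "real (Suc (nat \<lfloor>u\<rfloor>)) = of_int \<lfloor>u\<rfloor> + 1" using that by simp
    ultimately show ?thesis using g(2)[of "nat \<lfloor>u\<rfloor>"] by (metis subsetD)
  qed
  have u0: "1 / (1 - t) - 1 \<ge> 0" if "0 \<le> t" "t < 1" for t :: real
    using that by (simp add: field_simps)
  have close: "dist (h t) v \<le> (1 - t) / t" if "0 < t" "t \<le> 1" for t
  proof (cases "t = 1")
    case False
    let ?u = "1 / (1 - t) - 1"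
    have "dist (h t) v < 1 / (of_int \<lfloor>?u\<rfloor> + 1)"
      using Gin[OF u0[of t]] that False by (auto simp: h_def dist_commute)
    also have "\<dots> \<le> 1 / ?u"
    proof -
      have "0 < ?u" using that False by (simp add: field_simps)
      moreover have "?u \<le> of_int \<lfloor>?u\<rfloor> + 1" by linarith
      ultimately show ?thesis by (intro divide_left_mono mult_pos_pos) auto
    qed
    also have "\<dots> = (1 - t) / t" using that False by (simp add: field_simps)
    finally show ?thesis by simp
  qed (simp add: h_def)
  have "continuous_on {0..1} h"
    unfolding continuous_on_eq_continuous_within
  proof
    fix t :: real assume t: "t \<in> {0..1}"
    show "continuous (at t within {0..1}) h"
    proof (cases "t = 1")
      case True
      have "(h \<longlongrightarrow> v) (at 1 within {0..1})"
      proof (rule tendsto_0_le[of "\<lambda>t. (1 - t) / t" _ "\<lambda>t. dist (h t) v" 1, THEN tendsto_dist_iff[THEN iffD2]])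
        show "((\<lambda>t::real. (1 - t) / t) \<longlongrightarrow> 0) (at 1 within {0..1})"
          by (rule tendsto_eq_intros refl | simp)+
        have "eventually (\<lambda>t::real. t > 0) (at 1 within {0..1})"
          by (rule order_tendstoD(1)[OF tendsto_ident_at]) simp
        moreover have "eventually (\<lambda>t::real. t \<in> {0..1}) (at 1 within {0..1})"
          by (simp add: eventually_at_filter)
        ultimately show "\<forall>\<^sub>F x in at 1 within {0..1}. norm (dist (h x) v) \<le> norm ((1 - x) / x) * 1"
          by eventually_elim (use close in force)
      qed
      then show ?thesis using True by (simp add: continuous_within h_def)
    next
      case False
      have "continuous_on {..<1} (\<lambda>t. chain_path G (1 / (1 - t) - 1))"
        by (rule continuous_on_compose2[OF contG]) (auto intro!: continuous_intros)
      then have "continuous_on {..<1} h"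
        by (rule continuous_on_eq) (simp add: h_def)
      then have "isCont h t" using False t
        by (metis atLeastAtMost_iff continuous_on_eq_continuous_at lessThan_iff less_le open_lessThan)
      then show ?thesis by (rule continuous_at_imp_continuous_at_within)
    qed
  qed
  then have "path h" by (simp add: path_def)
  moreover have hS: "h t \<in> S" if "0 \<le> t" "t < 1" for t
    using Gin[OF u0[OF that]] that by (simp add: h_def)
  have "pathstart h \<in> S" using hS[of 0] by (simp add: pathstart_def)
  moreover have "path_image h - {v} \<subseteq> S"
  proof
    fix z assume "z \<in> path_image h - {v}"
    then obtain t where "t \<in> {0..1}" "z = h t" "z \<noteq> v" by (auto simp: path_image_def)
    then show "z \<in> S" using hS[of t] by (cases "t = 1") (auto simp: h_def)
  qed
  moreover have "pathfinish h = v" by (simp add: pathfinish_def h_def)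
  ultimately show thesis using that by blast
qed

text \<open>The complementary domains of a Jordan curve are uniformly locally connected: this follows from
  Janiszewski's theorem, applied to the curve and to the union of the complement of a ball with the
  part of the curve that is far away.\<close>

lemma Jordan_outside_accessible:
  fixes c :: "real \<Rightarrow> real \<times> real"
  assumes c: "simple_path c" "pathfinish c = pathstart c" and v: "v \<in> path_image c"
  obtains h where "path h" "pathstart h \<in> outside (path_image c)" "pathfinish h = v"
    "path_image h - {v} \<subseteq> outside (path_image c)"
proof -
  obtain c' where c': "simple_path c'" "path_image c' = path_image c" "pathfinish c' = v" "pathstart c' = v"
  proof -
    obtain t where t: "t \<in> {0..1}" "v = c t" using v by (auto simp: path_image_def)
    show ?thesis
      by (rule that[of "shiftpath t c"])
        (use t c in \<open>auto simp: simple_path_shiftpath path_image_shiftpath pathstart_shiftpath pathfinish_shiftpath\<close>)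
  qed
  let ?J = "path_image c'"
  let ?O = "outside ?J"
  note Jo = Jordan_inside_outside_prod[OF c'(1), unfolded c'(3,4), OF refl]
  have compJ: "compact ?J" using c'(1) compact_path_image simple_path_imp_path by blast
  have ulc: "\<exists>d>0. \<forall>x\<in>?O \<inter> ball v d. \<forall>y\<in>?O \<inter> ball v d. path_component (?O \<inter> ball v e) x y" if e: "e > 0" for e
  proof -
    have cont: "continuous_on {0..1} c'" using c'(1) simple_path_imp_path path_def by blast
    obtain \<eta> where \<eta>: "\<eta> > 0" "\<And>s t. s \<in> {0..1} \<Longrightarrow> t \<in> {0..1} \<Longrightarrow> dist s t < \<eta> \<Longrightarrow> dist (c' s) (c' t) < e"
      using compact_uniformly_continuous[OF cont compact_Icc] e unfolding uniformly_continuous_on_def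
      by (metis dist_commute)
    \<comment> \<open>By uniform continuity the curve stays within \<open>e\<close> of
      \<open>v\<close> for parameters closer than \<kappa> to 0 or 1. The remaining middle arc
      \<open>B\<close> is connected, misses \<open>v\<close>, and is exactly the intersection of the
      curve with \<open>?T\<close> below.\<close>
    define \<kappa> where "\<kappa> = min (\<eta>/2) (1/4)"
    have \<kappa>: "0 < \<kappa>" "\<kappa> < \<eta>" "\<kappa> \<le> 1/4" using \<eta>(1) by (auto simp: \<kappa>_def)
    define B where "B = c' ` {\<kappa>..1-\<kappa>}"
    have sub: "{\<kappa>..1-\<kappa>} \<subseteq> {0..1}" using \<kappa> by auto
    have compB: "compact B" "connected B"
      unfolding B_def using continuous_on_subset[OF cont sub]
      by (auto intro: compact_continuous_image connected_continuous_image)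
    have vB: "v \<notin> B"
    proof
      assume "v \<in> B"
      then obtain t where t: "t \<in> {\<kappa>..1-\<kappa>}" "c' t = c' 0" using c'(4) by (auto simp: B_def pathstart_def)
      have "\<forall>x\<in>{0..1}. \<forall>y\<in>{0..1}. c' x = c' y \<longrightarrow> x = y \<or> x = 0 \<and> y = 1 \<or> x = 1 \<and> y = 0"
        using c'(1) by (simp add: simple_path_def loop_free_def)
      from this[rule_format, of t 0] show False using t \<kappa> by auto
    qed
    have Bsub: "B \<subseteq> ?J" using sub by (auto simp: B_def path_image_def)
    have far: "?J - ball v e \<subseteq> B"
    proof
      fix z assume z: "z \<in> ?J - ball v e"
      then obtain t where t: "t \<in> {0..1}" "z = c' t" by (auto simp: path_image_def)
      have "\<not> t < \<kappa>"
        using \<eta>(2)[of 0 t] t z \<kappa> c'(4) by (auto simp: pathstart_def dist_real_def)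
      moreover have "\<not> t > 1 - \<kappa>"
        using \<eta>(2)[of 1 t] t z \<kappa> c'(3) by (auto simp: pathfinish_def dist_real_def)
      ultimately show "z \<in> B" using t by (auto simp: B_def)
    qed
    obtain d0 where d0: "d0 > 0" "ball v d0 \<inter> B = {}"
      using compB vB by (metis Compl_iff disjoint_eq_subset_Compl compact_imp_closed open_Compl open_contains_ball)
    define d where "d = min d0 e"
    have d: "d > 0" "ball v d \<inter> B = {}" "ball v d \<subseteq> ball v e"
      using d0 e by (auto simp: d_def disjoint_iff)
    have "path_component (?O \<inter> ball v e) x y" if xy: "x \<in> ?O \<inter> ball v d" "y \<in> ?O \<inter> ball v d" for x y
    proof -
      let ?T = "- ball v e \<union> B"
      have "connected_component (- (?J \<union> ?T)) x y"
      proof (rule Janiszewski_prod)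
        show "closed ?T" using compB by (simp add: closed_Un closed_Compl compact_imp_closed)
        have "?J \<inter> ?T = B" using far Bsub by auto
        then show "connected (?J \<inter> ?T)" using compB by simp
        show "connected_component (- ?J) x y"
          using xy Jo(5) unfolding connected_component_def
          by (intro exI[of _ ?O]) (auto simp: outside_def)
        show "connected_component (- ?T) x y"
          using xy d unfolding connected_component_def
          by (intro exI[of _ "ball v d"]) auto
      qed (use compJ in auto)
      moreover have opn: "open (- (?J \<union> ?T))"
        using compJ compB by (simp add: open_Compl open_Int compact_imp_closed)
      ultimately have "path_component (- (?J \<union> ?T)) x y"
        by (metis open_path_connected_component)
      then obtain g where g: "path g" "path_image g \<subseteq> - (?J \<union> ?T)" "pathstart g = x" "pathfinish g = y"
        unfolding path_component_def by blast
      have "path_image g \<subseteq> ?O"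
      proof -
        have "connected (path_image g)" "x \<in> path_image g" using g by auto
        moreover have "path_image g \<inter> ?J = {}" using g by auto
        ultimately have "connected_component (- ?J) x z" if "z \<in> path_image g" for z
          using that unfolding connected_component_def by blast
        then show ?thesis using xy outside_same_component by blast
      qed
      then show ?thesis using g unfolding path_component_def by (intro exI[of _ g]) auto
    qed
    then show ?thesis using d(1) by blast
  qed
  have "v \<in> closure ?O" using Jo(9) v c'(2) by auto
  from path_to_boundary[OF this ulc] obtain h where
    "path h" "pathstart h \<in> ?O" "pathfinish h = v" "path_image h - {v} \<subseteq> ?O" by blast
  then show thesis using that c'(2) by metis
qed

lemma ball_avoids_closed:
  fixes C :: "'a::metric_space set"
  assumes "closed C" "v \<notin> C"
  obtains d where "d > 0" "ball v d \<inter> C = {}"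
  using assms by (metis Compl_iff disjoint_eq_subset_Compl open_Compl open_contains_ball)

section \<open>Dense lines in plane continua\<close>

text \<open>This isolates what the planar argument takes from the symbolics. \<open>vert_up\<close>
  and \<open>vert_dn\<close> say contrapositively that off the line K accumulates vertically from
  both sides. The bound on \<open>snd q\<close> in \<open>small_cuts\<close> keeps the vertical ray
  above \<open>\<gamma> 0\<close> clear of the loops.\<close>

locale dense_line =
  fixes K :: "(real \<times> real) set" and \<gamma> :: "real \<Rightarrow> real \<times> real" and h :: real
  assumes compact_K: "compact K"
    and cont_\<gamma>: "continuous_on UNIV \<gamma>"
    and inj_\<gamma>: "inj \<gamma>"
    and range_\<gamma>: "range \<gamma> \<subseteq> K"
    and dense_up: "\<And>a. K \<subseteq> closure (\<gamma> ` {a<..})"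
    and dense_dn: "\<And>a. K \<subseteq> closure (\<gamma> ` {..<a})"
    and codense: "K \<subseteq> closure (K - range \<gamma>)"
    and top: "\<And>z. z \<in> K \<Longrightarrow> snd z \<le> h"
    and top_range: "\<And>z. z \<in> K \<Longrightarrow> snd z = h \<Longrightarrow> z \<in> range \<gamma>"
    and top_arc: "\<exists>\<eta>>0. \<forall>t. \<bar>t\<bar> < \<eta> \<longrightarrow> snd (\<gamma> t) = h"
    and vert_up: "\<And>x y e. (x, y) \<in> K \<Longrightarrow> e > 0 \<Longrightarrow> (\<And>y'. y < y' \<Longrightarrow> y' < y + e \<Longrightarrow> (x, y') \<notin> K) \<Longrightarrow>
      (x, y) \<in> range \<gamma>"
    and vert_dn: "\<And>x y e. (x, y) \<in> K \<Longrightarrow> e > 0 \<Longrightarrow> (\<And>y'. y - e < y' \<Longrightarrow> y' < y \<Longrightarrow> (x, y') \<notin> K) \<Longrightarrow>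
      (x, y) \<in> range \<gamma>"
    and small_cuts: "\<And>z e. z \<in> K \<Longrightarrow> e > 0 \<Longrightarrow> \<exists>g a b. arc g \<and> a < 0 \<and> 0 < b \<and> pathstart g = \<gamma> a \<and>
      pathfinish g = \<gamma> b \<and> path_image g \<inter> K = {\<gamma> a, \<gamma> b} \<and> path_image g \<subseteq> ball z e \<and>
      (\<forall>q\<in>path_image g. snd q \<le> h)"
begin

section \<open>Cuts and the loops they form with the line\<close>

definition cut :: "(real \<Rightarrow> real \<times> real) \<Rightarrow> real \<Rightarrow> real \<Rightarrow> bool" where
  "cut g a b \<longleftrightarrow> arc g \<and> a < b \<and> pathstart g = \<gamma> a \<and> pathfinish g = \<gamma> b \<and>
     path_image g \<inter> K = {\<gamma> a, \<gamma> b}"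

definition loop :: "(real \<Rightarrow> real \<times> real) \<Rightarrow> real \<Rightarrow> real \<Rightarrow> (real \<times> real) set" where
  "loop g a b = path_image g \<union> \<gamma> ` {a..b}"

definition seg :: "real \<Rightarrow> real \<Rightarrow> real \<Rightarrow> real \<times> real" where
  "seg a b = \<gamma> \<circ> linepath a b"

lemma \<gamma>_eq [simp]: "\<gamma> a = \<gamma> b \<longleftrightarrow> a = b"
  using inj_\<gamma> by (auto dest: injD)

lemma \<gamma>_in_K [simp]: "\<gamma> t \<in> K"
  using range_\<gamma> by auto

lemma closed_K: "closed K"
  by (simp add: compact_K compact_imp_closed)

lemma cont_\<gamma>_on: "continuous_on S \<gamma>"
  using cont_\<gamma> continuous_on_subset by blast

lemma seg_simps [simp]: "pathstart (seg a b) = \<gamma> a" "pathfinish (seg a b) = \<gamma> b"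
  by (simp_all add: seg_def pathstart_compose pathfinish_compose)

lemma path_image_seg: "a \<le> b \<Longrightarrow> path_image (seg a b) = \<gamma> ` {a..b}"
  by (simp add: seg_def path_image_compose closed_segment_eq_real_ivl)

lemma arc_seg:
  assumes "a < b" shows "arc (seg a b)"
  unfolding arc_def
proof
  show "path (seg a b)" unfolding seg_def by (intro path_continuous_image path_linepath cont_\<gamma>_on)
  have "inj_on (linepath a b) {0..1}" using arc_linepath[of a b] assms by (simp add: arc_def)
  then show "inj_on (seg a b) {0..1}" unfolding seg_def
    by (intro comp_inj_on inj_on_subset[OF inj_\<gamma>]) auto
qed

lemma compact_\<gamma>_image: "compact (\<gamma> ` {a..b})"
  by (simp add: compact_continuous_image cont_\<gamma>_on)

lemma connected_\<gamma>_image: "connected S \<Longrightarrow> connected (\<gamma> ` S)"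
  by (simp add: connected_continuous_image cont_\<gamma>_on)

lemma loop_Jordan:
  assumes "cut g a b"
  obtains c where "simple_path c" "pathfinish c = pathstart c" "path_image c = loop g a b"
proof
  let ?c = "g +++ reversepath (seg a b)"
  have g: "arc g" "a < b" "pathstart g = \<gamma> a" "pathfinish g = \<gamma> b" "path_image g \<inter> K = {\<gamma> a, \<gamma> b}"
    using assms by (auto simp: cut_def)
  have "\<gamma> ` {a..b} \<subseteq> K" by auto
  then show "simple_path ?c"
    using g arc_seg[of a b]
    by (intro simple_path_join_loop) (auto simp: arc_reversepath path_image_seg)
  show "pathfinish ?c = pathstart ?c" "path_image ?c = loop g a b"
    using g by (auto simp: path_image_join path_image_seg loop_def)
qed

lemma loop_K:
  assumes "cut g a b"
  shows "loop g a b \<inter> K = \<gamma> ` {a..b}"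
proof -
  have 1: "path_image g \<inter> K = {\<gamma> a, \<gamma> b}" and 2: "a < b" using assms by (auto simp: cut_def)
  have 3: "\<gamma> ` {a..b} \<subseteq> K" by auto
  have "{\<gamma> a, \<gamma> b} \<subseteq> \<gamma> ` {a..b}" using 2 by auto
  then show ?thesis unfolding loop_def using 1 3 by blast
qed

lemma loop_\<gamma>:
  assumes "cut g a b"
  shows "\<gamma> x \<in> loop g a b \<longleftrightarrow> a \<le> x \<and> x \<le> b"
proof -
  have "\<gamma> x \<in> loop g a b \<longleftrightarrow> \<gamma> x \<in> \<gamma> ` {a..b}" using loop_K[OF assms] \<gamma>_in_K by blast
  then show ?thesis by auto
qed

lemma cut_\<gamma>:
  assumes "cut g a b"
  shows "\<gamma> x \<in> path_image g \<longleftrightarrow> x = a \<or> x = b"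
  using assms unfolding cut_def by (metis IntI IntD1 \<gamma>_eq \<gamma>_in_K insert_iff singletonD)

lemma loop_facts:
  assumes "cut g a b"
  shows "inside (loop g a b) \<noteq> {}" "open (inside (loop g a b))"
    "connected (inside (loop g a b))" "open (outside (loop g a b))"
    "connected (outside (loop g a b))" "bounded (inside (loop g a b))"
    "\<not> bounded (outside (loop g a b))"
    "loop g a b \<subseteq> closure (inside (loop g a b))" "loop g a b \<subseteq> closure (outside (loop g a b))"
    "compact (loop g a b)" "closed (loop g a b)"
proof -
  obtain c where c: "simple_path c" "pathfinish c = pathstart c" "path_image c = loop g a b"
    using loop_Jordan[OF assms] .
  note J = Jordan_inside_outside_prod[OF c(1,2), unfolded c(3)]
  show "inside (loop g a b) \<noteq> {}" "open (inside (loop g a b))"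
    "connected (inside (loop g a b))" "open (outside (loop g a b))"
    "connected (outside (loop g a b))" "bounded (inside (loop g a b))"
    "\<not> bounded (outside (loop g a b))"
    "loop g a b \<subseteq> closure (inside (loop g a b))" "loop g a b \<subseteq> closure (outside (loop g a b))"
    using J by simp_all
  show "compact (loop g a b)" using c by (metis compact_path_image simple_path_imp_path)
  then show "closed (loop g a b)" by (rule compact_imp_closed)
qed

lemma connected_stays_inside:
  assumes "connected U" "U \<inter> J = {}" "U \<inter> inside J \<noteq> {}"
  shows "U \<subseteq> inside J"
proof
  fix x assume "x \<in> U"
  obtain y where "y \<in> U" "y \<in> inside J" using assms(3) by blast
  then have "connected_component (- J) y x"
    using assms(1,2) \<open>x \<in> U\<close> unfolding connected_component_def by blast
  then show "x \<in> inside J" using \<open>y \<in> inside J\<close> inside_same_component by blast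
qed

lemma connected_stays_outside:
  assumes "connected U" "U \<inter> J = {}" "U \<inter> outside J \<noteq> {}"
  shows "U \<subseteq> outside J"
proof
  fix x assume "x \<in> U"
  obtain y where "y \<in> U" "y \<in> outside J" using assms(3) by blast
  then have "connected_component (- J) y x"
    using assms(1,2) \<open>x \<in> U\<close> unfolding connected_component_def by blast
  then show "x \<in> outside J" using \<open>y \<in> outside J\<close> outside_same_component by blast
qed

lemma unbounded_connected_outside:
  assumes "connected U" "U \<inter> J = {}" "\<not> bounded U"
  shows "U \<subseteq> outside J"
proof
  fix x assume "x \<in> U"
  then have "U \<subseteq> connected_component_set (- J) x"
    using assms(1,2) by (intro connected_component_maximal) auto
  then show "x \<in> outside J" using assms(3) by (auto simp: outside intro: bounded_subset)
qed

lemma vertical_ray: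
  fixes x y :: real
  shows "connected ({x} \<times> {y<..})" "\<not> bounded ({x} \<times> {y<..})"
    "connected ({x} \<times> {y..})" "\<not> bounded ({x} \<times> {y..})"
    "connected ({x} \<times> {..y})" "\<not> bounded ({x} \<times> {..y})"
proof -
  have unb: "\<not> bounded ({x} \<times> S)" if "\<not> bounded S" for S :: "real set"
  proof
    assume "bounded ({x} \<times> S)"
    then have "bounded (snd ` ({x} \<times> S))" by (rule bounded_snd)
    then show False using that by simp
  qed
  have 1: "\<not> bounded {y<..}"
  proof
    assume "bounded {y<..}"
    then obtain M where "\<forall>v\<in>{y<..}. v \<le> M" using bounded_imp_bdd_above unfolding bdd_above_def by blast
    then have "max M y + 1 \<le> M" by (rule bspec) auto
    then show False by simp
  qed
  moreover have "{y<..} \<subseteq> {y..}" by auto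
  then have "\<not> bounded {y..}" using 1 bounded_subset by blast
  moreover have "\<not> bounded {..y}"
  proof
    assume "bounded {..y}"
    then obtain M where "\<forall>v\<in>{..y}. M \<le> v" using bounded_imp_bdd_below unfolding bdd_below_def by blast
    then have "M \<le> min M y - 1" by (rule bspec) (auto simp: min_def)
    then show False by simp
  qed
  ultimately show "connected ({x} \<times> {y<..})" "\<not> bounded ({x} \<times> {y<..})"
    "connected ({x} \<times> {y..})" "\<not> bounded ({x} \<times> {y..})"
    "connected ({x} \<times> {..y})" "\<not> bounded ({x} \<times> {..y})"
    using unb by (auto intro!: connected_Times)
qed

text \<open>The point \<open>\<gamma> 0\<close> lies on top of \<open>K\<close>, so near it the upper side of the arc is outside the loop,
  the lower side inside; and \<open>K\<close> accumulates there from below.\<close>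

lemma cut_around_top:
  assumes cut: "cut g a b" and ab: "a < 0" "0 < b" and g: "\<forall>q\<in>path_image g. snd q \<le> h"
  shows "K \<inter> inside (loop g a b) \<noteq> {}"
proof -
  let ?J = "loop g a b"
  note J = loop_facts[OF cut]
  obtain \<eta> where \<eta>: "\<eta> > 0" "\<And>t. \<bar>t\<bar> < \<eta> \<Longrightarrow> snd (\<gamma> t) = h" using top_arc by blast
  define \<zeta> where "\<zeta> = min \<eta> (min (-a) b) / 2"
  have \<zeta>: "0 < \<zeta>" "\<zeta> < \<eta>" "a < - \<zeta>" "\<zeta> < b" using \<eta>(1) ab by (auto simp: \<zeta>_def min_def split: if_splits)
  \<comment> \<open>\<open>C\<close> is the part of the loop away from \<open>\<gamma> 0\<close>. In
    a ball that misses it the loop reduces to points of height h, so each open half of the ball lies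
    on one side of the loop.\<close>
  define C where "C = path_image g \<union> \<gamma> ` {a..-\<zeta>} \<union> \<gamma> ` {\<zeta>..b}"
  have "compact C" unfolding C_def using cut
    by (intro compact_Un compact_\<gamma>_image compact_path_image arc_imp_path) (auto simp: cut_def)
  moreover have "\<gamma> 0 \<notin> C"
  proof -
    have "\<gamma> 0 \<notin> path_image g" using cut_\<gamma>[OF cut] ab by auto
    then show ?thesis using \<zeta>(1) by (auto simp: C_def)
  qed
  ultimately obtain e where e: "e > 0" "ball (\<gamma> 0) e \<inter> C = {}"
    by (metis Compl_iff compact_imp_closed disjoint_eq_subset_Compl open_Compl open_contains_ball)
  have Jball: "snd q = h" if q: "q \<in> ?J" "q \<in> ball (\<gamma> 0) e" for q
  proof -
    have "q \<notin> C" using q e by blast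
    then obtain t where t: "t \<in> {a..b}" "q = \<gamma> t" using q by (auto simp: loop_def C_def)
    then have "\<not> t \<le> - \<zeta>" "\<not> t \<ge> \<zeta>" using \<open>q \<notin> C\<close> by (auto simp: C_def)
    then show ?thesis using \<eta>(2)[of t] \<zeta> t by auto
  qed
  have snd0: "snd (\<gamma> 0) = h" using \<eta> by simp
  let ?up = "ball (\<gamma> 0) e \<inter> {q. h < snd q}" and ?lo = "ball (\<gamma> 0) e \<inter> {q. snd q < h}"
  have halfs: "convex {q::real\<times>real. h < snd q}" "convex {q::real\<times>real. snd q < h}"
  proof -
    have "{q::real\<times>real. h < snd q} = UNIV \<times> {h<..}" "{q::real\<times>real. snd q < h} = UNIV \<times> {..<h}" by auto
    then show "convex {q::real\<times>real. h < snd q}" "convex {q::real\<times>real. snd q < h}" by (simp_all add: convex_Times)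
  qed
  have ray: "{fst (\<gamma> 0)} \<times> {h<..} \<subseteq> outside ?J"
  proof (rule unbounded_connected_outside)
    have "snd q \<le> h" if "q \<in> ?J" for q
      using that g top[OF \<gamma>_in_K] by (auto simp: loop_def)
    then show "{fst (\<gamma> 0)} \<times> {h<..} \<inter> ?J = {}" by force
  qed (auto simp: vertical_ray)
  have up: "?up \<subseteq> outside ?J"
  proof (rule connected_stays_outside)
    show "connected ?up" by (intro convex_connected convex_Int halfs convex_ball)
    show "?up \<inter> ?J = {}" using Jball by force
    have "(fst (\<gamma> 0), h + e/2) \<in> ?up"
      using snd0 e by (simp add: mem_ball dist_prod_def dist_real_def)
    moreover have "(fst (\<gamma> 0), h + e/2) \<in> outside ?J" using ray e by auto
    ultimately show "?up \<inter> outside ?J \<noteq> {}" by blast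
  qed
  have lo: "?lo \<subseteq> inside ?J"
  proof (rule connected_stays_inside)
    show "connected ?lo" by (intro convex_connected convex_Int halfs convex_ball)
    show "?lo \<inter> ?J = {}" using Jball by force
    have "\<gamma> 0 \<in> closure (inside ?J)" using J(8) ab by (auto simp: loop_def)
    then obtain q where q: "q \<in> inside ?J" "q \<in> ball (\<gamma> 0) e"
      using e(1) by (metis closure_approachable dist_commute mem_ball)
    then obtain d where d: "d > 0" "ball q d \<subseteq> inside ?J \<inter> ball (\<gamma> 0) e"
      using J(2) by (metis IntI open_Int open_ball open_contains_ball)
    \<comment> \<open>\<open>q\<close> may itself have height h; then the slightly lower point
      \<open>q'\<close> does not.\<close>
    define q' where "q' = (fst q, snd q - d/2)"
    have "q' \<in> ball q d" "q \<in> ball q d" "snd q' < snd q" using d by (auto simp: q'_def mem_ball dist_prod_def dist_real_def)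
    then have "\<exists>r. r \<in> inside ?J \<inter> ball (\<gamma> 0) e \<and> snd r \<noteq> h" using d by (metis less_irrefl subsetD)
    then obtain r where "r \<in> inside ?J" "r \<in> ball (\<gamma> 0) e" "snd r \<noteq> h" by blast
    moreover have "\<not> snd r > h" using up calculation inside_Int_outside by blast
    ultimately show "?lo \<inter> inside ?J \<noteq> {}" by force
  qed
  have "\<gamma> 0 \<in> closure (K - range \<gamma>)" using codense by auto
  then obtain z where z: "z \<in> K - range \<gamma>" "z \<in> ball (\<gamma> 0) e"
    using e(1) by (metis closure_approachable dist_commute mem_ball)
  then have "snd z < h" using top[of z] top_range[of z] by force
  then show ?thesis using z lo by blast
qed

text \<open>Each tail of the line is connected, misses the loop and is dense in K. So a single point
  of K inside pulls in both tails, and the closure of a tail is already all of K.\<close>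

lemma cut_encloses:
  assumes cut: "cut g a b" and z: "K \<inter> inside (loop g a b) \<noteq> {}"
  shows "K - \<gamma> ` {a..b} \<subseteq> inside (loop g a b)" "\<gamma> ` {b<..} \<subseteq> inside (loop g a b)" "\<gamma> ` {..<a} \<subseteq> inside (loop g a b)"
proof -
  let ?J = "loop g a b"
  note J = loop_facts[OF cut]
  obtain z where z: "z \<in> K" "z \<in> inside ?J" using z by blast
  have JK: "?J \<inter> K = \<gamma> ` {a..b}" by (rule loop_K[OF cut])
  show up: "\<gamma> ` {b<..} \<subseteq> inside ?J"
  proof (rule connected_stays_inside)
    show "\<gamma> ` {b<..} \<inter> ?J = {}" using loop_\<gamma>[OF cut] by auto
    show "\<gamma> ` {b<..} \<inter> inside ?J \<noteq> {}"
      using dense_up[of b] z J(2) by (metis disjoint_iff open_Int_closure_eq_empty subsetD inf_commute)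
  qed (simp add: connected_\<gamma>_image)
  show "\<gamma> ` {..<a} \<subseteq> inside ?J"
  proof (rule connected_stays_inside)
    show "\<gamma> ` {..<a} \<inter> ?J = {}" using loop_\<gamma>[OF cut] by auto
    show "\<gamma> ` {..<a} \<inter> inside ?J \<noteq> {}"
      using dense_dn[of a] z J(2) by (metis disjoint_iff open_Int_closure_eq_empty subsetD inf_commute)
  qed (simp add: connected_\<gamma>_image)
  have "K \<subseteq> closure (inside ?J)" using dense_up[of b] closure_mono[OF up] by blast
  also have "\<dots> \<subseteq> ?J \<union> inside ?J" by (rule closure_inside_subset[OF J(11)])
  finally show "K - \<gamma> ` {a..b} \<subseteq> inside ?J" using JK by blast
qed

definition good :: "(real \<Rightarrow> real \<times> real) \<Rightarrow> real \<Rightarrow> real \<Rightarrow> bool" where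
  "good g a b \<longleftrightarrow> cut g a b \<and> K - \<gamma> ` {a..b} \<subseteq> inside (loop g a b)"

lemma good_outside: "good g a b \<Longrightarrow> outside (loop g a b) \<inter> K = {}"
  unfolding good_def by (auto simp: loop_def outside_def inside_def)

lemma good_inside: "good g a b \<Longrightarrow> K - range \<gamma> \<subseteq> inside (loop g a b)"
  unfolding good_def by auto

text \<open>A point off the line has positive distance from each compact piece of the line, so the
  end parameters of cuts near it exceed any bound in absolute value.\<close>

lemma exists_good:
  assumes z: "z \<in> K - range \<gamma>" and e: "e > 0"
  obtains g a b where "good g a b" "a < - M" "M < b" "path_image g \<subseteq> ball z e"
proof -
  have "z \<notin> \<gamma> ` {-\<bar>M\<bar>..\<bar>M\<bar>}" using z by auto
  then obtain d where d: "d > 0" "ball z d \<inter> \<gamma> ` {-\<bar>M\<bar>..\<bar>M\<bar>} = {}"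
    by (metis Compl_iff compact_\<gamma>_image compact_imp_closed disjoint_eq_subset_Compl open_Compl open_contains_ball)
  obtain g a b where g: "arc g" "a < 0" "0 < b" "pathstart g = \<gamma> a"
      "pathfinish g = \<gamma> b" "path_image g \<inter> K = {\<gamma> a, \<gamma> b}" "path_image g \<subseteq> ball z (min d e)"
      "\<forall>q\<in>path_image g. snd q \<le> h"
    using small_cuts[of z "min d e"] z d e by auto
  have cut: "cut g a b" using g by (simp add: cut_def)
  have "good g a b"
    using cut cut_encloses(1)[OF cut cut_around_top] g by (simp add: good_def)
  moreover have "\<gamma> a \<in> ball z d" "\<gamma> b \<in> ball z d" using g by auto
  then have "a \<notin> {-\<bar>M\<bar>..\<bar>M\<bar>}" "b \<notin> {-\<bar>M\<bar>..\<bar>M\<bar>}" using d by auto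
  then have "a < - M" "M < b" using g(2,3) by auto
  moreover have "path_image g \<subseteq> ball z e" using g(7) by auto
  ultimately show thesis using that[of g a b] by simp
qed

section \<open>K does not separate the plane\<close>

lemma K_minus_line: "\<exists>z. z \<in> K - range \<gamma> \<and> z \<notin> F" if "finite F"
proof (rule ccontr)
  assume "\<not> ?thesis"
  then have "K - range \<gamma> \<subseteq> F" by blast
  then have "finite (K - range \<gamma>)" using that finite_subset by blast
  then have "K \<subseteq> K - range \<gamma>" using codense by (metis closure_closed finite_imp_closed)
  then show False using \<gamma>_in_K[of 0] by blast
qed

text \<open>A cut \<open>g\<close> in the inside of a large good loop would make a theta curve; the part of the line
  beyond \<open>g\<close> would then have to lie in one of the two inner domains, although it contains part of
  the large loop.\<close>

lemma cut_in_outside: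
  assumes cut: "cut g a b" and w: "w \<in> path_image g - K"
  shows "w \<in> outside K"
proof -
  have g: "arc g" "a < b" "pathstart g = \<gamma> a" "pathfinish g = \<gamma> b" "path_image g \<inter> K = {\<gamma> a, \<gamma> b}"
    using cut by (auto simp: cut_def)
  obtain z where z: "z \<in> K - range \<gamma>" using K_minus_line[of "{}"] by auto
  have "z \<notin> path_image g" using z g by blast
  then obtain e where e: "e > 0" "ball z e \<inter> path_image g = {}"
    by (metis Compl_iff arc_imp_path closed_path_image disjoint_eq_subset_Compl g(1) open_Compl open_contains_ball)
  obtain q A B where q: "good q A B" "A < - (\<bar>a\<bar> + \<bar>b\<bar>)" "\<bar>a\<bar> + \<bar>b\<bar> < B" "path_image q \<subseteq> ball z e"
    using exists_good[OF z e(1)] .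
  have AB: "A < a" "b < B" using q by auto
  have cq: "arc q" "A < B" "pathstart q = \<gamma> A" "pathfinish q = \<gamma> B" "path_image q \<inter> K = {\<gamma> A, \<gamma> B}"
    and cutq: "cut q A B"
    using q(1) by (auto simp: cut_def good_def)
  note q\<gamma> = cut_\<gamma>[OF cutq] and g\<gamma> = cut_\<gamma>[OF cut]
  have qg: "path_image q \<inter> path_image g = {}" using q e by blast
  let ?J = "loop q A B"
  note J = loop_facts[OF cutq]
  let ?G = "path_image g - {\<gamma> a, \<gamma> b}"
  have GK: "?G \<inter> K = {}" "?G = path_image g - K" using g by auto
  have Gconn: "connected ?G"
    using connected_simple_path_endless[of g] g arc_imp_simple_path by auto
  have GJ: "?G \<inter> ?J = {}" using GK qg by (auto simp: loop_def)
  have "?G \<inter> inside ?J = {}"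
  proof (rule ccontr)
    assume ne: "?G \<inter> inside ?J \<noteq> {}"
    define c1 where "c1 = seg a b"
    define c2 where "c2 = reversepath (seg A a) +++ q +++ reversepath (seg b B)"
    have ic1: "path_image c1 = \<gamma> ` {a..b}" using g by (simp add: c1_def path_image_seg)
    have ic2: "path_image c2 = \<gamma> ` {A..a} \<union> path_image q \<union> \<gamma> ` {b..B}"
      using cq AB by (simp add: c2_def path_image_join path_image_seg Un_assoc)
    have arc_tail: "arc (q +++ reversepath (seg b B))"
      using cq AB g by (intro arc_join) (auto simp: arc_seg arc_reversepath path_image_seg q\<gamma>)
    have arc2: "arc c2"
      unfolding c2_def using cq AB g arc_tail
      by (intro arc_join) (auto simp: arc_seg arc_reversepath path_image_seg path_image_join q\<gamma>)
    have union12: "path_image c1 \<union> path_image c2 = ?J"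
    proof -
      have "{a..b} \<union> {A..a} \<union> {b..B} = {A..B}" using g AB by auto
      then have "\<gamma> ` {a..b} \<union> \<gamma> ` {A..a} \<union> \<gamma> ` {b..B} = \<gamma> ` {A..B}" by (metis image_Un)
      then show ?thesis unfolding ic1 ic2 loop_def by blast
    qed
    have split: "inside (path_image c1 \<union> path_image g) \<union> inside (path_image c2 \<union> path_image g) \<union>
           (path_image g - {\<gamma> a, \<gamma> b}) = inside (path_image c1 \<union> path_image c2)"
    proof (rule split_inside_simple_closed_curve_prod)
      show "simple_path c1" "simple_path c2" "simple_path g" using arc2 g
        by (auto simp: c1_def arc_seg arc_imp_simple_path)
      show "pathstart c1 = \<gamma> a" "pathfinish c1 = \<gamma> b" "pathstart c2 = \<gamma> a" "pathfinish c2 = \<gamma> b"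
        by (auto simp: c1_def c2_def)
      have c1g: "\<gamma> ` {a..b} \<inter> P = {\<gamma> a, \<gamma> b}"
        if "\<And>x. a \<le> x \<Longrightarrow> x \<le> b \<Longrightarrow> \<gamma> x \<in> P \<longleftrightarrow> x = a \<or> x = b" for P
      proof (intro equalityI subsetI)
        fix y assume "y \<in> \<gamma> ` {a..b} \<inter> P"
        then obtain x where "a \<le> x" "x \<le> b" "y = \<gamma> x" "\<gamma> x \<in> P" by auto
        then show "y \<in> {\<gamma> a, \<gamma> b}" using that[of x] by auto
      next
        fix y assume "y \<in> {\<gamma> a, \<gamma> b}"
        then show "y \<in> \<gamma> ` {a..b} \<inter> P" using that[of a] that[of b] g(2) by auto
      qed
      have "\<gamma> x \<in> path_image c2 \<longleftrightarrow> x = a \<or> x = b" if "a \<le> x" "x \<le> b" for x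
        using AB that by (auto simp: ic2 q\<gamma> inj_image_mem_iff[OF inj_\<gamma>])
      then show "path_image c1 \<inter> path_image c2 = {\<gamma> a, \<gamma> b}"
        unfolding ic1 by (rule c1g)
      show "path_image c1 \<inter> path_image g = {\<gamma> a, \<gamma> b}"
        unfolding ic1 by (rule c1g) (rule g\<gamma>)
      have "path_image c2 \<inter> path_image g \<subseteq> K \<inter> path_image g"
        using qg unfolding ic2 by auto
      moreover have "\<gamma> a \<in> path_image c2" "\<gamma> b \<in> path_image c2"
        using AB by (auto simp: ic2)
      ultimately show "path_image c2 \<inter> path_image g = {\<gamma> a, \<gamma> b}"
        using g(5) by blast
      show "path_image g \<inter> inside (path_image c1 \<union> path_image c2) \<noteq> {}"
        using ne unfolding union12 by blast
    qed (use g in auto)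
    let ?D1 = "inside (loop g a b)"
    have D1: "inside (path_image c1 \<union> path_image g) = ?D1" by (simp add: loop_def ic1 Un_commute)
    let ?J2 = "path_image c2 \<union> path_image g"
    \<comment> \<open>Of the two inner domains only \<open>?D1\<close> can accumulate at
      \<open>\<gamma> t\<close>. Points of K off the line near it therefore lie in
      \<open>?D1\<close>, and \<open>cut_encloses\<close> then drags the end
      \<open>\<gamma> B\<close> of the large loop inside it.\<close>
    define t where "t = (a + b)/2"
    have t: "a < t" "t < b" using g by (auto simp: t_def)
    have tJ2: "\<gamma> t \<notin> ?J2" using t AB g cq unfolding ic2 by (auto simp: g\<gamma> q\<gamma>)
    have J2: "closed ?J2" using arc2 g by (intro closed_Un) (auto simp: closed_path_image arc_imp_path)
    have tJ: "\<gamma> t \<in> ?J" using t AB by (auto simp: loop_def)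
    have "\<gamma> t \<notin> inside ?J2"
      using split tJ unfolding union12 by (metis IntI UnCI inside_no_overlap empty_iff)
    then have "\<gamma> t \<notin> closure (inside ?J2)" using tJ2 closure_inside_subset[OF J2] by blast
    then obtain d where d: "d > 0" "ball (\<gamma> t) d \<inter> inside ?J2 = {}"
      using ball_avoids_closed[OF closed_closure] closure_subset by (metis Int_mono order_refl subset_empty)
    have "\<gamma> t \<in> closure (K - range \<gamma>)" using codense by auto
    then obtain y where y: "y \<in> K - range \<gamma>" "y \<in> ball (\<gamma> t) d"
      using d(1) by (metis closure_approachable dist_commute mem_ball)
    have "y \<in> inside ?J" using good_inside[OF q(1)] y by blast
    then have "y \<in> ?D1" using split y d GK unfolding union12 D1 by blast
    then have "\<gamma> ` {b<..} \<subseteq> ?D1" using cut_encloses(2)[OF cut] y by blast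
    then have "\<gamma> B \<in> ?D1" using AB by auto
    then have "\<gamma> B \<in> inside ?J" using split unfolding union12 D1 by blast
    moreover have "\<gamma> B \<in> ?J" using cq by (auto simp: loop_def)
    ultimately show False by (metis IntI inside_no_overlap empty_iff)
  qed
  moreover have wG: "w \<in> ?G" using w GK by auto
  ultimately have wo: "w \<in> outside ?J" using GJ inside_Un_outside[of ?J] by blast
  have "outside ?J \<subseteq> outside K"
    by (rule unbounded_connected_outside) (use J good_outside[OF q(1)] in auto)
  then show ?thesis using wo by blast
qed

text \<open>On the vertical line through a point trapped by K there is a nearest point of K above
  and one below. The gap between them puts both on the line by \<open>vert_dn\<close> and
  \<open>vert_up\<close>, so the vertical segment is a cut, and cuts run outside K between their
  ends.\<close>

lemma Compl_eq_outside: "- K = outside K"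
proof -
  have "(x, y) \<in> outside K" if nK: "(x, y) \<notin> K" for x y
  proof (rule ccontr)
    assume no: "(x, y) \<notin> outside K"
    define S where "S = {v. (x, v) \<in> K}"
    have "continuous_on UNIV (\<lambda>v. (x, v))" by (intro continuous_intros)
    then have clS: "closed S" unfolding S_def
      using continuous_closed_preimage[of UNIV "\<lambda>v. (x, v)" K] closed_K by (simp add: vimage_def)
    have "S \<inter> {y..} \<noteq> {}"
    proof
      assume "S \<inter> {y..} = {}"
      then have "{x} \<times> {y..} \<inter> K = {}" by (auto simp: S_def)
      then have "{x} \<times> {y..} \<subseteq> outside K" by (rule unbounded_connected_outside[rotated]) (auto simp: vertical_ray)
      then show False using no by auto
    qed
    then obtain y2 where y2: "y2 \<in> S" "y2 \<ge> y" "\<And>v. v \<in> S \<Longrightarrow> v \<ge> y \<Longrightarrow> y2 \<le> v"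
    proof -
      assume a: "\<And>y2. y2 \<in> S \<Longrightarrow> y2 \<ge> y \<Longrightarrow> (\<And>v. v \<in> S \<Longrightarrow> v \<ge> y \<Longrightarrow> y2 \<le> v) \<Longrightarrow> thesis"
      have "Inf (S \<inter> {y..}) \<in> S \<inter> {y..}"
        by (rule closed_contains_Inf) (use clS \<open>S \<inter> {y..} \<noteq> {}\<close> in auto)
      moreover have "Inf (S \<inter> {y..}) \<le> v" if "v \<in> S" "v \<ge> y" for v
        using that by (intro cInf_lower) auto
      ultimately show thesis using a[of "Inf (S \<inter> {y..})"] by auto
    qed
    have "S \<inter> {..y} \<noteq> {}"
    proof
      assume "S \<inter> {..y} = {}"
      then have "{x} \<times> {..y} \<inter> K = {}" by (auto simp: S_def)
      then have "{x} \<times> {..y} \<subseteq> outside K" by (rule unbounded_connected_outside[rotated]) (auto simp: vertical_ray)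
      then show False using no by auto
    qed
    then obtain y1 where y1: "y1 \<in> S" "y1 \<le> y" "\<And>v. v \<in> S \<Longrightarrow> v \<le> y \<Longrightarrow> v \<le> y1"
    proof -
      assume a: "\<And>y1. y1 \<in> S \<Longrightarrow> y1 \<le> y \<Longrightarrow> (\<And>v. v \<in> S \<Longrightarrow> v \<le> y \<Longrightarrow> v \<le> y1) \<Longrightarrow> thesis"
      have "Sup (S \<inter> {..y}) \<in> S \<inter> {..y}"
        by (rule closed_contains_Sup) (use clS \<open>S \<inter> {..y} \<noteq> {}\<close> in auto)
      moreover have "v \<le> Sup (S \<inter> {..y})" if "v \<in> S" "v \<le> y" for v
        using that by (intro cSup_upper) auto
      ultimately show thesis using a[of "Sup (S \<inter> {..y})"] by auto
    qed
    have yS: "y \<notin> S" using nK by (simp add: S_def)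
    then have lt: "y1 < y" "y < y2" using y1 y2 by (metis less_le)+
    have gap: "(x, v) \<notin> K" if "y1 < v" "v < y2" for v
      using that y1(3)[of v] y2(3)[of v] by (cases "v \<le> y") (auto simp: S_def)
    have "(x, y2) \<in> range \<gamma>"
      by (rule vert_dn[of x y2 "y2 - y1"]) (use y2 lt gap in \<open>auto simp: S_def\<close>)
    then obtain b where b: "\<gamma> b = (x, y2)" by force
    have "(x, y1) \<in> range \<gamma>"
      by (rule vert_up[of x y1 "y2 - y1"]) (use y1 lt gap in \<open>auto simp: S_def\<close>)
    then obtain a where a: "\<gamma> a = (x, y1)" by force
    let ?g = "linepath (x, y1) (x, y2)"
    have im: "path_image ?g = {x} \<times> {y1..y2}"
    proof -
      have "closed_segment (x, y1) (x, y2) = {x} \<times> closed_segment y1 y2"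
        unfolding closed_segment_image_interval by (auto simp: image_iff algebra_simps)
      then have "closed_segment (x, y1) (x, y2) = {x} \<times> {y1..y2}"
        using lt by (simp add: closed_segment_eq_real_ivl)
      then show ?thesis by simp
    qed
    have imK: "path_image ?g \<inter> K = {(x, y1), (x, y2)}"
    proof (intro equalityI subsetI)
      fix q assume "q \<in> path_image ?g \<inter> K"
      then obtain v where v: "q = (x, v)" "y1 \<le> v" "v \<le> y2" "(x, v) \<in> K" unfolding im by auto
      then have "v = y1 \<or> v = y2" using gap[of v] by force
      then show "q \<in> {(x, y1), (x, y2)}" using v by auto
    next
      fix q assume "q \<in> {(x, y1), (x, y2)}"
      then show "q \<in> path_image ?g \<inter> K" unfolding im using y1(1) y2(1) lt by (auto simp: S_def)
    qed
    have arcs: "arc ?g" "arc (reversepath ?g)" using lt by (auto intro: arc_reversepath)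
    have "a \<noteq> b" using a b lt by auto
    have win: "(x, y) \<in> path_image ?g - K" using im lt nK by auto
    show False
    proof (cases "a < b")
      case True
      then have "cut ?g a b" using arcs imK a b by (auto simp: cut_def)
      from cut_in_outside[OF this win] show False using no by simp
    next
      case False
      then have "b < a" using \<open>a \<noteq> b\<close> by simp
      moreover have "path_image (reversepath ?g) \<inter> K = {\<gamma> b, \<gamma> a}"
        unfolding path_image_reversepath imK a b by (rule insert_commute)
      ultimately have "cut (reversepath ?g) b a" using arcs a b by (simp add: cut_def)
      moreover have "(x, y) \<in> path_image (reversepath ?g) - K" unfolding path_image_reversepath by (rule win)
      ultimately show False using cut_in_outside no by simp
    qed
  qed
  then show ?thesis by (auto simp: outside_def)
qed

section \<open>Which points are accessible\<close>

lemma connected_Compl: "connected (- K)"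
  unfolding Compl_eq_outside using compact_K by (intro connected_outside compact_imp_bounded) auto

text \<open>A path from \<open>w\<close> to a point far away, enlarged by the complement of a large
  disk, keeps a positive distance \<delta> from K. Loops whose cut lies in a \<delta>-ball about a
  point of K cannot meet this set and hence leave \<open>w\<close> outside.\<close>

lemma escape:
  assumes "w \<notin> K"
  obtains U \<delta> where "connected U" "\<not> bounded U" "w \<in> U" "\<delta> > 0" "\<And>u k. u \<in> U \<Longrightarrow> k \<in> K \<Longrightarrow> \<delta> \<le> dist k u"
proof -
  obtain B where B: "B > 0" "K \<subseteq> ball 0 B"
    using bounded_subset_ballD[OF compact_imp_bounded[OF compact_K], of 0] by auto
  define u :: "real \<times> real" where "u = (B + 2, 0)"
  have nu: "norm u = B + 2" using B by (simp add: u_def norm_prod_def)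
  have uK: "u \<notin> K" using B nu by (auto dest!: subsetD)
  have "path_component (- K) w u"
    using connected_Compl closed_K assms uK
    by (metis Compl_iff connected_iff_connected_component open_Compl open_path_connected_component)
  then obtain p where p: "path p" "path_image p \<subseteq> - K" "pathstart p = w" "pathfinish p = u"
    unfolding path_component_def by auto
  have "compact (path_image p)" using p by (simp add: compact_path_image)
  then obtain d where d: "d > 0" "\<And>x y. x \<in> path_image p \<Longrightarrow> y \<in> K \<Longrightarrow> d \<le> dist x y"
    using separate_compact_closed[of "path_image p" K] closed_K p(2) by blast
  define U where "U = path_image p \<union> - cball 0 (B + 1)"
  have "connected (- cball (0::real \<times> real) (B + 1))"
    by (rule connected_complement_bounded_convex) auto
  moreover have "u \<in> - cball 0 (B + 1)" using nu by simp
  moreover have "u \<in> path_image p" "w \<in> path_image p" using p by auto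
  ultimately have "connected U" "w \<in> U" unfolding U_def
    using p(1) by (auto intro!: connected_Un)
  moreover have "\<not> bounded U" unfolding U_def using cobounded_imp_unbounded[of "- cball 0 (B+1)"] by auto
  moreover have "min d 1 \<le> dist k v" if "v \<in> U" "k \<in> K" for v k
  proof (cases "v \<in> path_image p")
    case True
    then show ?thesis using d(2)[of v k] that by (simp add: dist_commute)
  next
    case False
    then have "norm v > B + 1" using that by (simp add: U_def)
    moreover have "norm k < B" using that B by auto
    moreover have "norm v \<le> norm k + dist k v" by (metis dist_norm norm_minus_commute norm_triangle_sub add.commute)
    ultimately show ?thesis by simp
  qed
  ultimately show thesis using that[of U "min d 1"] d by auto
qed

lemma escape_outside:
  assumes "connected U" "\<not> bounded U" "\<And>u k. u \<in> U \<Longrightarrow> k \<in> K \<Longrightarrow> \<delta> \<le> dist k u" "\<delta> > 0"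
    and "z \<in> K" "path_image g \<subseteq> ball z \<delta>"
  shows "U \<subseteq> outside (loop g a b)"
proof (rule unbounded_connected_outside)
  have "u \<notin> \<gamma> ` {a..b}" if "u \<in> U" for u
    using assms(3)[OF that, of u] \<open>\<delta> > 0\<close> by auto
  moreover have "u \<notin> path_image g" if "u \<in> U" for u
    using assms(3)[OF that \<open>z \<in> K\<close>] assms(6) by auto
  ultimately show "U \<inter> loop g a b = {}" by (auto simp: loop_def)
qed (use assms in auto)

lemma not_accessible:
  assumes a: "a \<in> K - range \<gamma>"
  shows "\<not> accessible K a"
proof
  assume "accessible K a"
  then obtain g where g: "arc g" "path_image g \<inter> K = {a}" by (auto simp: accessible_def)
  have ag: "a \<in> path_image g" using g by blast
  obtain w where w: "w \<in> path_image g" "w \<noteq> a"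
    using arc_distinct_ends[OF g(1)] pathstart_in_path_image pathfinish_in_path_image by metis
  then have wK: "w \<notin> K" using g by blast
  obtain U \<delta> where U: "connected U" "\<not> bounded U" "w \<in> U" "\<delta> > 0" "\<And>u k. u \<in> U \<Longrightarrow> k \<in> K \<Longrightarrow> \<delta> \<le> dist k u"
    using escape[OF wK] by blast
  obtain z where z: "z \<in> K - range \<gamma>" "z \<noteq> a" using K_minus_line[of "{a}"] by auto
  have "z \<notin> path_image g" using z g by blast
  moreover have "closed (path_image g)" using g by (simp add: arc_imp_path closed_path_image)
  ultimately obtain d where d: "d > 0" "ball z d \<inter> path_image g = {}" using ball_avoids_closed by metis
  have e: "min d \<delta> > 0" using d U by simp
  obtain q A B where q': "good q A B" "A < - 0" "0 < B" "path_image q \<subseteq> ball z (min d \<delta>)"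
    using exists_good[OF z(1) e] .
  note q = q'(1,4)
  have qd: "path_image q \<subseteq> ball z d" "path_image q \<subseteq> ball z \<delta>"
    using q(2) subset_ball[OF min.cobounded1[of d \<delta>]] subset_ball[OF min.cobounded2[of d \<delta>]] by blast+
  have "w \<in> outside (loop q A B)"
    using escape_outside[OF U(1,2,5,4), of z q A B] z qd U(3) by auto
  moreover have disj: "path_image g \<inter> loop q A B = {}"
  proof -
    have "path_image g \<inter> path_image q = {}" using d(2) qd(1) by blast
    moreover have "path_image g \<inter> \<gamma> ` {A..B} = {}"
    proof -
      have "\<gamma> ` {A..B} \<subseteq> K" "a \<notin> \<gamma> ` {A..B}" using a by auto
      then have "x \<notin> path_image g" if "x \<in> \<gamma> ` {A..B}" for x
        using that g(2) by (metis IntI singletonD subsetD)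
      then show ?thesis unfolding disjoint_iff by metis
    qed
    ultimately show ?thesis unfolding loop_def by blast
  qed
  moreover have "connected (path_image g)" using g(1) by (simp add: arc_imp_path connected_path_image)
  ultimately have "path_image g \<subseteq> outside (loop q A B)"
    using connected_stays_outside w(1) by blast
  moreover have "a \<in> inside (loop q A B)" using good_inside[OF q(1)] a by blast
  ultimately show False using ag inside_Int_outside by blast
qed

lemma line_accessible: "accessible K (\<gamma> t)"
proof -
  obtain z where z: "z \<in> K - range \<gamma>" using K_minus_line[of "{}"] by auto
  obtain q A B where q: "good q A B" "A < - \<bar>t\<bar>" "\<bar>t\<bar> < B" "path_image q \<subseteq> ball z 1"
    using exists_good[OF z zero_less_one] .
  have cut: "cut q A B" using q by (simp add: good_def)
  obtain c where c: "simple_path c" "pathfinish c = pathstart c" "path_image c = loop q A B"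
    using loop_Jordan[OF cut] .
  have "\<gamma> t \<in> path_image c" unfolding c(3) loop_\<gamma>[OF cut] using q by auto
  then obtain p where p: "path p" "pathstart p \<in> outside (path_image c)" "pathfinish p = \<gamma> t"
    "path_image p - {\<gamma> t} \<subseteq> outside (path_image c)"
    using Jordan_outside_accessible[OF c(1,2)] by metis
  have "pathstart p \<noteq> pathfinish p" using p(2,3) \<open>\<gamma> t \<in> path_image c\<close> by (auto simp: outside_def)
  then obtain g where g: "arc g" "path_image g \<subseteq> path_image p" "pathfinish g = pathfinish p"
    using path_contains_arc[OF p(1) refl refl] by metis
  have "path_image p \<inter> K \<subseteq> {\<gamma> t}" using p(4) good_outside[OF q(1)] unfolding c(3) by blast
  moreover have "\<gamma> t \<in> path_image g" using g(3) p(3) pathfinish_in_path_image by metis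
  moreover have "\<gamma> t \<in> K" by simp
  ultimately have "path_image g \<inter> K = {\<gamma> t}" using g(2) by blast
  then show ?thesis using g(1) by (auto simp: accessible_def)
qed

section \<open>Crosscuts and their domains\<close>

lemma interior_K: "interior K = {}"
proof (rule ccontr)
  assume "interior K \<noteq> {}"
  then obtain z e where z: "e > 0" "ball z e \<subseteq> K" by (auto simp: mem_interior)
  then have zK: "z \<in> K" by auto
  obtain g a b where g: "arc g" "path_image g \<inter> K = {\<gamma> a, \<gamma> b}" "path_image g \<subseteq> ball z e"
    using small_cuts[OF zK z(1)] by blast
  then have "path_image g = {\<gamma> a, \<gamma> b}" using z by blast
  then have "finite (path_image g)" by simp
  moreover have "infinite (path_image g)"
  proof -
    have "inj_on g {0..1}" using g(1) by (simp add: arc_def)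
    moreover have "infinite {0..1::real}" by (rule infinite_Icc) simp
    ultimately show ?thesis unfolding path_image_def using finite_imageD by blast
  qed
  ultimately show False by blast
qed

text \<open>Half of a crosscut touches K only in its end point, so that end point is accessible and,
  by \<open>not_accessible\<close>, on the line. Every crosscut is thus a cut, up to
  orientation.\<close>

lemma crosscutD:
  assumes "crosscut K Q"
  obtains g a b where "cut g a b" "Q = path_image g"
proof -
  obtain g where g: "arc g" "Q = path_image g" "Q \<inter> K = {pathstart g, pathfinish g}"
    using assms by (auto simp: crosscut_def)
  have ne: "pathfinish g \<noteq> pathstart g" using g(1) arc_distinct_ends by blast
  have half: "x \<in> range \<gamma>" if x: "x = pathstart g \<or> x = pathfinish g" for x
  proof (rule ccontr)
    assume "x \<notin> range \<gamma>"
    moreover have "x \<in> K" using g x by blast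
    ultimately have na: "\<not> accessible K x" using not_accessible by simp
    define g' where "g' = (if x = pathstart g then subpath 0 (1/2) g else subpath (1/2) 1 g)"
    have arc': "arc g'" using g(1) by (simp add: g'_def arc_subpath_arc)
    have im: "path_image g' = g ` (if x = pathstart g then {0..1/2} else {1/2..1})"
      by (simp add: g'_def path_image_subpath)
    have inj: "inj_on g {0..1}" using g(1) by (simp add: arc_def)
    have "path_image g' \<inter> K \<subseteq> {x}"
    proof
      fix y assume y: "y \<in> path_image g' \<inter> K"
      then obtain t where t: "y = g t" "t \<in> (if x = pathstart g then {0..1/2} else {1/2..1})" unfolding im by blast
      then have t01: "t \<in> {0..1}" by (auto split: if_splits)
      then have "y \<in> Q \<inter> K" using y t g(2) by (auto simp: path_image_def)
      then have "y = g 0 \<or> y = g 1" unfolding g(3) by (auto simp: pathstart_def pathfinish_def)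
      then have "t = 0 \<or> t = 1" using t(1) t01 inj by (auto dest!: inj_onD)
      then show "y \<in> {x}" using t x by (auto simp: pathstart_def pathfinish_def split: if_splits)
    qed
    moreover have "x \<in> path_image g'" using x unfolding im by (auto simp: pathstart_def pathfinish_def)
    ultimately have "path_image g' \<inter> K = {x}" using \<open>x \<in> K\<close> by blast
    then show False using na arc' by (auto simp: accessible_def)
  qed
  obtain a where a: "pathstart g = \<gamma> a" using half by blast
  obtain b where b: "pathfinish g = \<gamma> b" using half by blast
  have "a \<noteq> b" using a b ne by auto
  then consider "a < b" | "b < a" by linarith
  then show thesis
  proof cases
    case 1
    then have "cut g a b" using g a b by (simp add: cut_def)
    then show thesis using that g(2) by blast
  next
    case 2
    then have "cut (reversepath g) b a" using g a b by (simp add: cut_def arc_reversepath insert_commute)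
    then show thesis using that[of "reversepath g"] g(2) by simp
  qed
qed

lemma cut_crosscut: "cut g a b \<Longrightarrow> crosscut K (path_image g)"
  unfolding cut_def crosscut_def by metis

text \<open>The line provides an arc of \<open>K\<close> between the end points of a crosscut, which turns the crosscut
  into a Jordan curve; Janiszewski's theorem shows that the rest of \<open>K\<close> does not separate further.\<close>

lemma side_component:
  assumes cut: "cut g a b" and S: "S = inside (loop g a b) \<or> S = outside (loop g a b)"
    and x: "x \<in> S - K"
  shows "connected_component_set (- (K \<union> path_image g)) x = S - K"
proof -
  note J = loop_facts[OF cut]
  let ?J = "loop g a b"
  have KJ: "K \<union> ?J = K \<union> path_image g" by (auto simp: loop_def)
  have S': "open S" "connected S" "S \<inter> ?J = {}" using S J by (auto simp: inside_def outside_def)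
  show ?thesis
  proof (intro equalityI subsetI)
    fix y assume "y \<in> connected_component_set (- (K \<union> path_image g)) x"
    then obtain T where T: "connected T" "T \<subseteq> - (K \<union> ?J)" "x \<in> T" "y \<in> T"
      unfolding KJ by (auto simp: connected_component_def)
    have "T \<subseteq> S"
      using S connected_stays_inside[OF T(1), of ?J] connected_stays_outside[OF T(1), of ?J] T x by blast
    then show "y \<in> S - K" using T by blast
  next
    fix y assume y: "y \<in> S - K"
    have "connected_component (- (K \<union> ?J)) x y"
    proof (rule Janiszewski_prod[OF compact_K J(11)])
      show "connected (K \<inter> ?J)" using loop_K[OF cut] connected_\<gamma>_image by (simp add: Int_commute)
      show "connected_component (- K) x y"
        using connected_Compl x y unfolding connected_component_def by blast
      show "connected_component (- ?J) x y"
        using S' x y unfolding connected_component_def by blast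
    qed
    then show "y \<in> connected_component_set (- (K \<union> path_image g)) x" unfolding KJ by simp
  qed
qed

lemma open_minus_K_nonempty: "open S \<Longrightarrow> S \<noteq> {} \<Longrightarrow> S - K \<noteq> {}"
  using interior_K interior_maximal[of S K] by blast

text \<open>The complement of K and a crosscut has just two components, the sides of the loop with K
  removed. Only the inner one is bounded, which makes the definite description in
  \<open>cut_domain\<close> proper.\<close>

lemma cut_domain_eq:
  assumes cut: "cut g a b"
  shows "cut_domain K (path_image g) = inside (loop g a b) - K"
    "connected (inside (loop g a b) - K)"
proof -
  note J = loop_facts[OF cut]
  let ?J = "loop g a b" and ?C = "- (K \<union> path_image g)"
  obtain x where x: "x \<in> inside ?J - K"
    using open_minus_K_nonempty[OF J(2,1)] by blast
  note comp = side_component[OF cut disjI1[OF refl] x]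
  show "connected (inside ?J - K)" unfolding comp[symmetric] by simp
  have "x \<notin> ?J" using x inside_no_overlap[of ?J] by blast
  then have "x \<in> ?C" using x by (auto simp: loop_def)
  then have "inside ?J - K \<in> components ?C \<and> bounded (inside ?J - K)"
    using comp J(6) unfolding components_def by (auto intro: bounded_subset)
  moreover have "U = inside ?J - K" if U: "U \<in> components ?C" "bounded U" for U
  proof -
    obtain y where y: "y \<in> ?C" "U = connected_component_set ?C y" using U(1) by (auto simp: components_def)
    have "y \<notin> ?J" using y(1) loop_K[OF cut] by (auto simp: loop_def)
    then consider "y \<in> inside ?J" | "y \<in> outside ?J" using inside_Un_outside[of ?J] by blast
    then show ?thesis
    proof cases
      case 1
      then show ?thesis using side_component[OF cut disjI1[OF refl], of y] y by auto
    next
      case 2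
      then have "U = outside ?J - K" using side_component[OF cut disjI2[OF refl], of y] y by auto
      then have "bounded (outside ?J)"
        using U(2) compact_imp_bounded[OF compact_K] by (metis Un_Diff_cancel2 bounded_Un)
      then show ?thesis using J(7) by blast
    qed
  qed
  ultimately show "cut_domain K (path_image g) = inside ?J - K"
    unfolding cut_domain_def by (intro the_equality) auto
qed

end

lemma subset_ball_min: "S \<subseteq> ball z (min d e) \<longleftrightarrow> S \<subseteq> ball z d \<and> S \<subseteq> ball z e"
  by (auto simp: subset_iff)

lemma equiv_chain_equiv: "equiv {Q. crosscut_chain K Q} (chain_equiv K)"
proof (rule equivI)
  show "chain_equiv K \<subseteq> {Q. crosscut_chain K Q} \<times> {Q. crosscut_chain K Q}"
    by (auto simp: chain_equiv_def)
  show "refl_on {Q. crosscut_chain K Q} (chain_equiv K)"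
    by (auto simp: refl_on_def chain_equiv_def)
  show "sym (chain_equiv K)" by (auto simp: sym_def chain_equiv_def)
  show "trans (chain_equiv K)"
    unfolding trans_def chain_equiv_def
    by clarsimp (meson subset_trans)
qed

context dense_line
begin

text \<open>The inner loop avoids the connected unbounded set outside the outer loop, so that set is
  outside the inner loop too. Its closure contains the outer loop, hence the open inside of the
  inner loop misses both.\<close>

lemma nested_loops:
  assumes q: "good q A B" and g: "cut g a b" and sub: "path_image g \<subseteq> inside (loop q A B) \<union> K"
  shows "inside (loop g a b) \<subseteq> inside (loop q A B)"
proof -
  have cq: "cut q A B" using q by (simp add: good_def)
  note Jq = loop_facts[OF cq] and Jg = loop_facts[OF g]
  have "loop g a b \<subseteq> - outside (loop q A B)"
  proof -
    have "K \<inter> outside (loop q A B) = {}" using good_outside[OF q] by blast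
    moreover have "\<gamma> ` {a..b} \<subseteq> K" by auto
    ultimately show ?thesis using sub inside_Int_outside[of "loop q A B"] unfolding loop_def by blast
  qed
  then have "outside (loop q A B) \<subseteq> outside (loop g a b)"
    by (intro unbounded_connected_outside) (use Jq in auto)
  then have disj: "inside (loop g a b) \<inter> outside (loop q A B) = {}"
    using inside_Int_outside[of "loop g a b"] by blast
  then have "inside (loop g a b) \<inter> closure (outside (loop q A B)) = {}"
    using Jg(2) open_Int_closure_eq_empty by blast
  then show ?thesis using disj Jq(9) inside_Un_outside[of "loop q A B"] by blast
qed

lemma dense_sequence:
  obtains z :: "nat \<Rightarrow> real \<times> real" where "\<And>n. z n \<in> K - range \<gamma>"
    "\<And>k e N. k \<in> K \<Longrightarrow> e > 0 \<Longrightarrow> \<exists>n\<ge>N. dist (z n) k < e"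
proof -
  obtain D where D: "countable D" "D \<subseteq> K - range \<gamma>" "K - range \<gamma> \<subseteq> closure D"
    using separable[of "K - range \<gamma>"] by metis
  have ne: "D \<noteq> {}" using D(3) K_minus_line[of "{}"] by auto
  \<comment> \<open>\<open>prod_decode\<close> repeats every point of \<open>D\<close> infinitely
    often, so each approximation recurs at arbitrarily late indices.\<close>
  define z where "z n = from_nat_into D (fst (prod_decode n))" for n
  have "K \<subseteq> closure D" using codense closure_mono[OF D(3)] by auto
  have "\<exists>n\<ge>N. dist (z n) k < e" if k: "k \<in> K" "e > 0" for k e N
  proof -
    obtain d where d: "d \<in> D" "dist d k < e"
      using k \<open>K \<subseteq> closure D\<close> by (meson closure_approachable subsetD)
    obtain i where i: "from_nat_into D i = d" using from_nat_into_surj[OF D(1) d(1)] by blast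
    have "z (prod_encode (i, N)) = d" by (simp add: z_def i)
    then show ?thesis using d(2) le_prod_encode_2[of N i] by blast
  qed
  moreover have "z n \<in> K - range \<gamma>" for n using from_nat_into[OF ne] D(2) by (auto simp: z_def)
  ultimately show thesis using that by blast
qed

text \<open>Points off the line lie inside every good loop, so the next cut can be placed near
  \<open>z (Suc n)\<close> and inside the previous loop.\<close>

lemma nested_good_cuts:
  fixes z :: "nat \<Rightarrow> real \<times> real"
  assumes z: "\<And>n. z n \<in> K - range \<gamma>"
  obtains G A B where "\<And>n::nat. good (G n) (A n) (B n)" "\<And>n. path_image (G n) \<subseteq> ball (z n) (1 / Suc n)"
    "\<And>n. path_image (G (Suc n)) \<subseteq> inside (loop (G n) (A n) (B n))"
proof -
  define P where "P n x = (good (fst x) (fst (snd x)) (snd (snd x)) \<and> path_image (fst x) \<subseteq> ball (z n) (1 / Suc n))"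
    for n :: nat and x :: "(real \<Rightarrow> real \<times> real) \<times> real \<times> real"
  define R where "R x y = (path_image (fst y) \<subseteq> inside (loop (fst x) (fst (snd x)) (snd (snd x))))"
    for x y :: "(real \<Rightarrow> real \<times> real) \<times> real \<times> real"
  have 1: "\<exists>x. P 0 x"
  proof -
    obtain g a b where "good g a b" "a < - 0" "0 < b" "path_image g \<subseteq> ball (z 0) 1"
      using exists_good[OF z zero_less_one] .
    then have "P 0 (g, a, b)" by (simp add: P_def)
    then show ?thesis by blast
  qed
  have 2: "\<exists>y. P (Suc n) y \<and> R x y" if x: "P n x" for x n
  proof -
    obtain g a b where xg: "x = (g, a, b)" by (cases x)
    have gg: "good g a b" using x by (simp add: P_def xg)
    then have "open (inside (loop g a b))" using loop_facts(2) by (simp add: good_def)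
    moreover have "z (Suc n) \<in> inside (loop g a b)" using good_inside[OF gg] z by blast
    ultimately obtain e where e: "e > 0" "ball (z (Suc n)) e \<subseteq> inside (loop g a b)"
      using open_contains_ball by blast
    have e': "min e (1 / Suc (Suc n)) > 0" using e by simp
    obtain g' a' b' where "good g' a' b'" "a' < - 0" "0 < b'"
      "path_image g' \<subseteq> ball (z (Suc n)) (min e (1 / Suc (Suc n)))"
      using exists_good[OF z e'] .
    then have "P (Suc n) (g', a', b') \<and> R x (g', a', b')"
      using e(2) by (simp add: P_def R_def xg subset_ball_min) (meson subset_trans)
    then show ?thesis by blast
  qed
  obtain f where f: "\<And>n. P n (f n)" "\<And>n. R (f n) (f (Suc n))"
    using dependent_nat_choice[of P "\<lambda>_. R", OF 1 2] by blast
  show thesis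
    by (rule that[of "\<lambda>n. fst (f n)" "\<lambda>n. fst (snd (f n))" "\<lambda>n. snd (snd (f n))"])
      (use f in \<open>simp_all add: P_def R_def\<close>)
qed

lemma unique_canal: "\<exists>!P. simple_dense_canal K P"
proof -
  obtain z where z: "\<And>n::nat. z n \<in> K - range \<gamma>"
    and zd: "\<And>k e N. k \<in> K \<Longrightarrow> e > 0 \<Longrightarrow> \<exists>n\<ge>N. dist (z n) k < e"
    using dense_sequence by blast
  obtain G A B where good: "\<And>n::nat. good (G n) (A n) (B n)"
    and small: "\<And>n. path_image (G n) \<subseteq> ball (z n) (1 / Suc n)"
    and next_in: "\<And>n. path_image (G (Suc n)) \<subseteq> inside (loop (G n) (A n) (B n))"
    using nested_good_cuts[of z, OF z] by blast
  define C where "C n = path_image (G n)" for n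
  define D where "D n = inside (loop (G n) (A n) (B n))" for n
  have cut: "cut (G n) (A n) (B n)" for n using good by (simp add: good_def)
  note J = loop_facts[OF cut]
  have dom: "cut_domain K (C n) = D n - K" "connected (D n - K)" for n
    using cut_domain_eq[OF cut] by (auto simp: C_def D_def)
  have D_Suc: "D (Suc n) \<subseteq> D n" for n
    unfolding D_def by (rule nested_loops[OF good cut]) (use next_in in blast)
  then have D_mono: "m \<le> n \<Longrightarrow> D n \<subseteq> D m" for m n by (rule lift_Suc_antimono_le)
  have CD: "C n \<subseteq> D m" if "m < n" for m n
  proof -
    have "C n \<subseteq> D (n - 1)" using next_in[of "n - 1"] that by (simp add: C_def D_def)
    moreover have "D (n - 1) \<subseteq> D m" using that by (intro D_mono) simp
    ultimately show ?thesis by (rule subset_trans)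
  qed
  have CD0: "C n \<inter> D n = {}" for n
  proof -
    have "C n \<subseteq> loop (G n) (A n) (B n)" by (auto simp: C_def loop_def)
    then show ?thesis unfolding D_def using inside_no_overlap[of "loop (G n) (A n) (B n)"] by blast
  qed
  have disj: "C m \<inter> C n = {}" if "m \<noteq> n" for m n
    using that CD[of m n] CD[of n m] CD0[of m] CD0[of n] by (cases "m < n") force+
  have diam: "(\<lambda>n. diameter (C n)) \<longlonglongrightarrow> 0"
  proof (rule real_tendsto_sandwich)
    show "\<forall>\<^sub>F n in sequentially. 0 \<le> diameter (C n)"
      by (intro always_eventually allI diameter_ge_0 bounded_subset[OF bounded_ball]) (use small C_def in blast)
    have "diameter (C n) \<le> 2 * (1 / Suc n)" for n
    proof -
      have "diameter (C n) \<le> diameter (ball (z n) (1 / Suc n))"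
        using small[of n] by (intro diameter_subset bounded_ball) (simp add: C_def)
      then show ?thesis by simp
    qed
    then show "\<forall>\<^sub>F n in sequentially. diameter (C n) \<le> 2 * (1 / Suc n)" by simp
    show "(\<lambda>n. 2 * (1 / real (Suc n))) \<longlonglongrightarrow> 0"
      using tendsto_mult_right_zero[OF LIMSEQ_inverse_real_of_nat, of 2] by (simp add: inverse_eq_divide)
  qed simp
  \<comment> \<open>Subsequences of \<open>C\<close> are again chains and equivalent to
    \<open>C\<close>. Since the cuts follow a dense sequence, some subsequence converges to any
    prescribed point of K, which makes the principal set all of K.\<close>
  have chain_sub: "crosscut_chain K (C \<circ> f)" if "strict_mono f" for f
    unfolding crosscut_chain_def
  proof (intro conjI allI)
    show "crosscut K ((C \<circ> f) i)" for i using cut_crosscut[OF cut] by (simp add: C_def)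
    show "disjoint_family (C \<circ> f)"
      unfolding disjoint_family_on_def using disj strict_mono_eq[OF that] by simp
    show "(\<lambda>i. diameter ((C \<circ> f) i)) \<longlonglongrightarrow> 0"
      using LIMSEQ_subseq_LIMSEQ[OF diam that] by (simp add: o_def)
    show "cut_domain K ((C \<circ> f) (Suc i)) \<subseteq> cut_domain K ((C \<circ> f) i)" for i
      using D_mono[of "f i" "f (Suc i)"] strict_monoD[OF that, of i "Suc i"] by (auto simp: dom)
  qed
  have chain: "crosscut_chain K C" using chain_sub[of id] by (simp add: strict_mono_def)
  have equiv_sub: "(C, C \<circ> f) \<in> chain_equiv K" if "strict_mono f" for f
  proof -
    have "cut_domain K ((C \<circ> f) i) \<subseteq> cut_domain K (C i)" for i
      using D_mono[of i "f i"] seq_suble[OF that, of i] by (auto simp: dom)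
    moreover have "cut_domain K (C (f i)) \<subseteq> cut_domain K ((C \<circ> f) i)" for i by simp
    ultimately show ?thesis unfolding chain_equiv_def using chain chain_sub[OF that] by blast
  qed
  note eqv = equiv_chain_equiv[of K]
  \<comment> \<open>This bounds the impression from above: a point off K is eventually in the open
    outside of the loops, away from the closure of their insides.\<close>
  have esc: "\<exists>N. \<forall>n\<ge>N. w \<in> outside (loop (G n) (A n) (B n))" if w: "w \<notin> K" for w
  proof -
    obtain U \<delta> where U: "connected U" "\<not> bounded U" "w \<in> U" "\<delta> > 0" "\<And>u k. u \<in> U \<Longrightarrow> k \<in> K \<Longrightarrow> \<delta> \<le> dist k u"
      using escape[OF w] by blast
    obtain N where N: "inverse (real (Suc N)) < \<delta>" using reals_Archimedean[OF U(4)] by blast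
    have "w \<in> outside (loop (G n) (A n) (B n))" if n: "n \<ge> N" for n
    proof -
      have "1 / real (Suc n) \<le> 1 / real (Suc N)" using n by (intro divide_left_mono) auto
      then have "1 / real (Suc n) \<le> \<delta>" using N by (simp add: inverse_eq_divide)
      then have "path_image (G n) \<subseteq> ball (z n) \<delta>" using small[of n] subset_ball by blast
      then show ?thesis using escape_outside[OF U(1,2,5,4), of "z n" "G n"] z[of n] U(3) by blast
    qed
    then show ?thesis by blast
  qed
  have near: "\<exists>n\<ge>N. C n \<subseteq> ball k e" if "k \<in> K" "e > 0" for k e N
  proof -
    obtain N' where N': "inverse (real (Suc N')) < e/2" using reals_Archimedean[of "e/2"] \<open>e > 0\<close> by auto
    have "e/2 > 0" using \<open>e > 0\<close> by simp
    then obtain n where n: "n \<ge> max N N'" "dist (z n) k < e/2" using zd[OF \<open>k \<in> K\<close>] by blast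
    have "1 / real (Suc n) \<le> 1 / real (Suc N')" using n by (intro divide_left_mono) auto
    then have "1 / real (Suc n) < e/2" using N' by (simp add: inverse_eq_divide)
    then have "ball (z n) (1 / Suc n) \<subseteq> ball k e"
      using n(2) unfolding ball_subset_ball_iff by (simp add: dist_commute)
    then show ?thesis using small[of n] n(1) by (auto simp: C_def)
  qed
  define P0 where "P0 = chain_equiv K `` {C}"
  have P0: "P0 \<in> prime_ends K" using chain by (auto simp: prime_ends_def P0_def quotient_def)
  have sub_princ: "principal_set P \<subseteq> K" if P: "P \<in> prime_ends K" for P
  proof
    fix a assume "a \<in> principal_set P"
    then obtain Q where Q: "Q \<in> P" "\<And>e. e > 0 \<Longrightarrow> \<forall>\<^sub>F i in sequentially. Q i \<subseteq> ball a e"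
      by (auto simp: principal_set_def)
    have "crosscut_chain K Q" using P Q(1) eqv by (auto simp: prime_ends_def quotient_def chain_equiv_def)
    then have ne: "Q i \<inter> K \<noteq> {}" for i unfolding crosscut_chain_def crosscut_def by blast
    have "a \<in> closure K" unfolding closure_approachable
    proof (intro allI impI)
      fix e :: real assume "e > 0"
      then obtain i where "Q i \<subseteq> ball a e" using Q(2) by (meson eventually_happens' sequentially_bot)
      moreover obtain y where "y \<in> Q i" "y \<in> K" using ne[of i] by blast
      ultimately have "dist y a < e" by (metis dist_commute mem_ball subsetD)
      then show "\<exists>y\<in>K. dist y a < e" using \<open>y \<in> K\<close> by blast
    qed
    then show "a \<in> K" using closed_K by simp
  qed
  have princ: "principal_set P0 = K"
  proof (intro equalityI sub_princ[OF P0] subsetI)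
    fix a assume a: "a \<in> K"
    have ex: "\<exists>m>n. C m \<subseteq> ball a (1 / Suc k)" for n k
      using near[OF a, of "1 / Suc k" "Suc n"] by (auto simp: Suc_le_eq)
    have "\<exists>f. \<forall>k. C (f k) \<subseteq> ball a (1 / Suc k) \<and> f k < f (Suc k)"
    proof (rule dependent_nat_choice)
      show "\<exists>x. C x \<subseteq> ball a (1 / real (Suc 0))" using ex[of 0 0] by blast
      show "\<exists>y. C y \<subseteq> ball a (1 / real (Suc (Suc n))) \<and> x < y" for x n using ex[of x "Suc n"] by blast
    qed
    then obtain f where f: "\<And>k. C (f k) \<subseteq> ball a (1 / Suc k)" "\<And>k. f k < f (Suc k)" by blast
    have sm: "strict_mono f" using f(2) by (simp add: strict_mono_Suc_iff)
    have "C \<circ> f \<in> P0" using equiv_sub[OF sm] by (simp add: P0_def)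
    moreover have "\<forall>\<^sub>F i in sequentially. (C \<circ> f) i \<subseteq> ball a e" if e: "e > 0" for e
    proof -
      obtain N where N: "inverse (real (Suc N)) < e" using reals_Archimedean[OF e] by blast
      have "(C \<circ> f) i \<subseteq> ball a e" if i: "i \<ge> N" for i
      proof -
        have "1 / real (Suc i) \<le> 1 / real (Suc N)" using i by (intro divide_left_mono) auto
        then have "1 / real (Suc i) \<le> e" using N by (simp add: inverse_eq_divide)
        then show ?thesis using f(1)[of i] subset_ball by fastforce
      qed
      then show ?thesis using eventually_sequentially by blast
    qed
    ultimately show "a \<in> principal_set P0" unfolding principal_set_def by blast
  qed
  have clD: "K \<subseteq> closure (D n - K)" for n
  proof -
    have "x \<in> closure (D n - K)" if x: "x \<in> K - range \<gamma>" for x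
      unfolding closure_approachable
    proof (intro allI impI)
      fix e :: real assume "e > 0"
      have "x \<in> D n" using good_inside[OF good] x by (auto simp: D_def)
      moreover have "open (D n)" using J(2) by (simp add: D_def)
      ultimately have "open (D n \<inter> ball x e)" "x \<in> D n \<inter> ball x e" using \<open>e > 0\<close> by auto
      then obtain y where "y \<in> D n \<inter> ball x e - K" using open_minus_K_nonempty by blast
      then have "y \<in> D n - K" "dist y x < e" by (auto simp: dist_commute)
      then show "\<exists>y\<in>D n - K. dist y x < e" by blast
    qed
    then show ?thesis using codense closure_mono[of "K - range \<gamma>"] by (metis closed_closure closure_minimal subset_iff subset_trans)
  qed
  have impr: "impression K P0 = K"
  proof -
    \<comment> \<open>\<open>impression\<close> chooses some representative; interleaving it with
      \<open>C\<close> in both directions gives the two inclusions.\<close>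
    define R where "R = (SOME R. R \<in> P0)"
    have "C \<in> P0" using chain by (auto simp: P0_def chain_equiv_def)
    then have "R \<in> P0" unfolding R_def by (metis someI_ex)
    then have R: "\<And>i. \<exists>j. cut_domain K (R j) \<subseteq> cut_domain K (C i)" "\<And>i. \<exists>j. cut_domain K (C j) \<subseteq> cut_domain K (R i)"
      by (auto simp: P0_def chain_equiv_def)
    have "K \<subseteq> closure (cut_domain K (R i))" for i
    proof -
      obtain j where "cut_domain K (C j) \<subseteq> cut_domain K (R i)" using R(2) by blast
      then have "closure (D j - K) \<subseteq> closure (cut_domain K (R i))" unfolding dom by (rule closure_mono)
      then show ?thesis using clD[of j] by blast
    qed
    moreover have "w \<in> K" if w: "\<And>i. w \<in> closure (cut_domain K (R i))" for w
    proof (rule ccontr)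
      assume "w \<notin> K"
      then obtain n where n: "w \<in> outside (loop (G n) (A n) (B n))" using esc by blast
      obtain j where "cut_domain K (R j) \<subseteq> D n - K" using R(1)[of n] unfolding dom by blast
      then have "closure (cut_domain K (R j)) \<subseteq> closure (D n)" by (intro closure_mono) blast
      then have "w \<in> closure (D n)" using w by blast
      moreover have "outside (loop (G n) (A n) (B n)) \<inter> D n = {}" by (simp add: D_def Int_commute)
      ultimately show False using n J(4) open_Int_closure_eq_empty by blast
    qed
    ultimately show ?thesis unfolding impression_def Let_def R_def[symmetric] by blast
  qed
  have "simple_dense_canal K P0"
  proof -
    have "\<gamma> 0 \<in> K" "\<gamma> 1 \<in> K" "\<gamma> 0 \<noteq> \<gamma> 1" by simp_all
    then have "\<exists>a\<in>K. \<exists>b\<in>K. a \<noteq> b" by (intro bexI)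
    then show ?thesis unfolding simple_dense_canal_def using P0 princ impr by (intro conjI)
  qed
  moreover have "P = P0" if P: "simple_dense_canal K P" for P
  proof -
    have PP: "P \<in> prime_ends K" "principal_set P = K" "impression K P = K"
      using P by (auto simp: simple_dense_canal_def)
    obtain x where x: "x \<in> K - range \<gamma>" using K_minus_line[of "{}"] by auto
    then have "x \<in> principal_set P" using PP by blast
    then obtain Q where Q: "Q \<in> P" "\<And>e. e > 0 \<Longrightarrow> \<forall>\<^sub>F i in sequentially. Q i \<subseteq> ball x e"
      by (auto simp: principal_set_def)
    obtain R0 where R0: "crosscut_chain K R0" "P = chain_equiv K `` {R0}"
      using PP(1) by (auto simp: prime_ends_def quotient_def)
    have Qc: "crosscut_chain K Q" using Q(1) R0 by (auto simp: chain_equiv_def)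
    have PQ: "P = chain_equiv K `` {Q}" using Q(1) R0 eqv by (metis Image_singleton_iff equiv_class_eq)
    define R where "R = (SOME R. R \<in> P)"
    have "R \<in> P" unfolding R_def using Q(1) by (metis someI_ex)
    \<comment> \<open>That the impression is K means that every domain of \<open>Q\<close>
      accumulates on all of K. This later shows that \<open>D n\<close> meets the inner side of the
      loop of \<open>Q i\<close>.\<close>
    have KQ: "K \<subseteq> closure (cut_domain K (Q i))" for i
    proof -
      have "(Q, R) \<in> chain_equiv K" using \<open>R \<in> P\<close> PQ by blast
      then obtain j where "cut_domain K (R j) \<subseteq> cut_domain K (Q i)"
        unfolding chain_equiv_def by blast
      then have "closure (cut_domain K (R j)) \<subseteq> closure (cut_domain K (Q i))" by (rule closure_mono)
      moreover have "K \<subseteq> closure (cut_domain K (R j))"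
        using PP(3) unfolding impression_def Let_def R_def[symmetric] by blast
      ultimately show ?thesis by blast
    qed
    have Qcut: "\<exists>g a b. cut g a b \<and> Q i = path_image g" for i
      using Qc crosscutD unfolding crosscut_chain_def by metis
    have 1: "\<exists>i. cut_domain K (Q i) \<subseteq> cut_domain K (C n)" for n
    proof -
      have "x \<in> D n" "open (D n)" using good_inside[OF good] x J(2) by (auto simp: D_def)
      then obtain e where e: "e > 0" "ball x e \<subseteq> D n" using open_contains_ball by blast
      obtain i where i: "Q i \<subseteq> ball x e" using Q(2)[OF e(1)] by (meson eventually_happens' sequentially_bot)
      obtain g a b where g: "cut g a b" "Q i = path_image g" using Qcut by blast
      have "inside (loop g a b) \<subseteq> D n"
        unfolding D_def by (rule nested_loops[OF good g(1)]) (use i e g in \<open>auto simp: D_def\<close>)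
      then show ?thesis unfolding dom using cut_domain_eq(1)[OF g(1)] g(2) by (intro exI[of _ i]) auto
    qed
    have 2: "\<exists>n. cut_domain K (C n) \<subseteq> cut_domain K (Q i)" for i
    proof -
      obtain g a b where g: "cut g a b" "Q i = path_image g" using Qcut by blast
      have gs: "arc g" "path_image g \<inter> K = {\<gamma> a, \<gamma> b}" "pathstart g = \<gamma> a" "pathfinish g = \<gamma> b" "a < b"
        using g(1) by (auto simp: cut_def)
      \<comment> \<open>The open crosscut misses K and, for suitable late n, also the tiny cut
        \<open>C n\<close>. It contains the point \<open>w\<close> outside the n-th loop, so it
        stays outside and cannot cut \<open>D n\<close>.\<close>
      define Q0 where "Q0 = path_image g - {\<gamma> a, \<gamma> b}"
      have Q0: "connected Q0" "Q0 \<noteq> {}" "Q0 \<inter> K = {}"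
        unfolding Q0_def using connected_simple_path_endless[of g] nonempty_simple_path_endless[of g]
          gs arc_imp_simple_path by auto
      then obtain w where w: "w \<in> Q0" "w \<notin> K" by blast
      obtain N where N: "\<And>n. n \<ge> N \<Longrightarrow> w \<in> outside (loop (G n) (A n) (B n))" using esc[OF w(2)] by blast
      have "x \<notin> path_image g" using x gs(2) by blast
      then obtain d where d: "d > 0" "ball x d \<inter> path_image g = {}"
        using ball_avoids_closed closed_arc_image[OF gs(1)] by metis
      obtain n where n: "n \<ge> N" "C n \<subseteq> ball x d" using near[of x d N] x d by auto
      have "Q0 \<inter> loop (G n) (A n) (B n) = {}"
      proof -
        have "Q0 \<inter> path_image (G n) = {}" using n(2) d(2) by (auto simp: Q0_def C_def)
        moreover have "\<gamma> ` {A n..B n} \<subseteq> K" by auto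
        ultimately show ?thesis using Q0(3) unfolding loop_def by blast
      qed
      then have "Q0 \<subseteq> outside (loop (G n) (A n) (B n))"
        using connected_stays_outside[OF Q0(1)] N[OF n(1)] w(1) by blast
      then have "Q0 \<inter> D n = {}" using inside_Int_outside[of "loop (G n) (A n) (B n)"] unfolding D_def by blast
      then have DQ: "(D n - K) \<inter> loop g a b = {}"
      proof -
        have "loop g a b \<subseteq> Q0 \<union> K" by (auto simp: loop_def Q0_def)
        then show ?thesis using \<open>Q0 \<inter> D n = {}\<close> by blast
      qed
      have "(D n - K) \<inter> inside (loop g a b) \<noteq> {}"
      proof -
        have "x \<in> closure (cut_domain K (Q i))" using KQ x by blast
        moreover have "x \<in> D n" "open (D n)" using good_inside[OF good] x J(2) by (auto simp: D_def)
        ultimately have "D n \<inter> cut_domain K (Q i) \<noteq> {}" using open_Int_closure_eq_empty by blast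
        then show ?thesis using cut_domain_eq(1)[OF g(1)] g(2) by auto
      qed
      then have "D n - K \<subseteq> inside (loop g a b)"
        by (rule connected_stays_inside[OF dom(2) DQ])
      then show ?thesis unfolding dom using cut_domain_eq(1)[OF g(1)] g(2) by (intro exI[of _ n]) auto
    qed
    have "(C, Q) \<in> chain_equiv K" unfolding chain_equiv_def using chain Qc 1 2 by auto
    then show "P = P0" unfolding PQ P0_def using equiv_class_eq[OF eqv] by metis
  qed
  ultimately show ?thesis by blast
qed

end

section \<open>Codes of backward orbits\<close>

lemma less_eq_word_snoc:
  assumes "word_le (p @ [a]) (p @ [b])" "a \<noteq> b"
  shows "if even (ones p) then b else a"
proof -
  from assms have "word_less (p @ [a]) (p @ [b])" by (auto simp: word_le_def)
  then obtain k where k: "k < Suc (length p)"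
    "if even (ones (take k (p @ [a]))) then (p @ [a]) ! k < (p @ [b]) ! k else (p @ [b]) ! k < (p @ [a]) ! k"
    unfolding word_less_def by auto
  have "k = length p" using k by (cases "k < length p") (auto simp: nth_append split: if_splits)
  then show ?thesis using k(2) by (simp split: if_splits)
qed

lemma word_leI:
  assumes len: "length u = length v"
    and *: "\<And>k. k < length u \<Longrightarrow> take k u = take k v \<Longrightarrow> u ! k \<noteq> v ! k \<Longrightarrow>
      (if even (ones (take k u)) then v ! k else u ! k)"
  shows "word_le u v"
proof (cases "u = v")
  case False
  then have ex: "\<exists>k<length u. u ! k \<noteq> v ! k" using len nth_equalityI by blast
  define k where "k = (LEAST k. k < length u \<and> u ! k \<noteq> v ! k)"
  have k: "k < length u" "u ! k \<noteq> v ! k" using LeastI_ex[OF ex] unfolding k_def by auto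
  have "u ! i = v ! i" if "i < k" for i
    using not_less_Least[OF that[unfolded k_def]] that k by auto
  then have tk: "take k u = take k v" using k len by (intro nth_take_lemma) auto
  from *[OF k(1) tk k(2)] have "word_less u v"
    unfolding word_less_def using k tk len by (intro exI[of _ k]) (auto split: if_splits)
  then show ?thesis by (simp add: word_le_def)
qed (simp add: word_le_def)

lemma ones_snoc: "ones (u @ [b]) = ones u + (if b then 1 else 0)"
  by (simp add: ones_def)

locale tent_param =
  fixes s :: real
  assumes s_lo: "sqrt 2 < s" and s_hi: "s < 2"
begin

abbreviation "T \<equiv> tent s"

text \<open>\<open>d1\<close> to \<open>d4\<close> are the first four images of the critical point,
  where \<open>d3\<close> is \<open>T d2\<close> because \<open>d2\<close> lies left of 1/2;
  \<open>r\<close> is the fixed point in the right half.\<close>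

definition d1 :: real where "d1 = s / 2"
definition d2 :: real where "d2 = s * (1 - s / 2)"
definition d3 :: real where "d3 = s * d2"
definition d4 :: real where "d4 = T d3"
definition r :: real where "r = s / (1 + s)"

lemma s2: "s * s > 2"
proof -
  have "(0::real) < sqrt 2" by simp
  then have "0 < s" using s_lo by linarith
  then have "sqrt 2 * sqrt 2 < s * s" using s_lo by (intro mult_strict_mono) auto
  then show ?thesis by simp
qed

lemma s1: "s > 1" "s > 0"
proof -
  have "1 < sqrt (2::real)" by simp
  then show "s > 1" using s_lo by linarith
  then show "s > 0" by simp
qed

lemma T_half: "T (1/2) = d1" by (simp add: tent_def d1_def)

lemma T_left: "t \<le> 1/2 \<Longrightarrow> T t = s * t"
  using s1 by (simp add: tent_def min_def)

lemma T_right: "t \<ge> 1/2 \<Longrightarrow> T t = s * (1 - t)"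
  using s1 by (simp add: tent_def min_def)

lemma T_le: "T t \<le> d1"
  using s1 by (cases "t \<le> 1/2") (auto simp: T_left T_right d1_def)

lemma T_eq_d1: "T t = d1 \<longleftrightarrow> t = 1/2"
  using s1 by (cases "t \<le> 1/2") (auto simp: T_left T_right d1_def field_simps)

text \<open>The condition s > sqrt 2 enters in \<open>d3 < r\<close>, which amounts to (s^2 - 2)(s -
  1) > 0. Similarly \<open>d2 < 1/2\<close> is (s - 1)^2 > 0, and \<open>0 < d2\<close> is s <
  2.\<close>

lemma d_order: "0 < d2" "d2 < 1/2" "1/2 < r" "r < d1" "d1 < 1" "d2 < d3" "d3 < r" "1/2 < d1" "d2 < d1"
proof -
  show "0 < d2" using s1 s_hi by (simp add: d2_def)
  have "(s - 1)^2 > 0" using s1 by simp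
  then have "s * 2 < 1 + s * s" by (simp add: power2_eq_square algebra_simps)
  then show "d2 < 1/2" by (simp add: d2_def algebra_simps)
  show "1/2 < r" using s1 by (simp add: r_def field_simps)
  show "r < d1" using s1 by (simp add: r_def d1_def field_simps)
  show "d1 < 1" using s_hi by (simp add: d1_def)
  show "1/2 < d1" using s1 by (simp add: d1_def)
  show "d2 < d1" using \<open>d2 < 1/2\<close> \<open>1/2 < d1\<close> by simp
  show "d2 < d3" using \<open>0 < d2\<close> s1 by (simp add: d3_def)
  have "0 < (s * s - 2) * (s - 1)" using s2 s1 by (intro mult_pos_pos) auto
  then have "s * (2 - s) * (1 + s) < 2" by (simp add: algebra_simps)
  then have "s * (s * (2 - s) * (1 + s)) < s * 2" using s1 by (intro mult_strict_left_mono) auto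
  then show "d3 < r" using s1 by (simp add: d3_def d2_def r_def field_simps)
qed

text \<open>1 - 1/(2s) is the right preimage of 1/2. Hence the right preimage of a core point left
  of 1/2 exceeds \<open>d3\<close> and has in turn a left preimage in the core.\<close>

lemma d3_bound: "d3 < 1 - 1 / (2 * s)"
proof -
  have "r \<le> 1 - 1 / (2 * s)" using s1 by (simp add: r_def field_simps)
  then show ?thesis using d_order by linarith
qed

lemma T_r: "T r = r" using d_order s1 by (simp add: T_right) (simp add: r_def field_simps)
lemma T_d1: "T d1 = d2" using d_order by (simp add: T_right d2_def d1_def)
lemma d4_bounds: "d3 < d4" "d4 \<le> s * d3" "d4 \<le> s * (1 - d3)" "d4 \<le> d1"
proof -
  show "d4 \<le> s * d3" "d4 \<le> s * (1 - d3)" by (auto simp: d4_def tent_def)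
  show "d4 \<le> d1" by (simp add: d4_def T_le)
  have "d3 < s * d3" using d_order s1 by simp
  moreover have "d3 < s * (1 - d3)"
    using d_order(7) s1 by (simp add: r_def field_simps)
  ultimately show "d3 < d4" by (simp add: d4_def tent_def)
qed

abbreviation "core \<equiv> {d2..d1}"

lemma T_core:
  assumes "t \<in> core" shows "T t \<in> core"
proof (cases "t \<le> 1/2")
  case True
  have "s * t \<ge> 1 * t" using assms s1 d_order by (intro mult_right_mono) auto
  then show ?thesis using assms True T_le[of t] by (simp add: T_left)
next
  case False
  have "s * (1 - t) \<ge> s * (1 - d1)" using assms s1 by (intro mult_left_mono) auto
  then show ?thesis using False T_le[of t] T_d1 d_order by (simp add: T_right)
qed

lemma core_01: "core \<subseteq> {0..1}" using d_order by auto

lemma core_iff: "x \<in> tent_core s \<longleftrightarrow> (\<forall>n. x n \<in> core \<and> T (x (Suc n)) = x n)"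
proof -
  have "T (T (1/2)) = d2" "T (1/2) = d1" by (simp_all add: T_half T_d1)
  moreover have "0 \<le> t \<and> t \<le> 1" if "d2 \<le> t \<and> t \<le> d1" for t using that d_order by linarith
  ultimately show ?thesis unfolding tent_core_def tent_limit_def by auto
qed

text \<open>Lets a left coordinate be exchanged for its mirror image, which has the same image under
  T, without leaving the core. The bound 1 - d2 < d1 is (s - 1)(2 - s) > 0.\<close>

lemma one_minus_core: "t \<in> core \<Longrightarrow> 1 - t < d1"
proof -
  assume "t \<in> core"
  then have "1 - t \<le> 1 - d2" by simp
  moreover have "(s - 1) * (2 - s) > 0" using s1 s_hi by simp
  then have "1 - d2 < d1" by (simp add: d1_def d2_def algebra_simps)
  ultimately show "1 - t < d1" by simp
qed

lemma right_pre:
  assumes "t \<in> core"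
  shows "1 - t / s \<in> {1/2..d1}" "T (1 - t / s) = t" "1 - t / s = 1/2 \<longleftrightarrow> t = d1" "1 - t / s = d1 \<longleftrightarrow> t = d2"
proof -
  have 1: "t / s \<le> 1/2" using assms s1 by (simp add: d1_def field_simps)
  have 2: "1 - d1 \<le> t / s" using assms s1 by (simp add: d1_def d2_def field_simps)
  show "1 - t / s \<in> {1/2..d1}" using 1 2 by auto
  show "T (1 - t / s) = t" using 1 s1 by (simp add: T_right)
  show "1 - t / s = 1/2 \<longleftrightarrow> t = d1" using s1 by (auto simp: d1_def field_simps)
  show "1 - t / s = d1 \<longleftrightarrow> t = d2" using s1 by (auto simp: d1_def d2_def field_simps)
qed

text \<open>Unlike the right preimage, the left one stays in the core only from \<open>d3\<close>,
  the image of \<open>d2\<close>, upwards. This asymmetry is the source of the gaps.\<close>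

lemma left_pre:
  assumes "t \<in> core" "d3 \<le> t"
  shows "t / s \<in> {d2..1/2}" "T (t / s) = t" "t / s = 1/2 \<longleftrightarrow> t = d1" "t / s = d2 \<longleftrightarrow> t = d3"
proof -
  have 1: "t / s \<le> 1/2" using assms s1 by (simp add: d1_def field_simps)
  have 2: "d2 \<le> t / s" using assms s1 by (simp add: d3_def field_simps)
  show "t / s \<in> {d2..1/2}" using 1 2 by auto
  show "T (t / s) = t" using 1 s1 by (simp add: T_left)
  show "t / s = 1/2 \<longleftrightarrow> t = d1" "t / s = d2 \<longleftrightarrow> t = d3" using s1 by (auto simp: d1_def d3_def field_simps)
qed

lemma pre_d2: "t \<in> core \<Longrightarrow> T t = d2 \<Longrightarrow> t = d1"
proof (cases "t \<le> 1/2")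
  case True
  assume "t \<in> core" "T t = d2"
  then have "s * t = d2" "d2 \<le> t" using True by (auto simp: T_left)
  moreover have "t < s * t" using \<open>d2 \<le> t\<close> d_order s1 by simp
  ultimately show ?thesis by simp
next
  case False
  assume "T t = d2"
  then have "s * (1 - t) = s * (1 - d1)" using False by (simp add: T_right d2_def d1_def)
  then show ?thesis using s1 by simp
qed

definition br :: "bool \<Rightarrow> real \<Rightarrow> real" where
  "br b t = (if b then s * (1 - t) else s * t)"

definition side :: "bool \<Rightarrow> real \<Rightarrow> bool" where
  "side b t \<longleftrightarrow> (if b then 1/2 \<le> t else t \<le> 1/2)"

lemma T_br: "side b t \<Longrightarrow> T t = br b t"
  by (auto simp: side_def br_def T_left T_right split: if_splits)

lemma side_unique: "side a t \<Longrightarrow> side b t \<Longrightarrow> t \<noteq> 1/2 \<Longrightarrow> a = b"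
  by (auto simp: side_def split: if_splits)

lemma side_gt: "t \<noteq> 1/2 \<Longrightarrow> side b t \<longleftrightarrow> b = (t > 1/2)"
  by (auto simp: side_def)

lemma side_half [simp]: "side b (1/2)" by (simp add: side_def)

text \<open>The sign of the slope of the n-fold composition of the branches named by
  \<open>l\<close>; it also decides on which side a semicircle is drawn.\<close>

fun sg :: "(nat \<Rightarrow> bool) \<Rightarrow> nat \<Rightarrow> real" where
  "sg l 0 = 1"
| "sg l (Suc n) = sg l n * (if l n then -1 else 1)"

lemma sg_cases: "sg l n = 1 \<or> sg l n = -1"
  by (induction n) auto

lemma sg_sq [simp]: "sg l n * sg l n = 1"
  using sg_cases[of l n] by auto

lemma sg_abs [simp]: "\<bar>sg l n\<bar> = 1"
  using sg_cases[of l n] by auto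

lemma sg_cong: "(\<And>i. i < n \<Longrightarrow> l i = l' i) \<Longrightarrow> sg l n = sg l' n"
  by (induction n) auto

lemma sg_ones: "sg l n = (-1) ^ ones (map l [0..<n])"
  by (induction n) (auto simp: ones_snoc, simp add: ones_def)

lemma sg_add: "sg l (m + n) = sg l m * sg (\<lambda>i. l (m + i)) n"
  by (induction n) auto

lemma br_diff: "br b t - br b t' = (if b then -1 else 1) * s * (t - t')"
  by (simp add: br_def algebra_simps)

text \<open>Coordinates are indexed backwards, so \<open>x n\<close> comes before \<open>x 0\<close> in the orbit.\<close>

lemma branch_diff:
  assumes "\<And>i. i < n \<Longrightarrow> x i = br (l i) (x (Suc i))" "\<And>i. i < n \<Longrightarrow> y i = br (l i) (y (Suc i))"
  shows "x 0 - y 0 = sg l n * s ^ n * (x n - y n)"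
  using assms
proof (induction n)
  case (Suc n)
  have "x n - y n = (if l n then -1 else 1) * s * (x (Suc n) - y (Suc n))"
    using Suc.prems[of n] by (simp add: br_diff)
  then show ?case using Suc by simp
qed simp

section \<open>The critical orbit and the kneading sequence\<close>

definition cc :: "nat \<Rightarrow> real" where "cc j = (T ^^ j) (1/2)"

abbreviation "\<kappa> \<equiv> kneading s"

lemma cc_simps [simp]: "cc 0 = 1/2" "cc (Suc 0) = d1" "cc (Suc j) = T (cc j)"
  by (simp_all add: cc_def T_half)

lemma cc_add: "(T ^^ i) (cc j) = cc (i + j)"
  by (simp add: cc_def funpow_add)

lemma cc_period: "cc N = 1/2 \<Longrightarrow> cc (N + i) = cc i"
proof -
  assume "cc N = 1/2"
  then have "cc (i + N) = (T ^^ i) (1/2)" by (metis cc_add)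
  then show ?thesis by (simp add: cc_def add.commute)
qed

abbreviation "itin b \<equiv> crit_itinerary s b"

lemma itin_eq: "itin b j = (if cc j = 1/2 then b else cc j > 1/2)"
  by (simp add: crit_itinerary_def cc_def Let_def)

lemma kneading_cases: "\<exists>b. \<kappa> = itin b"
  by (auto simp: kneading_def)

lemma kneading_side: "side (\<kappa> j) (cc j)"
proof -
  obtain b where "\<kappa> = itin b" using kneading_cases by blast
  then show ?thesis by (metis itin_eq side_gt side_half)
qed

text \<open>Here the choice of the smaller itinerary in the definition of the kneading sequence enters.\<close>

lemma kneading_even:
  assumes "j \<ge> 1" "cc j = 1/2"
  shows "sg (\<lambda>i. \<kappa> (Suc i)) j = 1"
proof -
  define N where "N = (LEAST j. j \<ge> 1 \<and> cc j = 1/2)"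
  have N: "N \<ge> 1" "cc N = 1/2" using LeastI[of "\<lambda>j. j \<ge> 1 \<and> cc j = 1/2", OF conjI[OF assms]] by (auto simp: N_def)
  have Nmin: "cc i \<noteq> 1/2" if "1 \<le> i" "i < N" for i
    using not_less_Least[of i "\<lambda>j. j \<ge> 1 \<and> cc j = 1/2"] that by (auto simp: N_def)
  obtain M where M: "N = Suc M" using N by (cases N) auto
  define p where "p = map (\<lambda>j. itin False (Suc j)) [0..<M]"
  have pre: "itin b i = itin b' i" if "1 \<le> i" "i < N" for i b b' using Nmin[OF that] by (simp add: itin_eq)
  have pT: "p = map (\<lambda>j. itin b (Suc j)) [0..<M]" for b unfolding p_def using pre M by auto
  have iN: "itin b N = b" for b using N by (simp add: itin_eq)
  \<comment> \<open>The two itineraries first differ at the first return N, after the common block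
    \<open>p\<close>, so their order is read off the parity of \<open>p\<close>. Choosing the
    smaller one gives the block of length N an even number of ones.\<close>
  have less: "seq_less (\<lambda>j. itin False (Suc j)) (\<lambda>j. itin True (Suc j)) \<longleftrightarrow> even (ones p)"
  proof
    assume "even (ones p)"
    then have "word_less (p @ [False]) (p @ [True])" unfolding word_less_def by (intro exI[of _ M]) (auto simp: p_def nth_append)
    moreover have "map (\<lambda>j. itin b (Suc j)) [0..<N] = p @ [b]" for b using pT[of b] iN[of b] by (simp add: M)
    ultimately show "seq_less (\<lambda>j. itin False (Suc j)) (\<lambda>j. itin True (Suc j))"
      unfolding seq_less_def by metis
  next
    assume "seq_less (\<lambda>j. itin False (Suc j)) (\<lambda>j. itin True (Suc j))"
    then obtain n k where k': "k < n"
      "take k (map (\<lambda>j. itin False (Suc j)) [0..<n]) = take k (map (\<lambda>j. itin True (Suc j)) [0..<n])"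
      "if even (ones (take k (map (\<lambda>j. itin False (Suc j)) [0..<n])))
         then map (\<lambda>j. itin False (Suc j)) [0..<n] ! k < map (\<lambda>j. itin True (Suc j)) [0..<n] ! k
         else map (\<lambda>j. itin True (Suc j)) [0..<n] ! k < map (\<lambda>j. itin False (Suc j)) [0..<n] ! k"
      unfolding seq_less_def word_less_def length_map length_upt min.idem diff_zero by blast
    have k: "k < n" "take k (map (\<lambda>j. itin False (Suc j)) [0..<n]) = take k (map (\<lambda>j. itin True (Suc j)) [0..<n])"
      "if even (ones (take k (map (\<lambda>j. itin False (Suc j)) [0..<n]))) then itin False (Suc k) < itin True (Suc k)
         else itin True (Suc k) < itin False (Suc k)"
      using k' by (simp_all split: if_splits)
    have tk: "take k (map f [0..<n]) = map f [0..<k]" for f :: "nat \<Rightarrow> bool" using k(1) by (simp add: take_map)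
    have "\<not> k < M" using k(3) pre[of "Suc k"] M by (auto split: if_splits)
    moreover have "\<not> M < k"
    proof
      assume "M < k"
      then have "itin False (Suc M) = itin True (Suc M)" using k(2) unfolding tk by auto
      then show False using iN M by auto
    qed
    ultimately have "k = M" by simp
    then show "even (ones p)" using k(3) iN unfolding tk p_def M by (auto split: if_splits)
  qed
  have evN: "sg (\<lambda>i. \<kappa> (Suc i)) N = 1"
  proof -
    define b where "b = (\<not> even (ones p))"
    have kb: "\<kappa> = itin b" unfolding kneading_def less by (simp add: b_def)
    have "map (\<lambda>i. \<kappa> (Suc i)) [0..<N] = p @ [b]" unfolding kb using pT[of b] iN[of b] by (simp add: M)
    then show ?thesis unfolding sg_ones by (simp add: ones_snoc b_def)
  qed
  obtain b where kb: "\<kappa> = itin b" using kneading_cases by blast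
  have per: "\<kappa> (N + i) = \<kappa> i" if "i \<ge> 1" for i unfolding kb using cc_period[OF N(2)] by (simp add: itin_eq)
  show ?thesis using assms
  proof (induction j rule: less_induct)
    case (less j)
    have "j \<ge> N" using Nmin[of j] less.prems by fastforce
    then obtain i where i: "j = N + i" using le_Suc_ex by blast
    have ci: "cc i = 1/2" using less.prems cc_period[OF N(2)] i by simp
    have "sg (\<lambda>i. \<kappa> (Suc i)) j = sg (\<lambda>i. \<kappa> (Suc i)) N * sg (\<lambda>m. \<kappa> (Suc (N + m))) i" unfolding i by (rule sg_add)
    also have "sg (\<lambda>m. \<kappa> (Suc (N + m))) i = sg (\<lambda>i. \<kappa> (Suc i)) i" using per by (intro sg_cong) (metis add_Suc_right le_add1 plus_1_eq_Suc)
    also have "\<dots> = 1" using less.IH[of i] ci i N by (cases "i = 0") auto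
    finally show ?case using evN by simp
  qed
qed

lemma kneading_const: "cc i = 1/2 \<Longrightarrow> cc j = 1/2 \<Longrightarrow> \<kappa> i = \<kappa> j"
  using kneading_cases by (auto simp: itin_eq)

lemma forward_diff:
  assumes "\<And>m. m < k \<Longrightarrow> y (Suc m) = br (b m) (y m)" "\<And>m. m < k \<Longrightarrow> z (Suc m) = br (b m) (z m)"
  shows "y k - z k = sg b k * s ^ k * (y 0 - z 0)"
  using assms
proof (induction k)
  case (Suc k)
  have "y (Suc k) - z (Suc k) = (if b k then -1 else 1) * s * (y k - z k)"
    using Suc.prems[of k] by (simp add: br_diff)
  then show ?case using Suc by simp
qed simp

section \<open>Which codes represent a point of the core\<close>

lemma coord_step:
  assumes "x \<in> tent_core s"
  shows "T (coord s x i) = coord s x (i + 1)"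
proof (cases "i < 0")
  case True
  then obtain n where n: "i = - int (Suc n)" by (metis add.inverse_inverse negD)
  then have "nat (- i) = Suc n" "nat (- (i + 1)) = n" "i + 1 \<le> 0" by auto
  then show ?thesis using assms n by (simp add: coord_def core_iff)
next
  case False
  then obtain n where n: "i = int n" by (metis nonneg_int_cases not_less)
  have "coord s x (int m) = (T ^^ m) (x 0)" for m by (simp add: coord_def)
  from this[of n] this[of "Suc n"] show ?thesis unfolding n by (simp add: add.commute)
qed

lemma coord_core:
  assumes "x \<in> tent_core s"
  shows "coord s x i \<in> core"
proof (cases "i \<le> 0")
  case True
  then show ?thesis using assms by (simp add: coord_def core_iff)
next
  case False
  have "(T ^^ m) (x 0) \<in> core" for m
    using assms T_core by (induction m) (auto simp: core_iff)
  then show ?thesis using False by (simp add: coord_def)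
qed

lemma coord_half:
  assumes "x \<in> tent_core s" "coord s x k = 1/2"
  shows "coord s x (k + int j) = cc j"
proof (induction j)
  case (Suc j)
  then show ?case using coord_step[OF assms(1), of "k + int j"] by (simp add: ac_simps)
qed (use assms in simp)

lemma coord_neg [simp]: "coord s x (- int n) = x n"
  unfolding coord_def by simp

lemma represents_iff:
  assumes "x \<in> tent_core s"
  shows "represents s a x \<longleftrightarrow> a \<in> adm_sequences s \<and> (\<forall>i. side (a i) (coord s x i))"
proof -
  have "x \<in> tent_limit s" using assms by (simp add: tent_core_def)
  moreover have "coord s x i \<in> {0..1}" for i using coord_core[OF assms, of i] core_01 by blast
  ultimately show ?thesis unfolding represents_def side_def by (auto split: if_splits)
qed

text \<open>On the left branch each backward step divides by s, so the coordinates would shrink to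
  0, while the core stays above d2 > 0. This rules out the codes of the ray for points of the
  core.\<close>

lemma not_eventually_left:
  assumes x: "x \<in> tent_core s" and a: "\<And>i. i < k \<Longrightarrow> coord s x i \<le> 1/2"
  shows False
proof -
  define z where "z n = coord s x (k - 1 - int n)" for n
  have step: "z n = s * z (Suc n)" for n
    using coord_step[OF x, of "k - 1 - int (Suc n)"] a[of "k - 1 - int (Suc n)"]
    by (simp add: z_def T_left algebra_simps)
  have pow: "z 0 = s ^ n * z n" for n
  proof (induction n)
    case (Suc n)
    then show ?case using step[of n] by simp
  qed simp
  obtain n where n: "s ^ n > 1 / d2" using real_arch_pow[OF s1(1)] by blast
  have "z n \<ge> d2" "z 0 \<le> d1" using coord_core[OF x] by (auto simp: z_def)
  then have "1 / d2 * d2 < s ^ n * z n" using n d_order(1) by (intro mult_less_le_imp_less) auto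
  then show False using pow[of n] \<open>z 0 \<le> d1\<close> d_order by simp
qed

text \<open>After a visit to 1/2 a code can deviate from the kneading sequence only at a return to
  1/2. There \<open>kneading_even\<close> says that the kneading sequence takes the smaller symbol,
  so the deviating word would exceed it and violate the upper admissibility bound.\<close>

lemma represents_forced:
  assumes x: "x \<in> tent_core s" and rep: "represents s a x" and k: "coord s x k = 1/2" and j: "1 \<le> j"
  shows "a (k + int j) = \<kappa> j"
proof -
  have sd: "side (a i) (coord s x i)" for i using rep represents_iff[OF x] by blast
  have left: "\<exists>i<m. a i" for m
  proof (rule ccontr)
    assume "\<not> ?thesis"
    then have "coord s x i \<le> 1/2" if "i < m" for i using sd[of i] that by (auto simp: side_def split: if_splits)
    then show False using not_eventually_left[OF x] by blast
  qed
  have "a \<in> adm_sequences s" using rep by (simp add: represents_def)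
  moreover have "\<not> (\<exists>k. a k \<and> (\<forall>i<k. \<not> a i) \<and> P k)" for P using left by meson
  moreover have "a \<noteq> (\<lambda>_. False)" using left[of 0] by auto
  ultimately have adm: "adm_word s (map a [i..j])" for i j
    unfolding adm_sequences_def by simp
  show ?thesis using j
  proof (induction j rule: less_induct)
    case (less j)
    have cj: "coord s x (k + int j) = cc j" by (rule coord_half[OF x k])
    show ?case
    proof (rule ccontr)
      assume ne: "a (k + int j) \<noteq> \<kappa> j"
      have "cc j = 1/2" using side_unique[of "a (k + int j)" "cc j" "\<kappa> j"] sd[of "k + int j"] kneading_side[of j] ne cj by auto
      then have ev: "sg (\<lambda>i. \<kappa> (Suc i)) j = 1" using kneading_even less.prems by simp
      obtain m where m: "j = Suc m" using less.prems by (cases j) auto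
      define p where "p = map (\<lambda>i. \<kappa> (Suc i)) [0..<m]"
      have u1: "map \<kappa> [1..<1 + j] = p @ [\<kappa> j]"
      proof (rule nth_equalityI)
        fix i assume "i < length (map \<kappa> [1..<1 + j])"
        then have "i < Suc m" by (simp add: m del: upt_Suc)
        then show "map \<kappa> [1..<1 + j] ! i = (p @ [\<kappa> j]) ! i"
          by (cases "i = m") (auto simp: p_def m nth_append nth_map nth_upt simp del: upt_Suc)
      qed (simp add: p_def m del: upt_Suc)
      have len: "length [k + 1..k + int j] = j" by simp
      have u2: "map a [k + 1..k + int j] = p @ [a (k + int j)]"
      proof (rule nth_equalityI)
        fix i assume "i < length (map a [k + 1..k + int j])"
        then have i: "i < j" by simp
        have "map a [k + 1..k + int j] ! i = a (k + int (Suc i))" using i by (simp add: ac_simps)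
        then show "map a [k + 1..k + int j] ! i = (p @ [a (k + int j)]) ! i"
          using less.IH[of "Suc i"] i m by (cases "i = m") (auto simp: p_def nth_append)
      qed (simp add: p_def m)
      have "word_le (drop 0 (map a [k + 1..k + int j])) (map \<kappa> [1..<1 + (length (map a [k + 1..k + int j]) - 0)])"
        using adm[of "k+1" "k + int j"] less.prems unfolding adm_word_def by (metis len length_map less_le_trans zero_less_one)
      then have "word_le (map a [k + 1..k + int j]) (map \<kappa> [1..<1 + j])" by (simp del: upt_Suc)
      then have "word_le (p @ [a (k + int j)]) (p @ [\<kappa> j])" unfolding u1 u2 .
      then have "if even (ones p) then \<kappa> j else a (k + int j)" using ne by (rule less_eq_word_snoc)
      moreover have "sg (\<lambda>i. \<kappa> (Suc i)) j = (-1) ^ ones p * (if \<kappa> j then -1 else 1)"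
        unfolding m by (simp add: sg_ones p_def ones_snoc)
      ultimately show False using ev ne by (auto split: if_splits)
    qed
  qed
qed

text \<open>Admissibility is checked by comparing the orbit with the critical orbit. While symbols
  agree, the difference is multiplied by s up to sign, so at the first disagreement the order of
  words mirrors the order of points, which lie between d2 and d1. A point equal to d1 or d2 comes
  from 1/2 one or two steps earlier and cannot disagree, by \<open>rule\<close>.\<close>

lemma represents_intro:
  assumes x: "x \<in> tent_core s" and sd: "\<And>i. side (a i) (coord s x i)"
    and rule: "\<And>k j. coord s x k = 1/2 \<Longrightarrow> 1 \<le> j \<Longrightarrow> a (k + int j) = \<kappa> j"
  shows "represents s a x"
proof -
  have cmp: "sg (\<lambda>m. a (i0 + int m)) k * (coord s x i0 - cc q) * s ^ k = coord s x (i0 + int k) - cc (q + k)"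
    if "\<And>m. m < k \<Longrightarrow> a (i0 + int m) = \<kappa> (q + m)" for i0 q k
  proof -
    have 1: "coord s x (i0 + int (Suc m)) = br (a (i0 + int m)) (coord s x (i0 + int m))" for m
      using coord_step[OF x, of "i0 + int m"] T_br[OF sd[of "i0 + int m"]] by (simp add: ac_simps)
    have 2: "cc (q + Suc m) = br (a (i0 + int m)) (cc (q + m))" if "m < k" for m
      using T_br[OF kneading_side[of "q + m"]] \<open>m < k \<Longrightarrow> a (i0 + int m) = \<kappa> (q + m)\<close> that by simp
    from forward_diff[of k "\<lambda>m. coord s x (i0 + int m)" "\<lambda>m. a (i0 + int m)" "\<lambda>m. cc (q + m)", OF 1 2]
    show ?thesis by (simp add: algebra_simps)
  qed
  have "adm_word s (map a [i..j])" for i j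
    unfolding adm_word_def
  proof (intro allI impI)
    fix i' assume i': "i' < length (map a [i..j])"
    let ?w = "drop i' (map a [i..j])" and ?n = "length (map a [i..j]) - i'"
    let ?i = "i + int i'"
    have wn: "?w ! k = a (?i + int k)" if "k < ?n" for k
      using that by (simp add: ac_simps)
    have wt: "take k ?w = map (\<lambda>m. a (?i + int m)) [0..<k]" if "k < ?n" for k
      using that wn by (intro nth_equalityI) auto
    have parity: "even (ones (take k ?w)) \<longleftrightarrow> sg (\<lambda>m. a (?i + int m)) k = 1" if "k < ?n" for k
      unfolding wt[OF that] sg_ones by (cases "even (ones (map (\<lambda>m. a (?i + int m)) [0..<k]))") auto
    have agree: "a (?i + int m) = \<kappa> (q + m)"
      if "take k ?w = take k (map \<kappa> [q..<q + ?n])" "m < k" "k < ?n" for q k m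
    proof -
      have mn: "m < ?n" using that by linarith
      have "a (?i + int m) = ?w ! m" using wn[OF mn] by simp
      also have "\<dots> = map \<kappa> [q..<q + ?n] ! m" using that by (metis nth_take)
      also have "\<dots> = \<kappa> (q + m)" using mn by simp
      finally show ?thesis .
    qed
    have decide: "(\<kappa> (q + k) \<longleftrightarrow> (coord s x ?i - cc q) * sg (\<lambda>m. a (?i + int m)) k < 0) \<and>
        (a (?i + int k) \<longleftrightarrow> (coord s x ?i - cc q) * sg (\<lambda>m. a (?i + int m)) k > 0)"
      if tk: "take k ?w = take k (map \<kappa> [q..<q + ?n])" and k: "k < ?n" and ne: "a (?i + int k) \<noteq> \<kappa> (q + k)"
        and noteq: "coord s x ?i \<noteq> cc q" for q k
    proof -
      let ?D = "coord s x (?i + int k) - cc (q + k)"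
      have D: "?D = (coord s x ?i - cc q) * sg (\<lambda>m. a (?i + int m)) k * s ^ k"
        using cmp[of k ?i q] agree[OF tk _ k] by (simp add: algebra_simps)
      have "?D \<noteq> 0" using D noteq s1 sg_cases[of "\<lambda>m. a (?i + int m)" k] by auto
      then have "(\<kappa> (q + k) \<longleftrightarrow> ?D < 0) \<and> (a (?i + int k) \<longleftrightarrow> ?D > 0)"
        using ne sd[of "?i + int k"] kneading_side[of "q + k"] by (auto simp: side_def split: if_splits)
      moreover have "?D < 0 \<longleftrightarrow> (coord s x ?i - cc q) * sg (\<lambda>m. a (?i + int m)) k < 0"
        "?D > 0 \<longleftrightarrow> (coord s x ?i - cc q) * sg (\<lambda>m. a (?i + int m)) k > 0"
        unfolding D using s1 by (auto simp: mult_less_0_iff zero_less_mult_iff)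
      ultimately show ?thesis by simp
    qed
    show "word_le (map \<kappa> [2..<2 + ?n]) ?w \<and> word_le ?w (map \<kappa> [1..<1 + ?n])"
    proof
      show "word_le ?w (map \<kappa> [1..<1 + ?n])"
      proof (rule word_leI)
        fix k assume k: "k < length ?w" and tk: "take k ?w = take k (map \<kappa> [1..<1 + ?n])"
          and ne: "?w ! k \<noteq> map \<kappa> [1..<1 + ?n] ! k"
        have kn: "k < ?n" using k by (simp del: upt_Suc)
        have ne': "a (?i + int k) \<noteq> \<kappa> (1 + k)" using ne wn[OF kn] kn by (simp del: upt_Suc)
        have cc1: "cc 1 = d1" by (simp add: T_half)
        have nd: "coord s x ?i \<noteq> cc 1"
        proof
          assume "coord s x ?i = cc 1"
          then have "coord s x (?i - 1) = 1/2" using coord_step[OF x, of "?i - 1"] T_eq_d1 unfolding cc1 by simp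
          from rule[OF this, of "1 + k"] ne' show False by (simp add: ac_simps)
        qed
        have "coord s x ?i < cc 1" using nd coord_core[OF x, of ?i] unfolding cc1 by simp
        then show "if even (ones (take k ?w)) then map \<kappa> [1..<1 + ?n] ! k else ?w ! k"
          using decide[OF tk kn ne' nd] parity[OF kn] wn[OF kn] kn sg_cases[of "\<lambda>m. a (?i + int m)" k]
          by (auto simp del: upt_Suc)
      qed (simp del: upt_Suc)
      show "word_le (map \<kappa> [2..<2 + ?n]) ?w"
      proof (rule word_leI)
        fix k assume k: "k < length (map \<kappa> [2..<2 + ?n])" and tk: "take k (map \<kappa> [2..<2 + ?n]) = take k ?w"
          and ne: "map \<kappa> [2..<2 + ?n] ! k \<noteq> ?w ! k"
        have kn: "k < ?n" using k by (simp del: upt_Suc)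
        have ne': "a (?i + int k) \<noteq> \<kappa> (2 + k)" using ne wn[OF kn] kn by (simp del: upt_Suc)
        have cc2: "cc 2 = d2" by (simp add: numeral_2_eq_2 T_half T_d1)
        have nd: "coord s x ?i \<noteq> cc 2"
        proof
          assume "coord s x ?i = cc 2"
          then have "coord s x (?i - 1) = d1"
            using coord_step[OF x, of "?i - 1"] pre_d2[OF coord_core[OF x]] cc2 by simp
          then have "coord s x (?i - 2) = 1/2" using coord_step[OF x, of "?i - 2"] T_eq_d1 by simp
          from rule[OF this, of "2 + k"] ne' show False by (simp add: ac_simps)
        qed
        have "coord s x ?i > cc 2" using nd coord_core[OF x, of ?i] cc2 by simp
        then show "if even (ones (take k (map \<kappa> [2..<2 + ?n]))) then ?w ! k else map \<kappa> [2..<2 + ?n] ! k"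
          using decide[OF tk[symmetric] kn ne' nd] parity[OF kn] wn[OF kn] kn sg_cases[of "\<lambda>m. a (?i + int m)" k]
          unfolding tk by (auto simp del: upt_Suc)
      qed (simp del: upt_Suc)
    qed
  qed
  then have "a \<in> adm_sequences s" by (simp add: adm_sequences_def)
  then show ?thesis using represents_iff[OF x] sd by blast
qed

text \<open>The left parts of the admissible codes of \<open>x\<close>: a code may switch sides freely only at the first
  visit of the critical point; from then on it is the kneading sequence.\<close>

definition coded :: "(nat \<Rightarrow> real) \<Rightarrow> (nat \<Rightarrow> bool) \<Rightarrow> bool" where
  "coded x l \<longleftrightarrow> (\<forall>n. side (l n) (x (Suc n))) \<and>
     (\<forall>n j. x (Suc n) = 1/2 \<longrightarrow> 1 \<le> j \<longrightarrow> j \<le> n \<longrightarrow> l (n - j) = \<kappa> j)"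

lemma coded_side: "coded x l \<Longrightarrow> side (l n) (x (Suc n))"
  by (simp add: coded_def)

lemma coded_kneading: "coded x l \<Longrightarrow> x (Suc n) = 1/2 \<Longrightarrow> 1 \<le> j \<Longrightarrow> j \<le> n \<Longrightarrow> l (n - j) = \<kappa> j"
  by (simp add: coded_def)

lemma coded_br: "x \<in> tent_core s \<Longrightarrow> coded x l \<Longrightarrow> x n = br (l n) (x (Suc n))"
  using T_br[OF coded_side] by (metis core_iff)

text \<open>\<open>\<kappa> 0\<close> is the symbol that the kneading sequence writes at all returns
  of the critical orbit, since \<open>cc 0\<close> is 1/2. Writing it at visits of 1/2 with
  non-negative index makes the right half comply with a visit at any earlier index.\<close>

definition full_code :: "(nat \<Rightarrow> real) \<Rightarrow> (nat \<Rightarrow> bool) \<Rightarrow> int \<Rightarrow> bool" where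
  "full_code x l i = (if i < 0 then l (nat (- i - 1)) else
     if coord s x i = 1/2 then \<kappa> 0 else coord s x i > 1/2)"

lemma left_full_code [simp]: "left_part (full_code x l) = l"
  by (rule ext) (simp add: left_part_def full_code_def)

lemma coded_represents:
  assumes x: "x \<in> tent_core s" and l: "coded x l"
  shows "represents s (full_code x l) x"
proof (rule represents_intro[OF x])
  show sd: "side (full_code x l i) (coord s x i)" for i
  proof (cases "i < 0")
    case True
    then obtain n where n: "i = - int (Suc n)" by (metis add.inverse_inverse negD)
    then show ?thesis using coded_side[OF l, of n] unfolding n coord_neg by (simp add: full_code_def nat_add_distrib)
  next
    case False
    then show ?thesis
      by (metis full_code_def side_gt side_half)
  qed
  show "full_code x l (k + int j) = \<kappa> j" if k: "coord s x k = 1/2" and j: "1 \<le> j" for k j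
  proof (cases "k + int j < 0")
    case True
    then obtain m where m: "k + int j = - int (Suc m)" by (metis add.inverse_inverse negD)
    then have k': "k = - int (Suc (m + j))" by simp
    have "x (Suc (m + j)) = 1/2" using k unfolding k' coord_neg .
    from coded_kneading[OF l this j] show ?thesis unfolding m by (simp add: full_code_def nat_add_distrib)
  next
    case False
    have "coord s x (k + int j) = cc j" using coord_half[OF x k] .
    then show ?thesis
      using kneading_const[of j 0] kneading_side[of j] False side_gt[of "cc j" "\<kappa> j"] by (auto simp: full_code_def)
  qed
qed

lemma represents_coded:
  assumes x: "x \<in> tent_core s" and a: "represents s a x"
  shows "coded x (left_part a)"
  unfolding coded_def
proof (intro conjI allI impI)
  have sd: "side (a i) (coord s x i)" for i using a represents_iff[OF x] by blast
  show "side (left_part a n) (x (Suc n))" for n using sd[of "- int (Suc n)"] unfolding coord_neg left_part_def .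
  show "left_part a (n - j) = \<kappa> j" if "x (Suc n) = 1/2" "1 \<le> j" "j \<le> n" for n j
  proof -
    have "- int (Suc n) + int j = - int (Suc (n - j))" using that by (simp add: of_nat_diff)
    moreover have "coord s x (- int (Suc n)) = 1/2" unfolding coord_neg by (rule that)
    ultimately show ?thesis using represents_forced[OF x a _ that(2)] unfolding left_part_def by metis
  qed
qed

lemma basic_arc_core: "basic_arc s l \<inter> tent_core s = {x \<in> tent_core s. coded x l}"
  unfolding basic_arc_def using coded_represents represents_coded left_full_code by fast

lemma ones_rev: "ones (rev w) = ones w"
  by (simp add: ones_def count_list_rev)

lemma ones_left_part: "ones (map a [- int n..-1]) = ones (map (left_part a) [0..<n])"
proof -
  have "map a [- int n..-1] = rev (map (left_part a) [0..<n])"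
    by (rule nth_equalityI) (auto simp: rev_nth left_part_def of_nat_diff)
  then show ?thesis by (simp add: ones_rev)
qed

lemma sg_odd: "odd (ones (map l [0..<n])) \<longleftrightarrow> sg l n = -1"
  unfolding sg_ones by (cases "even (ones (map l [0..<n]))") auto

text \<open>This is the only place where the code of \<open>x\<close> is ambiguous.\<close>

definition last_hit :: "(nat \<Rightarrow> real) \<Rightarrow> nat \<Rightarrow> bool" where
  "last_hit x n \<longleftrightarrow> x (Suc n) = 1/2 \<and> (\<forall>m>n. x (Suc m) \<noteq> 1/2)"

lemma coded_flip:
  assumes l: "coded x l" and n: "last_hit x n"
  shows "coded x (l(n := b))"
  unfolding coded_def
proof (intro conjI allI impI)
  show "side ((l(n := b)) m) (x (Suc m))" for m
    using coded_side[OF l, of m] n side_half[of b] unfolding last_hit_def by (metis fun_upd_apply)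
  show "(l(n := b)) (m - j) = \<kappa> j" if "x (Suc m) = 1/2" "1 \<le> j" "j \<le> m" for m j
  proof -
    have "m \<le> n" using that n by (meson last_hit_def not_le_imp_less)
    then have "m - j \<noteq> n" using that by linarith
    then show ?thesis using coded_kneading[OF l that] by simp
  qed
qed

text \<open>A visit of 1/2 further in the past would force both codes to the kneading symbol at
  n.\<close>

lemma flip_last_hit:
  assumes "coded x l" "coded x l'" "l n \<noteq> l' n" "x \<in> tent_core s"
  shows "last_hit x n"
proof -
  have "x (Suc n) = 1/2" using side_unique[of "l n" "x (Suc n)" "l' n"] coded_side assms by blast
  moreover have "x (Suc m) \<noteq> 1/2" if "m > n" for m
  proof
    assume "x (Suc m) = 1/2"
    then have "l (m - (m - n)) = l' (m - (m - n))" using coded_kneading assms(1,2) that by (metis diff_le_self less_imp_le_nat Suc_leI zero_less_diff One_nat_def)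
    then show False using that assms(3) by simp
  qed
  ultimately show ?thesis by (simp add: last_hit_def)
qed

definition cap :: "(nat \<Rightarrow> real) \<Rightarrow> (nat \<Rightarrow> bool) \<Rightarrow> nat \<Rightarrow> (real \<times> real) set" where
  "cap x l n = semicircle (sg l n = -1) (x 0) (psi (\<lambda>_. True) l) (psi (\<lambda>_. True) (l(n := \<not> l n)))"

text \<open>From here on only one-sided codes matter: identified representatives differ in exactly
  the symbol at the last hit, so each semicircle is determined by \<open>x\<close>, one of its codes
  and that index.\<close>

lemma phi_R_eq:
  assumes "Y \<subseteq> tent_core s"
  shows "phi_R s Y = {(x 0, psi (\<lambda>_. True) l) | x l. x \<in> Y \<and> coded x l} \<union>
     \<Union>{cap x l n | x l n. x \<in> Y \<and> coded x l \<and> last_hit x n}"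
proof -
  have 1: "(\<Union>l. ((\<lambda>x. x 0) ` (basic_arc s l \<inter> Y)) \<times> {psi (\<lambda>_. True) l}) =
    {(x 0, psi (\<lambda>_. True) l) | x l. x \<in> Y \<and> coded x l}"
  proof -
    have "basic_arc s l \<inter> Y = {x \<in> Y. coded x l}" for l using basic_arc_core[of l] assms by blast
    then show ?thesis by auto
  qed
  let ?S = "{semicircle (odd (ones (map a [k + 1..-1]))) (x 0)
           (psi (\<lambda>_. True) (left_part a)) (psi (\<lambda>_. True) (left_part b)) | x a b k.
         x \<in> Y \<and> represents s a x \<and> represents s b x \<and> k < 0 \<and> identified_at s k a b}"
  have "?S \<subseteq> {cap x l n | x l n. x \<in> Y \<and> coded x l \<and> last_hit x n}"
  proof clarify
    fix x a b k assume x: "x \<in> Y" and a: "represents s a x" and b: "represents s b x" and k: "k < (0::int)"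
      and id: "identified_at s k a b"
    have xc: "x \<in> tent_core s" using x assms by blast
    obtain n where n: "k = - int (Suc n)" using k by (metis add.inverse_inverse negD)
    have ca: "coded x (left_part a)" "coded x (left_part b)" using represents_coded[OF xc] a b by auto
    have "left_part a n \<noteq> left_part b n" using id by (simp add: identified_at_def left_part_def n)
    then have lh: "last_hit x n" using flip_last_hit ca xc by blast
    have "left_part b = (left_part a)(n := \<not> left_part a n)"
    proof
      fix m show "left_part b m = ((left_part a)(n := \<not> left_part a n)) m"
        using id by (auto simp: identified_at_def left_part_def n)
    qed
    moreover have "map a [k + 1..-1] = map a [- int n..-1]" by (simp add: n)
    ultimately have "semicircle (odd (ones (map a [k + 1..-1]))) (x 0)
           (psi (\<lambda>_. True) (left_part a)) (psi (\<lambda>_. True) (left_part b)) = cap x (left_part a) n"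
      unfolding cap_def by (simp add: ones_left_part sg_odd)
    then show "\<exists>x' l n. semicircle (odd (ones (map a [k + 1..-1]))) (x 0)
           (psi (\<lambda>_. True) (left_part a)) (psi (\<lambda>_. True) (left_part b)) = cap x' l n \<and> x' \<in> Y \<and> coded x' l \<and> last_hit x' n"
      using x ca lh by blast
  qed
  moreover have "{cap x l n | x l n. x \<in> Y \<and> coded x l \<and> last_hit x n} \<subseteq> ?S"
  proof clarify
    fix x l n assume x: "x \<in> Y" and l: "coded x l" and n: "last_hit x n"
    have xc: "x \<in> tent_core s" using x assms by blast
    let ?l' = "l(n := \<not> l n)"
    let ?a = "full_code x l" and ?b = "full_code x ?l'" and ?k = "- int (Suc n)"
    have a: "represents s ?a x" "represents s ?b x"
      using coded_represents[OF xc] l coded_flip[OF l n] by auto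
    have kk: "coord s x ?k = 1/2" using n unfolding coord_neg last_hit_def by simp
    have "identified_at s ?k ?a ?b"
      unfolding identified_at_def
    proof (intro conjI allI impI)
      show "?a ?k \<noteq> ?b ?k" by (simp add: full_code_def nat_add_distrib)
      show "?a i = ?b i" if "i \<noteq> ?k" for i using that by (auto simp: full_code_def)
      show "?a (?k + int j) = \<kappa> j" if "1 \<le> j" for j using represents_forced[OF xc a(1) kk that] .
    qed
    moreover have "cap x l n = semicircle (odd (ones (map ?a [?k + 1..-1]))) (x 0)
           (psi (\<lambda>_. True) (left_part ?a)) (psi (\<lambda>_. True) (left_part ?b))"
    proof -
      have "map ?a [?k + 1..-1] = map ?a [- int n..-1]" by simp
      then show ?thesis unfolding cap_def by (simp add: ones_left_part sg_odd)
    qed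
    ultimately show "\<exists>x' a b k. cap x l n = semicircle (odd (ones (map a [k + 1..-1]))) (x' 0)
           (psi (\<lambda>_. True) (left_part a)) (psi (\<lambda>_. True) (left_part b)) \<and>
         x' \<in> Y \<and> represents s a x' \<and> represents s b x' \<and> k < 0 \<and> identified_at s k a b"
      using x a by (intro exI conjI) (assumption | simp)+
  qed
  ultimately have "?S = {cap x l n | x l n. x \<in> Y \<and> coded x l \<and> last_hit x n}" by (rule antisym)
  then show ?thesis unfolding phi_R_def drawing_def using 1 by simp
qed

end

section \<open>Heights and semicircles\<close>

text \<open>With \<open>ez l n = (-1)\<^sup>k\<close>, where \<open>k\<close> is the number of zeros among the first \<open>n\<close> symbols, the height of the
  basic arc with code \<open>l\<close> is \<open>1/2 + (\<Sum>n\<ge>1. ez l n / 3\<^sup>n)\<close>. The partial sums \<open>cn l n\<close> are the heights of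
  the centres of the semicircles that join \<open>l\<close> to the code with the opposite symbol at \<open>n\<close>.\<close>

definition sb :: "bool \<Rightarrow> real" where "sb b = (if b then 1 else -1)"

lemma sb_simps [simp]: "sb True = 1" "sb False = -1" "\<bar>sb b\<bar> = 1" "sb b * sb b = 1" "sb (\<not> b) = - sb b"
  by (auto simp: sb_def)

fun ez :: "(nat \<Rightarrow> bool) \<Rightarrow> nat \<Rightarrow> real" where
  "ez l 0 = 1"
| "ez l (Suc n) = ez l n * sb (l n)"

fun cn :: "(nat \<Rightarrow> bool) \<Rightarrow> nat \<Rightarrow> real" where
  "cn l 0 = 1/2"
| "cn l (Suc n) = cn l n + ez l (Suc n) / 3 ^ Suc n"

definition ht :: "(nat \<Rightarrow> bool) \<Rightarrow> real" where "ht l = psi (\<lambda>_. True) l"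

definition rad :: "(nat \<Rightarrow> bool) \<Rightarrow> nat \<Rightarrow> real" where "rad l n = \<bar>ht l - cn l n\<bar>"

definition tl_code :: "nat \<Rightarrow> (nat \<Rightarrow> bool) \<Rightarrow> nat \<Rightarrow> bool" where "tl_code n l i = l (n + i)"

lemma ez_cases: "ez l n = 1 \<or> ez l n = -1"
  by (induction n) (auto simp: sb_def)

lemma ez_abs [simp]: "\<bar>ez l n\<bar> = 1" using ez_cases[of l n] by auto

lemma ez_sq [simp]: "ez l n * ez l n = 1" using ez_cases[of l n] by auto

lemma ez_cong: "(\<And>i. i < n \<Longrightarrow> l i = l' i) \<Longrightarrow> ez l n = ez l' n"
  by (induction n) auto

lemma cn_cong: "(\<And>i. i < n \<Longrightarrow> l i = l' i) \<Longrightarrow> cn l n = cn l' n"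
  by (induction n) (auto simp: ez_cong[of _ l l'])

lemma ez_head: "ez l (Suc n) = sb (l 0) * ez (\<lambda>i. l (Suc i)) n"
  by (induction n) auto

lemma ez_parity: "(-1) powi (int (ones (map (\<lambda>_. True) [0..<n])) - int (ones (map l [0..<n]))) = ez l n"
proof -
  have 1: "ones (map (\<lambda>_. True) [0..<n]) = n"
    by (induction n) (auto simp: ones_def)
  have 2: "(-1) ^ n * (-1) ^ ones (map l [0..<n]) = ez l n"
    by (induction n) (auto simp: ones_snoc sb_def, simp_all add: ones_def)
  have "(-1::real) powi (int n - int k) = (-1) ^ n * (-1) ^ k" for k
    by (simp add: power_int_diff field_simps flip: power_mult_distrib)
  then show ?thesis using 1 2 by simp
qed

lemma ht_series: "ht l = (\<Sum>n. ez l (Suc n) / 3 ^ Suc n) + 1/2"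
  unfolding ht_def psi_def ez_parity ..

lemma geometric_third: "(\<lambda>n. 1 / 3 ^ Suc n :: real) sums (1/2)"
  using sums_mult[OF geometric_sums[of "1/3::real"], of "1/3"] by (simp add: power_one_over power_divide)

lemma ht_summable: "summable (\<lambda>n. ez l (Suc n) / 3 ^ Suc n)" and ht_bound: "\<bar>ht l - 1/2\<bar> \<le> 1/2"
proof -
  have n: "norm (ez l (Suc n) / 3 ^ Suc n) = 1 / 3 ^ Suc n" for n
    by (simp add: abs_mult)
  then have "summable (\<lambda>n. norm (ez l (Suc n) / 3 ^ Suc n))"
    using sums_summable[OF geometric_third] by (simp only: n)
  then show "summable (\<lambda>n. ez l (Suc n) / 3 ^ Suc n)" by (rule summable_norm_cancel)
  have "\<bar>ht l - 1/2\<bar> \<le> (\<Sum>n. norm (ez l (Suc n) / 3 ^ Suc n))"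
    unfolding ht_series using summable_norm[OF \<open>summable (\<lambda>n. norm (ez l (Suc n) / 3 ^ Suc n))\<close>] by simp
  also have "\<dots> = 1/2" using sums_unique[OF geometric_third] by (simp only: n)
  finally show "\<bar>ht l - 1/2\<bar> \<le> 1/2" .
qed

lemma ht_le: "ht l \<le> 1" "0 \<le> ht l"
  using ht_bound[of l] by linarith+

lemma ht_rec: "ht l = 1/2 + sb (l 0) * (1/3 + (ht (\<lambda>i. l (Suc i)) - 1/2) / 3)"
proof -
  let ?f = "\<lambda>n. ez l (Suc n) / 3 ^ Suc n" and ?l = "\<lambda>i. l (Suc i)"
  have "suminf ?f = (\<Sum>n. ?f (Suc n)) + ?f 0"
    using suminf_split_head[OF ht_summable[of l]] by simp
  also have "(\<Sum>n. ?f (Suc n)) = (\<Sum>n. sb (l 0) / 3 * (ez ?l (Suc n) / 3 ^ Suc n))"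
    by (rule suminf_cong) (simp only: ez_head[of l "Suc _"] power_Suc times_divide_times_eq mult.assoc)
  also have "\<dots> = sb (l 0) / 3 * (\<Sum>n. ez ?l (Suc n) / 3 ^ Suc n)"
    by (rule suminf_mult[OF ht_summable])
  finally show ?thesis unfolding ht_series by (simp add: algebra_simps)
qed

lemma ht_center: "ht l = cn l n + ez l n / 3 ^ n * (ht (tl_code n l) - 1/2)"
proof (induction n)
  case 0
  then show ?case by (simp add: tl_code_def[abs_def])
next
  case (Suc n)
  have "(\<lambda>i. tl_code n l (Suc i)) = tl_code (Suc n) l" by (simp add: tl_code_def fun_eq_iff)
  then have h: "ht (tl_code n l) - 1/2 = sb (l n) * (1/3 + (ht (tl_code (Suc n) l) - 1/2) / 3)"
    using ht_rec[of "tl_code n l"] by (simp add: tl_code_def)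
  have "ht l = cn l n + ez l n / 3 ^ n * (sb (l n) * (1/3 + (ht (tl_code (Suc n) l) - 1/2) / 3))"
    using Suc unfolding h .
  also have "\<dots> = cn l (Suc n) + ez l (Suc n) / 3 ^ Suc n * (ht (tl_code (Suc n) l) - 1/2)"
    by (simp add: field_simps)
  finally show ?case .
qed

lemma ht_near_cn: "\<bar>ht l - cn l n\<bar> \<le> 1 / (2 * 3 ^ n)"
proof -
  have "\<bar>ht l - cn l n\<bar> = \<bar>ez l n\<bar> / 3 ^ n * \<bar>ht (tl_code n l) - 1/2\<bar>"
    using ht_center[of l n] by (simp add: abs_mult)
  also have "\<dots> \<le> 1 / 3 ^ n * (1/2)"
    unfolding ez_abs by (intro mult_left_mono ht_bound) simp
  finally show ?thesis by simp
qed

lemma cn_step: "\<bar>cn l (Suc m) - cn l m\<bar> = 1 / 3 ^ Suc m"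
proof -
  have "cn l (Suc m) - cn l m = ez l (Suc m) / 3 ^ Suc m" unfolding cn.simps by (rule add_diff_cancel_left')
  then show ?thesis by (simp only: abs_divide ez_abs) simp
qed

text \<open>Heights form a Cantor set: a height deviates from its centre of level m by at most half
  of 1/3^m, so this separation makes a height determine the prefix. A difference that exists already
  at level m loses only two steps of 1/3^(m + 1), which leaves 4/3^(m + 1).\<close>

lemma cn_separated: "i < m \<Longrightarrow> l i \<noteq> l' i \<Longrightarrow> \<bar>cn l m - cn l' m\<bar> \<ge> 2 / 3 ^ m"
proof (induction m arbitrary: i)
  case 0
  then show ?case by simp
next
  case (Suc m)
  show ?case
  proof (cases "\<exists>i<m. l i \<noteq> l' i")
    case True
    then have "\<bar>cn l m - cn l' m\<bar> \<ge> 2 / 3 ^ m" using Suc.IH by blast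
    moreover have "2 / 3 ^ m = (6::real) / 3 ^ Suc m" by simp
    ultimately have "\<bar>cn l m - cn l' m\<bar> \<ge> 6 / 3 ^ Suc m" by (simp only:)
    then have "\<bar>cn l (Suc m) - cn l' (Suc m)\<bar> \<ge> 6 / 3 ^ Suc m - 1 / 3 ^ Suc m - 1 / 3 ^ Suc m"
      using cn_step[of l m] cn_step[of l' m] by linarith
    moreover have "6 / 3 ^ Suc m - 1 / 3 ^ Suc m - 1 / 3 ^ Suc m = (4::real) / 3 ^ Suc m" by (simp add: field_simps)
    moreover have "(2::real) / 3 ^ Suc m \<le> 4 / 3 ^ Suc m" by (intro divide_right_mono) auto
    ultimately show ?thesis by linarith
  next
    case False
    then have eq: "cn l m = cn l' m" "ez l m = ez l' m" by (auto intro: cn_cong ez_cong)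
    have "l m \<noteq> l' m" using False Suc.prems less_Suc_eq by blast
    then have "sb (l' m) = - sb (l m)" by (auto simp: sb_def)
    then have "cn l (Suc m) - cn l' (Suc m) = 2 * (ez l (Suc m) / 3 ^ Suc m)" unfolding cn.simps ez.simps eq by simp
    then show ?thesis by (simp only: abs_mult abs_divide ez_abs) simp
  qed
qed

lemma same_prefix:
  assumes "\<bar>y - cn l n\<bar> \<le> 1 / (2 * 3 ^ n)" "\<bar>y - cn l' n\<bar> \<le> 1 / (2 * 3 ^ n)" "i < n"
  shows "l i = l' i"
proof (rule ccontr)
  assume "l i \<noteq> l' i"
  then have "\<bar>cn l n - cn l' n\<bar> \<ge> 2 / 3 ^ n" by (rule cn_separated[OF \<open>i < n\<close>])
  moreover have "\<bar>cn l n - cn l' n\<bar> \<le> 1 / (2 * 3 ^ n) + 1 / (2 * 3 ^ n)" using assms(1,2) by linarith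
  moreover have "1 / (2 * 3 ^ n) + 1 / (2 * 3 ^ n) < (2::real) / 3 ^ n" by (simp add: field_simps)
  ultimately show False by linarith
qed

lemma ht_prefix: "\<bar>ht l' - cn l n\<bar> \<le> 1 / (2 * 3 ^ n) \<Longrightarrow> i < n \<Longrightarrow> l' i = l i"
  using same_prefix[OF ht_near_cn] by metis

lemma ht_inj: "ht l = ht l' \<Longrightarrow> l = l'"
proof
  fix i assume "ht l = ht l'"
  then show "l i = l' i" using ht_prefix[of l l' "Suc i" i] ht_near_cn[of l' "Suc i"] by simp
qed

lemma ht_close:
  assumes "\<And>i. i < n \<Longrightarrow> l i = l' i"
  shows "\<bar>ht l - ht l'\<bar> \<le> 1 / 3 ^ n"
proof -
  have "cn l n = cn l' n" using assms by (rule cn_cong)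
  then have "\<bar>ht l - ht l'\<bar> \<le> 1 / (2 * 3 ^ n) + 1 / (2 * 3 ^ n)"
    using ht_near_cn[of l n] ht_near_cn[of l' n] by linarith
  then show ?thesis by simp
qed

lemma ht_True: "ht (\<lambda>_. True) = 1"
  using ht_rec[of "\<lambda>_. True"] by (simp add: field_simps)

lemma ht_eq_1: "ht l = 1 \<longleftrightarrow> l = (\<lambda>_. True)"
  using ht_True ht_inj by metis

text \<open>Changing symbol n reverses the sign of every later term of the series, so the height is
  reflected in the partial sum.\<close>

lemma ht_flip: "ht (l(n := \<not> l n)) = 2 * cn l n - ht l"
proof -
  let ?l = "l(n := \<not> l n)"
  have 1: "cn ?l n = cn l n" "ez ?l n = ez l n" by (auto intro: cn_cong ez_cong)
  have "(\<lambda>i. tl_code n ?l (Suc i)) = (\<lambda>i. tl_code n l (Suc i))" by (simp add: tl_code_def fun_eq_iff)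
  then have "ht (tl_code n ?l) - 1/2 = - (ht (tl_code n l) - 1/2)"
    using ht_rec[of "tl_code n ?l"] ht_rec[of "tl_code n l"] by (simp add: tl_code_def)
  then have "ht ?l = cn l n + ez l n / 3 ^ n * - (ht (tl_code n l) - 1/2)"
    using ht_center[of ?l n] unfolding 1 by (simp only:)
  then have "ht ?l = cn l n - ez l n / 3 ^ n * (ht (tl_code n l) - 1/2)"
    unfolding mult_minus_right by simp
  then show ?thesis using ht_center[of l n] by linarith
qed

lemma cn_flip [simp]: "cn (l(n := b)) n = cn l n"
  by (rule cn_cong) simp

lemma rad_flip [simp]: "rad (l(n := b)) n = rad l n"
proof (cases "b = l n")
  case False
  then have "b = (\<not> l n)" by blast
  then show ?thesis by (simp add: rad_def ht_flip)
qed (simp add: fun_upd_idem)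

lemma rad_le: "rad l n \<le> 1 / (2 * 3 ^ n)"
  unfolding rad_def by (rule ht_near_cn)

text \<open>The first term after the partial sum outweighs all later ones together and so decides
  the sign.\<close>

lemma ht_minus_cn: "ht l - cn l n = ez l (Suc n) * rad l n" "rad l n > 0"
proof -
  have 1: "\<bar>ht l - cn l n - ez l (Suc n) / 3 ^ Suc n\<bar> \<le> 1 / (2 * 3 ^ Suc n)"
    using ht_near_cn[of l "Suc n"] by (simp add: algebra_simps)
  have 2: "1 / (2 * 3 ^ Suc n) < (1::real) / 3 ^ Suc n" by (intro divide_strict_left_mono) auto
  have "(ez l (Suc n) = 1 \<and> ht l - cn l n > 0) \<or> (ez l (Suc n) = -1 \<and> ht l - cn l n < 0)"
  proof (cases "ez l (Suc n) = 1")
    case True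
    then show ?thesis using 1 2 by (auto simp: abs_le_iff simp del: power_Suc ez.simps)
  next
    case False
    then have "ez l (Suc n) = -1" using ez_cases by blast
    then show ?thesis using 1 2 by (auto simp: abs_le_iff simp del: power_Suc ez.simps)
  qed
  then show "ht l - cn l n = ez l (Suc n) * rad l n" "rad l n > 0" by (auto simp: rad_def)
qed

lemma ht_on_circle:
  assumes "\<bar>ht l' - cn l n\<bar> = rad l n"
  shows "l' = l \<or> l' = l(n := \<not> l n)"
proof -
  have "ht l' = ht l \<or> ht l' = ht (l(n := \<not> l n))"
    using assms unfolding ht_flip rad_def by (auto simp: abs_if split: if_splits)
  then show ?thesis using ht_inj by blast
qed

text \<open>\<rho>^2 - (y - C)^2 is the product of the distances from y to the ends of the interval
  of radius \<rho> about C, and both distances grow with the interval. For semicircles: an outer one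
  reaches farther from its axis at every height of the inner one.\<close>

lemma circle_nested:
  fixes y C \<rho> C' \<rho>' :: real
  assumes "\<bar>y - C\<bar> \<le> \<rho>" "C' - \<rho>' < C - \<rho>" "C + \<rho> < C' + \<rho>'"
  shows "\<rho>^2 - (y - C)^2 < \<rho>'^2 - (y - C')^2"
proof -
  have 1: "0 \<le> y - (C - \<rho>)" "0 \<le> C + \<rho> - y" using assms(1) by (auto simp: abs_le_iff)
  have "(y - (C - \<rho>)) * (C + \<rho> - y) < (y - (C' - \<rho>')) * (C' + \<rho>' - y)"
    using 1 assms(2,3) by (intro mult_strict_mono') auto
  then show ?thesis by (simp add: power2_eq_square algebra_simps)
qed

context tent_param
begin

section \<open>Semicircles, basic arcs and their disjointness\<close>

lemma cap_iff:
  "q \<in> cap x l n \<longleftrightarrow> (fst q - x 0)^2 + (snd q - cn l n)^2 = (rad l n)^2 \<and> 0 \<le> sg l n * (fst q - x 0)"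
proof -
  have mid: "(ht l + ht (l(n := \<not> l n))) / 2 = cn l n" by (simp add: ht_flip)
  have dia: "\<bar>ht l - ht (l(n := \<not> l n))\<bar> / 2 = rad l n"
  proof -
    have "ht l - ht (l(n := \<not> l n)) = 2 * (ht l - cn l n)" by (simp add: ht_flip)
    then show ?thesis unfolding rad_def by (simp only: abs_mult) simp
  qed
  have "dist (x 0, cn l n) q = rad l n \<longleftrightarrow> (dist (x 0, cn l n) q)^2 = (rad l n)^2"
    using ht_minus_cn(2)[of l n] by (simp add: power2_eq_iff_nonneg)
  also have "(dist (x 0, cn l n) q)^2 = (fst q - x 0)^2 + (snd q - cn l n)^2"
    by (simp add: dist_prod_def dist_real_def power2_commute)
  finally show ?thesis
    unfolding cap_def semicircle_def ht_def[symmetric] mid dia using sg_cases[of l n] by auto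
qed

lemma cap_height: "q \<in> cap x l n \<Longrightarrow> \<bar>snd q - cn l n\<bar> \<le> rad l n" "q \<in> cap x l n \<Longrightarrow> \<bar>fst q - x 0\<bar> \<le> rad l n"
proof -
  assume q: "q \<in> cap x l n"
  have "(snd q - cn l n)^2 \<le> (rad l n)^2" "(fst q - x 0)^2 \<le> (rad l n)^2"
    using q unfolding cap_iff by (smt (verit) zero_le_power2)+
  then show "\<bar>snd q - cn l n\<bar> \<le> rad l n" "\<bar>fst q - x 0\<bar> \<le> rad l n"
    using ht_minus_cn(2)[of l n] by (auto simp: abs_le_square_iff[symmetric])
qed

lemma cap_end: "q \<in> cap x l n \<Longrightarrow> fst q = x 0 \<Longrightarrow> snd q = ht l \<or> snd q = ht (l(n := \<not> l n))"
proof -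
  assume "q \<in> cap x l n" "fst q = x 0"
  then have "\<bar>snd q - cn l n\<bar> = rad l n"
    using ht_minus_cn(2)[of l n] by (auto simp: cap_iff power2_eq_iff abs_if)
  then show ?thesis unfolding ht_flip rad_def by (auto simp: abs_if split: if_splits)
qed

lemma ends_on_cap: "(x 0, ht l) \<in> cap x l n" "(x 0, ht (l(n := \<not> l n))) \<in> cap x l n"
  by (auto simp: cap_iff rad_def ht_flip power2_eq_square algebra_simps)

lemma coded_diff:
  assumes "x \<in> tent_core s" "x' \<in> tent_core s" "coded x l" "coded x' l'" "\<And>i. i < n \<Longrightarrow> l' i = l i"
  shows "x' 0 - x 0 = sg l n * s ^ n * (x' n - x n)"
proof (rule branch_diff)
  show "x' i = br (l i) (x' (Suc i))" if "i < n" for i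
    using coded_br[OF assms(2,4), of i] assms(5)[OF that] by simp
  show "x i = br (l i) (x (Suc i))" for i using coded_br[OF assms(1,3)] .
qed

lemma coded_unique:
  assumes "x \<in> tent_core s" "x' \<in> tent_core s" "coded x l" "coded x' l" "x 0 = x' 0"
  shows "x = x'"
proof
  fix n
  have "x' 0 - x 0 = sg l n * s ^ n * (x' n - x n)" using assms by (intro coded_diff) auto
  then show "x n = x' n" using assms(5) s1 sg_cases[of l n] by auto
qed

lemma core_hit: "x \<in> tent_core s \<Longrightarrow> x (Suc n) = 1/2 \<longleftrightarrow> x n = d1"
  using T_eq_d1[of "x (Suc n)"] by (auto simp: core_iff)

text \<open>Geometrically: all basic arcs with the prefix of a cap end before the cap.\<close>

lemma prefix_bound:
  assumes "x \<in> tent_core s" "x' \<in> tent_core s" "coded x l" "coded x' l'" "\<And>i. i < n \<Longrightarrow> l' i = l i"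
    and "x (Suc n) = 1/2"
  shows "sg l n * (x' 0 - x 0) \<le> 0" "x' 0 = x 0 \<longleftrightarrow> x' (Suc n) = 1/2"
proof -
  have xn: "x n = d1" using core_hit assms by blast
  have x'n: "x' n \<le> d1" using assms(2) core_iff by auto
  have eq: "x' 0 - x 0 = sg l n * s ^ n * (x' n - d1)" using coded_diff[OF assms(1-5)] xn by simp
  have "sg l n * (x' 0 - x 0) = s ^ n * (x' n - d1)" unfolding eq using sg_cases[of l n] by auto
  then show "sg l n * (x' 0 - x 0) \<le> 0" using s1 x'n by (simp add: mult_nonneg_nonpos)
  show "x' 0 = x 0 \<longleftrightarrow> x' (Suc n) = 1/2"
  proof -
    have "x' 0 = x 0 \<longleftrightarrow> sg l n * s ^ n * (x' n - d1) = 0" unfolding eq[symmetric] by simp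
    also have "\<dots> \<longleftrightarrow> x' n = d1" using s1 sg_cases[of l n] by (simp only: mult_eq_0_iff) auto
    finally show ?thesis unfolding core_hit[OF assms(2)] .
  qed
qed

text \<open>A height in the range of the cap forces its prefix, and by \<open>prefix_bound\<close>
  the basic arc then lies on the other side of the axis. So they can meet only at an end of the
  cap.\<close>

lemma horizontal_cap:
  assumes x: "x \<in> tent_core s" "coded x l" "last_hit x n" and x': "x' \<in> tent_core s" "coded x' l'"
    and q: "(x' 0, ht l') \<in> cap x l n"
  shows "x' = x"
proof -
  have "\<bar>ht l' - cn l n\<bar> \<le> 1 / (2 * 3 ^ n)" using cap_height(1)[OF q] rad_le[of l n] by simp
  then have pre: "l' i = l i" if "i < n" for i using ht_prefix that by blast
  have "sg l n * (x' 0 - x 0) \<le> 0"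
    using prefix_bound(1)[OF x(1) x'(1) x(2) x'(2) pre] x(3) by (simp add: last_hit_def)
  moreover have "0 \<le> sg l n * (x' 0 - x 0)" using q by (simp add: cap_iff)
  ultimately have eq: "x' 0 = x 0" using sg_cases[of l n] by auto
  then have "ht l' = ht l \<or> ht l' = ht (l(n := \<not> l n))" using cap_end[OF q] by simp
  then have "l' = l \<or> l' = l(n := \<not> l n)" using ht_inj by blast
  then have "coded x l'" using coded_flip x by auto
  then show ?thesis using coded_unique[OF x'(1) x(1) x'(2)] eq by blast
qed

text \<open>The two ends of the deeper cap share n symbols, hence the first n', so its whole range
  of heights stays in the interval of that prefix. The other cap stays in the interval of its own
  prefix.\<close>

lemma caps_prefix:
  assumes "n' \<le> n" and y: "\<bar>y - cn l n\<bar> \<le> rad l n" "\<bar>y - cn l' n'\<bar> \<le> rad l' n'" and "i < n'"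
  shows "l i = l' i"
proof -
  have conv: "\<bar>y - c\<bar> \<le> B" if "\<bar>ht l - c\<bar> \<le> B" "\<bar>ht (l(n := \<not> l n)) - c\<bar> \<le> B" for c B
    using y(1) that unfolding ht_flip rad_def by linarith
  have c: "cn (l(n := \<not> l n)) n' = cn l n'" using \<open>n' \<le> n\<close> by (intro cn_cong) auto
  have "\<bar>y - cn l n'\<bar> \<le> 1 / (2 * 3 ^ n')"
    using conv ht_near_cn[of l n'] ht_near_cn[of "l(n := \<not> l n)" n'] c by simp
  moreover have "\<bar>y - cn l' n'\<bar> \<le> 1 / (2 * 3 ^ n')" using y(2) rad_le[of l' n'] by simp
  ultimately show ?thesis using same_prefix \<open>i < n'\<close> by blast
qed

text \<open>If an end of the shallower cap were enclosed by the deeper one, its basic arc would end at both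
  caps and the orbit would meet the critical point twice.\<close>

lemma caps_nested:
  assumes x: "x \<in> tent_core s" "coded x l" "last_hit x n"
    and x': "x' \<in> tent_core s" "coded x' l'" "last_hit x' n'"
    and n: "n' < n" and same: "sg l n = sg l' n'"
    and y: "\<bar>y - cn l n\<bar> \<le> rad l n" "\<bar>y - cn l' n'\<bar> \<le> rad l' n'"
  shows "cn l' n' - rad l' n' < cn l n - rad l n" "cn l n + rad l n < cn l' n' + rad l' n'"
    "sg l n * (x 0 - x' 0) \<le> 0"
proof -
  have pre: "l i = l' i" if "i < n'" for i
    using caps_prefix[OF less_imp_le[OF n] y that] .
  then have C: "cn l n' = cn l' n'" and E: "ez l n' = ez l' n'" by (auto intro: cn_cong ez_cong)
  show side: "sg l n * (x 0 - x' 0) \<le> 0"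
    using prefix_bound(1)[OF x'(1) x(1) x'(2) x(2) pre] x'(3) same by (simp add: last_hit_def)
  \<comment> \<open>The end of the shallower cap that lies on the same side of its centre as the
    deeper cap.\<close>
  define lB where "lB = l'(n' := l n')"
  have cB: "coded x' lB" unfolding lB_def using coded_flip x' by blast
  define \<sigma> where "\<sigma> = ez l (Suc n')"
  have \<sigma>B: "ez lB (Suc n') = \<sigma>" unfolding \<sigma>_def by (rule ez_cong) (auto simp: lB_def pre)
  have eB: "ht lB - cn l' n' = \<sigma> * rad l' n'"
    using ht_minus_cn(1)[of lB n'] unfolding \<sigma>B by (simp add: lB_def)
  have htl: "\<sigma> * (ht l - cn l' n') > 0"
    using ht_minus_cn[of l n'] by (simp add: \<sigma>_def C mult.assoc[symmetric] del: ez.simps)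
  have htl': "\<sigma> * (ht (l(n := \<not> l n)) - cn l' n') > 0"
  proof -
    let ?l = "l(n := \<not> l n)"
    have "cn ?l n' = cn l' n'" "ez ?l (Suc n') = \<sigma>" unfolding C[symmetric] \<sigma>_def using n by (auto intro!: cn_cong ez_cong simp del: ez.simps)
    then show ?thesis using ht_minus_cn[of ?l n'] by (simp add: mult.assoc[symmetric] \<sigma>_def del: ez.simps)
  qed
  have far: "\<bar>ht lB - cn l n\<bar> > rad l n"
  proof (rule ccontr)
    assume "\<not> ?thesis"
    then have "\<bar>ht lB - cn l n\<bar> \<le> 1 / (2 * 3 ^ n)" using rad_le[of l n] by linarith
    then have preB: "lB i = l i" if "i < n" for i using ht_prefix that by blast
    have "sg l n * (x' 0 - x 0) \<le> 0" and hit: "x' 0 = x 0 \<longleftrightarrow> x' (Suc n) = 1/2"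
      using prefix_bound[OF x(1) x'(1) x(2) cB preB] x(3) by (auto simp: last_hit_def)
    then have "x' 0 = x 0" using side sg_cases[of l n] by auto
    then show False using hit x'(3) n by (simp add: last_hit_def)
  qed
  have \<sigma>: "\<sigma> = 1 \<or> \<sigma> = -1" unfolding \<sigma>_def by (rule ez_cases)
  have rl: "ht l - cn l n = rad l n \<or> ht l - cn l n = - rad l n" by (auto simp: rad_def abs_if)
  have "rad l' n' > 0" "rad l n > 0" using ht_minus_cn by auto
  then show "cn l' n' - rad l' n' < cn l n - rad l n" "cn l n + rad l n < cn l' n' + rad l' n'"
    using \<sigma> eB htl htl' far rl y unfolding ht_flip by (auto simp: abs_if abs_le_iff split: if_splits)
qed

definition draw :: "(nat \<Rightarrow> real) \<Rightarrow> (real \<times> real) set" where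
  "draw x = {(x 0, ht l) | l. coded x l} \<union> \<Union>{cap x l n | l n. coded x l \<and> last_hit x n}"

lemma phi_R_draw: "Y \<subseteq> tent_core s \<Longrightarrow> phi_R s Y = (\<Union>x\<in>Y. draw x)"
  unfolding phi_R_eq draw_def ht_def[symmetric] by blast

text \<open>At equal level the caps are concentric, and equal radii force equal codes. At different
  levels, caps on the same side are nested by \<open>caps_nested\<close> and
  \<open>circle_nested\<close>, while caps on opposite sides turn away from each other and could
  only share an end point.\<close>

lemma caps_disjoint:
  assumes x: "x \<in> tent_core s" "coded x l" "last_hit x n"
    and x': "x' \<in> tent_core s" "coded x' l'" "last_hit x' n'"
    and n: "n' \<le> n" and q: "q \<in> cap x l n" "q \<in> cap x' l' n'"
  shows "x = x'"
proof -
  note h = cap_height(1)[OF q(1)] cap_height(1)[OF q(2)]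
  have pre: "l i = l' i" if "i < n'" for i using caps_prefix[OF n h that] .
  have pb: "sg l' n' * (x 0 - x' 0) \<le> 0" "x 0 = x' 0 \<longleftrightarrow> x (Suc n') = 1/2"
    using prefix_bound[OF x'(1) x(1) x'(2) x(2) pre] x'(3) by (auto simp: last_hit_def)
  show ?thesis
  proof (cases "n' = n")
    case True
    have C: "cn l n = cn l' n" unfolding True[symmetric] using pre by (rule cn_cong)
    have "x 0 = x' 0" using pb(2) x(3) True by (simp add: last_hit_def)
    moreover from this have "(rad l n)^2 = (rad l' n)^2" using q True by (simp add: cap_iff C)
    then have "rad l n = rad l' n" using ht_minus_cn(2)[of l n] ht_minus_cn(2)[of l' n] by simp
    then have "l' = l \<or> l' = l(n := \<not> l n)" by (intro ht_on_circle) (simp add: rad_def C)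
    then have "coded x l'" using coded_flip x by auto
    ultimately show ?thesis using coded_unique x(1) x'(1,2) by blast
  next
    case False
    then have lt: "n' < n" using n by simp
    show ?thesis
    proof (cases "sg l n = sg l' n'")
      case True
      note nest = caps_nested[OF x x' lt True h]
      have "rad l n ^ 2 - (snd q - cn l n)^2 < rad l' n' ^ 2 - (snd q - cn l' n')^2"
        using circle_nested[OF h(1) nest(1,2)] .
      then have "(fst q - x 0)^2 < (fst q - x' 0)^2" using q by (simp add: cap_iff algebra_simps)
      then have "\<bar>fst q - x 0\<bar> < \<bar>fst q - x' 0\<bar>" by (simp add: abs_le_square_iff not_le[symmetric])
      moreover have "0 \<le> sg l n * (fst q - x' 0)" "0 \<le> sg l n * (fst q - x 0)" using q True by (auto simp: cap_iff)
      ultimately show ?thesis using nest(3) sg_cases[of l n] by auto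
    next
      case False
      then have "sg l n = - sg l' n'" using sg_cases[of l n] sg_cases[of l' n'] by auto
      then have "0 \<le> sg l' n' * (fst q - x' 0)" "0 \<le> - sg l' n' * (fst q - x 0)" using q by (auto simp: cap_iff)
      then have "fst q = x 0" using pb(1) sg_cases[of l' n'] by auto
      then have "q = (x 0, ht l) \<or> q = (x 0, ht (l(n := \<not> l n)))" using cap_end[OF q(1)] by (auto simp: prod_eq_iff)
      then show ?thesis using horizontal_cap[OF x' x(1) _ ] q(2) x coded_flip by metis
    qed
  qed
qed

text \<open>Stands in for the injectivity of the embedding.\<close>

lemma draw_disjoint:
  assumes "x \<in> tent_core s" "x' \<in> tent_core s" "q \<in> draw x" "q \<in> draw x'"
  shows "x = x'"
proof -
  have cases: "(\<exists>l. q = (x 0, ht l) \<and> coded x l) \<or> (\<exists>l n. q \<in> cap x l n \<and> coded x l \<and> last_hit x n)"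
    if "q \<in> draw x" for x using that unfolding draw_def by blast
  show ?thesis
    using cases[OF assms(3)] cases[OF assms(4)]
  proof (elim disjE exE conjE)
    fix l l' assume *: "q = (x 0, ht l)" "coded x l" "q = (x' 0, ht l')" "coded x' l'"
    then have "ht l = ht l'" "x 0 = x' 0" by simp_all
    then show ?thesis using coded_unique[OF assms(1,2)] ht_inj * by blast
  next
    fix l l' n' assume "q = (x 0, ht l)" "coded x l" "q \<in> cap x' l' n'" "coded x' l'" "last_hit x' n'"
    then show ?thesis using horizontal_cap[OF assms(2) _ _ assms(1)] by blast
  next
    fix l l' n assume "q = (x' 0, ht l')" "coded x' l'" "q \<in> cap x l n" "coded x l" "last_hit x n"
    then show ?thesis using horizontal_cap[OF assms(1) _ _ assms(2)] by blast
  next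
    fix l l' n n' assume *: "q \<in> cap x l n" "coded x l" "last_hit x n" "q \<in> cap x' l' n'" "coded x' l'" "last_hit x' n'"
    show ?thesis
    proof (cases "n' \<le> n")
      case True
      then show ?thesis using caps_disjoint[OF assms(1) *(2,3) assms(2) *(5,6)] * by blast
    next
      case False
      then have "n \<le> n'" by simp
      from caps_disjoint[OF assms(2) *(5,6) assms(1) *(2,3) this *(4,1)] show ?thesis by simp
    qed
  qed
qed

section \<open>The arc component of the fixed point\<close>

lemma T_image_left: "b \<le> 1/2 \<Longrightarrow> a \<le> b \<Longrightarrow> {s * a..s * b} \<subseteq> T ` {a..b}"
proof
  fix y assume *: "b \<le> 1/2" "a \<le> b" "y \<in> {s * a..s * b}"
  then have "a \<le> y / s" "y / s \<le> b" using s1 by (auto simp: field_simps)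
  moreover from this have "y / s \<le> 1/2" using * by linarith
  ultimately have "y / s \<in> {a..b}" "y / s \<le> 1/2" by auto
  moreover from this have "T (y / s) = s * (y / s)" by (intro T_left)
  then have "T (y / s) = y" using s1 by simp
  ultimately have "y / s \<in> {a..b}" "T (y / s) = y" by auto
  then show "y \<in> T ` {a..b}" by (metis image_eqI)
qed

lemma T_image_right: "1/2 \<le> a \<Longrightarrow> a \<le> b \<Longrightarrow> {s * (1 - b)..s * (1 - a)} \<subseteq> T ` {a..b}"
proof
  fix y assume *: "1/2 \<le> a" "a \<le> b" "y \<in> {s * (1 - b)..s * (1 - a)}"
  have "y / s \<le> 1 - a" "1 - b \<le> y / s" using * s1 by (auto simp: field_simps)
  then have "a \<le> 1 - y / s" "1 - y / s \<le> b" by linarith+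
  moreover from this have "1/2 \<le> 1 - y / s" using * by linarith
  ultimately have "1 - y / s \<in> {a..b}" "1/2 \<le> 1 - y / s" by auto
  moreover from this have "T (1 - y / s) = s * (1 - (1 - y / s))" by (intro T_right)
  then have "T (1 - y / s) = y" using s1 by simp
  ultimately have "1 - y / s \<in> {a..b}" "T (1 - y / s) = y" by auto
  then show "y \<in> T ` {a..b}" by (metis image_eqI)
qed

lemma T_core_image: "core \<subseteq> T ` core"
proof -
  have "{s * (1 - d1)..s * (1 - 1/2)} \<subseteq> T ` {1/2..d1}"
    by (rule T_image_right) (use d_order in auto)
  moreover have "s * (1 - d1) = d2" "s * (1 - 1/2) = d1" by (simp_all add: d1_def d2_def)
  moreover have "{1/2..d1} \<subseteq> core" using d_order by auto
  ultimately show ?thesis by (metis image_mono subset_trans)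
qed

text \<open>The second case is a fold at 1/2: the longer half keeps at least half of the length, and
  its image ends at d1. An interval ending at d1 that folds again contains the right half of the
  core, whose image is the whole core.\<close>

lemma T_interval:
  assumes "a \<in> core" "b \<in> core" "a < b"
  obtains "b \<le> 1/2 \<or> 1/2 \<le> a" "\<exists>a' b'. a' \<in> core \<and> b' \<in> core \<and> b' - a' = s * (b - a) \<and> {a'..b'} \<subseteq> T ` {a..b}"
  | a' where "a' \<in> core" "d1 - a' \<ge> s * (b - a) / 2" "{a'..d1} \<subseteq> T ` {a..b}"
proof -
  consider "b \<le> 1/2" | "1/2 \<le> a" | "a < 1/2" "1/2 < b" by linarith
  then show thesis
  proof cases
    case 1
    have "s * a \<in> core" "s * b \<in> core" using T_core[OF assms(1)] T_core[OF assms(2)] 1 assms(3) by (auto simp: T_left)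
    moreover have "s * b - s * a = s * (b - a)" by (simp add: algebra_simps)
    moreover have "{s * a..s * b} \<subseteq> T ` {a..b}" using T_image_left[OF 1] assms(3) by simp
    ultimately show thesis using 1 by (intro that(1)) blast+
  next
    case 2
    have "s * (1 - b) \<in> core" "s * (1 - a) \<in> core" using T_core[OF assms(1)] T_core[OF assms(2)] 2 assms(3) by (auto simp: T_right)
    moreover have "s * (1 - a) - s * (1 - b) = s * (b - a)" by (simp add: algebra_simps)
    moreover have "{s * (1 - b)..s * (1 - a)} \<subseteq> T ` {a..b}" using T_image_right[OF 2] assms(3) by simp
    ultimately show thesis using 2 by (intro that(1)) blast+
  next
    case 3
    show thesis
    proof (cases "1/2 - a \<ge> b - 1/2")
      case True
      have "s * a \<in> core" using T_core[OF assms(1)] 3 by (simp add: T_left)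
      moreover have "d1 - s * a \<ge> s * (b - a) / 2"
      proof -
        have "s * (1/2 - a) \<ge> s * ((b - a) / 2)" using True s1 by (intro mult_left_mono) auto
        then show ?thesis by (simp add: d1_def algebra_simps)
      qed
      moreover have "{s * a..d1} \<subseteq> T ` {a..b}"
      proof -
        have "{s * a..s * (1/2)} \<subseteq> T ` {a..1/2}" using 3 by (intro T_image_left) auto
        moreover have "T ` {a..1/2} \<subseteq> T ` {a..b}" using 3 by (intro image_mono) auto
        moreover have "s * (1/2) = d1" by (simp add: d1_def)
        ultimately show ?thesis by (metis subset_trans)
      qed
      ultimately show thesis by (rule that(2))
    next
      case False
      have "s * (1 - b) \<in> core" using T_core[OF assms(2)] 3 by (simp add: T_right)
      moreover have "d1 - s * (1 - b) \<ge> s * (b - a) / 2"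
      proof -
        have "s * (b - 1/2) \<ge> s * ((b - a) / 2)" using False s1 by (intro mult_left_mono) auto
        then show ?thesis by (simp add: d1_def algebra_simps)
      qed
      moreover have "{s * (1 - b)..d1} \<subseteq> T ` {a..b}"
      proof -
        have "{s * (1 - b)..s * (1 - 1/2)} \<subseteq> T ` {1/2..b}" using 3 by (intro T_image_right) auto
        moreover have "T ` {1/2..b} \<subseteq> T ` {a..b}" using 3 by (intro image_mono) auto
        moreover have "s * (1 - 1/2) = d1" by (simp add: d1_def)
        ultimately show ?thesis by (metis subset_trans)
      qed
      ultimately show thesis by (rule that(2))
    qed
  qed
qed

lemma T_twice_interval:
  assumes "a \<in> core" "b \<in> core" "a < b"
  obtains "core \<subseteq> T ` T ` {a..b}"
  | a' b' where "a' \<in> core" "b' \<in> core" "b' - a' \<ge> s * s / 2 * (b - a)" "{a'..b'} \<subseteq> T ` T ` {a..b}"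
proof -
  have next_step: "\<exists>a' b'. a' \<in> core \<and> b' \<in> core \<and> b' - a' \<ge> s * (v - u) / 2 \<and> {a'..b'} \<subseteq> T ` {u..v}"
    if uv: "u \<in> core" "v \<in> core" "u < v" for u v
    using uv
  proof (cases rule: T_interval)
    case 1
    then obtain a' b' where "a' \<in> core" "b' \<in> core" "b' - a' = s * (v - u)" "{a'..b'} \<subseteq> T ` {u..v}" by blast
    moreover have "s * (v - u) \<ge> s * (v - u) / 2" using s1 uv by simp
    ultimately show ?thesis by (metis)
  next
    case (2 a')
    moreover have "d1 \<in> core" using d_order by simp
    ultimately show ?thesis by blast
  qed
  show thesis using assms
  proof (cases rule: T_interval)
    case 1
    then obtain u v where uv: "u \<in> core" "v \<in> core" "v - u = s * (b - a)" "{u..v} \<subseteq> T ` {a..b}" by blast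
    have "s * (b - a) > 0" using s1 assms by simp
    then obtain a' b' where "a' \<in> core" "b' \<in> core" "b' - a' \<ge> s * (v - u) / 2" "{a'..b'} \<subseteq> T ` {u..v}"
      using next_step[of u v] uv by auto
    moreover have "s * (v - u) / 2 = s * s / 2 * (b - a)" using uv by simp
    ultimately show thesis using that(2)[of a' b'] uv(4) by (metis image_mono subset_trans)
  next
    case (2 u)
    show thesis
    proof (cases "u \<le> 1/2")
      case True
      then have "{1/2..d1} \<subseteq> T ` {a..b}" using 2 by auto
      moreover have "core \<subseteq> T ` {1/2..d1}"
      proof -
        have "{s * (1 - d1)..s * (1 - 1/2)} \<subseteq> T ` {1/2..d1}"
          by (rule T_image_right) (use d_order in auto)
        then show ?thesis by (simp add: d1_def d2_def)
      qed
      ultimately show thesis using that(1) by (meson image_mono subset_trans)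
    next
      case False
      have len: "d1 - u > 0" using 2(2) s1 assms by (smt (verit) mult_pos_pos half_gt_zero)
      have im: "{s * (1 - d1)..s * (1 - u)} \<subseteq> T ` {u..d1}" using False len by (intro T_image_right) auto
      have "s * (1 - u) \<in> core" "s * (1 - d1) \<in> core" using T_core[OF 2(1)] T_core[of d1] False d_order by (auto simp: T_right)
      moreover have "s * (1 - u) - s * (1 - d1) \<ge> s * s / 2 * (b - a)"
      proof -
        have "s * (d1 - u) \<ge> s * (s * (b - a) / 2)" using 2(2) s1 by (intro mult_left_mono) auto
        then show ?thesis by (simp add: algebra_simps)
      qed
      moreover have "{s * (1 - d1)..s * (1 - u)} \<subseteq> T ` T ` {a..b}" using im 2(3) by (meson image_mono subset_trans)
      ultimately show thesis using that(2) by blast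
    qed
  qed
qed

lemma funpow_image: "(f ^^ (m + n)) ` A = (f ^^ m) ` (f ^^ n) ` A"
  by (simp add: funpow_add image_comp)

lemma funpow_Suc_image: "(f ^^ Suc n) ` A = f ` (f ^^ n) ` A"
  by (simp add: image_image)

lemma funpow_2_image: "(f ^^ 2) ` A = f ` f ` A"
  by (simp add: numeral_2_eq_2 image_image)

lemma core_onto: "core \<subseteq> (T ^^ m) ` A \<Longrightarrow> core \<subseteq> (T ^^ (j + m)) ` A"
proof (induction j)
  case (Suc j)
  then have "T ` core \<subseteq> T ` (T ^^ (j + m)) ` A" by (intro image_mono) simp
  then show ?case using T_core_image unfolding add_Suc funpow_Suc_image by blast
qed simp

text \<open>Two iterations cover the critical point at most once or are onto the core, so they expand
  intervals by at least \<open>s\<^sup>2 / 2\<close>; this is where \<open>s > sqrt 2\<close> is essential.\<close>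

lemma expanding_intervals_onto:
  "a \<in> core \<Longrightarrow> b \<in> core \<Longrightarrow> a < b \<Longrightarrow> (s * s / 2) ^ k * (b - a) > 1 \<Longrightarrow> core \<subseteq> (T ^^ (2 * k)) ` {a..b}"
proof (induction k arbitrary: a b)
  case 0
  then show ?case using d_order by auto
next
  case (Suc k)
  show ?case using Suc.prems(1-3)
  proof (cases rule: T_twice_interval)
    case 1
    then have "core \<subseteq> (T ^^ 2) ` {a..b}" by (simp only: funpow_2_image)
    from core_onto[OF this, of "2 * k"] show ?thesis by (simp add: add.commute)
  next
    case (2 a' b')
    have "1 < (s * s / 2) ^ k * (s * s / 2 * (b - a))" using Suc.prems(4) by (simp add: algebra_simps)
    also have "\<dots> \<le> (s * s / 2) ^ k * (b' - a')" using 2 s1 by (intro mult_left_mono) auto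
    finally have gt: "1 < (s * s / 2) ^ k * (b' - a')" .
    moreover have "a' < b'"
      using gt s1 by (smt (verit) mult_nonneg_nonpos zero_le_power divide_nonneg_pos mult_nonneg_nonneg)
    ultimately have "core \<subseteq> (T ^^ (2 * k)) ` {a'..b'}" using Suc.IH 2 by blast
    also have "\<dots> \<subseteq> (T ^^ (2 * k)) ` (T ^^ 2) ` {a..b}"
      using 2(4) by (intro image_mono) (simp only: funpow_2_image)
    finally show ?thesis unfolding funpow_image[symmetric] by (simp add: add.commute)
  qed
qed

lemma locally_eventually_onto:
  assumes "\<eta> > 0"
  obtains M where "\<And>m a b. m \<ge> M \<Longrightarrow> a \<in> core \<Longrightarrow> b \<in> core \<Longrightarrow> b - a \<ge> \<eta> \<Longrightarrow> core \<subseteq> (T ^^ m) ` {a..b}"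
proof -
  have "s * s / 2 > 1" using s2 by simp
  then obtain k where k: "(s * s / 2) ^ k > 1 / \<eta>" using real_arch_pow by blast
  have "core \<subseteq> (T ^^ m) ` {a..b}" if "m \<ge> 2 * k" "a \<in> core" "b \<in> core" "b - a \<ge> \<eta>" for m a b
  proof -
    have "1 < (s * s / 2) ^ k * \<eta>" using k assms by (simp add: field_simps)
    also have "\<dots> \<le> (s * s / 2) ^ k * (b - a)" using that s1 by (intro mult_left_mono) auto
    finally have "core \<subseteq> (T ^^ (2 * k)) ` {a..b}" using that assms by (intro expanding_intervals_onto) auto
    from core_onto[OF this, of "m - 2 * k"] show ?thesis using that(1) by simp
  qed
  then show thesis using that by blast
qed

lemma T_continuous: "continuous_on S T"
  unfolding tent_def by (intro continuous_intros)

lemma Tn_continuous: "continuous_on S (T ^^ n)"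
proof (induction n)
  case (Suc n)
  show ?case unfolding funpow.simps by (rule continuous_on_compose[OF Suc T_continuous])
qed (simp add: id_def)

lemma core_funpow: "x \<in> tent_core s \<Longrightarrow> (T ^^ m) (x (m + n)) = x n"
proof (induction m arbitrary: n)
  case (Suc m)
  have "(T ^^ Suc m) (x (Suc m + n)) = T ((T ^^ m) (x (m + Suc n)))" by simp
  also have "\<dots> = x n" using Suc.IH[OF Suc.prems, of "Suc n"] Suc.prems core_iff by simp
  finally show ?case .
qed simp

lemma Tn_core: "t \<in> core \<Longrightarrow> (T ^^ m) t \<in> core"
  by (induction m) (use T_core in auto)

text \<open>The arc component is the unstable manifold of the fixed point; \<open>X \<xi>\<close> parametrizes it by
  arc length.\<close>

definition \<delta>0 :: real where "\<delta>0 = min (r - 1/2) (d1 - r)"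

definition \<sigma> :: real where "\<sigma> = - 1 / s"

definition mX :: "real \<Rightarrow> nat" where "mX \<xi> = (LEAST k. \<bar>\<xi>\<bar> / s ^ k < \<delta>0)"

definition X :: "real \<Rightarrow> nat \<Rightarrow> real" where
  "X \<xi> n = (T ^^ mX \<xi>) (r + \<sigma> ^ (n + mX \<xi>) * \<xi>)"

section \<open>The unstable manifold of the fixed point\<close>

lemma \<delta>0_pos: "\<delta>0 > 0" using d_order by (simp add: \<delta>0_def)

lemma near_r: "\<bar>\<delta>\<bar> < \<delta>0 \<Longrightarrow> 1/2 < r + \<delta> \<and> r + \<delta> < d1 \<and> r + \<delta> \<in> core"
  using d_order by (auto simp: \<delta>0_def)

lemma T_near_r: "\<bar>\<delta>\<bar> < \<delta>0 \<Longrightarrow> T (r + \<delta>) = r - s * \<delta>"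
proof -
  assume "\<bar>\<delta>\<bar> < \<delta>0"
  then have "T (r + \<delta>) = s * (1 - r) - s * \<delta>" using near_r[of \<delta>] by (simp add: T_right algebra_simps)
  moreover have "s * (1 - r) = r" using T_r d_order by (simp add: T_right)
  ultimately show ?thesis by simp
qed

lemma abs_\<sigma>: "\<bar>\<sigma> ^ k * \<xi>\<bar> = \<bar>\<xi>\<bar> / s ^ k"
  using s1 by (simp add: \<sigma>_def abs_mult power_abs power_divide)

lemma T_\<sigma>: "\<bar>\<xi>\<bar> / s ^ Suc k < \<delta>0 \<Longrightarrow> T (r + \<sigma> ^ Suc k * \<xi>) = r + \<sigma> ^ k * \<xi>"
  using T_near_r[of "\<sigma> ^ Suc k * \<xi>"] abs_\<sigma>[of "Suc k" \<xi>] s1 by (simp add: \<sigma>_def)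

lemma small_mono: "\<bar>\<xi>\<bar> / s ^ k < \<delta>0 \<Longrightarrow> k \<le> m \<Longrightarrow> \<bar>\<xi>\<bar> / s ^ m < \<delta>0"
proof -
  assume "\<bar>\<xi>\<bar> / s ^ k < \<delta>0" "k \<le> m"
  have "s ^ k \<le> s ^ m" using s1 \<open>k \<le> m\<close> by (intro power_increasing) auto
  then have "\<bar>\<xi>\<bar> / s ^ m \<le> \<bar>\<xi>\<bar> / s ^ k" using s1 by (intro divide_left_mono) auto
  then show ?thesis using \<open>\<bar>\<xi>\<bar> / s ^ k < \<delta>0\<close> by simp
qed

lemma small_exists: "\<exists>k. \<bar>\<xi>\<bar> / s ^ k < \<delta>0"
proof -
  obtain k where "s ^ k > \<bar>\<xi>\<bar> / \<delta>0" using real_arch_pow[OF s1(1)] by blast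
  then show ?thesis using \<delta>0_pos s1 by (intro exI[of _ k]) (simp add: field_simps)
qed

lemma small_mX: "\<bar>\<xi>\<bar> / s ^ mX \<xi> < \<delta>0"
  unfolding mX_def by (rule LeastI_ex[OF small_exists])

lemma T\<sigma>_funpow: "\<bar>\<xi>\<bar> / s ^ Suc k < \<delta>0 \<Longrightarrow> (T ^^ j) (r + \<sigma> ^ (k + j) * \<xi>) = r + \<sigma> ^ k * \<xi>"
proof (induction j)
  case (Suc j)
  have "\<bar>\<xi>\<bar> / s ^ Suc (k + j) < \<delta>0" using small_mono[OF Suc.prems, of "Suc (k + j)"] by simp
  from T_\<sigma>[OF this] have "T (r + \<sigma> ^ (k + Suc j) * \<xi>) = r + \<sigma> ^ (k + j) * \<xi>" by simp
  then show ?case using Suc by (simp add: funpow_swap1)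
qed simp

text \<open>Any sufficiently deep starting level gives the same point, because T is affine with
  slope -s along the orbit near \<open>r\<close>. A common level for bounded \<xi> yields
  continuity.\<close>

lemma X_eval:
  assumes "\<bar>\<xi>\<bar> / s ^ M < \<delta>0"
  shows "X \<xi> n = (T ^^ M) (r + \<sigma> ^ (n + M) * \<xi>)"
proof -
  have "mX \<xi> \<le> M" unfolding mX_def by (rule Least_le) (rule assms)
  then obtain j where j: "M = mX \<xi> + j" using le_Suc_ex by blast
  have "\<bar>\<xi>\<bar> / s ^ Suc (n + mX \<xi>) < \<delta>0" by (rule small_mono[OF small_mX]) simp
  from T\<sigma>_funpow[OF this, of j] show ?thesis
    unfolding j X_def by (simp add: funpow_add add.assoc)
qed

lemma X_far: "\<bar>\<xi>\<bar> / s ^ Suc n < \<delta>0 \<Longrightarrow> X \<xi> n = r + \<sigma> ^ n * \<xi>"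
  unfolding X_def by (rule T\<sigma>_funpow)

lemma X_core: "X \<xi> \<in> tent_core s"
  unfolding core_iff
proof (intro allI conjI)
  fix n
  show "X \<xi> n \<in> core" unfolding X_def
    by (intro Tn_core conjunct2[OF conjunct2[OF near_r]]) (simp only: abs_\<sigma> small_mono[OF small_mX] le_add2)
  have 1: "\<bar>\<xi>\<bar> / s ^ Suc (mX \<xi>) < \<delta>0" by (rule small_mono[OF small_mX]) simp
  show "T (X \<xi> (Suc n)) = X \<xi> n"
    using X_eval[OF 1, of n] by (simp add: X_def)
qed

lemma X_continuous: "continuous_on UNIV (\<lambda>\<xi>. X \<xi> n)"
proof -
  have "isCont (\<lambda>\<xi>. X \<xi> n) \<xi>0" for \<xi>0
  proof -
    obtain M where M: "\<bar>\<bar>\<xi>0\<bar> + 1\<bar> / s ^ M < \<delta>0" using small_exists by blast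
    have eq: "X \<xi> n = (T ^^ M) (r + \<sigma> ^ (n + M) * \<xi>)" if "\<xi> \<in> ball \<xi>0 1" for \<xi>
    proof (rule X_eval)
      have "\<bar>\<xi>\<bar> \<le> \<bar>\<bar>\<xi>0\<bar> + 1\<bar>" using that by (auto simp: dist_real_def)
      then have "\<bar>\<xi>\<bar> / s ^ M \<le> \<bar>\<bar>\<xi>0\<bar> + 1\<bar> / s ^ M" using s1 by (intro divide_right_mono) auto
      then show "\<bar>\<xi>\<bar> / s ^ M < \<delta>0" using M by simp
    qed
    have "continuous_on (ball \<xi>0 1) (\<lambda>\<xi>. (T ^^ M) (r + \<sigma> ^ (n + M) * \<xi>))"
      by (rule continuous_on_compose2[OF Tn_continuous[of UNIV]]) (auto intro!: continuous_intros)
    then have "continuous_on (ball \<xi>0 1) (\<lambda>\<xi>. X \<xi> n)" by (rule continuous_on_eq) (simp add: eq)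
    then show ?thesis by (simp add: continuous_on_eq_continuous_at)
  qed
  then show ?thesis by (simp add: continuous_at_imp_continuous_on)
qed

lemma X_far_eventually: "\<exists>N. \<forall>n\<ge>N. X \<xi> n = r + \<sigma> ^ n * \<xi>"
proof -
  obtain N where "\<bar>\<xi>\<bar> / s ^ N < \<delta>0" using small_exists by blast
  then have "\<bar>\<xi>\<bar> / s ^ Suc n < \<delta>0" if "n \<ge> N" for n using small_mono that by (meson le_SucI)
  then show ?thesis using X_far by blast
qed

lemma X_inj: "X \<xi> = X \<xi>' \<longleftrightarrow> \<xi> = \<xi>'"
proof
  assume eq: "X \<xi> = X \<xi>'"
  obtain N N' where N: "\<And>n. n \<ge> N \<Longrightarrow> X \<xi> n = r + \<sigma> ^ n * \<xi>" "\<And>n. n \<ge> N' \<Longrightarrow> X \<xi>' n = r + \<sigma> ^ n * \<xi>'"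
    using X_far_eventually by metis
  have "\<sigma> ^ max N N' * \<xi> = \<sigma> ^ max N N' * \<xi>'" using N(1)[OF max.cobounded1[of N N']] N(2)[OF max.cobounded2[of N' N]] eq by (metis add_left_cancel)
  moreover have "\<sigma> \<noteq> 0" using s1 by (simp add: \<sigma>_def)
  ultimately show "\<xi> = \<xi>'" by simp
qed simp

lemma X_tendsto: "X \<xi> \<longlonglongrightarrow> r"
proof -
  obtain N where N: "\<And>n. n \<ge> N \<Longrightarrow> X \<xi> n = r + \<sigma> ^ n * \<xi>" using X_far_eventually by metis
  have "\<bar>\<sigma>\<bar> < 1" using s1 by (simp add: \<sigma>_def)
  then have "(\<lambda>n. r + \<sigma> ^ n * \<xi>) \<longlonglongrightarrow> r + 0 * \<xi>" by (intro tendsto_intros LIMSEQ_power_zero) simp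
  moreover have "eventually (\<lambda>n. X \<xi> n = r + \<sigma> ^ n * \<xi>) sequentially" using N eventually_sequentially by blast
  ultimately show ?thesis by (simp add: tendsto_cong)
qed

lemma X_zero: "X 0 = (\<lambda>_. r)"
proof
  fix n
  have "\<bar>0\<bar> / s ^ Suc n < \<delta>0" using \<delta>0_pos by simp
  from X_far[OF this] show "X 0 n = r" by simp
qed

lemma range_X_iff:
  assumes "x \<in> tent_core s"
  shows "x \<in> range X \<longleftrightarrow> x \<longlonglongrightarrow> r"
proof
  show "x \<in> range X \<Longrightarrow> x \<longlonglongrightarrow> r" using X_tendsto by blast
  assume "x \<longlonglongrightarrow> r"
  then obtain N where N: "\<And>n. n \<ge> N \<Longrightarrow> \<bar>x n - r\<bar> < \<delta>0"
    using \<delta>0_pos unfolding LIMSEQ_def dist_real_def by blast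
  have step: "x (Suc n) - r = \<sigma> * (x n - r)" if "n \<ge> N" for n
  proof -
    have "x n = r - s * (x (Suc n) - r)" using T_near_r[of "x (Suc n) - r"] N[of "Suc n"] that assms core_iff by simp
    then show ?thesis using s1 by (simp add: \<sigma>_def field_simps)
  qed
  have pow: "x (N + j) - r = \<sigma> ^ j * (x N - r)" for j
    by (induction j) (simp_all add: step)
  define \<xi> where "\<xi> = (x N - r) / \<sigma> ^ N"
  have s0: "\<sigma> \<noteq> 0" using s1 by (simp add: \<sigma>_def)
  have far: "x n = X \<xi> n" if "n \<ge> N" for n
  proof -
    obtain j where j: "n = N + j" using \<open>n \<ge> N\<close> le_Suc_ex by blast
    have val: "x (N + i) = r + \<sigma> ^ (N + i) * \<xi>" for i using pow[of i] s0 by (simp add: \<xi>_def power_add)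
    have "\<bar>\<xi>\<bar> / s ^ Suc n < \<delta>0" using N[of "N + Suc j"] val[of "Suc j"] abs_\<sigma>[of "Suc n" \<xi>] j by simp
    then show ?thesis using X_far[of \<xi> n] val[of j] j by simp
  qed
  have "x n = X \<xi> n" for n
    using core_funpow[OF assms, of N n] core_funpow[OF X_core, of N \<xi> n] far[of "N + n"] by simp
  then show "x \<in> range X" by blast
qed

text \<open>The inverse of the right branch contracts towards \<open>r\<close>, so a code that is
  eventually constant one belongs to an orbit converging to \<open>r\<close>. Conversely,
  \<open>r\<close> lies strictly right of 1/2.\<close>

lemma range_X_code:
  assumes "x \<in> tent_core s" "coded x l"
  shows "x \<in> range X \<longleftrightarrow> (\<exists>N. \<forall>n\<ge>N. l n)"
proof
  assume "x \<in> range X"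
  then have "x \<longlonglongrightarrow> r" using range_X_iff assms by blast
  then have "eventually (\<lambda>n. x n > 1/2) sequentially" using d_order by (intro order_tendstoD(1)) auto
  then obtain N where "\<And>n. n \<ge> N \<Longrightarrow> x n > 1/2" using eventually_sequentially by auto
  then have "l n" if "n \<ge> N" for n using coded_side[OF assms(2), of n] that by (smt (verit) le_SucI side_def)
  then show "\<exists>N. \<forall>n\<ge>N. l n" by blast
next
  assume "\<exists>N. \<forall>n\<ge>N. l n"
  then obtain N where N: "\<And>n. n \<ge> N \<Longrightarrow> l n" by blast
  have rr: "s * (1 - r) = r" using T_r d_order by (simp add: T_right)
  have step: "x (Suc n) - r = \<sigma> * (x n - r)" if "n \<ge> N" for n
  proof -
    have "x n = s * (1 - x (Suc n))" using coded_br[OF assms, of n] N[OF that] by (simp add: br_def)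
    then have "x n - r = s * (1 - x (Suc n)) - s * (1 - r)" using rr by simp
    also have "\<dots> = - s * (x (Suc n) - r)" by (simp add: algebra_simps)
    finally show ?thesis using s1 by (simp add: \<sigma>_def)
  qed
  have pow: "x (j + N) = r + \<sigma> ^ j * (x N - r)" for j
  proof (induction j)
    case (Suc j)
    then show ?case using step[of "j + N"] by simp
  qed simp
  have "\<bar>\<sigma>\<bar> < 1" using s1 by (simp add: \<sigma>_def)
  then have "(\<lambda>j. r + \<sigma> ^ j * (x N - r)) \<longlonglongrightarrow> r + 0 * (x N - r)" by (intro tendsto_intros LIMSEQ_power_zero) simp
  then have "(\<lambda>j. x (j + N)) \<longlonglongrightarrow> r" unfolding pow by simp
  then have "x \<longlonglongrightarrow> r" by (rule LIMSEQ_offset)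
  then show "x \<in> range X" using range_X_iff assms by blast
qed

text \<open>Staying on the right branch for all forward times multiplies the distance to
  \<open>r\<close> by s at each step, which forces \<open>x 0 = r\<close>; the left code then
  determines the past.\<close>

lemma fixed_point_unique: "(THE x. x \<in> tent_core s \<and> represents s (\<lambda>_. True) x) = X 0"
proof (rule the_equality)
  have co: "coord s (\<lambda>_. r) i = r" for i
  proof -
    have "(T ^^ m) r = r" for m by (induction m) (simp_all add: T_r)
    then show ?thesis by (simp add: coord_def)
  qed
  have "represents s (\<lambda>_. True) (X 0)" unfolding X_zero
  proof (rule represents_intro)
    show "(\<lambda>_. r) \<in> tent_core s" using X_core[of 0] unfolding X_zero .
  qed (use co d_order in \<open>auto simp: side_def\<close>)
  then show "X 0 \<in> tent_core s \<and> represents s (\<lambda>_. True) (X 0)" using X_core by blast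
  fix x assume x: "x \<in> tent_core s \<and> represents s (\<lambda>_. True) x"
  then have xc: "x \<in> tent_core s" and rep: "represents s (\<lambda>_. True) x" by auto
  have sd: "1/2 \<le> coord s x i" for i using rep represents_iff[OF xc] by (simp add: side_def)
  have rr: "s * (1 - r) = r" using T_r d_order by (simp add: T_right)
  have pow: "coord s x (int m) - r = (-s) ^ m * (x 0 - r)" for m
  proof (induction m)
    case 0
    show ?case using coord_neg[of x 0] by simp
  next
    case (Suc m)
    have "coord s x (int (Suc m)) = s * (1 - coord s x (int m))"
      using coord_step[OF xc, of "int m"] T_right[OF sd[of "int m"]] by (simp add: add.commute)
    then have "coord s x (int (Suc m)) - r = s * (1 - coord s x (int m)) - s * (1 - r)" using rr by simp
    also have "\<dots> = - s * (coord s x (int m) - r)" by (simp add: algebra_simps)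
    finally show ?case using Suc by simp
  qed
  have x0: "x 0 = r"
  proof (rule ccontr)
    assume ne: "x 0 \<noteq> r"
    obtain m where m: "s ^ m > 1 / \<bar>x 0 - r\<bar>" using real_arch_pow[OF s1(1)] by blast
    then have "s ^ m * \<bar>x 0 - r\<bar> > 1" using ne by (simp add: field_simps)
    moreover have "\<bar>coord s x (int m) - r\<bar> = s ^ m * \<bar>x 0 - r\<bar>" unfolding pow using s1 by (simp add: abs_mult power_abs)
    moreover have "\<bar>coord s x (int m) - r\<bar> \<le> 1" using coord_core[OF xc, of "int m"] d_order by (auto simp: abs_le_iff)
    ultimately show False by simp
  qed
  have "coded x (\<lambda>_. True)" using represents_coded[OF xc rep] by (simp add: left_part_def[abs_def])
  moreover have "coded (X 0) (\<lambda>_. True)"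
    using represents_coded[OF X_core \<open>represents s (\<lambda>_. True) (X 0)\<close>] by (simp add: left_part_def[abs_def])
  moreover have "x 0 = X 0 0" using x0 by (simp add: X_zero)
  ultimately show "x = X 0" by (rule coded_unique[OF xc X_core])
qed

text \<open>If coordinate n moved by \<eta> along a short piece of the path, coordinate 0 would
  sweep the whole core on that piece, by \<open>locally_eventually_onto\<close>; uniform continuity
  forbids this. So the oscillation of deep coordinates dies out along the path, and convergence to
  \<open>r\<close> spreads from one of its points to all.\<close>

lemma path_from_fixed_point:
  fixes g :: "real \<Rightarrow> nat \<Rightarrow> real"
  assumes g: "path g" "path_image g \<subseteq> tent_core s" and t: "t0 \<in> {0..1}" "t1 \<in> {0..1}" "g t0 \<in> range X"
  shows "g t1 \<in> range X"
proof -
  have core: "g t \<in> tent_core s" if "t \<in> {0..1}" for t using g(2) that by (auto simp: path_image_def)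
  have cont: "continuous_on {0..1} (\<lambda>t. g t n)" for n
    using g(1) unfolding path_def by (rule continuous_on_product_then_coordinatewise)
  have "uniformly_continuous_on {0..1} (\<lambda>t. g t 0)" by (rule compact_uniformly_continuous[OF cont compact_Icc])
  then obtain \<delta> where \<delta>: "\<delta> > 0" "\<And>t t'. t \<in> {0..1} \<Longrightarrow> t' \<in> {0..1} \<Longrightarrow> dist t' t < \<delta> \<Longrightarrow> dist (g t' 0) (g t 0) < d1 - d2"
    unfolding uniformly_continuous_on_def using d_order(9) by (metis diff_gt_0_iff_gt)
  obtain K where K: "inverse (real (Suc K)) < \<delta>" using reals_Archimedean[OF \<delta>(1)] by blast
  define k where "k = Suc K"
  have k: "k > 0" "1 / real k < \<delta>" using K by (auto simp: k_def inverse_eq_divide)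
  have osc: "\<exists>M. \<forall>n\<ge>M. \<forall>u\<in>{0..1}. \<forall>v\<in>{0..1}. \<bar>u - v\<bar> \<le> 1 / k \<longrightarrow> \<bar>g u n - g v n\<bar> < \<eta>" if \<eta>: "\<eta> > 0" for \<eta>
  proof -
    obtain M where M: "\<And>m a b. m \<ge> M \<Longrightarrow> a \<in> core \<Longrightarrow> b \<in> core \<Longrightarrow> b - a \<ge> \<eta> \<Longrightarrow> core \<subseteq> (T ^^ m) ` {a..b}"
      using locally_eventually_onto[OF \<eta>] by blast
    have *: "\<not> g v n - g u n \<ge> \<eta>" if n: "n \<ge> M" and uv: "u \<in> {0..1}" "v \<in> {0..1}" "\<bar>u - v\<bar> \<le> 1 / k" for n u v
    proof
      assume ge: "g v n - g u n \<ge> \<eta>"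
      have co: "g u n \<in> core" "g v n \<in> core" using core[OF uv(1)] core[OF uv(2)] core_iff by blast+
      have sub: "closed_segment u v \<subseteq> {0..1}" using uv by (auto simp: closed_segment_eq_real_ivl split: if_splits)
      have "connected ((\<lambda>t. g t n) ` closed_segment u v)"
        using continuous_on_subset[OF cont sub] by (intro connected_continuous_image) auto
      then have "{g u n..g v n} \<subseteq> (\<lambda>t. g t n) ` closed_segment u v"
        by (intro connected_contains_Icc) auto
      moreover have "core \<subseteq> (T ^^ n) ` {g u n..g v n}" using M[OF n co ge] .
      ultimately have "core \<subseteq> (T ^^ n) ` (\<lambda>t. g t n) ` closed_segment u v" by (meson image_mono subset_trans)
      moreover have "(T ^^ n) (g t n) = g t 0" if "t \<in> closed_segment u v" for t
        using core_funpow[OF core, of t n 0] sub that by auto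
      ultimately have sub0: "core \<subseteq> (\<lambda>t. g t 0) ` closed_segment u v" by (force simp: image_iff subset_iff)
      have "d1 \<in> core" "d2 \<in> core" using d_order by auto
      then obtain a b where ab: "a \<in> closed_segment u v" "g a 0 = d1" "b \<in> closed_segment u v" "g b 0 = d2"
        using sub0 by (metis (no_types, lifting) imageE subsetD)
      have "\<bar>a - b\<bar> \<le> \<bar>u - v\<bar>" using ab(1,3) by (auto simp: closed_segment_eq_real_ivl split: if_splits)
      then have "dist a b < \<delta>" using uv(3) k by (simp add: dist_real_def)
      then have "dist (g a 0) (g b 0) < d1 - d2" using \<delta>(2)[of b a] ab sub by blast
      then show False using ab d_order by (simp add: dist_real_def)
    qed
    have "\<bar>g u n - g v n\<bar> < \<eta>" if "n \<ge> M" "u \<in> {0..1}" "v \<in> {0..1}" "\<bar>u - v\<bar> \<le> 1 / k" for n u v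
      using *[of n u v] *[of n v u] that by (simp add: abs_minus_commute)
    then show ?thesis by blast
  qed
  define d where "d = (t1 - t0) / k"
  define p where "p j = t0 + real j * d" for j
  have p01: "p j \<in> {0..1}" if "j \<le> k" for j
  proof -
    have "p j = (1 - real j / k) * t0 + (real j / k) * t1" using k by (simp add: p_def d_def field_simps)
    moreover have "0 \<le> real j / k" "real j / k \<le> 1" using that k by auto
    ultimately show ?thesis using t(1,2) convex_bound_le[of t0 1 t1 "1 - real j / k" "real j / k"] by auto
  qed
  have pk: "p 0 = t0" "p k = t1" using k by (auto simp: p_def d_def)
  have stepp: "\<bar>p j - p (Suc j)\<bar> \<le> 1 / k" for j
  proof -
    have "p j - p (Suc j) = - d" by (simp add: p_def distrib_right)
    moreover have "\<bar>t1 - t0\<bar> \<le> 1" using t by auto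
    then have "\<bar>d\<bar> \<le> 1 / k" using k by (simp add: d_def divide_right_mono)
    ultimately show ?thesis by simp
  qed
  have "(\<lambda>n. g t1 n - g t0 n) \<longlonglongrightarrow> 0"
    unfolding LIMSEQ_def
  proof (intro allI impI)
    fix e :: real assume e: "e > 0"
    have "e / 2 / k > 0" using e k by simp
    from osc[OF this] obtain M where M: "\<And>n u v. n \<ge> M \<Longrightarrow> u \<in> {0..1} \<Longrightarrow> v \<in> {0..1} \<Longrightarrow> \<bar>u - v\<bar> \<le> 1 / k \<Longrightarrow> \<bar>g u n - g v n\<bar> < e / 2 / k"
      by metis
    have "\<bar>g (p 0) n - g (p j) n\<bar> \<le> real j * (e / 2 / k)" if "n \<ge> M" "j \<le> k" for n j
      using that(2)
    proof (induction j)
      case (Suc j)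
      have "\<bar>g (p j) n - g (p (Suc j)) n\<bar> < e / 2 / k" using M[OF that(1) p01 p01 stepp] Suc.prems by simp
      moreover have "\<bar>g (p 0) n - g (p j) n\<bar> \<le> real j * (e / 2 / k)" using Suc by simp
      moreover have "real (Suc j) * (e / 2 / k) = real j * (e / 2 / k) + e / 2 / k"
        unfolding of_nat_Suc by (simp only: distrib_right mult_1 add.commute)
      ultimately show ?case by linarith
    qed simp
    from this[of _ k] have *: "\<bar>g t0 n - g t1 n\<bar> \<le> e / 2" if "n \<ge> M" for n using that pk k by simp
    show "\<exists>no. \<forall>n\<ge>no. dist (g t1 n - g t0 n) 0 < e"
    proof (intro exI allI impI)
      fix n assume "n \<ge> M"
      from *[OF this] show "dist (g t1 n - g t0 n) 0 < e" using e by (simp add: dist_real_def abs_minus_commute)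
    qed

  qed
  moreover have "g t0 \<longlonglongrightarrow> r" using t(3) X_tendsto by force
  ultimately have "(\<lambda>n. (g t1 n - g t0 n) + g t0 n) \<longlonglongrightarrow> 0 + r" by (rule tendsto_add)
  then have "g t1 \<longlonglongrightarrow> r" by simp
  then show ?thesis using range_X_iff[OF core[OF t(2)]] by simp
qed

lemma arc_X:
  assumes "a < b"
  shows "arc (X \<circ> linepath a b)" "path_image (X \<circ> linepath a b) = X ` {a..b}"
proof -
  have "continuous_on UNIV X" by (rule continuous_on_coordinatewise_then_product) (rule X_continuous)
  then have "path (X \<circ> linepath a b)" by (intro path_continuous_image path_linepath) (rule continuous_on_subset, auto)
  moreover have "inj_on (X \<circ> linepath a b) {0..1}"
  proof (rule comp_inj_on)
    show "inj_on (linepath a b) {0..1}" using arc_linepath[of a b] assms by (simp add: arc_def)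
    show "inj_on X (linepath a b ` {0..1})" by (simp add: inj_on_def X_inj)
  qed
  ultimately show "arc (X \<circ> linepath a b)" by (simp add: arc_def)
  show "path_image (X \<circ> linepath a b) = X ` {a..b}"
    using assms by (simp add: path_image_compose closed_segment_eq_real_ivl)
qed

lemma arc_comp_R_eq: "arc_comp_R s = range X"
  unfolding arc_comp_R_def fixed_point_unique arc_comp_def
proof (intro equalityI subsetI)
  fix y assume "y \<in> \<Union> {path_image g |g. arc g \<and> path_image g \<subseteq> tent_core s \<and> X 0 \<in> path_image g}"
  then obtain g where g: "arc g" "path_image g \<subseteq> tent_core s" "X 0 \<in> path_image g" "y \<in> path_image g" by blast
  obtain t0 t1 where "t0 \<in> {0..1}" "X 0 = g t0" "t1 \<in> {0..1}" "y = g t1"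
    using g(3,4) unfolding path_image_def by blast
  then show "y \<in> range X" using path_from_fixed_point[OF arc_imp_path[OF g(1)] g(2), of t0 t1] by (metis rangeI)
next
  fix y assume "y \<in> range X"
  then obtain \<xi> where \<xi>: "y = X \<xi>" by blast
  \<comment> \<open>The shift by 1 keeps the interval non-degenerate when \<xi> is 0.\<close>
  have ab: "min 0 \<xi> - 1 < max 0 \<xi>" by simp
  note A = arc_X[OF ab]
  have "X 0 \<in> X ` {min 0 \<xi> - 1..max 0 \<xi>}" "y \<in> X ` {min 0 \<xi> - 1..max 0 \<xi>}" unfolding \<xi> by auto
  moreover have "X ` {min 0 \<xi> - 1..max 0 \<xi>} \<subseteq> tent_core s" using X_core by blast
  ultimately have "\<exists>g. arc g \<and> path_image g \<subseteq> tent_core s \<and> X 0 \<in> path_image g \<and> y \<in> path_image g"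
    using A by (intro exI[of _ "X \<circ> linepath (min 0 \<xi> - 1) (max 0 \<xi>)"]) (simp only: simp_thms)
  then show "y \<in> \<Union> {path_image g |g. arc g \<and> path_image g \<subseteq> tent_core s \<and> X 0 \<in> path_image g}"
    by blast
qed

text \<open>Points on either side of 1/2 are sent below d1 and then follow the critical orbit at
  distance s^(n + 1) |t|. When that orbit returns to 1/2, the even parity from
  \<open>kneading_even\<close> puts them on the side that the kneading sequence names.\<close>

lemma after_hit:
  "\<exists>\<delta>>0. \<forall>t. 0 < \<bar>t\<bar> \<and> \<bar>t\<bar> < \<delta> \<longrightarrow>
     (\<forall>i. 1 \<le> i \<and> i \<le> n \<longrightarrow> (T ^^ i) (1/2 + t) \<noteq> 1/2 \<and> \<kappa> i = ((T ^^ i) (1/2 + t) > 1/2)) \<and>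
     (T ^^ Suc n) (1/2 + t) = cc (Suc n) - sg (\<lambda>i. \<kappa> (Suc i)) n * s ^ Suc n * \<bar>t\<bar>"
proof (induction n)
  case 0
  have "T (1/2 + t) = d1 - s * \<bar>t\<bar>" for t
    by (cases "t \<le> 0") (simp_all add: T_left T_right d1_def algebra_simps)
  then show ?case by (intro exI[of _ 1]) (auto simp: T_half)
next
  case (Suc n)
  let ?k = "\<lambda>i. \<kappa> (Suc i)"
  obtain \<delta> where \<delta>: "\<delta> > 0" and IH: "\<And>t. 0 < \<bar>t\<bar> \<Longrightarrow> \<bar>t\<bar> < \<delta> \<Longrightarrow>
     (\<forall>i. 1 \<le> i \<and> i \<le> n \<longrightarrow> (T ^^ i) (1/2 + t) \<noteq> 1/2 \<and> \<kappa> i = ((T ^^ i) (1/2 + t) > 1/2)) \<and>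
     (T ^^ Suc n) (1/2 + t) = cc (Suc n) - sg ?k n * s ^ Suc n * \<bar>t\<bar>"
    using Suc.IH by blast
  define \<delta>' where "\<delta>' = (if cc (Suc n) = 1/2 then \<delta> else min \<delta> (\<bar>cc (Suc n) - 1/2\<bar> / s ^ Suc n))"
  have \<delta>': "\<delta>' > 0" "\<delta>' \<le> \<delta>" using \<delta> s1 by (auto simp: \<delta>'_def)
  have "((T ^^ Suc n) (1/2 + t) \<noteq> 1/2 \<and> \<kappa> (Suc n) = ((T ^^ Suc n) (1/2 + t) > 1/2)) \<and>
     (T ^^ Suc (Suc n)) (1/2 + t) = cc (Suc (Suc n)) - sg ?k (Suc n) * s ^ Suc (Suc n) * \<bar>t\<bar>"
    if t: "0 < \<bar>t\<bar>" "\<bar>t\<bar> < \<delta>'" for t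
  proof -
    define v where "v = (T ^^ Suc n) (1/2 + t)"
    have v: "v = cc (Suc n) - sg ?k n * s ^ Suc n * \<bar>t\<bar>" unfolding v_def using IH t \<delta>'(2) by simp
    define P where "P = s ^ Suc n * \<bar>t\<bar>"
    have vP: "v = cc (Suc n) - sg ?k n * P" unfolding v P_def by (simp only: mult.assoc)
    have pos: "P > 0" using s1 t by (simp add: P_def)
    have strict: "v \<noteq> 1/2 \<and> \<kappa> (Suc n) = (v > 1/2)"
    proof (cases "cc (Suc n) = 1/2")
      case True
      have "sg ?k (Suc n) = 1" using kneading_even[of "Suc n"] True by simp
      then have "sg ?k n = (if \<kappa> (Suc n) then -1 else 1)" using sg_cases[of ?k n] by (auto split: if_splits)
      then show ?thesis using True pos unfolding vP True by auto
    next
      case False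
      then have "\<bar>t\<bar> < \<bar>cc (Suc n) - 1/2\<bar> / s ^ Suc n" using t(2) by (simp add: \<delta>'_def)
      then have small: "P < \<bar>cc (Suc n) - 1/2\<bar>" using s1 unfolding P_def by (simp only: pos_less_divide_eq zero_less_power mult.commute)
      have "\<kappa> (Suc n) = (cc (Suc n) > 1/2)" using kneading_side[of "Suc n"] side_gt[OF False] by blast
      then show ?thesis using vP small pos sg_cases[of ?k n] by (auto simp: abs_if simp del: cc_simps split: if_splits)
    qed
    have "T v = br (\<kappa> (Suc n)) v" using strict by (intro T_br) (simp add: side_gt)
    moreover have "cc (Suc (Suc n)) = br (\<kappa> (Suc n)) (cc (Suc n))" using T_br[OF kneading_side[of "Suc n"]] by simp
    ultimately have "T v - cc (Suc (Suc n)) = (if \<kappa> (Suc n) then -1 else 1) * s * (v - cc (Suc n))"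
      by (simp only: br_diff)
    also have "v - cc (Suc n) = - (sg ?k n * s ^ Suc n * \<bar>t\<bar>)" using v by simp
    finally have "T v = cc (Suc (Suc n)) - sg ?k (Suc n) * s ^ Suc (Suc n) * \<bar>t\<bar>" by (simp add: algebra_simps split: if_splits)
    moreover have "(T ^^ Suc (Suc n)) (1/2 + t) = T v" by (simp add: v_def)
    ultimately show ?thesis using strict unfolding v_def[symmetric] by (simp only: simp_thms)
  qed
  note new = this
  show ?case
  proof (intro exI[of _ \<delta>'] conjI \<delta>'(1) allI impI)
    fix t i assume t: "0 < \<bar>t\<bar> \<and> \<bar>t\<bar> < \<delta>'" and i: "1 \<le> i \<and> i \<le> Suc n"
    have t': "0 < \<bar>t\<bar>" "\<bar>t\<bar> < \<delta>'" "\<bar>t\<bar> < \<delta>" using t \<delta>'(2) by auto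
    show "(T ^^ i) (1/2 + t) \<noteq> 1/2" using new[OF t'(1,2)] IH[OF t'(1,3)] i by (cases "i = Suc n") auto
    show "\<kappa> i = ((T ^^ i) (1/2 + t) > 1/2)" using new[OF t'(1,2)] IH[OF t'(1,3)] i by (cases "i = Suc n") auto
  next
    fix t assume t: "0 < \<bar>t\<bar> \<and> \<bar>t\<bar> < \<delta>'"
    then show "(T ^^ Suc (Suc n)) (1/2 + t) = cc (Suc (Suc n)) - sg ?k (Suc n) * s ^ Suc (Suc n) * \<bar>t\<bar>"
      using new[of t] by blast
  qed
qed

text \<open>Every code is realized by the orbits that start on one side of a far back coordinate.\<close>

definition one_sided :: "(nat \<Rightarrow> real) \<Rightarrow> (nat \<Rightarrow> bool) \<Rightarrow> nat \<Rightarrow> real \<Rightarrow> bool" where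
  "one_sided x l m \<tau> \<longleftrightarrow> (\<tau> = 1 \<or> \<tau> = -1) \<and> (\<exists>\<delta>>0. \<forall>t. 0 < t \<and> t < \<delta> \<longrightarrow> x m + \<tau> * t \<in> core \<and>
     (\<forall>i<m. (T ^^ i) (x m + \<tau> * t) \<noteq> 1/2 \<and> l (m - 1 - i) = ((T ^^ i) (x m + \<tau> * t) > 1/2)))"

lemma one_sided_hit:
  assumes x: "x \<in> tent_core s" "coded x l" and hit: "x (Suc n) = 1/2"
  shows "one_sided x l (Suc n) (sb (l n))"
proof -
  obtain \<delta> where \<delta>: "\<delta> > 0" "\<And>t i. 0 < \<bar>t\<bar> \<Longrightarrow> \<bar>t\<bar> < \<delta> \<Longrightarrow> 1 \<le> i \<Longrightarrow> i \<le> n \<Longrightarrow>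
      (T ^^ i) (1/2 + t) \<noteq> 1/2 \<and> \<kappa> i = ((T ^^ i) (1/2 + t) > 1/2)"
    using after_hit[of n] by blast
  define \<delta>' where "\<delta>' = min \<delta> (min (1/2 - d2) (d1 - 1/2))"
  have \<delta>': "\<delta>' > 0" using \<delta>(1) d_order by (simp add: \<delta>'_def)
  have "x (Suc n) + sb (l n) * t \<in> core \<and>
     (\<forall>i<Suc n. (T ^^ i) (x (Suc n) + sb (l n) * t) \<noteq> 1/2 \<and> l (Suc n - 1 - i) = ((T ^^ i) (x (Suc n) + sb (l n) * t) > 1/2))"
    if t: "0 < t" "t < \<delta>'" for t
  proof (intro conjI allI impI)
    have abs: "0 < \<bar>sb (l n) * t\<bar>" "\<bar>sb (l n) * t\<bar> < \<delta>" using t by (auto simp: \<delta>'_def abs_mult)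
    show "x (Suc n) + sb (l n) * t \<in> core" using t d_order unfolding hit by (auto simp: \<delta>'_def sb_def)
    fix i assume i: "i < Suc n"
    show "(T ^^ i) (x (Suc n) + sb (l n) * t) \<noteq> 1/2"
      unfolding hit using \<delta>(2)[OF abs, of i] i t by (cases "i = 0") (auto simp: sb_def)
    show "l (Suc n - 1 - i) = ((T ^^ i) (x (Suc n) + sb (l n) * t) > 1/2)"
    proof (cases "i = 0")
      case True
      then show ?thesis unfolding hit using t by (auto simp: sb_def)
    next
      case False
      then show ?thesis unfolding hit using \<delta>(2)[OF abs, of i] i coded_kneading[OF x(2) hit, of i] by simp
    qed
  qed
  then show ?thesis unfolding one_sided_def using \<delta>' by (auto simp: sb_def)
qed

lemma one_sided_0:
  assumes "x \<in> tent_core s"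
  shows "\<exists>\<tau>. one_sided x l 0 \<tau>"
proof (cases "x 0 < d1")
  case True
  moreover have "d2 \<le> x 0" using assms core_iff by auto
  ultimately have "one_sided x l 0 1" unfolding one_sided_def by (auto intro!: exI[of _ "d1 - x 0"])
  then show ?thesis by blast
next
  case False
  moreover have "d2 \<le> x 0" "x 0 \<le> d1" using assms core_iff by auto
  ultimately have "one_sided x l 0 (-1)" unfolding one_sided_def using d_order by (auto intro!: exI[of _ "d1 - d2"])
  then show ?thesis by blast
qed

lemma one_sided_step:
  assumes x: "x \<in> tent_core s" "coded x l" and M: "one_sided x l M \<tau>"
    and ne: "x (Suc M) \<noteq> 1/2" "x (Suc M) \<noteq> d1" "x (Suc M) \<noteq> d2"
  shows "\<exists>\<tau>. one_sided x l (Suc M) \<tau>"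
proof -
  obtain \<delta> where \<tau>: "\<tau> = 1 \<or> \<tau> = -1" and \<delta>: "\<delta> > 0" "\<And>t i. 0 < t \<Longrightarrow> t < \<delta> \<Longrightarrow> i < M \<Longrightarrow>
     (T ^^ i) (x M + \<tau> * t) \<noteq> 1/2 \<and> l (M - 1 - i) = ((T ^^ i) (x M + \<tau> * t) > 1/2)"
    using M unfolding one_sided_def by blast
  have xc: "d2 < x (Suc M)" "x (Suc M) < d1" using x(1) ne core_iff by (auto simp: less_le)
  define \<tau>' where "\<tau>' = \<tau> * (if l M then -1 else 1)"
  have \<tau>': "\<tau>' = 1 \<or> \<tau>' = -1" using \<tau> by (auto simp: \<tau>'_def)
  define \<delta>' where "\<delta>' = min (\<delta> / s) (min \<bar>x (Suc M) - 1/2\<bar> (min (x (Suc M) - d2) (d1 - x (Suc M))))"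
  have \<delta>': "\<delta>' > 0" using \<delta>(1) s1 ne xc by (simp add: \<delta>'_def)
  have lM: "l M = (x (Suc M) > 1/2)" using coded_side[OF x(2), of M] side_gt[OF ne(1)] by blast
  have "x (Suc M) + \<tau>' * t \<in> core \<and> (\<forall>i<Suc M. (T ^^ i) (x (Suc M) + \<tau>' * t) \<noteq> 1/2 \<and>
      l (Suc M - 1 - i) = ((T ^^ i) (x (Suc M) + \<tau>' * t) > 1/2))" if t: "0 < t" "t < \<delta>'" for t
  proof (intro conjI allI impI)
    let ?y = "x (Suc M) + \<tau>' * t"
    have b: "t < \<delta> / s" "t < \<bar>x (Suc M) - 1/2\<bar>" "t < x (Suc M) - d2" "t < d1 - x (Suc M)" using t by (auto simp: \<delta>'_def)
    show "?y \<in> core" using b t \<tau>' by auto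
    have y: "?y \<noteq> 1/2 \<and> l M = (?y > 1/2)" using b t \<tau>' lM by (auto simp: abs_if split: if_splits)
    have "T ?y = br (l M) ?y" using y by (intro T_br) (simp add: side_gt)
    moreover have "x M = br (l M) (x (Suc M))" using coded_br[OF x] .
    ultimately have "T ?y - x M = (if l M then -1 else 1) * s * (\<tau>' * t)" using br_diff[of "l M" ?y "x (Suc M)"] by simp
    then have Ty: "T ?y = x M + \<tau> * (s * t)" by (auto simp: \<tau>'_def algebra_simps split: if_splits)
    have st: "0 < s * t" "s * t < \<delta>" using b(1) t s1 by (auto simp: field_simps)
    fix i assume i: "i < Suc M"
    have "(T ^^ i) ?y \<noteq> 1/2 \<and> l (Suc M - 1 - i) = ((T ^^ i) ?y > 1/2)"
    proof (cases i)
      case 0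
      then show ?thesis using y by simp
    next
      case (Suc j)
      then have "(T ^^ i) ?y = (T ^^ j) (x M + \<tau> * (s * t))" by (simp only: funpow_Suc_right comp_apply Ty)
      moreover have "M - 1 - j = Suc M - 1 - i" "j < M" using Suc i by auto
      ultimately show ?thesis using \<delta>(2)[OF st, of j] by simp
    qed
    then show "(T ^^ i) ?y \<noteq> 1/2" "l (Suc M - 1 - i) = ((T ^^ i) ?y > 1/2)" by auto
  qed
  then show ?thesis unfolding one_sided_def using \<tau>' \<delta>' by blast
qed

lemma core_d2: "x \<in> tent_core s \<Longrightarrow> x n = d2 \<Longrightarrow> x (Suc (Suc n)) = 1/2"
  using pre_d2[of "x (Suc n)"] core_hit[of x "Suc n"] core_iff by metis

text \<open>A visit of 1/2 beyond m gives such an index at once. Otherwise the induction starts at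
  the last visit, or at 0 when there is none. Beyond it the values 1/2, d1 and d2 never occur,
  because d1 and d2 have 1/2 in their past.\<close>

lemma one_sided_exists:
  assumes x: "x \<in> tent_core s" "coded x l"
  shows "\<exists>M\<ge>m. \<exists>\<tau>. one_sided x l M \<tau>"
proof (cases "\<exists>n\<ge>m. x (Suc n) = 1/2")
  case True
  then obtain n where "n \<ge> m" "x (Suc n) = 1/2" by blast
  then show ?thesis using one_sided_hit[OF x, of n] by (intro exI[of _ "Suc n"]) auto
next
  case False
  have "\<exists>M0. (\<exists>\<tau>. one_sided x l M0 \<tau>) \<and> (\<forall>n\<ge>M0. x (Suc n) \<noteq> 1/2)"
  proof (cases "\<exists>n. x (Suc n) = 1/2")
    case True
    define n where "n = Max {n. x (Suc n) = 1/2}"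
    have "k < m" if "x (Suc k) = 1/2" for k using False that not_le by blast
    then have "{n. x (Suc n) = 1/2} \<subseteq> {..<m}" by blast
    then have fin: "finite {n. x (Suc n) = 1/2}" by (rule finite_subset) simp
    moreover have "{n. x (Suc n) = 1/2} \<noteq> {}" using True by blast
    ultimately have n: "x (Suc n) = 1/2" using Max_in[OF fin] unfolding n_def by blast
    have "x (Suc k) \<noteq> 1/2" if "k \<ge> Suc n" for k
    proof
      assume "x (Suc k) = 1/2"
      then have "k \<le> n" unfolding n_def by (intro Max_ge[OF fin]) simp
      then show False using that by simp
    qed
    then show ?thesis using one_sided_hit[OF x n] by blast
  next
    case False
    then show ?thesis using one_sided_0[OF x(1)] by blast
  qed
  then obtain M0 where M0: "\<exists>\<tau>. one_sided x l M0 \<tau>" "\<And>n. n \<ge> M0 \<Longrightarrow> x (Suc n) \<noteq> 1/2" by blast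
  have "\<exists>\<tau>. one_sided x l (M0 + j) \<tau>" for j
  proof (induction j)
    case (Suc j)
    have "x (Suc (M0 + j)) \<noteq> d1" using core_hit[OF x(1)] M0(2)[of "Suc (M0 + j)"] by auto
    moreover have "x (Suc (M0 + j)) \<noteq> d2" using core_d2[OF x(1)] M0(2)[of "Suc (Suc (M0 + j))"] by auto
    ultimately show ?case using Suc one_sided_step[OF x] M0(2)[of "M0 + j"] by auto
  qed (use M0 in simp)
  then show ?thesis by (meson le_add2)
qed

section \<open>Orbits with a prescribed remote past\<close>

definition hist :: "real \<Rightarrow> (nat \<Rightarrow> real) \<Rightarrow> bool" where
  "hist u h \<longleftrightarrow> h 0 = u \<and> (\<forall>i. h i \<in> core) \<and> (\<forall>i. T (h (Suc i)) = h i) \<and> (\<forall>i. h (Suc i) \<noteq> 1/2)"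

text \<open>Replaces everything before coordinate N by a chosen history of \<open>u\<close>.
  Histories avoid 1/2 at all positive indices, so the code of the grafted part is
  unambiguous.\<close>

definition graft :: "real \<Rightarrow> nat \<Rightarrow> (nat \<Rightarrow> real) \<Rightarrow> nat \<Rightarrow> real" where
  "graft u N h i = (if i \<le> N then (T ^^ (N - i)) u else h (i - N))"

definition glue :: "(nat \<Rightarrow> bool) \<Rightarrow> nat \<Rightarrow> (nat \<Rightarrow> real) \<Rightarrow> nat \<Rightarrow> bool" where
  "glue v N h i = (if i < N then v i else h (Suc (i - N)) > 1/2)"

lemma graft_above: "hist u h \<Longrightarrow> graft u N h (N + i) = h i"
  by (cases i) (auto simp: graft_def hist_def)

lemma graft_core:
  assumes "hist u h"
  shows "graft u N h \<in> tent_core s"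
  unfolding core_iff
proof (intro allI conjI)
  have u: "u \<in> core" "h 0 = u" using assms unfolding hist_def by metis+
  fix n
  show "graft u N h n \<in> core" using assms Tn_core[OF u(1)] by (auto simp: graft_def hist_def)
  show "T (graft u N h (Suc n)) = graft u N h n"
  proof (cases "n < N")
    case True
    then have "N - n = Suc (N - Suc n)" by simp
    then show ?thesis using True by (simp add: graft_def)
  next
    case False
    then obtain i where i: "n = N + i" using le_Suc_ex not_less by blast
    show ?thesis using graft_above[OF assms, of N i] graft_above[OF assms, of N "Suc i"] assms unfolding i hist_def by simp
  qed
qed

lemma glue_side:
  assumes "hist u h" "i \<ge> N"
  shows "side (glue v N h i) (graft u N h (Suc i))"
proof -
  obtain j where j: "i = N + j" using assms(2) le_Suc_ex by blast
  have "graft u N h (Suc i) = h (Suc j)" using graft_above[OF assms(1), of N "Suc j"] j by simp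
  moreover have "h (Suc j) \<noteq> 1/2" using assms(1) by (simp add: hist_def)
  ultimately show ?thesis using j by (simp add: glue_def side_gt)
qed

lemma open_interval_eventually_onto:
  assumes "v1 < v2" "{v1<..<v2} \<subseteq> core"
  obtains M where "\<And>m y. m \<ge> M \<Longrightarrow> y \<in> core \<Longrightarrow> \<exists>u\<in>{v1<..<v2}. (T ^^ m) u = y"
proof -
  define a where "a = (2 * v1 + v2) / 3"
  define b where "b = (v1 + 2 * v2) / 3"
  have ab: "v1 < a" "a < b" "b < v2" using assms(1) by (auto simp: a_def b_def field_simps)
  then have "a \<in> {v1<..<v2}" "b \<in> {v1<..<v2}" by auto
  then have "a \<in> core" "b \<in> core" using assms(2) by blast+
  moreover obtain M where "\<And>m a' b'. m \<ge> M \<Longrightarrow> a' \<in> core \<Longrightarrow> b' \<in> core \<Longrightarrow> b' - a' \<ge> b - a \<Longrightarrow> core \<subseteq> (T ^^ m) ` {a'..b'}"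
    using locally_eventually_onto[of "b - a"] ab by auto
  ultimately have "core \<subseteq> (T ^^ m) ` {a..b}" if "m \<ge> M" for m using that by blast
  moreover have "{a..b} \<subseteq> {v1<..<v2}" using ab by auto
  ultimately show thesis using that by (metis (no_types, lifting) imageE subsetD)
qed

lemma third_power_small:
  assumes "e > 0"
  obtains m where "\<And>k. k \<ge> m \<Longrightarrow> 1 / 3 ^ k < (e::real)"
proof -
  obtain m where m: "(1/3::real) ^ m < e" using real_arch_pow_inv[OF assms] by (metis divide_less_eq_1_pos one_less_numeral_iff semiring_norm(77) zero_less_numeral)
  have "1 / 3 ^ k < e" if "k \<ge> m" for k
  proof -
    have "(1::real) / 3 ^ k \<le> 1 / 3 ^ m" using that by (intro divide_left_mono) auto
    then show ?thesis using m by (simp add: power_divide)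
  qed
  then show thesis using that by blast
qed

text \<open>The remote past of an approximating point can be prescribed: \<open>u\<close> does not depend on \<open>h\<close>.\<close>

lemma graft_near:
  assumes x: "x \<in> tent_core s" "coded x l" and e: "e > 0" and V: "v1 < v2" "{v1<..<v2} \<subseteq> core"
  obtains N0 where "\<And>N. N \<ge> N0 \<Longrightarrow> \<exists>u\<in>{v1<..<v2}. \<exists>v. \<forall>h. hist u h \<longrightarrow> coded (graft u N h) (glue v N h) \<and>
     \<bar>(T ^^ N) u - x 0\<bar> < e \<and> \<bar>ht (glue v N h) - ht l\<bar> < e"
proof -
  obtain m where m: "\<And>k. k \<ge> m \<Longrightarrow> 1 / 3 ^ k < e" using third_power_small[OF e] by blast
  obtain M \<tau> where M: "M \<ge> m" "one_sided x l M \<tau>" using one_sided_exists[OF x] by blast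
  obtain \<delta> where \<tau>: "\<tau> = 1 \<or> \<tau> = -1" and \<delta>: "\<delta> > 0" "\<And>t. 0 < t \<Longrightarrow> t < \<delta> \<Longrightarrow> x M + \<tau> * t \<in> core"
    "\<And>t i. 0 < t \<Longrightarrow> t < \<delta> \<Longrightarrow> i < M \<Longrightarrow>
     (T ^^ i) (x M + \<tau> * t) \<noteq> 1/2 \<and> l (M - 1 - i) = ((T ^^ i) (x M + \<tau> * t) > 1/2)"
    using M(2) unfolding one_sided_def by blast
  obtain k0 where k0: "\<And>m y. m \<ge> k0 \<Longrightarrow> y \<in> core \<Longrightarrow> \<exists>u\<in>{v1<..<v2}. (T ^^ m) u = y"
    using open_interval_eventually_onto[OF V] by blast
  define \<delta>' where "\<delta>' = min \<delta> (e / s ^ M)"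
  have \<delta>': "\<delta>' > 0" using \<delta>(1) e s1 by (simp add: \<delta>'_def)
  \<comment> \<open>A target off the countable critical orbit guarantees that the orbit from
    \<open>u\<close> to the target never meets 1/2, so that no kneading condition arises for the
    code.\<close>
  have "\<exists>t\<in>{0<..<\<delta>'}. x M + \<tau> * t \<notin> range cc"
  proof (rule ccontr)
    assume "\<not> ?thesis"
    then have "(\<lambda>t. x M + \<tau> * t) ` {0<..<\<delta>'} \<subseteq> range cc" by blast
    then have "countable ((\<lambda>t. x M + \<tau> * t) ` {0<..<\<delta>'})" by (rule countable_subset) simp
    moreover have "inj_on (\<lambda>t. x M + \<tau> * t) {0<..<\<delta>'}" using \<tau> by (auto simp: inj_on_def)
    ultimately have "countable {0<..<\<delta>'}" by (rule countable_image_inj_on)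
    then show False using uncountable_open_interval \<delta>' by blast
  qed
  then obtain t where t: "0 < t" "t < \<delta>'" and w: "x M + \<tau> * t \<notin> range cc" by auto
  define w where "w = x M + \<tau> * t"
  have t\<delta>: "t < \<delta>" "t < e / s ^ M" using t by (auto simp: \<delta>'_def)
  have wc: "w \<in> core" using \<delta>(2)[OF t(1) t\<delta>(1)] by (simp add: w_def)
  have wi: "(T ^^ i) w \<noteq> 1/2" "l (M - 1 - i) = ((T ^^ i) w > 1/2)" if "i < M" for i
    using \<delta>(3)[OF t(1) t\<delta>(1) that] by (auto simp: w_def)
  have "\<exists>u\<in>{v1<..<v2}. \<exists>v. \<forall>h. hist u h \<longrightarrow> coded (graft u N h) (glue v N h) \<and>
     \<bar>(T ^^ N) u - x 0\<bar> < e \<and> \<bar>ht (glue v N h) - ht l\<bar> < e" if N: "N \<ge> M + k0" for N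
  proof -
    define k where "k = N - M"
    have k: "k \<ge> k0" "N = k + M" using N by (auto simp: k_def)
    obtain u where u: "u \<in> {v1<..<v2}" "(T ^^ k) u = w" using k0[OF k(1) wc] by blast
    have shift: "(T ^^ (j + k)) u = (T ^^ j) w" for j using u(2) by (simp add: funpow_add)
    have nohit: "(T ^^ i) u \<noteq> 1/2" if "i < N" for i
    proof (cases "i < k")
      case True
      show ?thesis
      proof
        assume "(T ^^ i) u = 1/2"
        then have "(T ^^ (k - i)) (1/2) = w" using True u(2) by (metis comp_apply funpow_add less_imp_le_nat le_add_diff_inverse2)
        then show False using w unfolding w_def[symmetric] cc_def by blast
      qed
    next
      case False
      then have "i = (i - k) + k" "i - k < M" using that k by auto
      then show ?thesis using shift[of "i - k"] wi(1) by metis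
    qed
    define v where "v i = ((T ^^ (N - Suc i)) u > 1/2)" for i
    have vl: "v i = l i" if "i < M" for i
    proof -
      have "N - Suc i = (M - Suc i) + k" using that k by simp
      then have "v i = ((T ^^ (M - Suc i)) w > 1/2)" using shift by (simp add: v_def)
      also have "\<dots> = l (M - 1 - (M - Suc i))" using wi(2)[of "M - Suc i"] that by simp
      finally show ?thesis using that by simp
    qed
    have "coded (graft u N h) (glue v N h) \<and> \<bar>(T ^^ N) u - x 0\<bar> < e \<and> \<bar>ht (glue v N h) - ht l\<bar> < e"
      if h: "hist u h" for h
    proof (intro conjI)
      have nh: "graft u N h (Suc i) \<noteq> 1/2" for i
      proof (cases "Suc i \<le> N")
        case True
        then show ?thesis using nohit[of "N - Suc i"] by (simp add: graft_def)
      next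
        case False
        then obtain j where "i = N + j" using le_Suc_ex not_less_eq_eq by blast
        then show ?thesis using graft_above[OF h, of N "Suc j"] h by (simp add: hist_def)
      qed
      have sd: "side (glue v N h i) (graft u N h (Suc i))" for i
      proof (cases "i < N")
        case True
        then show ?thesis using nh[of i] by (simp add: glue_def v_def graft_def side_gt)
      qed (use glue_side[OF h] in simp)
      show cod: "coded (graft u N h) (glue v N h)" unfolding coded_def using nh sd by blast
      have pre: "glue v N h i = l i" if "i < M" for i using vl[OF that] that k by (simp add: glue_def)
      have "\<bar>ht (glue v N h) - ht l\<bar> \<le> 1 / 3 ^ M" by (rule ht_close) (rule pre)
      then show "\<bar>ht (glue v N h) - ht l\<bar> < e" using m[OF M(1)] by simp
      have "graft u N h 0 - x 0 = sg l M * s ^ M * (graft u N h M - x M)"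
        by (rule coded_diff[OF x(1) graft_core[OF h] x(2) cod pre])
      moreover have "graft u N h M = w" using u(2) k by (simp add: graft_def)
      moreover have "graft u N h 0 = (T ^^ N) u" by (simp add: graft_def)
      ultimately have "\<bar>(T ^^ N) u - x 0\<bar> = s ^ M * t" using \<tau> t s1 by (auto simp: abs_mult w_def)
      also have "\<dots> < e" using t\<delta>(2) s1 by (simp add: field_simps)
      finally show "\<bar>(T ^^ N) u - x 0\<bar> < e" .
    qed
    then show ?thesis using u(1) by blast
  qed
  then show thesis using that by blast
qed

text \<open>If a coordinate beyond the last visit lay on the critical orbit, that orbit would return
  to 1/2, so 1/2 would be periodic. Going one period deeper excludes this case too, since
  periodicity would then produce another visit beyond n.\<close>

lemma off_critical_orbit:
  assumes x: "x \<in> tent_core s" and n: "last_hit x n"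
  obtains m0 where "m0 > Suc n" "\<And>M j. M \<ge> m0 \<Longrightarrow> x M \<noteq> cc j"
proof (cases "\<exists>p\<ge>1. cc p = 1/2")
  case True
  then obtain p where p: "p \<ge> 1" "cc p = 1/2" by blast
  have "x M \<noteq> cc j" if M: "M \<ge> Suc n + p" for M j
  proof
    assume eq: "x M = cc j"
    define i where "i = M - (Suc n + p)"
    have "x (Suc n + p) = (T ^^ i) (x M)" using core_funpow[OF x, of i "Suc n + p"] M by (simp add: i_def)
    then have a: "x (Suc n + p) = cc (i + j)" unfolding eq cc_add .
    have "x (Suc n) = (T ^^ p) (x (p + Suc n))" using core_funpow[OF x, of p "Suc n"] by simp
    then have "1/2 = cc (p + (i + j))" using a n cc_add by (simp add: last_hit_def add.commute)
    then have "x (Suc (n + p)) = 1/2" using a cc_period[OF p(2), of "i + j"] by simp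
    then show False using n p by (simp add: last_hit_def)
  qed
  then show thesis using that[of "Suc n + p"] p by auto
next
  case False
  have "x M \<noteq> cc j" if M: "M \<ge> Suc (Suc n)" for M j
  proof
    assume eq: "x M = cc j"
    have "x (Suc n) = (T ^^ (M - Suc n)) (x M)" using core_funpow[OF x, of "M - Suc n" "Suc n"] M by simp
    then have "cc ((M - Suc n) + j) = 1/2" unfolding eq cc_add using n by (simp add: last_hit_def)
    moreover have "(M - Suc n) + j \<ge> 1" using M by linarith
    ultimately show False using False by blast
  qed
  then show thesis using that[of "Suc (Suc n)"] by auto
qed

text \<open>The counterpart of \<open>graft_near\<close> for semicircles. All coordinates up to some
  M > n + 1 are kept exactly, so the approximating point has a cap of the same level with the same
  centre, and only the radius varies.\<close>

lemma graft_cap_near: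
  assumes x: "x \<in> tent_core s" "coded x l" and n: "last_hit x n" and e: "e > 0"
    and V: "v1 < v2" "{v1<..<v2} \<subseteq> core"
  obtains N0 where "\<And>N. N \<ge> N0 \<Longrightarrow> n < N \<and> (\<exists>u\<in>{v1<..<v2}. \<exists>v. (\<forall>i\<le>n. v i = l i) \<and> (T ^^ N) u = x 0 \<and> (\<forall>h. hist u h \<longrightarrow>
     coded (graft u N h) (glue v N h) \<and> last_hit (graft u N h) n \<and> \<bar>ht (glue v N h) - ht l\<bar> < e))"
proof -
  obtain m where m: "\<And>k. k \<ge> m \<Longrightarrow> 1 / 3 ^ k < e" using third_power_small[OF e] by blast
  obtain m0 where m0: "m0 > Suc n" "\<And>M j. M \<ge> m0 \<Longrightarrow> x M \<noteq> cc j" using off_critical_orbit[OF x(1) n] by blast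
  define M where "M = max m m0"
  have M: "M \<ge> m" "M > Suc n" "\<And>j. x M \<noteq> cc j" using m0 by (auto simp: M_def)
  obtain k0 where k0: "\<And>m y. m \<ge> k0 \<Longrightarrow> y \<in> core \<Longrightarrow> \<exists>u\<in>{v1<..<v2}. (T ^^ m) u = y"
    using open_interval_eventually_onto[OF V] by blast
  have xMc: "x M \<in> core" using x(1) core_iff by blast
  have "n < N \<and> (\<exists>u\<in>{v1<..<v2}. \<exists>v. (\<forall>i\<le>n. v i = l i) \<and> (T ^^ N) u = x 0 \<and> (\<forall>h. hist u h \<longrightarrow>
     coded (graft u N h) (glue v N h) \<and> last_hit (graft u N h) n \<and> \<bar>ht (glue v N h) - ht l\<bar> < e))"
    if N: "N \<ge> M + k0" for N
  proof
    show "n < N" using N M by simp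
    define k where "k = N - M"
    have k: "k \<ge> k0" "N = k + M" using N by (auto simp: k_def)
    obtain u where u: "u \<in> {v1<..<v2}" "(T ^^ k) u = x M" using k0[OF k(1) xMc] by blast
    have low: "(T ^^ (N - i)) u = x i" if "i \<le> M" for i
    proof -
      have "N - i = (M - i) + k" using that k by simp
      then have "(T ^^ (N - i)) u = (T ^^ (M - i)) (x M)" using u(2) by (simp add: funpow_add)
      then show ?thesis using core_funpow[OF x(1), of "M - i" i] that by simp
    qed
    have nohit: "(T ^^ i) u \<noteq> 1/2" if "i < k" for i
    proof
      assume "(T ^^ i) u = 1/2"
      then have "(T ^^ (k - i)) (1/2) = x M" using that u(2) by (metis comp_apply funpow_add less_imp_le_nat le_add_diff_inverse2)
      then show False using M(3) by (metis cc_def)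
    qed
    define v where "v i = (if i < M then l i else (T ^^ (N - Suc i)) u > 1/2)" for i
    have "coded (graft u N h) (glue v N h) \<and> last_hit (graft u N h) n \<and> \<bar>ht (glue v N h) - ht l\<bar> < e"
      if h: "hist u h" for h
    proof (intro conjI)
      have gl: "graft u N h i = x i" if "i \<le> M" for i using low[OF that] that k by (simp add: graft_def)
      have nh: "graft u N h (Suc i) \<noteq> 1/2" if "i \<ge> M" for i
      proof (cases "Suc i \<le> N")
        case True
        then show ?thesis using nohit[of "N - Suc i"] that k by (simp add: graft_def)
      next
        case False
        then obtain j where "i = N + j" using le_Suc_ex not_less_eq_eq by blast
        then show ?thesis using graft_above[OF h, of N "Suc j"] h by (simp add: hist_def)
      qed
      have pre: "glue v N h i = l i" if "i < M" for i using that k by (simp add: glue_def v_def)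
      have sd: "side (glue v N h i) (graft u N h (Suc i))" for i
      proof -
        consider "i < M" | "M \<le> i" "i < N" | "N \<le> i" by linarith
        then show ?thesis
        proof cases
          case 1
          then show ?thesis using pre gl[of "Suc i"] coded_side[OF x(2), of i] by simp
        next
          case 2
          then show ?thesis using nh[of i] by (simp add: glue_def v_def graft_def side_gt)
        qed (use glue_side[OF h] in simp)
      qed
      have last: "graft u N h (Suc i) \<noteq> 1/2" if "i > n" for i
        using nh[of i] gl[of "Suc i"] n that by (cases "i \<ge> M") (auto simp: last_hit_def)
      show "last_hit (graft u N h) n" using last gl[of "Suc n"] M n by (simp add: last_hit_def)
      show "coded (graft u N h) (glue v N h)" unfolding coded_def
      proof (intro conjI allI impI sd)
        fix q j assume q: "graft u N h (Suc q) = 1/2" "1 \<le> j" "j \<le> q"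
        have "q \<le> n" using last q(1) not_le by blast
        then have "x (Suc q) = 1/2" using gl[of "Suc q"] q M by simp
        from coded_kneading[OF x(2) this q(2,3)] show "glue v N h (q - j) = \<kappa> j" using pre[of "q - j"] \<open>q \<le> n\<close> M by simp
      qed
      have "\<bar>ht (glue v N h) - ht l\<bar> \<le> 1 / 3 ^ M" by (rule ht_close) (rule pre)
      then show "\<bar>ht (glue v N h) - ht l\<bar> < e" using m[OF M(1)] by simp
    qed
    moreover have "\<forall>i\<le>n. v i = l i" using M by (simp add: v_def)
    moreover have "(T ^^ N) u = x 0" using low[of 0] by simp
    ultimately show "\<exists>u\<in>{v1<..<v2}. \<exists>v. (\<forall>i\<le>n. v i = l i) \<and> (T ^^ N) u = x 0 \<and> (\<forall>h. hist u h \<longrightarrow>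
     coded (graft u N h) (glue v N h) \<and> last_hit (graft u N h) n \<and> \<bar>ht (glue v N h) - ht l\<bar> < e)"
      using u(1) by blast
  qed
  then show thesis using that by blast
qed

section \<open>Gaps and cuts\<close>

text \<open>The past of t along the right branch alone. It converges to \<open>r\<close>, so
  grafting it yields a point of \<R>.\<close>

fun rh :: "real \<Rightarrow> nat \<Rightarrow> real" where
  "rh t 0 = t"
| "rh t (Suc i) = 1 - rh t i / s"

lemma rh_val: "rh t i = r + \<sigma> ^ i * (t - r)"
proof (induction i)
  case (Suc i)
  have "r / s = 1 / (1 + s)" using s1 by (simp add: r_def)
  then have "1 - r / s = r" using s1 by (simp add: r_def divide_simps)
  moreover have "1 - rh t i / s = 1 - r / s + \<sigma> * (\<sigma> ^ i * (t - r))" using Suc s1 by (simp add: \<sigma>_def add_divide_distrib)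
  ultimately show ?case by simp
qed simp

lemma rh_core: "t \<in> core \<Longrightarrow> rh t i \<in> core"
proof (induction i)
  case (Suc i)
  then show ?case using right_pre(1)[of "rh t i"] d_order by simp
qed simp

lemma hist_rh:
  assumes "t \<in> core" "t \<noteq> d1" "t \<noteq> d2"
  shows "hist t (rh t)" "rh t (Suc i) > 1/2"
proof -
  have ge: "rh t (Suc i) \<ge> 1/2" for i using right_pre(1)[OF rh_core[OF assms(1)], of i] by simp
  have ne: "rh t i \<noteq> d1 \<and> rh t (Suc i) \<noteq> d1" for i
  proof (induction i)
    case 0
    show ?case using assms right_pre(4)[OF assms(1)] by simp
  next
    case (Suc i)
    have "rh t (Suc i) \<noteq> d2" using ge[of i] d_order by linarith
    then show ?case using Suc right_pre(4)[OF rh_core[OF assms(1)], of "Suc i"] by simp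
  qed
  have gt: "rh t (Suc i) \<noteq> 1/2" for i using ne right_pre(3)[OF rh_core[OF assms(1)], of i] by simp
  show "rh t (Suc i) > 1/2" using ge[of i] gt[of i] by linarith
  show "hist t (rh t)" unfolding hist_def
    using rh_core[OF assms(1)] gt right_pre(2)[OF rh_core[OF assms(1)]] by simp
qed

definition hc :: "real \<Rightarrow> (nat \<Rightarrow> real) \<Rightarrow> nat \<Rightarrow> real" where
  "hc u h i = (case i of 0 \<Rightarrow> u | Suc j \<Rightarrow> h j)"

lemma hc_simps [simp]: "hc u h 0 = u" "hc u h (Suc j) = h j"
  by (simp_all add: hc_def)

lemma hist_hc:
  assumes "hist t h" "u \<in> core" "T t = u" "t \<noteq> 1/2"
  shows "hist u (hc u h)"
proof -
  have h: "h 0 = t" "\<And>i. h i \<in> core" "\<And>i. T (h (Suc i)) = h i" "\<And>i. h (Suc i) \<noteq> 1/2"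
    using assms(1) by (auto simp: hist_def)
  have "hc u h i \<in> core \<and> T (hc u h (Suc i)) = hc u h i \<and> hc u h (Suc i) \<noteq> 1/2" for i
  proof (cases i)
    case 0
    show ?thesis unfolding 0 hc_simps h(1) using assms(2-4) by blast
  next
    case (Suc j)
    show ?thesis unfolding Suc hc_simps using h by blast
  qed
  then show ?thesis unfolding hist_def by simp
qed

text \<open>Since \<sigma> is negative, the parity of N + k, together with the side of
  \<open>r\<close> on which t lies, decides on which end of the line the grafted point lies.\<close>

lemma graft_X:
  assumes h: "hist u h" and k: "\<And>i. h (k + i) = rh t i"
  shows "graft u N h = X ((t - r) / \<sigma> ^ (N + k))"
proof -
  let ?x = "graft u N h"
  have val: "?x (i + (N + k)) = r + \<sigma> ^ i * (t - r)" for i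
    using graft_above[OF h, of N "k + i"] k[of i] rh_val by (simp add: ac_simps)
  have "\<bar>\<sigma>\<bar> < 1" using s1 by (simp add: \<sigma>_def)
  then have "(\<lambda>i. r + \<sigma> ^ i * (t - r)) \<longlonglongrightarrow> r + 0 * (t - r)" by (intro tendsto_intros LIMSEQ_power_zero) simp
  then have "(\<lambda>i. ?x (i + (N + k))) \<longlonglongrightarrow> r" unfolding val by simp
  then have "?x \<longlonglongrightarrow> r" by (rule LIMSEQ_offset)
  then obtain \<xi> where \<xi>: "?x = X \<xi>" using range_X_iff[OF graft_core[OF h]] by blast
  obtain M where M: "\<And>n. n \<ge> M \<Longrightarrow> X \<xi> n = r + \<sigma> ^ n * \<xi>" using X_far_eventually by metis
  have s0: "\<sigma> \<noteq> 0" using s1 by (simp add: \<sigma>_def)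
  have "\<sigma> ^ (M + (N + k)) * \<xi> = \<sigma> ^ M * (t - r)"
    using M[of "M + (N + k)"] val[of M] \<xi> by simp
  then have "\<sigma> ^ (N + k) * \<xi> = t - r" using s0 by (simp add: power_add)
  then have "\<xi> = (t - r) / \<sigma> ^ (N + k)" using s0 by (simp add: field_simps)
  then show ?thesis using \<xi> by simp
qed

lemma tl_glue: "tl_code N (glue v N h) = (\<lambda>i. h (Suc i) > 1/2)"
  by (simp add: tl_code_def glue_def fun_eq_iff)

lemma ht_Suc: "ht l = (if l 0 then 2/3 + ht (\<lambda>i. l (Suc i)) / 3 else 1/3 - ht (\<lambda>i. l (Suc i)) / 3)"
  by (subst ht_rec) (simp add: sb_def diff_divide_distrib)

text \<open>The heights \<open>2/3\<close> and \<open>1/9\<close> belong to the codes \<open>1,0,1,1,\<dots>\<close> and \<open>0,1,0,1,1,\<dots>\<close>. A code with a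
  height strictly in between starts with \<open>0,0\<close>, which is impossible over \<open>u < d4\<close>. The two histories
  reach the fixed point after numbers of steps of different parity, hence on different ends of the
  arc component.\<close>

lemma gap_histories:
  assumes u: "d3 < u" "u < d4"
  obtains h1 h2 t1 t2 where "hist u h1" "hist u h2" "ht (\<lambda>i. h1 (Suc i) > 1/2) = 2/3" "ht (\<lambda>i. h2 (Suc i) > 1/2) = 1/9"
    "\<And>i. h1 (2 + i) = rh t1 i" "\<And>i. h2 (3 + i) = rh t2 i" "t1 < r" "t2 < r"
proof -
  have uc: "u \<in> core" "u \<noteq> d1" "u \<noteq> d2" "u \<noteq> d3" using u d_order d4_bounds by auto
  \<comment> \<open>Code 1,0,1,1,...: the left preimage of \<open>a\<close> stays in the core
    because u < s (1 - d3) gives d3 < a.\<close>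
  define a where "a = 1 - u / s"
  define b where "b = a / s"
  have a: "a \<in> {1/2..d1}" "T a = u" "a \<noteq> 1/2" "a \<noteq> d1" using right_pre[OF uc(1)] uc unfolding a_def by auto
  have "u < s * (1 - d3)" using u d4_bounds by linarith
  then have ad3: "d3 < a" using s1 by (simp add: a_def field_simps)
  have ac: "a \<in> core" using a d_order by auto
  have b: "b \<in> {d2..1/2}" "T b = a" "b \<noteq> 1/2" "b \<noteq> d2" using left_pre[OF ac] ad3 a unfolding b_def by auto
  have bc: "b \<in> core" "b \<noteq> d1" using b d_order by auto
  note hb = hist_rh[OF bc(1,2) b(4)]
  define h1 where "h1 = hc u (hc a (rh b))"
  have 1: "hist u h1" unfolding h1_def using hist_hc[OF hist_hc[OF hb(1) ac b(2,3)] uc(1) a(2,3)] .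
  have c1: "(\<lambda>i. h1 (Suc i) > 1/2) = (\<lambda>i. i \<noteq> 1)"
  proof
    fix i show "(h1 (Suc i) > 1/2) = (i \<noteq> 1)"
    proof (cases i)
      case 0
      then show ?thesis using a by (simp add: h1_def)
    next
      case (Suc j)
      then show ?thesis using b hb(2) by (cases j) (auto simp: h1_def simp del: rh.simps(2))
    qed
  qed
  have hF: "ht (\<lambda>i. i \<noteq> 0) = 0"
    using ht_Suc[of "\<lambda>i. i \<noteq> 0"] ht_True by simp
  have e1: "ht (\<lambda>i. i \<noteq> 1) = 2/3"
    using ht_Suc[of "\<lambda>i. i \<noteq> 1"] hF by simp
  \<comment> \<open>Code 0,1,0,1,1,...: the first left preimage needs d3 < u, the second one is
    supplied by \<open>d3_bound\<close>.\<close>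
  define a' where "a' = u / s"
  define b' where "b' = 1 - a' / s"
  define e where "e = b' / s"
  have a': "a' \<in> {d2..1/2}" "T a' = u" "a' \<noteq> 1/2" "a' \<noteq> d2" using left_pre[OF uc(1)] u uc unfolding a'_def by auto
  have a'c: "a' \<in> core" "a' \<noteq> d1" using a' d_order by auto
  have b': "b' \<in> {1/2..d1}" "T b' = a'" "b' \<noteq> 1/2" "b' \<noteq> d1" using right_pre[OF a'c(1)] a'c a' unfolding b'_def by auto
  have b'c: "b' \<in> core" using b' d_order by auto
  have b'd3: "d3 < b'"
  proof -
    have "a' / s \<le> 1 / (2 * s)" using a' s1 by (simp add: field_simps)
    then show ?thesis using d3_bound by (simp add: b'_def)
  qed
  have ee: "e \<in> {d2..1/2}" "T e = b'" "e \<noteq> 1/2" "e \<noteq> d2" using left_pre[OF b'c] b'd3 b' unfolding e_def by auto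
  have ec: "e \<in> core" "e \<noteq> d1" using ee d_order by auto
  note he = hist_rh[OF ec(1,2) ee(4)]
  define h2 where "h2 = hc u (hc a' (hc b' (rh e)))"
  have 2: "hist u h2" unfolding h2_def
    using hist_hc[OF hist_hc[OF hist_hc[OF he(1) b'c ee(2,3)] a'c(1) b'(2,3)] uc(1) a'(2,3)] .
  have c2: "(\<lambda>i. h2 (Suc i) > 1/2) = (\<lambda>i. i \<noteq> 0 \<and> i \<noteq> 2)"
  proof
    fix i show "(h2 (Suc i) > 1/2) = (i \<noteq> 0 \<and> i \<noteq> 2)"
    proof (cases i)
      case 0
      then show ?thesis using a' by (simp add: h2_def)
    next
      case (Suc j)
      show ?thesis
      proof (cases j)
        case 0
        then show ?thesis using Suc b' by (simp add: h2_def)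
      next
        case (Suc k)
        then show ?thesis using \<open>i = Suc j\<close> ee he(2) by (cases k) (auto simp: h2_def simp del: rh.simps(2))
      qed
    qed
  qed
  have e2: "ht (\<lambda>i. i \<noteq> 0 \<and> i \<noteq> 2) = 1/9"
  proof -
    have "(\<lambda>i. Suc i \<noteq> 0 \<and> Suc i \<noteq> 2) = (\<lambda>i. i \<noteq> 1)" by auto
    then show ?thesis using ht_Suc[of "\<lambda>i. i \<noteq> 0 \<and> i \<noteq> 2"] e1 by simp
  qed
  show thesis
  proof (rule that[OF 1 2])
    show "ht (\<lambda>i. h1 (Suc i) > 1/2) = 2/3" "ht (\<lambda>i. h2 (Suc i) > 1/2) = 1/9" using c1 c2 e1 e2 by simp_all
    show "h1 (2 + i) = rh b i" "h2 (3 + i) = rh e i" for i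
      by (simp_all add: h1_def h2_def numeral_2_eq_2 numeral_3_eq_3)
    show "b < r" "e < r" using b ee d_order by auto
  qed
qed

text \<open>Without the kneading condition of \<open>coded\<close>: the estimates in the gaps depend
  only on which branch each step takes.\<close>

definition sided :: "(nat \<Rightarrow> real) \<Rightarrow> (nat \<Rightarrow> bool) \<Rightarrow> bool" where
  "sided x l \<longleftrightarrow> (\<forall>i. side (l i) (x (Suc i)))"

lemma coded_sided: "coded x l \<Longrightarrow> sided x l" by (simp add: coded_def sided_def)

lemma sided_br: "x \<in> tent_core s \<Longrightarrow> sided x l \<Longrightarrow> x n = br (l n) (x (Suc n))"
  using T_br[of "l n" "x (Suc n)"] by (simp add: sided_def core_iff)

lemma sided_diff:
  assumes "x \<in> tent_core s" "x' \<in> tent_core s" "sided x l" "sided x' l'" "\<And>i. i < n \<Longrightarrow> l' i = l i"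
  shows "x' 0 - x 0 = sg l n * s ^ n * (x' n - x n)"
proof (rule branch_diff)
  show "x' i = br (l i) (x' (Suc i))" if "i < n" for i
    using sided_br[OF assms(2,4), of i] assms(5)[OF that] by simp
  show "x i = br (l i) (x (Suc i))" for i using sided_br[OF assms(1,3)] .
qed

text \<open>The code has two zeros at N, so coordinate N is s^2 times coordinate N + 2, hence at
  least s^2 d2 = s d3, and d4 does not exceed this.\<close>

lemma gap_height:
  assumes x: "x \<in> tent_core s" "sided x l" and h: "1/9 < ht (tl_code N l)" "ht (tl_code N l) < 2/3"
  shows "x N \<ge> d4"
proof -
  let ?l = "tl_code N l"
  have b: "0 \<le> ht l" for l using ht_le by blast
  have 1: "\<not> l N"
  proof
    assume "l N"
    then have "ht ?l = 2/3 + ht (\<lambda>i. ?l (Suc i)) / 3" using ht_Suc[of ?l] by (simp add: tl_code_def)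
    then show False using h(2) b[of "\<lambda>i. ?l (Suc i)"] by simp
  qed
  then have e: "ht ?l = 1/3 - ht (\<lambda>i. ?l (Suc i)) / 3" using ht_Suc[of ?l] by (simp add: tl_code_def)
  have 2: "\<not> l (Suc N)"
  proof
    assume "l (Suc N)"
    then have "ht (\<lambda>i. ?l (Suc i)) = 2/3 + ht (\<lambda>i. ?l (Suc (Suc i))) / 3"
      using ht_Suc[of "\<lambda>i. ?l (Suc i)"] by (simp add: tl_code_def)
    then show False using h(1) e b[of "\<lambda>i. ?l (Suc (Suc i))"] by simp
  qed
  have "x N = s * x (Suc N)" "x (Suc N) = s * x (Suc (Suc N))"
    using sided_br[OF x, of N] sided_br[OF x, of "Suc N"] 1 2 by (simp_all add: br_def)
  moreover have "d2 \<le> x (Suc (Suc N))" using x core_iff by auto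
  ultimately have "s * d3 \<le> x N" using s1 by (simp add: d3_def)
  then show ?thesis using d4_bounds by linarith
qed

text \<open>Base points are taken from the lower half of the interval from d3 to d4. Competitors,
  which lie at d4 or above, then keep a distance of at least \<eta>.\<close>

definition \<eta> :: real where "\<eta> = (d4 - d3) / 2"

lemma \<eta>_pos: "\<eta> > 0" using d4_bounds by (simp add: \<eta>_def)

definition gap_pair :: "nat \<Rightarrow> (nat \<Rightarrow> real) \<Rightarrow> (nat \<Rightarrow> real) \<Rightarrow> (nat \<Rightarrow> bool) \<Rightarrow> (nat \<Rightarrow> bool) \<Rightarrow> bool" where
  "gap_pair N x1 x2 l1 l2 \<longleftrightarrow> x1 \<in> tent_core s \<and> x2 \<in> tent_core s \<and> coded x1 l1 \<and> coded x2 l2 \<and>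
     (\<forall>i<N. l1 i = l2 i) \<and> x1 N = x2 N \<and> x1 0 = x2 0 \<and> x1 N \<le> d4 - \<eta> \<and>
     ht (tl_code N l1) = 2/3 \<and> ht (tl_code N l2) = 1/9"

definition btw :: "real \<Rightarrow> real \<Rightarrow> real \<Rightarrow> bool" where
  "btw a b y \<longleftrightarrow> a < y \<and> y < b \<or> b < y \<and> y < a"

lemma gap_pair_heights:
  assumes "gap_pair N x1 x2 l1 l2"
  shows "ht l1 = cn l1 N + ez l1 N / 3 ^ N * (1/6)" "ht l2 = cn l1 N - ez l1 N / 3 ^ N * (7/18)"
proof -
  have h: "ht (tl_code N l1) = 2/3" "ht (tl_code N l2) = 1/9" and "\<And>i. i < N \<Longrightarrow> l2 i = l1 i"
    using assms by (auto simp: gap_pair_def)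
  then have "cn l2 N = cn l1 N" "ez l2 N = ez l1 N" by (auto intro: cn_cong ez_cong)
  then show "ht l1 = cn l1 N + ez l1 N / 3 ^ N * (1/6)" "ht l2 = cn l1 N - ez l1 N / 3 ^ N * (7/18)"
    using ht_center[of l1 N] ht_center[of l2 N] h by simp_all
qed

lemma gap_pair_width:
  assumes "gap_pair N x1 x2 l1 l2"
  shows "\<bar>ht l1 - ht l2\<bar> \<le> 1 / 3 ^ N" "ht l1 \<noteq> ht l2"
proof -
  have "ht l1 - ht l2 = ez l1 N / 3 ^ N * (5/9)" unfolding gap_pair_heights[OF assms] by simp
  then have 1: "\<bar>ht l1 - ht l2\<bar> = 1 / 3 ^ N * (5/9)" by (simp add: abs_mult)
  define w where "w = 1 / (3::real) ^ N"
  have 2: "0 < w" by (simp add: w_def)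
  show "\<bar>ht l1 - ht l2\<bar> \<le> 1 / 3 ^ N" using 1 2 unfolding w_def[symmetric] by linarith
  show "ht l1 \<noteq> ht l2" using 1 by auto
qed

text \<open>A height strictly in between shares the prefix of length N and falls under
  \<open>gap_height\<close>. The distance \<eta> at coordinate N is stretched by s^N on the way to
  coordinate 0.\<close>

lemma gap_pair_far:
  assumes P: "gap_pair N x1 x2 l1 l2" and x': "x' \<in> tent_core s" "sided x' l'" and b: "btw (ht l1) (ht l2) (ht l')"
  shows "\<bar>x' 0 - x1 0\<bar> \<ge> \<eta>"
proof -
  note H = gap_pair_heights[OF P]
  \<comment> \<open>This will turn out to be the height of the tail minus 1/2, so that 2/3 and 1/9
    become 1/6 and -7/18.\<close>
  define q where "q = ez l1 N * 3 ^ N * (ht l' - cn l1 N)"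
  have e2: "ez l1 N * ez l1 N = 1" by simp
  have hq: "ht l' = cn l1 N + ez l1 N / 3 ^ N * q" using ez_cases[of l1 N] by (auto simp: q_def)
  have q: "- (7/18) < q \<and> q < 1/6"
  proof -
    define w where "w = ez l1 N / 3 ^ N"
    have "btw (w * (1/6)) (w * - (7/18)) (w * q)" using b unfolding btw_def H hq w_def[symmetric] by auto
    moreover have "w > 0 \<or> w < 0" using ez_cases[of l1 N] by (auto simp: w_def)
    ultimately show ?thesis unfolding btw_def mult_less_cancel_left by linarith
  qed
  have "\<bar>ht l' - cn l1 N\<bar> = \<bar>q\<bar> / 3 ^ N" unfolding hq by (simp add: abs_mult)
  also have "\<dots> \<le> (1/2) / 3 ^ N" using q by (intro divide_right_mono) auto
  finally have pre: "l' i = l1 i" if "i < N" for i using ht_prefix that by simp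
  have c: "cn l' N = cn l1 N" "ez l' N = ez l1 N" using pre by (auto intro: cn_cong ez_cong)
  have "ez l1 N / 3 ^ N * (ht (tl_code N l') - 1/2) = ez l1 N / 3 ^ N * q"
    using ht_center[of l' N, unfolded c] hq by (metis add_left_cancel)
  moreover have "ez l1 N / 3 ^ N \<noteq> 0" using ez_cases[of l1 N] by auto
  ultimately have "ht (tl_code N l') - 1/2 = q" unfolding mult_cancel_left by blast
  then have "x' N \<ge> d4" using q by (intro gap_height[OF x']) auto
  moreover have "x1 N \<le> d4 - \<eta>" "x1 \<in> tent_core s" "sided x1 l1" using P coded_sided by (auto simp: gap_pair_def)
  moreover from this have "x' 0 - x1 0 = sg l1 N * s ^ N * (x' N - x1 N)" using sided_diff[of x1 x' l1 l' N] x' pre by blast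
  ultimately have "\<bar>x' 0 - x1 0\<bar> = s ^ N * (x' N - x1 N)" "x' N - x1 N \<ge> \<eta>" using s1 \<eta>_pos by (auto simp: abs_mult)
  moreover have "1 \<le> s ^ N" using s1 by (simp add: one_le_power)
  then have "1 * \<eta> \<le> s ^ N * (x' N - x1 N)" using \<open>x' N - x1 N \<ge> \<eta>\<close> \<eta>_pos by (intro mult_mono) auto
  ultimately show ?thesis by simp
qed

lemma gap_pair_flip:
  assumes P: "gap_pair N x1 x2 l1 l2" and n: "last_hit x1 n" "last_hit x2 n" "n < N"
  shows "gap_pair N x1 x2 (l1(n := b)) (l2(n := b))"
proof -
  have "tl_code N (l(n := b)) = tl_code N l" for l using n(3) by (auto simp: tl_code_def)
  then show ?thesis using P coded_flip n by (auto simp: gap_pair_def)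
qed

lemma draw_cases:
  assumes "q \<in> draw x"
  obtains l where "q = (x 0, ht l)" "coded x l"
  | l n where "q \<in> cap x l n" "coded x l" "last_hit x n" "fst q \<noteq> x 0"
proof -
  from assms consider (a) l where "q = (x 0, ht l)" "coded x l"
    | (b) l n where "q \<in> cap x l n" "coded x l" "last_hit x n" unfolding draw_def by blast
  then show thesis
  proof cases
    case a
    then show thesis using that(1) by blast
  next
    case b
    show thesis
    proof (cases "fst q = x 0")
      case True
      then have "q = (x 0, ht l) \<or> q = (x 0, ht (l(n := \<not> l n)))" using cap_end[OF b(1)] by (auto simp: prod_eq_iff)
      then show thesis using that(1) b coded_flip by blast
    next
      case False
      then show thesis using that(2) b by blast
    qed
  qed
qed

text \<open>A basic arc in between is too far away. A semicircle through the open segment would have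
  both ends strictly between the two heights, hence radius below \<eta>, although its axis is at
  distance at least \<eta>.\<close>

lemma vertical_gap:
  assumes P: "gap_pair N x1 x2 l1 l2" and N: "1 / 3 ^ N < \<eta>" and b: "btw (ht l1) (ht l2) y" and x': "x' \<in> tent_core s"
  shows "(x1 0, y) \<notin> draw x'"
proof
  assume "(x1 0, y) \<in> draw x'"
  then show False
  proof (cases rule: draw_cases)
    case (1 l)
    then show ?thesis using gap_pair_far[OF P x' coded_sided[OF 1(2)]] b \<eta>_pos by simp
  next
    case (2 l n)
    let ?q = "(x1 0, y)"
    note h = cap_height[OF 2(1)]
    have edge: "\<bar>ht l0 - cn l n\<bar> > rad l n" if l0: "x0 \<in> tent_core s" "coded x0 l0" "x0 0 = x1 0" for x0 l0
    proof (rule ccontr)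
      assume "\<not> ?thesis"
      then have "\<bar>ht l0 - cn l n\<bar> \<le> 1 / (2 * 3 ^ n)" using rad_le[of l n] by linarith
      then have pre: "l0 i = l i" if "i < n" for i using ht_prefix that by blast
      have "sg l n * (x0 0 - x' 0) \<le> 0" using prefix_bound(1)[OF x' l0(1) 2(2) l0(2) pre] 2(3) by (simp add: last_hit_def)
      moreover have "0 \<le> sg l n * (x1 0 - x' 0)" using 2(1) by (simp add: cap_iff)
      ultimately show False using l0(3) 2(4) sg_cases[of l n] by auto
    qed
    have e1: "\<bar>ht l1 - cn l n\<bar> > rad l n" and e2: "\<bar>ht l2 - cn l n\<bar> > rad l n"
      using edge P unfolding gap_pair_def by metis+
    have hl: "ht l = cn l n + rad l n \<or> ht l = cn l n - rad l n" by (auto simp: rad_def abs_if)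
    have inside: "btw (ht l1) (ht l2) (ht l)" "2 * rad l n < \<bar>ht l1 - ht l2\<bar>"
      using h(1) b e1 e2 hl unfolding btw_def snd_conv by linarith+
    then have "\<bar>x' 0 - x1 0\<bar> \<ge> \<eta>" using gap_pair_far[OF P x' coded_sided[OF 2(2)]] by blast
    moreover have "\<bar>x1 0 - x' 0\<bar> \<le> rad l n" using h(2) by simp
    moreover have "rad l n < \<eta>" using inside(2) gap_pair_width(1)[OF P] N ht_minus_cn(2)[of l n] by linarith
    ultimately show False by linarith
  qed
qed

lemma square_less_abs: "(a::real)^2 < b^2 \<Longrightarrow> \<bar>a\<bar> < \<bar>b\<bar>"
  by (simp add: abs_le_square_iff not_le[symmetric])

text \<open>The annular version of \<open>vertical_gap\<close>, between two semicircles with common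
  centre. Basic arcs reach at most the axis, where \<open>far\<close> excludes them; caps facing the
  other way cannot enter; shallower caps pass around the outer one; a cap of the same level is
  concentric and excluded by \<open>far\<close>; a deeper cap would be caught in the
  annulus.\<close>

lemma radial_gap:
  assumes xa: "xa \<in> tent_core s" "coded xa la" "last_hit xa n"
    and xb: "xb \<in> tent_core s" "coded xb lb" "last_hit xb n" and x0: "xa 0 = xb 0"
    and pre: "\<And>i. i < n \<Longrightarrow> la i = lb i"
    and \<rho>: "rad la n < \<rho>" "\<rho> < rad lb n" "rad lb n - rad la n < \<eta>"
    and far: "\<And>x' l'. x' \<in> tent_core s \<Longrightarrow> coded x' l' \<Longrightarrow> (\<And>i. i < n \<Longrightarrow> l' i = la i) \<Longrightarrow>
        rad la n < rad l' n \<Longrightarrow> rad l' n < rad lb n \<Longrightarrow> \<bar>x' 0 - xa 0\<bar> \<ge> \<eta>"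
    and q: "(fst q - xa 0)^2 + (snd q - cn la n)^2 = \<rho>^2" "0 \<le> sg la n * (fst q - xa 0)"
    and x': "x' \<in> tent_core s"
  shows "q \<notin> draw x'"
proof
  assume "q \<in> draw x'"
  define C where "C = cn la n"
  define \<tau> where "\<tau> = sg la n"
  have C: "cn la n = C" "cn lb n = C" using cn_cong[of n lb la] pre by (auto simp: C_def)
  have \<tau>: "sg la n = \<tau>" "sg lb n = \<tau>" using sg_cong[of n lb la] pre by (auto simp: \<tau>_def)
  have \<tau>c: "\<tau> = 1 \<or> \<tau> = -1" unfolding \<tau>_def by (rule sg_cases)
  have ra: "rad la n > 0" by (rule ht_minus_cn)
  have \<rho>0: "\<rho> > 0" using ra \<rho> by simp
  have q2: "0 \<le> \<tau> * (fst q - xb 0)" "0 \<le> \<tau> * (fst q - xa 0)" using q(2) by (auto simp: \<tau>_def x0)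
  have "(snd q - C)^2 \<le> \<rho>^2" using q(1) by (smt (verit) C(1) zero_le_power2)
  then have y\<rho>: "\<bar>snd q - C\<bar> \<le> \<rho>" using \<rho>0 by (simp add: abs_le_square_iff[symmetric])
  have yb: "\<bar>snd q - cn lb n\<bar> \<le> rad lb n" using y\<rho> \<rho>(2) C by simp
  have hits: "xa (Suc n) = 1/2" "xb (Suc n) = 1/2" using xa(3) xb(3) by (auto simp: last_hit_def)
  from \<open>q \<in> draw x'\<close> show False
  proof (cases rule: draw_cases)
    case (1 l')
    have "\<bar>ht l' - cn lb n\<bar> \<le> 1 / (2 * 3 ^ n)" using yb rad_le[of lb n] 1 by simp
    then have pre': "l' i = lb i" if "i < n" for i using ht_prefix that by blast
    have "\<tau> * (x' 0 - xb 0) \<le> 0" using prefix_bound(1)[OF xb(1) x' xb(2) 1(2) pre' hits(2)] \<tau> by simp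
    then have eq: "x' 0 = xa 0" using q2(1) \<tau>c 1(1) x0 by auto
    then have "(ht l' - C)^2 = \<rho>^2" using q(1) 1(1) C by simp
    moreover have "cn l' n = C" using cn_cong[of n l' lb] pre' C by simp
    ultimately have "rad l' n = \<rho>" using \<rho>0 by (auto simp: rad_def power2_eq_iff abs_if)
    then show False using far[OF x' 1(2)] pre' pre \<rho> eq \<eta>_pos by simp
  next
    case (2 l' n')
    note h' = cap_height[OF 2(1)]
    have q': "0 \<le> sg l' n' * (fst q - x' 0)" "(fst q - x' 0)^2 + (snd q - cn l' n')^2 = (rad l' n')^2"
      using 2(1) by (auto simp: cap_iff)
    have hit': "x' (Suc n') = 1/2" using 2(3) by (simp add: last_hit_def)
    show False
    proof (cases "sg l' n' = \<tau>")
      case False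
      then have sg': "sg l' n' = - \<tau>" using \<tau>c sg_cases[of l' n'] by auto
      show False
      proof (cases "n' \<le> n")
        case True
        have p: "lb i = l' i" if "i < n'" for i using caps_prefix[OF True yb h'(1) that] .
        have "sg l' n' * (xb 0 - x' 0) \<le> 0" by (rule prefix_bound(1)[OF x' xb(1) 2(2) xb(2) p hit'])
        then show False using q'(1) q2(1) 2(4) \<tau>c unfolding sg' by auto
      next
        case False
        then have "n \<le> n'" by simp
        then have p: "l' i = lb i" if "i < n" for i using caps_prefix[OF _ h'(1) yb that] by blast
        have "\<tau> * (x' 0 - xb 0) \<le> 0" using prefix_bound(1)[OF xb(1) x' xb(2) 2(2) p hits(2)] \<tau> by simp
        then show False using q'(1) q2(1) 2(4) \<tau>c unfolding sg' by auto
      qed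
    next
      case True
      consider "n' < n" | "n' = n" | "n < n'" by linarith
      then show False
      proof cases
        case 1
        note nest = caps_nested[OF xb x' 2(2,3) 1 _ yb h'(1)]
        have "sg lb n = sg l' n'" using True \<tau> by simp
        note nest = nest[OF this]
        have "\<rho>^2 - (snd q - C)^2 < (rad l' n')^2 - (snd q - cn l' n')^2"
          by (rule circle_nested[OF y\<rho>]) (use nest(1,2) C \<rho> in linarith)+
        then have "(fst q - xb 0)^2 < (fst q - x' 0)^2" using q(1) q'(2) C x0 by simp
        then have "\<bar>fst q - xb 0\<bar> < \<bar>fst q - x' 0\<bar>" by (rule square_less_abs)
        then show False using nest(3) q'(1) q2(1) \<tau>c True \<tau> by auto
      next
        case 2: 2
        have p: "l' i = lb i" if "i < n" for i using caps_prefix[of n n' "snd q" l' lb i] h'(1) yb that 2 by simp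
        have "x' 0 = xb 0" using prefix_bound(2)[OF xb(1) x' xb(2) \<open>coded x' l'\<close> p hits(2)] hit' 2 by simp
        moreover have "cn l' n = C" using cn_cong[of n l' lb] p C by simp
        ultimately have "(rad l' n)^2 = \<rho>^2" using q(1) q'(2) 2 C x0 by simp
        then have "rad l' n = \<rho>" using \<rho>0 ht_minus_cn(2)[of l' n] by simp
        then show False using far[OF x' \<open>coded x' l'\<close>] p pre \<rho> \<open>x' 0 = xb 0\<close> x0 \<eta>_pos by simp
      next
        case 3
        have le: "n \<le> n'" using 3 by simp
        have p: "l' i = lb i" if "i < n" for i using caps_prefix[OF le h'(1) yb that] .
        have C': "cn l' n = C" using cn_cong[of n l' lb] p C by simp
        have "sg l' n' = sg lb n" "sg l' n' = sg la n" using True \<tau> by auto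
        note nb = caps_nested[OF x' 2(2,3) xb 3 this(1) h'(1) yb]
        have na: False if "\<bar>y0 - cn l' n'\<bar> \<le> rad l' n'" "\<bar>y0 - C\<bar> \<le> rad la n" for y0
        proof -
          have "\<bar>y0 - cn la n\<bar> \<le> rad la n" using that C by simp
          note nest = caps_nested[OF x' 2(2,3) xa 3 \<open>sg l' n' = sg la n\<close> that(1) this]
          have "rad l' n' ^ 2 - (snd q - cn l' n')^2 < (rad la n)^2 - (snd q - C)^2"
            using circle_nested[OF h'(1) nest(1,2)] C by simp
          also have "\<dots> < \<rho>^2 - (snd q - C)^2" using power_strict_mono[OF \<rho>(1), of 2] ra by simp
          finally have "(fst q - x' 0)^2 < (fst q - xa 0)^2" using q(1) q'(2) C by simp
          then have "\<bar>fst q - x' 0\<bar> < \<bar>fst q - xa 0\<bar>" by (rule square_less_abs)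
          then show False using nest(3) q'(1) q2(2) \<tau>c True by auto
        qed
        define R where "R = rad l' n'"
        have R0: "R > 0" unfolding R_def by (rule ht_minus_cn)
        \<comment> \<open>Nested inside the outer cap but disjoint in height from the inner one, the
          deeper cap has radius below \<eta>, while its axis lies at least \<eta> behind the common
          axis of the two caps.\<close>
        have sep: "cn l' n' + R < C - rad la n \<or> C + rad la n < cn l' n' - R"
        proof (rule ccontr)
          assume *: "\<not> ?thesis"
          define y0 where "y0 = max (cn l' n' - R) (C - rad la n)"
          have "\<bar>y0 - cn l' n'\<bar> \<le> R" "\<bar>y0 - C\<bar> \<le> rad la n" using * R0 ra unfolding y0_def by linarith+
          then show False using na by (simp add: R_def)
        qed
        have hl: "ht l' = cn l' n' + R \<or> ht l' = cn l' n' - R" by (auto simp: R_def rad_def abs_if)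
        have nbR: "C - rad lb n < cn l' n' - R" "cn l' n' + R < C + rad lb n" using nb(1,2) C by (auto simp: R_def)
        have "rad la n < \<bar>ht l' - C\<bar>" "\<bar>ht l' - C\<bar> < rad lb n" using sep hl nbR R0 by linarith+
        then have "\<bar>x' 0 - xa 0\<bar> \<ge> \<eta>" using far[OF x' 2(2)] p pre C' by (simp add: rad_def)
        moreover have "\<bar>fst q - x' 0\<bar> \<le> R" using h'(2) by (simp add: R_def)
        moreover have "R < \<eta>" using sep nbR \<rho>(3) R0 by linarith
        moreover have "\<bar>x' 0 - xa 0\<bar> \<le> \<bar>fst q - x' 0\<bar>" using nb(3) q2(1) \<tau>c True x0 by auto
        ultimately show False by linarith
      qed
    qed
  qed
qed

end

lemma dist_Pair_le: "dist (a, b) (c, d) \<le> \<bar>a - c\<bar> + \<bar>b - (d::real)\<bar>" for a b c d :: real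
  using sqrt_sum_squares_le_sum_abs[of "a - c" "b - d"] by (simp add: dist_Pair_Pair dist_real_def)

lemma norm_1_iff: "norm d = 1 \<longleftrightarrow> (fst d)^2 + (snd d)^2 = 1" for d :: "real \<times> real"
  unfolding norm_prod_def by simp

context tent_param
begin

abbreviation KK :: "(real \<times> real) set" where "KK \<equiv> \<Union>x\<in>tent_core s. draw x"

lemma cap_ray: "norm d = 1 \<Longrightarrow> 0 \<le> sg l n * fst d \<Longrightarrow> (x 0, cn l n) + rad l n *\<^sub>R d \<in> cap x l n"
proof -
  assume d: "norm d = 1" "0 \<le> sg l n * fst d"
  have "(rad l n * fst d)^2 + (rad l n * snd d)^2 = (rad l n)^2 * ((fst d)^2 + (snd d)^2)"
    by (simp add: power_mult_distrib algebra_simps)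
  moreover have "0 \<le> rad l n * (sg l n * fst d)" using d ht_minus_cn(2)[of l n] by simp
  ultimately show ?thesis unfolding cap_iff using d(1) unfolding norm_1_iff by (simp add: mult.left_commute)
qed

lemma cap_rayE:
  assumes "z \<in> cap x l n"
  obtains d where "norm d = 1" "0 \<le> sg l n * fst d" "z = (x 0, cn l n) + rad l n *\<^sub>R d"
proof -
  let ?d = "(1 / rad l n) *\<^sub>R (z - (x 0, cn l n))"
  have r: "rad l n > 0" by (rule ht_minus_cn)
  have z: "(fst z - x 0)^2 + (snd z - cn l n)^2 = (rad l n)^2" "0 \<le> sg l n * (fst z - x 0)" using assms cap_iff by auto
  have "norm ?d = 1" unfolding norm_1_iff using r z(1)
    by (simp add: power_divide add_divide_distrib[symmetric] del: add_divide_distrib)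
  moreover have "0 \<le> sg l n * fst ?d" using z(2) r by (simp add: zero_le_mult_iff)
  moreover have "z = (x 0, cn l n) + rad l n *\<^sub>R ?d" using r by simp
  ultimately show thesis using that by blast
qed

lemma draw_horizontal: "coded x l \<Longrightarrow> (x 0, ht l) \<in> draw x"
  and draw_cap: "coded x l \<Longrightarrow> last_hit x n \<Longrightarrow> q \<in> cap x l n \<Longrightarrow> q \<in> draw x"
  unfolding draw_def by blast+

text \<open>A point on a basic arc is approached by \<open>graft_near\<close>; a point on a
  semicircle is approached along its own radius by \<open>graft_cap_near\<close>. The past
  \<open>h\<close> stays free, so one lemma serves both ends of the line and its complement.\<close>

lemma draw_near:
  assumes x: "x \<in> tent_core s" "z \<in> draw x" and e: "e > 0" and V: "v1 < v2" "{v1<..<v2} \<subseteq> core"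
  obtains N0 where "\<And>N. N \<ge> N0 \<Longrightarrow> \<exists>u\<in>{v1<..<v2}. \<forall>h. hist u h \<longrightarrow> (\<exists>q\<in>draw (graft u N h). dist q z < e)"
  using x(2)
proof (cases rule: draw_cases)
  case (1 l)
  have e2: "e / 2 > 0" using e by simp
  show thesis
  proof (rule graft_near[OF x(1) 1(2) e2 V])
    fix N0 assume *: "\<And>N. N \<ge> N0 \<Longrightarrow> \<exists>u\<in>{v1<..<v2}. \<exists>v. \<forall>h. hist u h \<longrightarrow> coded (graft u N h) (glue v N h) \<and>
     \<bar>(T ^^ N) u - x 0\<bar> < e / 2 \<and> \<bar>ht (glue v N h) - ht l\<bar> < e / 2"
    show thesis
    proof (rule that)
      fix N assume "N \<ge> N0"
      then obtain u v where u: "u \<in> {v1<..<v2}" and h: "\<And>h. hist u h \<Longrightarrow> coded (graft u N h) (glue v N h) \<and>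
         \<bar>(T ^^ N) u - x 0\<bar> < e / 2 \<and> \<bar>ht (glue v N h) - ht l\<bar> < e / 2" using * by blast
      have "\<exists>q\<in>draw (graft u N h). dist q z < e" if "hist u h" for h
      proof
        have "graft u N h 0 = (T ^^ N) u" by (simp add: graft_def)
        then show "((T ^^ N) u, ht (glue v N h)) \<in> draw (graft u N h)" using draw_horizontal h[OF that] by metis
        show "dist ((T ^^ N) u, ht (glue v N h)) z < e"
          unfolding 1(1) using h[OF that] dist_Pair_le[of "(T ^^ N) u" "ht (glue v N h)" "x 0" "ht l"] by linarith
      qed
      then show "\<exists>u\<in>{v1<..<v2}. \<forall>h. hist u h \<longrightarrow> (\<exists>q\<in>draw (graft u N h). dist q z < e)" using u by blast
    qed
  qed
next
  case (2 l n)
  show thesis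
  proof (rule graft_cap_near[OF x(1) 2(2,3) e V])
    fix N0 assume *: "\<And>N. N \<ge> N0 \<Longrightarrow> n < N \<and> (\<exists>u\<in>{v1<..<v2}. \<exists>v. (\<forall>i\<le>n. v i = l i) \<and> (T ^^ N) u = x 0 \<and> (\<forall>h. hist u h \<longrightarrow>
     coded (graft u N h) (glue v N h) \<and> last_hit (graft u N h) n \<and> \<bar>ht (glue v N h) - ht l\<bar> < e))"
    obtain d where d: "norm d = 1" "0 \<le> sg l n * fst d" "z = (x 0, cn l n) + rad l n *\<^sub>R d"
      using cap_rayE[OF 2(1)] by blast
    show thesis
    proof (rule that)
      fix N assume "N \<ge> N0"
      then obtain u v where u: "u \<in> {v1<..<v2}" and v: "\<And>i. i \<le> n \<Longrightarrow> v i = l i" "(T ^^ N) u = x 0" "n < N" and h: "\<And>h. hist u h \<Longrightarrow>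
        coded (graft u N h) (glue v N h) \<and> last_hit (graft u N h) n \<and> \<bar>ht (glue v N h) - ht l\<bar> < e" using * by blast
      have "\<exists>q\<in>draw (graft u N h). dist q z < e" if "hist u h" for h
      proof
        let ?l = "glue v N h"
        have l: "?l i = l i" if "i < n" for i using v that by (simp add: glue_def)
        have c: "cn ?l n = cn l n" "sg ?l n = sg l n" using l by (auto intro: cn_cong sg_cong)
        have g0: "graft u N h 0 = x 0" using v by (simp add: graft_def)
        show "(x 0, cn l n) + rad ?l n *\<^sub>R d \<in> draw (graft u N h)"
          using draw_cap[of _ ?l n] h[OF that] cap_ray[of d ?l n "graft u N h"] d unfolding c g0 by blast
        have "dist ((x 0, cn l n) + rad ?l n *\<^sub>R d) z = \<bar>rad ?l n - rad l n\<bar>"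
          unfolding d(3) dist_norm by (simp add: scaleR_left_diff_distrib[symmetric] d(1))
        also have "\<dots> \<le> \<bar>ht ?l - ht l\<bar>" unfolding rad_def c by linarith
        finally show "dist ((x 0, cn l n) + rad ?l n *\<^sub>R d) z < e" using h[OF that] by simp
      qed
      then show "\<exists>u\<in>{v1<..<v2}. \<forall>h. hist u h \<longrightarrow> (\<exists>q\<in>draw (graft u N h). dist q z < e)" using u by blast
    qed
  qed
qed

lemma btw_convex:
  assumes "y1 \<noteq> y2" "0 < t" "t < 1"
  shows "btw y1 y2 ((1 - t) * y1 + t * y2)"
proof -
  have e: "(1 - t) * y1 + t * y2 = y1 + t * (y2 - y1)" "(1 - t) * y1 + t * y2 = y2 - (1 - t) * (y2 - y1)" by (auto simp: algebra_simps)
  consider "y2 - y1 > 0" | "y2 - y1 < 0" using assms(1) by linarith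
  then show ?thesis
  proof cases
    case 1
    then have "t * (y2 - y1) > 0" "(1 - t) * (y2 - y1) > 0" using assms by simp_all
    then show ?thesis using e unfolding btw_def by linarith
  next
    case 2
    then have "t * (y2 - y1) < 0" "(1 - t) * (y2 - y1) < 0" using assms by (simp_all add: mult_less_0_iff)
    then show ?thesis using e unfolding btw_def by linarith
  qed
qed

lemma gap_interval: "{d3<..<d3 + \<eta>} \<subseteq> core" "d3 + \<eta> = d4 - \<eta>"
  using d4_bounds d_order by (auto simp: \<eta>_def field_simps)

definition gap_cut :: "real \<times> real \<Rightarrow> real \<times> real \<Rightarrow> bool" where
  "gap_cut q1 q2 \<longleftrightarrow> q1 \<noteq> q2 \<and> closed_segment q1 q2 \<inter> KK = {q1, q2} \<and>
     (\<exists>\<xi>1 \<xi>2. \<xi>1 * \<xi>2 < 0 \<and> q1 \<in> draw (X \<xi>1) \<and> q2 \<in> draw (X \<xi>2))"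

lemma gap_pair_graft:
  assumes u: "u \<in> {d3<..<d3 + \<eta>}"
  obtains h1 h2 \<xi>1 \<xi>2 where "hist u h1" "hist u h2" "\<xi>1 * \<xi>2 < 0" "graft u N h1 = X \<xi>1" "graft u N h2 = X \<xi>2"
    "\<And>v. coded (graft u N h1) (glue v N h1) \<Longrightarrow> coded (graft u N h2) (glue v N h2) \<Longrightarrow>
       gap_pair N (graft u N h1) (graft u N h2) (glue v N h1) (glue v N h2)"
proof -
  have "d3 < u" "u < d4" using u gap_interval(2) \<eta>_pos by auto
  from gap_histories[OF this] obtain h1 h2 t1 t2 where h: "hist u h1" "hist u h2"
    and ht: "ht (\<lambda>i. h1 (Suc i) > 1/2) = 2/3" "ht (\<lambda>i. h2 (Suc i) > 1/2) = 1/9"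
    and rh: "\<And>i. h1 (2 + i) = rh t1 i" "\<And>i. h2 (3 + i) = rh t2 i" and t: "t1 < r" "t2 < r" by metis
  \<comment> \<open>The exponents N + 2 and N + 3 have different parity and both t1 and t2 lie left
    of \<open>r\<close>, so the two parameters have opposite signs.\<close>
  let ?a = "(t1 - r) / \<sigma> ^ (N + 2)" and ?b = "(t2 - r) / \<sigma> ^ (N + 3)"
  have "\<sigma> < 0" using s1 by (simp add: \<sigma>_def)
  then have "\<sigma> ^ (N + 2) * \<sigma> ^ (N + 3) < 0"
  proof -
    have "\<sigma> ^ (N + 2) * \<sigma> ^ (N + 3) = (\<sigma> ^ (N + 2)) ^ 2 * \<sigma>" by (simp add: power2_eq_square numeral_3_eq_3)
    moreover have "(\<sigma> ^ (N + 2)) ^ 2 > 0" using \<open>\<sigma> < 0\<close> by simp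
    ultimately show ?thesis using \<open>\<sigma> < 0\<close> by (metis mult_pos_neg)
  qed
  moreover have "(t1 - r) * (t2 - r) > 0" using t by (simp add: mult_neg_neg)
  ultimately have "?a * ?b < 0" by (simp add: divide_pos_neg)
  moreover have "gap_pair N (graft u N h1) (graft u N h2) (glue v N h1) (glue v N h2)"
    if "coded (graft u N h1) (glue v N h1)" "coded (graft u N h2) (glue v N h2)" for v
    unfolding gap_pair_def using that graft_core h ht u gap_interval(2)
    by (simp add: tl_glue graft_def glue_def)
  ultimately show thesis using that[OF h _ graft_X[OF h(1) rh(1)] graft_X[OF h(2) rh(2)]] by blast
qed

lemma closed_segment_KK:
  assumes "q1 \<in> KK" "q2 \<in> KK" "\<And>t. 0 < t \<Longrightarrow> t < 1 \<Longrightarrow> (1 - t) *\<^sub>R q1 + t *\<^sub>R q2 \<notin> KK"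
  shows "closed_segment q1 q2 \<inter> KK = {q1, q2}"
proof
  show "closed_segment q1 q2 \<inter> KK \<subseteq> {q1, q2}"
  proof
    fix q assume q: "q \<in> closed_segment q1 q2 \<inter> KK"
    then obtain t where t: "0 \<le> t" "t \<le> 1" "q = (1 - t) *\<^sub>R q1 + t *\<^sub>R q2" by (auto simp: in_segment)
    then have "t = 0 \<or> t = 1" using assms(3)[of t] q by fastforce
    then show "q \<in> {q1, q2}" using t(3) by auto
  qed
qed (use assms in auto)

lemma small_gap_cut:
  assumes x: "x \<in> tent_core s" "z \<in> draw x" and e: "e > 0"
  obtains q1 q2 where "gap_cut q1 q2" "closed_segment q1 q2 \<subseteq> ball z e"
proof -
  obtain m where m: "\<And>k. k \<ge> m \<Longrightarrow> 1 / 3 ^ k < \<eta>" using third_power_small[OF \<eta>_pos] by blast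
  note V = gap_interval(1)
  have V0: "d3 < d3 + \<eta>" using \<eta>_pos by simp
  have seg: "closed_segment q1 q2 \<subseteq> ball z e" if "q1 \<in> ball z e" "q2 \<in> ball z e" for q1 q2
    using that by (simp add: closed_segment_subset)
  from x(2) show thesis
  proof (cases rule: draw_cases)
    case (1 l)
    have e2: "e / 2 > 0" using e by simp
    show thesis
    proof (rule graft_near[OF x(1) 1(2) e2 V0 V])
      fix N0 assume *: "\<And>N. N \<ge> N0 \<Longrightarrow> \<exists>u\<in>{d3<..<d3 + \<eta>}. \<exists>v. \<forall>h. hist u h \<longrightarrow> coded (graft u N h) (glue v N h) \<and>
       \<bar>(T ^^ N) u - x 0\<bar> < e / 2 \<and> \<bar>ht (glue v N h) - ht l\<bar> < e / 2"
      define N where "N = max m N0"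
      obtain u v where u: "u \<in> {d3<..<d3 + \<eta>}" and h: "\<And>h. hist u h \<Longrightarrow> coded (graft u N h) (glue v N h) \<and>
         \<bar>(T ^^ N) u - x 0\<bar> < e / 2 \<and> \<bar>ht (glue v N h) - ht l\<bar> < e / 2" using *[of N] max.cobounded2[of N0 m] unfolding N_def by blast
      obtain h1 h2 \<xi>1 \<xi>2 where g: "hist u h1" "hist u h2" "\<xi>1 * \<xi>2 < 0" "graft u N h1 = X \<xi>1" "graft u N h2 = X \<xi>2"
        "\<And>v. coded (graft u N h1) (glue v N h1) \<Longrightarrow> coded (graft u N h2) (glue v N h2) \<Longrightarrow>
           gap_pair N (graft u N h1) (graft u N h2) (glue v N h1) (glue v N h2)"
        using gap_pair_graft[OF u] by metis
      define a where "a = (T ^^ N) u"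
      let ?l1 = "glue v N h1" and ?l2 = "glue v N h2"
      have a: "graft u N h 0 = a" for h by (simp add: graft_def a_def)
      have P: "gap_pair N (graft u N h1) (graft u N h2) ?l1 ?l2" using g(6) h g(1,2) by blast
      have near: "(a, ht (glue v N h')) \<in> ball z e" if "hist u h'" for h'
        unfolding 1(1) mem_ball a_def
        using h[OF that] dist_Pair_le[of "x 0" "ht l" "(T ^^ N) u" "ht (glue v N h')"] by linarith
      have d: "(a, ht ?l1) \<in> draw (X \<xi>1)" "(a, ht ?l2) \<in> draw (X \<xi>2)"
        using draw_horizontal[of "graft u N h1" ?l1] draw_horizontal[of "graft u N h2" ?l2] h[OF g(1)] h[OF g(2)]
        unfolding a unfolding g(4,5) by blast+
      have out: "(1 - t) *\<^sub>R (a, ht ?l1) + t *\<^sub>R (a, ht ?l2) \<notin> KK" if t: "0 < t" "t < 1" for t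
      proof -
        have "btw (ht ?l1) (ht ?l2) ((1 - t) * ht ?l1 + t * ht ?l2)" by (rule btw_convex[OF gap_pair_width(2)[OF P] t])
        from vertical_gap[OF P _ this] have "(a, (1 - t) * ht ?l1 + t * ht ?l2) \<notin> KK"
          using m[of N] a by (auto simp: N_def)
        moreover have "(1 - t) * a + t * a = a" by (simp add: algebra_simps)
        ultimately show ?thesis by simp
      qed
      have "gap_cut (a, ht ?l1) (a, ht ?l2)"
        unfolding gap_cut_def using g(3) d gap_pair_width(2)[OF P] closed_segment_KK[OF _ _ out] X_core by blast
      then show thesis using that seg near g(1,2) by blast
    qed
  next
    case (2 l n)
    obtain d where d: "norm d = 1" "0 \<le> sg l n * fst d" "z = (x 0, cn l n) + rad l n *\<^sub>R d"
      using cap_rayE[OF 2(1)] by blast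
    show thesis
    proof (rule graft_cap_near[OF x(1) 2(2,3) e V0 V])
      fix N0 assume *: "\<And>N. N \<ge> N0 \<Longrightarrow> n < N \<and> (\<exists>u\<in>{d3<..<d3 + \<eta>}. \<exists>v. (\<forall>i\<le>n. v i = l i) \<and> (T ^^ N) u = x 0 \<and> (\<forall>h. hist u h \<longrightarrow>
       coded (graft u N h) (glue v N h) \<and> last_hit (graft u N h) n \<and> \<bar>ht (glue v N h) - ht l\<bar> < e))"
      define N where "N = max m N0"
      obtain u v where u: "u \<in> {d3<..<d3 + \<eta>}" and v: "\<And>i. i \<le> n \<Longrightarrow> v i = l i" "(T ^^ N) u = x 0" "n < N" and h: "\<And>h. hist u h \<Longrightarrow>
        coded (graft u N h) (glue v N h) \<and> last_hit (graft u N h) n \<and> \<bar>ht (glue v N h) - ht l\<bar> < e"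
        using *[of N] max.cobounded2[of N0 m] unfolding N_def by blast
      obtain h1 h2 \<xi>1 \<xi>2 where g: "hist u h1" "hist u h2" "\<xi>1 * \<xi>2 < 0" "graft u N h1 = X \<xi>1" "graft u N h2 = X \<xi>2"
        "\<And>v. coded (graft u N h1) (glue v N h1) \<Longrightarrow> coded (graft u N h2) (glue v N h2) \<Longrightarrow>
           gap_pair N (graft u N h1) (graft u N h2) (glue v N h1) (glue v N h2)"
        using gap_pair_graft[OF u] by metis
      define l1 where "l1 = glue v N h1"
      define l2 where "l2 = glue v N h2"
      define x1 where "x1 = graft u N h1"
      define x2 where "x2 = graft u N h2"
      have x12: "x1 \<in> tent_core s" "x2 \<in> tent_core s" "coded x1 l1" "coded x2 l2" "last_hit x1 n" "last_hit x2 n" "x1 0 = x 0" "x2 0 = x 0"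
        using graft_core h g(1,2) v(2) unfolding x1_def x2_def l1_def l2_def by (auto simp: graft_def)
      have P: "gap_pair N x1 x2 l1 l2" using g(6) h g(1,2) unfolding x1_def x2_def l1_def l2_def by blast
      have pre: "l1 i = l i" "l2 i = l i" if "i \<le> n" for i using v that unfolding l1_def l2_def by (auto simp: glue_def)
      have c: "cn l1 n = cn l n" "sg l1 n = sg l n" "cn l2 n = cn l n" "sg l2 n = sg l n"
        using pre by (auto intro: cn_cong sg_cong)
      have H: "ht (l'(n := b)) = cn l n + ez l n * sb b * rad l' n" if "\<And>i. i < n \<Longrightarrow> l' i = l i" for l' b
      proof -
        have "cn l' n = cn l n" "ez l' n = ez l n" "ez (l'(n := b)) n = ez l' n" using that by (auto intro: cn_cong ez_cong)
        then show ?thesis using ht_minus_cn(1)[of "l'(n := b)" n] by simp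
      qed
      have eb: "ez l n * sb b = 1 \<or> ez l n * sb b = -1" for b using ez_cases[of l n] by (cases b) auto
      have H12: "ht (l1(n := b)) = cn l n + ez l n * sb b * rad l1 n" "ht (l2(n := b)) = cn l n + ez l n * sb b * rad l2 n" for b
        using H pre by auto
      have H12': "ht l1 = cn l n + ez l n * sb (l n) * rad l1 n" "ht l2 = cn l n + ez l n * sb (l n) * rad l2 n"
        using H12[of "l n"] pre[of n] by (simp_all add: fun_upd_idem)
      have w: "rad l1 n \<noteq> rad l2 n" "\<bar>rad l1 n - rad l2 n\<bar> < \<eta>"
      proof -
        have "\<bar>rad l1 n - rad l2 n\<bar> = \<bar>ht l1 - ht l2\<bar>" using H12' eb[of "l n"] by auto
        then show "\<bar>rad l1 n - rad l2 n\<bar> < \<eta>" using gap_pair_width(1)[OF P] m[of N] by (auto simp: N_def)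
        show "rad l1 n \<noteq> rad l2 n" using H12' gap_pair_width(2)[OF P] by auto
      qed
      \<comment> \<open>A competing code may carry either symbol at n. Both codes of the gap pair
        are flipped there to match it, which is possible because n is a last hit of both
        orbits.\<close>
      have far: "\<bar>x' 0 - x 0\<bar> \<ge> \<eta>" if x': "x' \<in> tent_core s" "coded x' l'" and p: "\<And>i. i < n \<Longrightarrow> l' i = l i"
        and b: "btw (rad l1 n) (rad l2 n) (rad l' n)" for x' l'
      proof -
        have "ht l' = cn l n + ez l n * sb (l' n) * rad l' n" using H[of l' "l' n"] p by simp
        then have "btw (ht (l1(n := l' n))) (ht (l2(n := l' n))) (ht l')"
          using b eb[of "l' n"] unfolding H12 btw_def by auto
        from gap_pair_far[OF gap_pair_flip[OF P x12(5,6) v(3)] x'(1) coded_sided[OF x'(2)] this]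
        show ?thesis using x12 by simp
      qed
      define c0 where "c0 = (x 0, cn l n)"
      define q1 where "q1 = c0 + rad l1 n *\<^sub>R d"
      define q2 where "q2 = c0 + rad l2 n *\<^sub>R d"
      have dq: "q1 \<in> draw (X \<xi>1)" "q2 \<in> draw (X \<xi>2)"
        using draw_cap[of _ _ n] x12 cap_ray[of d l1 n x1] cap_ray[of d l2 n x2] d g(4,5)
        unfolding c x1_def x2_def q1_def q2_def c0_def by metis+
      have near: "dist z (c0 + rad l' n *\<^sub>R d) < e" if "\<bar>ht l' - ht l\<bar> < e" "cn l' n = cn l n" for l'
      proof -
        have "dist z (c0 + rad l' n *\<^sub>R d) = \<bar>rad l n - rad l' n\<bar>"
          unfolding d(3) dist_norm c0_def by (simp add: scaleR_left_diff_distrib[symmetric] d(1))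
        also have "\<dots> \<le> \<bar>ht l' - ht l\<bar>" unfolding rad_def that(2) by linarith
        finally show ?thesis using that by simp
      qed
      have nq: "q1 \<in> ball z e" "q2 \<in> ball z e"
        using near[of l1] near[of l2] c h g(1,2) unfolding q1_def q2_def l1_def l2_def by auto
      have dn0: "d \<noteq> 0" using d(1) by auto
      then have neq: "q1 \<noteq> q2" using w(1) unfolding q1_def q2_def by simp
      have out: "(1 - t) *\<^sub>R q1 + t *\<^sub>R q2 \<notin> KK" if t: "0 < t" "t < 1" for t
      proof
        define \<rho> where "\<rho> = (1 - t) * rad l1 n + t * rad l2 n"
        assume "(1 - t) *\<^sub>R q1 + t *\<^sub>R q2 \<in> KK"
        moreover have "(1 - t) *\<^sub>R q1 + t *\<^sub>R q2 = c0 + \<rho> *\<^sub>R d"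
          unfolding q1_def q2_def \<rho>_def by (simp add: algebra_simps)
        ultimately obtain x' where x': "x' \<in> tent_core s" "c0 + \<rho> *\<^sub>R d \<in> draw x'" by auto
        have b: "btw (rad l1 n) (rad l2 n) \<rho>" unfolding \<rho>_def by (rule btw_convex[OF w(1) t])
        then have \<rho>0: "\<rho> > 0" using ht_minus_cn(2)[of l1 n] ht_minus_cn(2)[of l2 n] unfolding btw_def by auto
        let ?q = "c0 + \<rho> *\<^sub>R d"
        have "(\<rho> * fst d)^2 + (\<rho> * snd d)^2 = \<rho>^2 * ((fst d)^2 + (snd d)^2)"
          by (simp add: power_mult_distrib algebra_simps)
        then have q: "(fst ?q - x 0)^2 + (snd ?q - cn l n)^2 = \<rho>^2" using d(1) by (simp add: c0_def norm_1_iff)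
        have "0 \<le> \<rho> * (sg l n * fst d)" using \<rho>0 d(2) by simp
        then have q': "0 \<le> sg l n * (fst ?q - x 0)" by (simp add: c0_def mult.left_commute)
        consider "rad l1 n < \<rho>" "\<rho> < rad l2 n" | "rad l2 n < \<rho>" "\<rho> < rad l1 n" using b unfolding btw_def by blast
        then show False
        proof cases
          case 1
          have "?q \<notin> draw x'"
          proof (rule radial_gap[OF x12(1,3,5) x12(2,4,6) _ _ 1])
            fix x' l' assume "x' \<in> tent_core s" "coded x' l'" "\<And>i. i < n \<Longrightarrow> l' i = l1 i" "rad l1 n < rad l' n" "rad l' n < rad l2 n"
            then show "\<bar>x' 0 - x1 0\<bar> \<ge> \<eta>" using far[of x' l'] pre x12 unfolding btw_def by simp
          qed (use x12 pre w(2) x' q q' c in auto)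
          then show False using x' by blast
        next
          case 2
          have "?q \<notin> draw x'"
          proof (rule radial_gap[OF x12(2,4,6) x12(1,3,5) _ _ 2])
            fix x' l' assume "x' \<in> tent_core s" "coded x' l'" "\<And>i. i < n \<Longrightarrow> l' i = l2 i" "rad l2 n < rad l' n" "rad l' n < rad l1 n"
            then show "\<bar>x' 0 - x2 0\<bar> \<ge> \<eta>" using far[of x' l'] pre x12 unfolding btw_def by simp
          qed (use x12 pre w(2) x' q q' c in auto)
          then show False using x' by blast
        qed
      qed
      have "gap_cut q1 q2"
        unfolding gap_cut_def using g(3) dq neq closed_segment_KK[OF _ _ out] X_core by blast
      then show thesis using that seg nq by blast
    qed
  qed
qed

lemma small_segment_cut:
  assumes "z \<in> KK" "e > 0"
  obtains q1 q2 \<xi>1 \<xi>2 where "\<xi>1 < 0" "0 < \<xi>2" "q1 \<in> draw (X \<xi>1)" "q2 \<in> draw (X \<xi>2)" "q1 \<noteq> q2"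
    "closed_segment q1 q2 \<inter> KK = {q1, q2}" "closed_segment q1 q2 \<subseteq> ball z e"
proof -
  obtain x where "x \<in> tent_core s" "z \<in> draw x" using assms by blast
  from small_gap_cut[OF this assms(2)] obtain q1 q2 where *: "gap_cut q1 q2" "closed_segment q1 q2 \<subseteq> ball z e" .
  then obtain \<xi>1 \<xi>2 where \<xi>: "\<xi>1 * \<xi>2 < 0" "q1 \<in> draw (X \<xi>1)" "q2 \<in> draw (X \<xi>2)"
    and q: "q1 \<noteq> q2" "closed_segment q1 q2 \<inter> KK = {q1, q2}" unfolding gap_cut_def by blast
  consider "\<xi>1 < 0" "0 < \<xi>2" | "\<xi>2 < 0" "0 < \<xi>1" using \<xi>(1) by (auto simp: mult_less_0_iff)
  then show thesis
  proof cases
    case 1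
    show thesis using that[OF 1 \<xi>(2,3) q *(2)] .
  next
    case 2
    show thesis using that[OF 2 \<xi>(3,2) q(1)[symmetric]] q(2) *(2) by (simp add: closed_segment_commute insert_commute)
  qed
qed

end

text \<open>The sign flips at each zero, so consecutive zeros carry opposite signs. This allows the
  height of a code to be changed in either direction.\<close>

lemma zeros_both_signs:
  assumes zeros: "\<And>N. \<exists>n\<ge>N. \<not> l n" and w: "w = 1 \<or> w = (-1::real)"
  shows "\<exists>n\<ge>N. \<not> l n \<and> ez l n = w"
proof (rule ccontr)
  assume *: "\<not> ?thesis"
  obtain m where m: "m \<ge> N" "\<not> l m" using zeros by blast
  then have "ez l m = - w" using * ez_cases[of l m] w by force
  then have "ez l (Suc m + k) = w" for k
  proof (induction k)
    case 0
    then show ?case using m by simp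
  next
    case (Suc k)
    have e: "ez l (Suc m + k) = w" using Suc by blast
    have "N \<le> Suc m + k" using m by simp
    then have "l (Suc m + k)" using e * by blast
    then show ?case using e by simp
  qed
  moreover obtain n where "n \<ge> Suc m" "\<not> l n" using zeros by blast
  ultimately show False using * m by (metis le_Suc_ex le_trans le_add1 add_Suc_right Suc_leD)
qed

context tent_param
begin

section \<open>Density of both ends and of the complement\<close>

lemma \<sigma>_power: "u / \<sigma> ^ N = (if even N then 1 else -1) * (u * s ^ N)"
  using s1 by (simp add: \<sigma>_def power_divide)

text \<open>The end is selected by the parity of N: \<open>u\<close> is taken right of
  \<open>r\<close> with the right-branch history, so the parameter of the grafted point is (u - r)
  s^N with sign (-1)^N.\<close>

lemma dense_half:
  assumes z: "z \<in> KK" and e: "e > 0"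
  shows "\<exists>\<xi>. (if p then \<xi> > M else \<xi> < M) \<and> (\<exists>q\<in>draw (X \<xi>). dist q z < e)"
proof -
  obtain x where x: "x \<in> tent_core s" "z \<in> draw x" using z by blast
  have V: "r + \<delta>0 / 2 < r + \<delta>0" "{r + \<delta>0 / 2 <..< r + \<delta>0} \<subseteq> core"
    using \<delta>0_pos d_order by (auto simp: \<delta>0_def)
  show ?thesis
  proof (rule draw_near[OF x e V])
    fix N0 assume N0: "\<And>N. N \<ge> N0 \<Longrightarrow> \<exists>u\<in>{r + \<delta>0 / 2 <..< r + \<delta>0}. \<forall>h. hist u h \<longrightarrow> (\<exists>q\<in>draw (graft u N h). dist q z < e)"
    obtain k where k: "\<bar>M\<bar> / (\<delta>0 / 2) < s ^ k" using real_arch_pow[OF s1(1)] by blast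
    define N where "N = 2 * max N0 k + (if p then 0 else 1)"
    have N: "N \<ge> N0" "N \<ge> k" "even N = p" by (auto simp: N_def)
    have "s ^ k \<le> s ^ N" using N s1 by (simp add: power_increasing)
    then have "\<delta>0 / 2 * s ^ k \<le> \<delta>0 / 2 * s ^ N" using \<delta>0_pos by (intro mult_left_mono) auto
    moreover have "\<bar>M\<bar> < \<delta>0 / 2 * s ^ k" using k \<delta>0_pos by (simp add: pos_divide_less_eq mult.commute)
    ultimately have sN: "\<bar>M\<bar> < \<delta>0 / 2 * s ^ N" by linarith
    obtain u where u: "u \<in> {r + \<delta>0 / 2 <..< r + \<delta>0}" "\<And>h. hist u h \<Longrightarrow> (\<exists>q\<in>draw (graft u N h). dist q z < e)"
      using N0[OF N(1)] by blast
    have "u \<in> core" "u \<noteq> d1" "u \<noteq> d2" using u(1) \<delta>0_pos d_order by (auto simp: \<delta>0_def)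
    then have h: "hist u (rh u)" by (rule hist_rh)
    have "graft u N (rh u) = X ((u - r) / \<sigma> ^ (N + 0))" by (rule graft_X[OF h]) simp
    then have g: "graft u N (rh u) = X ((if p then 1 else -1) * ((u - r) * s ^ N))" using N(3) \<sigma>_power by simp
    have "\<delta>0 / 2 * s ^ N < (u - r) * s ^ N" using u(1) s1 by (intro mult_strict_right_mono) auto
    then have "if p then (if p then 1 else -1) * ((u - r) * s ^ N) > M else (if p then 1 else -1) * ((u - r) * s ^ N) < M"
      using sN by (cases p) auto
    then show ?thesis using u(2)[OF h] unfolding g by blast
  qed
qed

text \<open>A history that alternates between the two halves. It does not converge to
  \<open>r\<close>, so grafting it leaves the line.\<close>

fun alt :: "real \<Rightarrow> nat \<Rightarrow> real" where
  "alt u 0 = u"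
| "alt u (Suc i) = (if even i then 1 - alt u i / s else alt u i / s)"

lemma alt_bounds:
  assumes u: "d2 < u" "u < 1/2"
  shows "if even i then d2 < alt u i \<and> alt u i < 1/2 else d3 < alt u i \<and> 1/2 < alt u i \<and> alt u i < d1"
    "T (alt u (Suc i)) = alt u i"
proof -
  have even_step: "d3 < 1 - t / s \<and> 1/2 < 1 - t / s \<and> 1 - t / s < d1 \<and> T (1 - t / s) = t" if t: "d2 < t" "t < 1/2" for t
  proof -
    have tc: "t \<in> core" "t \<noteq> d1" "t \<noteq> d2" using t d_order by auto
    have "t / s < 1 / (2 * s)" using t s1 by (simp add: field_simps)
    then have "d3 < 1 - t / s" using d3_bound by linarith
    moreover have "1 - t / s \<noteq> 1/2" "1 - t / s \<noteq> d1" using right_pre[OF tc(1)] tc by blast+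
    moreover have "1/2 \<le> 1 - t / s \<and> 1 - t / s \<le> d1" using right_pre(1)[OF tc(1)] by (simp only: atLeastAtMost_iff)
    ultimately show ?thesis using right_pre(2)[OF tc(1)] by linarith
  qed
  have odd_step: "d2 < t / s \<and> t / s < 1/2 \<and> T (t / s) = t" if t: "d3 < t" "1/2 < t" "t < d1" for t
  proof -
    have tc: "t \<in> core" "d3 \<le> t" "t \<noteq> d1" "t \<noteq> d3" using t d_order by auto
    have "t / s \<noteq> 1/2" "t / s \<noteq> d2" using left_pre[OF tc(1,2)] tc by blast+
    moreover have "d2 \<le> t / s \<and> t / s \<le> 1/2" using left_pre(1)[OF tc(1,2)] by (simp only: atLeastAtMost_iff)
    ultimately show ?thesis using left_pre(2)[OF tc(1,2)] by linarith
  qed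
  have *: "(if even i then d2 < alt u i \<and> alt u i < 1/2 else d3 < alt u i \<and> 1/2 < alt u i \<and> alt u i < d1)" for i
  proof (induction i)
    case (Suc i)
    then show ?case using even_step odd_step by (cases "even i") auto
  qed (use u in simp)
  then show "if even i then d2 < alt u i \<and> alt u i < 1/2 else d3 < alt u i \<and> 1/2 < alt u i \<and> alt u i < d1" .
  show "T (alt u (Suc i)) = alt u i" using *[of i] even_step odd_step by (cases "even i") auto
qed

lemma codense_draw:
  assumes z: "z \<in> KK" and e: "e > 0"
  shows "\<exists>x'\<in>tent_core s - range X. \<exists>q\<in>draw x'. dist q z < e"
proof -
  obtain x where x: "x \<in> tent_core s" "z \<in> draw x" using z by blast
  have V: "d2 < 1/2" "{d2<..<1/2} \<subseteq> core" using d_order by auto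
  show ?thesis
  proof (rule draw_near[OF x e V])
    fix N0 assume N0: "\<And>N. N \<ge> N0 \<Longrightarrow> \<exists>u\<in>{d2 <..< 1/2}. \<forall>h. hist u h \<longrightarrow> (\<exists>q\<in>draw (graft u N h). dist q z < e)"
    obtain u where u: "u \<in> {d2 <..< 1/2}" "\<And>h. hist u h \<Longrightarrow> (\<exists>q\<in>draw (graft u N0 h). dist q z < e)"
      using N0[of N0] by blast
    have u': "d2 < u" "u < 1/2" using u by auto
    note ab = alt_bounds[OF u']
    have "alt u i \<in> core \<and> alt u i \<noteq> 1/2" for i using ab(1)[of i] d_order by (cases "even i") auto
    then have h: "hist u (alt u)" using ab(2) by (simp add: hist_def del: alt.simps(2))
    have "graft u N0 (alt u) \<notin> range X"
    proof
      assume "graft u N0 (alt u) \<in> range X"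
      then have "graft u N0 (alt u) \<longlonglongrightarrow> r" using range_X_iff[OF graft_core[OF h]] by blast
      then have "\<forall>\<^sub>F n in sequentially. 1/2 < graft u N0 (alt u) n" using order_tendstoD(1) d_order by blast
      then obtain M where "\<And>n. n \<ge> M \<Longrightarrow> 1/2 < graft u N0 (alt u) n" by (auto simp: eventually_sequentially)
      then have "1/2 < alt u (2 * M)" using graft_above[OF h, of N0 "2 * M"] by (metis add.commute trans_le_add1 le_add1 mult_2)
      then show False using ab(1)[of "2 * M"] by simp
    qed
    then show ?thesis using graft_core[OF h] u(2)[OF h] by blast
  qed
qed

section \<open>The top of the drawing and vertical accumulation\<close>

lemma draw_height_le: "q \<in> draw x \<Longrightarrow> snd q \<le> 1"
proof (erule draw_cases)
  fix l n assume q: "q \<in> cap x l n"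
  have "cn l n + rad l n = ht l \<or> cn l n + rad l n = ht (l(n := \<not> l n))" unfolding ht_flip rad_def by linarith
  then have "cn l n + rad l n \<le> 1" using ht_le(1) by metis
  then show "snd q \<le> 1" using cap_height(1)[OF q] by linarith
qed (simp add: ht_le)

lemma draw_height_top:
  assumes q: "q \<in> draw x" "snd q = 1" and x: "x \<in> tent_core s"
  shows "x \<in> range X"
proof -
  have "\<exists>l. coded x l \<and> ht l = 1" using q(1)
  proof (cases rule: draw_cases)
    case (1 l)
    then show ?thesis using q by auto
  next
    case (2 l n)
    have *: "cn l n + rad l n = ht l \<or> cn l n + rad l n = ht (l(n := \<not> l n))" unfolding ht_flip rad_def by linarith
    then have "cn l n + rad l n \<le> 1" using ht_le(1) by metis
    then have "cn l n + rad l n = 1" using cap_height(1)[OF 2(1)] q(2) by linarith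
    then show ?thesis using * 2 coded_flip by metis
  qed
  then obtain l where "coded x l" "l = (\<lambda>_. True)" using ht_eq_1 by blast
  then show ?thesis using range_X_code[OF x] by blast
qed

lemma draw_near_fixed_point:
  assumes "\<bar>\<xi>\<bar> < \<delta>0" "q \<in> draw (X \<xi>)"
  shows "snd q = 1"
proof -
  have gt: "X \<xi> (Suc n) > 1/2" for n
  proof -
    have "\<bar>\<xi>\<bar> / s ^ 0 < \<delta>0" using assms by simp
    then have "\<bar>\<xi>\<bar> / s ^ k < \<delta>0" for k by (rule small_mono) simp
    then have *: "X \<xi> (Suc n) = r + \<sigma> ^ Suc n * \<xi>" "\<bar>\<sigma> ^ Suc n * \<xi>\<bar> < \<delta>0" using X_far abs_\<sigma> by metis+
    show ?thesis using near_r[OF *(2)] *(1) by simp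
  qed
  show ?thesis using assms(2)
  proof (cases rule: draw_cases)
    case (1 l)
    have "l n" for n using coded_side[OF 1(2), of n] gt[of n] by (auto simp: side_def split: if_splits)
    then have "l = (\<lambda>_. True)" by auto
    then show ?thesis using 1 ht_True by simp
  next
    case (2 l n)
    then show ?thesis using gt[of n] by (simp add: last_hit_def)
  qed
qed

text \<open>Reflecting coordinate n + 1 in 1/2 turns the zero at n into a one without changing the
  coordinates up to n; right preimages then supply ones forever. The height moves in the direction
  of \<open>ez l n\<close>, so zeros of both signs give accumulation from above and below.\<close>

lemma fill_ones:
  assumes x: "x \<in> tent_core s" "coded x l" and n: "\<not> l n"
  obtains x' where "x' \<in> tent_core s" "coded x' (\<lambda>i. i < n \<longrightarrow> l i)" "\<And>i. i \<le> n \<Longrightarrow> x' i = x i"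
    "\<And>m. last_hit x m \<Longrightarrow> m < n \<Longrightarrow> last_hit x' m"
proof -
  define t where "t = 1 - x (Suc n)"
  have xc: "x (Suc n) \<in> core" "x (Suc n) \<le> 1/2" using x(1) core_iff coded_side[OF x(2), of n] n by (auto simp: side_def)
  have t: "t \<in> core" "t \<noteq> d1" "t \<noteq> d2" "t \<ge> 1/2" "T t = x n"
    using one_minus_core[OF xc(1)] xc d_order coded_br[OF x, of n] n T_right[of t] by (auto simp: t_def br_def)
  note h = hist_rh[OF t(1-3)]
  define x' where "x' = graft t (Suc n) (rh t)"
  let ?l = "\<lambda>i. i < n \<longrightarrow> l i"
  have low: "x' i = x i" if "i \<le> n" for i
  proof -
    have "Suc n - i = Suc (n - i)" using that by simp
    then have "x' i = (T ^^ (n - i)) (T t)" using that by (simp add: x'_def graft_def funpow_swap1)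
    then show ?thesis using core_funpow[OF x(1), of "n - i" i] that t(5) by simp
  qed
  have mid: "x' (Suc n) = t" by (simp add: x'_def graft_def)
  have high: "x' (Suc m) > 1/2" if m: "m > n" for m
  proof -
    obtain i where "m = Suc n + i" using m by (metis less_iff_Suc_add add_Suc)
    then show ?thesis using graft_above[OF h(1), of "Suc n" "Suc i"] h(2)[of i] by (simp add: x'_def)
  qed
  have hit: "m \<le> n \<and> x (Suc m) = 1/2" if "x' (Suc m) = 1/2" for m
  proof -
    have "m \<le> n" using high[of m] that by (metis less_irrefl not_le_imp_less)
    then show ?thesis using low[of "Suc m"] mid that by (cases "m = n") (auto simp: t_def)
  qed
  show thesis
  proof (rule that)
    show "x' \<in> tent_core s" unfolding x'_def by (rule graft_core[OF h(1)])
    show "coded x' ?l" unfolding coded_def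
    proof (intro conjI allI impI)
      fix m
      consider "m < n" | "m = n" | "n < m" by linarith
      then show "side (?l m) (x' (Suc m))"
      proof cases
        case 1
        then show ?thesis using low[of "Suc m"] coded_side[OF x(2), of m] by simp
      next
        case 2
        then show ?thesis using mid t(4) by (simp add: side_def)
      next
        case 3
        then show ?thesis using high[of m] by (simp add: side_def)
      qed
    next
      fix m j assume "x' (Suc m) = 1/2" "1 \<le> j" "j \<le> m"
      moreover from this have "m \<le> n" "x (Suc m) = 1/2" using hit by auto
      moreover from calculation have "m - j < n" by linarith
      ultimately show "?l (m - j) = \<kappa> j" using coded_kneading[OF x(2), of m j] by simp
    qed
    show "x' i = x i" if "i \<le> n" for i using low[OF that] .
    show "last_hit x' m" if "last_hit x m" "m < n" for m
      using that hit low[of "Suc m"] unfolding last_hit_def by (metis Suc_leI)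
  qed
qed

lemma fill_ones_height:
  assumes "\<not> l n"
  shows "ez l n * (ht (\<lambda>i. i < n \<longrightarrow> l i) - ht l) > 0" "\<bar>ht (\<lambda>i. i < n \<longrightarrow> l i) - ht l\<bar> \<le> 1 / 3 ^ n"
proof -
  let ?l = "\<lambda>i. i < n \<longrightarrow> l i"
  have c: "cn ?l n = cn l n" "ez ?l n = ez l n" by (auto intro: cn_cong ez_cong)
  have "ht ?l - ht l = ez l n * (rad ?l n + rad l n)"
    using ht_minus_cn(1)[of ?l n] ht_minus_cn(1)[of l n] assms c by (simp add: algebra_simps)
  then have "ez l n * (ht ?l - ht l) = rad ?l n + rad l n" by (simp add: mult.assoc[symmetric])
  then show "ez l n * (ht ?l - ht l) > 0" using ht_minus_cn(2)[of ?l n] ht_minus_cn(2)[of l n] by simp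
  show "\<bar>ht ?l - ht l\<bar> \<le> 1 / 3 ^ n" by (rule ht_close) simp
qed

lemma fill_ones_near:
  assumes x: "x \<in> tent_core s" "x \<notin> range X" "coded x l" and w: "w = 1 \<or> w = -1" and e: "e > 0"
  obtains x' l' where "x' \<in> tent_core s" "coded x' l'" "x' 0 = x 0" "0 < w * (ht l' - ht l)" "w * (ht l' - ht l) < e"
    "\<And>i. i \<le> m \<Longrightarrow> l' i = l i" "last_hit x m \<Longrightarrow> last_hit x' m"
proof -
  obtain k where k: "\<And>n. n \<ge> k \<Longrightarrow> 1 / 3 ^ n < e" using third_power_small[OF e] by blast
  have "\<exists>n\<ge>N. \<not> l n" for N using range_X_code[OF x(1,3)] x(2) by blast
  then obtain n where n: "n \<ge> max k (Suc m)" "\<not> l n" "ez l n = w" using zeros_both_signs w by metis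
  obtain x' where x': "x' \<in> tent_core s" "coded x' (\<lambda>i. i < n \<longrightarrow> l i)" "\<And>i. i \<le> n \<Longrightarrow> x' i = x i"
    "\<And>m. last_hit x m \<Longrightarrow> m < n \<Longrightarrow> last_hit x' m" using fill_ones[OF x(1,3) n(2)] by metis
  note H = fill_ones_height[of l n, OF n(2)]
  have "1 / 3 ^ n < e" using k n by simp
  then have "w * (ht (\<lambda>i. i < n \<longrightarrow> l i) - ht l) < e" using H w by auto
  moreover have "x' 0 = x 0" using x'(3) by simp
  ultimately show thesis using that[OF x'(1,2)] H(1) x'(4)[of m] n by simp
qed

lemma vertical_accumulation:
  assumes x: "x \<in> tent_core s" "x \<notin> range X" "z \<in> draw x" and w: "w = 1 \<or> w = -1" and e: "e > 0"
  shows "\<exists>y. 0 < w * (y - snd z) \<and> w * (y - snd z) < e \<and> (fst z, y) \<in> KK"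
  using x(3)
proof (cases rule: draw_cases)
  case (1 l)
  from fill_ones_near[OF x(1,2) 1(2) w e] obtain x' l' where "x' \<in> tent_core s" "coded x' l'" "x' 0 = x 0"
    "0 < w * (ht l' - ht l)" "w * (ht l' - ht l) < e" by metis
  then show ?thesis using draw_horizontal[of x' l'] 1 by (intro exI[of _ "ht l'"]) auto
next
  case (2 l n)
  obtain a y where z: "z = (a, y)" by fastforce
  define f where "f t = (a - x 0)^2 + (t - cn l n)^2" for t
  define \<rho> where "\<rho> = rad l n"
  have \<rho>: "\<rho> > 0" "f y = \<rho>^2" "0 \<le> sg l n * (a - x 0)" using 2(1) ht_minus_cn(2) by (auto simp: \<rho>_def f_def cap_iff z)
  \<comment> \<open>Since f is symmetric about the centre of the cap, one trial step may return to
    the value f y, but not both e/2 and e/3. A cap with squared radius between f y and f y1 is then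
    met on the same vertical by the intermediate value theorem.\<close>
  obtain y1 where y1: "0 < w * (y1 - y)" "w * (y1 - y) < e" "f y1 \<noteq> f y"
  proof (cases "f (y + w * (e / 2)) = f y")
    case False
    then show thesis using that[of "y + w * (e / 2)"] w e by auto
  next
    case True
    then have a: "\<bar>y + w * (e / 2) - cn l n\<bar> = \<bar>y - cn l n\<bar>" by (simp add: f_def abs_eq_iff power2_eq_iff)
    have "f (y + w * (e / 3)) \<noteq> f y"
    proof
      assume "f (y + w * (e / 3)) = f y"
      then have "\<bar>y + w * (e / 3) - cn l n\<bar> = \<bar>y - cn l n\<bar>" by (simp add: f_def abs_eq_iff power2_eq_iff)
      then have "y + w * (e / 3) - cn l n = y - cn l n \<or> y + w * (e / 3) - cn l n = - (y - cn l n)"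
        "y + w * (e / 2) - cn l n = y - cn l n \<or> y + w * (e / 2) - cn l n = - (y - cn l n)"
        using a by (simp_all only: abs_eq_iff)
      then show False using w e by auto
    qed
    then show thesis using that[of "y + w * (e / 3)"] w e by auto
  qed
  define \<rho>1 where "\<rho>1 = sqrt (f y1)"
  have \<rho>1: "\<rho>1 \<ge> 0" "f y1 = \<rho>1^2" by (auto simp: \<rho>1_def f_def)
  then have "\<rho>1 \<noteq> \<rho>" using y1(3) \<rho>(2) by auto
  \<comment> \<open>v tells whether the radius has to grow or shrink, and v * E whether the height
    of the code has to rise or fall for that.\<close>
  define v where "v = sgn (\<rho>1 - \<rho>)"
  have v: "v = 1 \<or> v = -1" "\<bar>\<rho>1 - \<rho>\<bar> = v * (\<rho>1 - \<rho>)" "\<bar>\<rho>1 - \<rho>\<bar> > 0" using \<open>\<rho>1 \<noteq> \<rho>\<close> by (auto simp: v_def sgn_if abs_if)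
  define E where "E = ez l (Suc n)"
  have E: "E = 1 \<or> E = -1" using ez_cases unfolding E_def .
  have vE: "v * E = 1 \<or> v * E = -1" using v(1) E by auto
  obtain x' l' where x': "x' \<in> tent_core s" "coded x' l'" "x' 0 = x 0"
    "0 < v * E * (ht l' - ht l)" "v * E * (ht l' - ht l) < \<bar>\<rho>1 - \<rho>\<bar>"
    "\<And>i. i \<le> n \<Longrightarrow> l' i = l i" "last_hit x' n" using fill_ones_near[OF x(1,2) 2(2) vE v(3), of n] 2(3) by metis
  have c: "cn l' n = cn l n" "ez l' (Suc n) = E" "sg l' n = sg l n"
    unfolding E_def using x'(6) by (auto intro: cn_cong ez_cong sg_cong simp del: ez.simps)
  define \<rho>' where "\<rho>' = rad l' n"
  have "ht l' - ht l = E * (\<rho>' - \<rho>)"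
    using ht_minus_cn(1)[of l' n] ht_minus_cn(1)[of l n] c by (simp add: \<rho>'_def \<rho>_def E_def algebra_simps del: ez.simps)
  moreover have "v * E * (E * (\<rho>' - \<rho>)) = v * (E * E) * (\<rho>' - \<rho>)" by (simp only: mult.assoc)
  ultimately have "v * E * (ht l' - ht l) = v * (\<rho>' - \<rho>)" using E by auto
  then have "0 < v * (\<rho>' - \<rho>)" "v * (\<rho>' - \<rho>) < v * (\<rho>1 - \<rho>)" using x'(4,5) v(2) by linarith+
  then have b: "\<rho> < \<rho>' \<and> \<rho>' < \<rho>1 \<or> \<rho>1 < \<rho>' \<and> \<rho>' < \<rho>" using v(1) by auto
  have "\<rho>' > 0" unfolding \<rho>'_def by (rule ht_minus_cn)
  then have b2: "\<rho>^2 < \<rho>'^2 \<and> \<rho>'^2 < \<rho>1^2 \<or> \<rho>1^2 < \<rho>'^2 \<and> \<rho>'^2 < \<rho>^2"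
    using b \<rho>(1) \<rho>1(1) power_strict_mono[of _ _ 2] by (metis less_imp_le zero_less_numeral)
  have "continuous_on UNIV f" unfolding f_def by (intro continuous_intros)
  then have "connected (f ` closed_segment y y1)" by (intro connected_continuous_image) (auto intro: continuous_on_subset)
  then have "\<rho>'^2 \<in> f ` closed_segment y y1"
    using connectedD_interval[of "f ` closed_segment y y1" "f y" "f y1"] connectedD_interval[of "f ` closed_segment y y1" "f y1" "f y"]
      b2 \<rho>(2) \<rho>1(2) by (metis ends_in_segment image_eqI less_imp_le)
  then obtain y' where y': "y' \<in> closed_segment y y1" "f y' = \<rho>'^2" by auto
  have "y' \<noteq> y" using y'(2) \<rho>(2) b2 by auto
  then have "0 < w * (y' - y)" "w * (y' - y) \<le> w * (y1 - y)" using y'(1) y1(1) w by (auto simp: closed_segment_eq_real_ivl split: if_splits)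
  moreover have "(a, y') \<in> cap x' l' n" using y'(2) c x'(3) \<rho>(3) by (simp add: cap_iff f_def \<rho>'_def)
  then have "(a, y') \<in> KK" using draw_cap x' by blast
  ultimately show ?thesis using y1(2) z by (intro exI[of _ y']) auto
qed

end

section \<open>Compactness of the drawing\<close>

lemma prefix_of_close_heights:
  assumes "\<bar>ht l - ht l'\<bar> < 1 / 3 ^ n" "i < n"
  shows "l i = l' i"
proof (rule ccontr)
  assume "l i \<noteq> l' i"
  from cn_separated[of i n l l', OF assms(2) this] have "\<bar>cn l n - cn l' n\<bar> \<ge> 2 / 3 ^ n" .
  moreover have "2 / 3 ^ n = 1 / (3::real) ^ n + 1 / (2 * 3 ^ n) + 1 / (2 * 3 ^ n)" by (simp add: field_simps)
  ultimately show False using assms(1) ht_near_cn[of l n] ht_near_cn[of l' n] by linarith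
qed

context tent_param
begin

lemma codes_converge:
  assumes "(\<lambda>k. ht (L k)) \<longlonglongrightarrow> y"
  obtains l where "\<And>n. \<forall>\<^sub>F k in sequentially. L k n = l n" "y = ht l"
proof -
  have "\<exists>b. \<forall>\<^sub>F k in sequentially. L k n = b" for n
  proof -
    have "Cauchy (\<lambda>k. ht (L k))" using assms by (rule LIMSEQ_imp_Cauchy)
    then obtain K where K: "\<And>k. k \<ge> K \<Longrightarrow> dist (ht (L k)) (ht (L K)) < 1 / 3 ^ Suc n"
      unfolding Cauchy_def by (metis order_refl divide_pos_pos zero_less_one zero_less_numeral zero_less_power)
    have "L k n = L K n" if "k \<ge> K" for k
      using prefix_of_close_heights[of "L k" "L K" "Suc n" n] K[OF that] by (simp add: dist_real_def)
    then show ?thesis unfolding eventually_sequentially by blast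
  qed
  then obtain l where l: "\<And>n. \<forall>\<^sub>F k in sequentially. L k n = l n" by metis
  have "(\<lambda>k. ht (L k)) \<longlonglongrightarrow> ht l"
  proof (rule tendstoI)
    fix e :: real assume "e > 0"
    then obtain m where m: "\<And>k. k \<ge> m \<Longrightarrow> 1 / 3 ^ k < e" using third_power_small by blast
    have "\<forall>\<^sub>F k in sequentially. \<forall>i\<in>{..<m}. L k i = l i" using l by (intro eventually_ball_finite) auto
    then show "\<forall>\<^sub>F k in sequentially. dist (ht (L k)) (ht l) < e"
    proof eventually_elim
      case (elim k)
      then have "\<bar>ht (L k) - ht l\<bar> \<le> 1 / 3 ^ m" by (intro ht_close) auto
      then show ?case using m[of m] by (simp add: dist_real_def)
    qed
  qed
  then have "y = ht l" using assms LIMSEQ_unique by blast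
  then show thesis using that l by blast
qed

text \<open>Symbols stabilize, and inverse branches carry the limit of coordinate 0 to all deeper
  ones. The delicate point is the kneading condition where the limit visits 1/2 and the
  approximating orbits pass beside it: by \<open>after_hit\<close> these already follow the kneading
  sequence.\<close>

lemma coded_limit:
  assumes x: "\<And>k. xs k \<in> tent_core s" "\<And>k. coded (xs k) (L k)"
    and a: "(\<lambda>k. xs k 0) \<longlonglongrightarrow> a" and y: "(\<lambda>k. ht (L k)) \<longlonglongrightarrow> y"
  obtains x l where "x \<in> tent_core s" "coded x l" "a = x 0" "y = ht l"
    "\<And>n. (\<lambda>k. xs k n) \<longlonglongrightarrow> x n" "\<And>n. \<forall>\<^sub>F k in sequentially. L k n = l n"
proof -
  obtain l where l: "\<And>n. \<forall>\<^sub>F k in sequentially. L k n = l n" "y = ht l" using codes_converge[OF y] by blast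
  define ib :: "bool \<Rightarrow> real \<Rightarrow> real" where "ib b t = (if b then 1 - t / s else t / s)" for b t
  have ib: "xs k (Suc n) = ib (L k n) (xs k n)" for k n
    using coded_br[OF x, of k n] s1 by (simp add: ib_def br_def)
  define x where "x = rec_nat a (\<lambda>n t. ib (l n) t)"
  have x_simps: "x 0 = a" "x (Suc n) = ib (l n) (x n)" for n by (simp_all add: x_def)
  have lim: "(\<lambda>k. xs k n) \<longlonglongrightarrow> x n" for n
  proof (induction n)
    case 0
    show ?case using a x_simps by simp
  next
    case (Suc n)
    then have "(\<lambda>k. ib (l n) (xs k n)) \<longlonglongrightarrow> x (Suc n)"
      unfolding x_simps ib_def using s1 by (cases "l n") (auto intro!: tendsto_intros)
    moreover have "\<forall>\<^sub>F k in sequentially. ib (l n) (xs k n) = xs k (Suc n)"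
      using l(1)[of n] by eventually_elim (simp add: ib)
    ultimately show ?case by (rule Lim_transform_eventually)
  qed
  have bounds: "x n \<in> core" for n
  proof -
    have "d2 \<le> xs k n \<and> xs k n \<le> d1" for k using x(1)[of k] core_iff by auto
    then show ?thesis using LIMSEQ_le_const[OF lim[of n], of d2] LIMSEQ_le_const2[OF lim[of n], of d1] by auto
  qed
  have step: "T (x (Suc n)) = x n" for n
  proof -
    have "(\<lambda>k. T (xs k (Suc n))) \<longlonglongrightarrow> T (x (Suc n))"
      using continuous_on_tendsto_compose[OF T_continuous[of UNIV] lim[of "Suc n"]] by simp
    moreover have "T (xs k (Suc n)) = xs k n" for k using x(1) core_iff by blast
    ultimately show ?thesis using LIMSEQ_unique[OF lim[of n]] by simp
  qed
  have xc: "x \<in> tent_core s" using bounds step core_iff by blast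
  have "coded x l" unfolding coded_def
  proof (intro conjI allI impI)
    fix n
    have ev: "\<forall>\<^sub>F k in sequentially. side (l n) (xs k (Suc n))"
      using l(1)[of n]
    proof eventually_elim
      case (elim k)
      then show ?case using coded_side[OF x(2)[of k], of n] by simp
    qed
    show "side (l n) (x (Suc n))"
    proof (cases "l n")
      case True
      then have "\<forall>\<^sub>F k in sequentially. 1/2 \<le> xs k (Suc n)" using ev by (simp add: side_def)
      then have "1/2 \<le> x (Suc n)" by (intro tendsto_lowerbound[OF lim]) auto
      then show ?thesis using True by (simp add: side_def)
    next
      case False
      then have "\<forall>\<^sub>F k in sequentially. xs k (Suc n) \<le> 1/2" using ev by (simp add: side_def)
      then have "x (Suc n) \<le> 1/2" by (intro tendsto_upperbound[OF lim]) auto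
      then show ?thesis using False by (simp add: side_def)
    qed
  next
    fix n j assume hit: "x (Suc n) = 1/2" and j: "1 \<le> j" "j \<le> n"
    obtain \<delta> where \<delta>: "\<delta> > 0" "\<And>t i. 0 < \<bar>t\<bar> \<Longrightarrow> \<bar>t\<bar> < \<delta> \<Longrightarrow> 1 \<le> i \<Longrightarrow> i \<le> n \<Longrightarrow>
       (T ^^ i) (1/2 + t) \<noteq> 1/2 \<and> \<kappa> i = ((T ^^ i) (1/2 + t) > 1/2)" using after_hit[of n] by blast
    have "\<forall>\<^sub>F k in sequentially. dist (xs k (Suc n)) (1/2) < \<delta>" using tendstoD[OF lim[of "Suc n"] \<delta>(1)] hit by simp
    then have "\<forall>\<^sub>F k in sequentially. l (n - j) = \<kappa> j" using l(1)[of "n - j"]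
    proof eventually_elim
      case (elim k)
      show ?case
      proof (cases "xs k (Suc n) = 1/2")
        case True
        then show ?thesis using coded_kneading[OF x(2) _ j] elim by metis
      next
        case False
        define t where "t = xs k (Suc n) - 1/2"
        have t: "0 < \<bar>t\<bar>" "\<bar>t\<bar> < \<delta>" "xs k (Suc n) = 1/2 + t" using False elim by (auto simp: t_def dist_real_def)
        have "(T ^^ j) (xs k (j + Suc (n - j))) = xs k (Suc (n - j))" by (rule core_funpow[OF x(1)])
        moreover have "j + Suc (n - j) = Suc n" using j by simp
        ultimately have "xs k (Suc (n - j)) = (T ^^ j) (1/2 + t)" using t by simp
        then show ?thesis using \<delta>(2)[OF t(1,2) j] coded_side[OF x(2), of k "n - j"] elim(2) side_gt by metis
      qed
    qed
    then show "l (n - j) = \<kappa> j" by (simp add: eventually_const_iff)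
  qed
  then show thesis using that[OF xc _ _ l(2) lim l(1)] x_simps(1) by simp
qed

definition level_cap :: "(real \<times> real) \<Rightarrow> (nat \<Rightarrow> real) \<Rightarrow> (nat \<Rightarrow> bool) \<Rightarrow> nat \<Rightarrow> bool" where
  "level_cap q x l n \<longleftrightarrow> last_hit x n \<and> q \<in> cap x l n"

lemma KK_point:
  assumes "q \<in> KK"
  obtains x l where "x \<in> tent_core s" "coded x l" "q = (x 0, ht l) \<or> (\<exists>n. level_cap q x l n)"
  using assms unfolding draw_def level_cap_def by blast

lemma level_cap_dist:
  assumes "level_cap q x l n"
  shows "dist q (x 0, ht l) \<le> 2 / 3 ^ n"
proof -
  have h: "\<bar>snd q - cn l n\<bar> \<le> rad l n" "\<bar>fst q - x 0\<bar> \<le> rad l n" using assms cap_height unfolding level_cap_def by blast+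
  have "dist q (x 0, ht l) \<le> \<bar>fst q - x 0\<bar> + \<bar>snd q - ht l\<bar>" using dist_Pair_le[of "fst q" "snd q"] by simp
  also have "\<bar>snd q - ht l\<bar> \<le> \<bar>snd q - cn l n\<bar> + rad l n" unfolding rad_def by linarith
  also have "\<bar>fst q - x 0\<bar> + (\<bar>snd q - cn l n\<bar> + rad l n) \<le> 4 * rad l n" using h ht_minus_cn(2)[of l n] by linarith
  also have "4 * rad l n \<le> 2 / 3 ^ n" using rad_le[of l n] by (simp add: field_simps)
  finally show ?thesis by linarith
qed

lemma KK_bounded: "bounded KK"
proof -
  have "dist (0, 0) q \<le> 4" if qK: "q \<in> KK" for q
  proof -
    obtain x l where x: "x \<in> tent_core s" "coded x l" "q = (x 0, ht l) \<or> (\<exists>n. level_cap q x l n)" by (rule KK_point[OF qK])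
    have "(2::real) / 3 ^ n \<le> 2" for n by (simp add: divide_le_eq)
    then have "dist q (x 0, ht l) \<le> 2" using x(3) level_cap_dist by (metis dist_self order_trans zero_le_numeral)
    moreover have "x 0 \<in> core" using x core_iff by blast
    then have "\<bar>x 0\<bar> \<le> 1" using d_order by auto
    then have "dist (0, 0) (x 0, ht l) \<le> 2" using dist_Pair_le[of 0 0 "x 0" "ht l"] ht_le[of l] by linarith
    ultimately show ?thesis by (metis dist_commute dist_triangle_le add_mono numeral_Bit0)
  qed
  then show ?thesis unfolding bounded_def by blast
qed

text \<open>Along a subsequence the codes at both ends of the caps converge to codes of one orbit
  that still differ at n. So n is the last hit of the limit, and the caps converge to a cap.\<close>

lemma level_cap_limit:
  assumes x: "\<And>k. xs k \<in> tent_core s" "\<And>k. coded (xs k) (L k)" "\<And>k. level_cap (f k) (xs k) (L k) n" and f: "f \<longlonglongrightarrow> z"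
  shows "z \<in> KK"
proof -
  have "(xs k 0, ht (L k)) \<in> {0..1} \<times> {0..1}" for k
  proof -
    have "xs k 0 \<in> core" using x(1) core_iff by blast
    then show ?thesis using d_order ht_le[of "L k"] by auto
  qed
  moreover have "compact ({0..1} \<times> {0..1} :: (real \<times> real) set)" by (intro compact_Times) auto
  ultimately obtain p \<rho> where \<rho>: "strict_mono \<rho>" "((\<lambda>k. (xs k 0, ht (L k))) \<circ> \<rho>) \<longlonglongrightarrow> p"
    unfolding compact_def by meson
  have pl: "(\<lambda>k. xs (\<rho> k) 0) \<longlonglongrightarrow> fst p" "(\<lambda>k. ht (L (\<rho> k))) \<longlonglongrightarrow> snd p"
    using tendsto_fst[OF \<rho>(2)] tendsto_snd[OF \<rho>(2)] by (simp_all add: o_def)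
  obtain x l where xl: "x \<in> tent_core s" "coded x l" "fst p = x 0" "snd p = ht l"
    "\<And>n. (\<lambda>k. xs (\<rho> k) n) \<longlonglongrightarrow> x n" "\<And>n. \<forall>\<^sub>F k in sequentially. L (\<rho> k) n = l n"
    using coded_limit[OF x(1) x(2) pl] by blast
  have lh: "last_hit (xs (\<rho> k)) n" for k using x(3) by (simp add: level_cap_def)
  let ?M = "\<lambda>k. (L (\<rho> k))(n := \<not> L (\<rho> k) n)"
  have ev: "\<forall>\<^sub>F k in sequentially. \<forall>i\<in>{..<n}. L (\<rho> k) i = l i" using xl(6) by (intro eventually_ball_finite) auto
  have cnl: "\<forall>\<^sub>F k in sequentially. cn (L (\<rho> k)) n = cn l n \<and> sg (L (\<rho> k)) n = sg l n"
    using ev by eventually_elim (auto intro: cn_cong sg_cong)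
  have cnt: "(\<lambda>k. cn (L (\<rho> k)) n) \<longlonglongrightarrow> cn l n"
    by (rule Lim_transform_eventually[OF tendsto_const]) (use cnl in eventually_elim, simp)
  have "(\<lambda>k. 2 * cn (L (\<rho> k)) n - ht (L (\<rho> k))) \<longlonglongrightarrow> 2 * cn l n - ht l" using pl(2) xl(4) by (intro tendsto_intros cnt) simp
  then have M: "(\<lambda>k. ht (?M k)) \<longlonglongrightarrow> 2 * cn l n - ht l" unfolding ht_flip .
  obtain x' l' where xl': "x' \<in> tent_core s" "coded x' l'" "fst p = x' 0" "2 * cn l n - ht l = ht l'" "\<And>n. (\<lambda>k. xs (\<rho> k) n) \<longlonglongrightarrow> x' n" "\<And>n. \<forall>\<^sub>F k in sequentially. ?M k n = l' n"
    by (rule coded_limit[of "\<lambda>k. xs (\<rho> k)" ?M, OF x(1) coded_flip[OF x(2) lh] pl(1) M]) (rule that, assumption+)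
  have "x' = x" using LIMSEQ_unique[OF xl'(5) xl(5)] by (intro ext)
  moreover have "l n \<noteq> l' n"
  proof
    assume "l n = l' n"
    have "\<forall>\<^sub>F k in sequentially. False" using xl(6)[of n] xl'(6)[of n] by eventually_elim (use \<open>l n = l' n\<close> in simp)
    then show False by simp
  qed
  ultimately have lhx: "last_hit x n" using flip_last_hit[OF xl(2)] xl'(2) xl(1) by blast
  have fl: "(\<lambda>k. f (\<rho> k)) \<longlonglongrightarrow> z" using LIMSEQ_subseq_LIMSEQ[OF f \<rho>(1)] by (simp add: o_def)
  note fl1 = tendsto_fst[OF fl] and fl2 = tendsto_snd[OF fl]
  have c: "(fst (f (\<rho> k)) - xs (\<rho> k) 0)^2 + (snd (f (\<rho> k)) - cn (L (\<rho> k)) n)^2 = (rad (L (\<rho> k)) n)^2"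
    "0 \<le> sg (L (\<rho> k)) n * (fst (f (\<rho> k)) - xs (\<rho> k) 0)" for k
    using x(3)[of "\<rho> k"] unfolding level_cap_def cap_iff by blast+
  have "(\<lambda>k. (fst (f (\<rho> k)) - xs (\<rho> k) 0)^2 + (snd (f (\<rho> k)) - cn (L (\<rho> k)) n)^2) \<longlonglongrightarrow> (fst z - x 0)^2 + (snd z - cn l n)^2"
    by (intro tendsto_intros fl1 fl2 xl(5) cnt)
  moreover have "(\<lambda>k. (rad (L (\<rho> k)) n)^2) \<longlonglongrightarrow> (rad l n)^2"
    unfolding rad_def using pl(2) xl(4) by (intro tendsto_intros cnt) simp
  ultimately have 1: "(fst z - x 0)^2 + (snd z - cn l n)^2 = (rad l n)^2" unfolding c(1) by (rule LIMSEQ_unique)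
  have "(\<lambda>k. sg l n * (fst (f (\<rho> k)) - xs (\<rho> k) 0)) \<longlonglongrightarrow> sg l n * (fst z - x 0)" by (intro tendsto_intros fl1 xl(5))
  moreover have "\<forall>\<^sub>F k in sequentially. 0 \<le> sg l n * (fst (f (\<rho> k)) - xs (\<rho> k) 0)"
    using cnl by eventually_elim (metis c(2))
  ultimately have 2: "0 \<le> sg l n * (fst z - x 0)" by (intro tendsto_lowerbound) auto
  have "z \<in> cap x l n" using 1 2 by (simp add: cap_iff)
  then show ?thesis using draw_cap[OF xl(2) lhx] xl(1) by blast
qed

text \<open>Either infinitely many points lie on caps of one level, or the caps shrink and their
  points may be replaced by end points of basic arcs.\<close>

lemma KK_closed: "closed KK"
  unfolding closed_sequential_limits
proof (intro allI impI, elim conjE)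
  fix f z assume fK: "\<forall>k. f k \<in> KK" and f: "f \<longlonglongrightarrow> z"
  have "\<forall>k. \<exists>x l. x \<in> tent_core s \<and> coded x l \<and> (f k = (x 0, ht l) \<or> (\<exists>n. level_cap (f k) x l n))" using KK_point fK by metis
  then obtain xs L where x: "\<And>k. xs k \<in> tent_core s" "\<And>k. coded (xs k) (L k)"
    "\<And>k. f k = (xs k 0, ht (L k)) \<or> (\<exists>n. level_cap (f k) (xs k) (L k) n)" by metis
  show "z \<in> KK"
  proof (cases "\<exists>n. infinite {k. level_cap (f k) (xs k) (L k) n}")
    case True
    then obtain n where n: "infinite {k. level_cap (f k) (xs k) (L k) n}" by blast
    define \<rho> where "\<rho> = enumerate {k. level_cap (f k) (xs k) (L k) n}"
    have \<rho>: "strict_mono \<rho>" "\<And>k. level_cap (f (\<rho> k)) (xs (\<rho> k)) (L (\<rho> k)) n"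
      using strict_mono_enumerate[OF n] enumerate_in_set[OF n] unfolding \<rho>_def by auto
    have "(\<lambda>k. f (\<rho> k)) \<longlonglongrightarrow> z" using LIMSEQ_subseq_LIMSEQ[OF f \<rho>(1)] by (simp add: o_def)
    then show ?thesis by (rule level_cap_limit[of "\<lambda>k. xs (\<rho> k)" "\<lambda>k. L (\<rho> k)", OF x(1,2) \<rho>(2)])
  next
    case False
    have "(\<lambda>k. dist (f k) (xs k 0, ht (L k))) \<longlonglongrightarrow> 0"
    proof (rule tendstoI)
      fix e :: real assume "e > 0"
      then obtain m where m: "\<And>k. k \<ge> m \<Longrightarrow> 1 / 3 ^ k < e / 2" using third_power_small[of "e / 2"] by auto
      have "finite (\<Union>n<m. {k. level_cap (f k) (xs k) (L k) n})" using False by simp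
      then have "\<forall>\<^sub>F k in sequentially. k \<notin> (\<Union>n<m. {k. level_cap (f k) (xs k) (L k) n})"
        unfolding cofinite_eq_sequentially[symmetric] eventually_cofinite by simp
      then show "\<forall>\<^sub>F k in sequentially. dist (dist (f k) (xs k 0, ht (L k))) 0 < e"
      proof eventually_elim
        case (elim k)
        from x(3)[of k] show ?case
        proof
          assume "\<exists>n. level_cap (f k) (xs k) (L k) n"
          then obtain n where n: "level_cap (f k) (xs k) (L k) n" by blast
          then have "n \<ge> m" using elim not_le_imp_less by blast
          then have "2 / 3 ^ n < e" using m[of n] by simp
          then show ?thesis using level_cap_dist[OF n] by simp
        qed (use \<open>e > 0\<close> in simp)
      qed
    qed
    then have d0: "(\<lambda>k. dist (f k) (xs k 0, ht (L k))) \<longlonglongrightarrow> 0" .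
    have h: "(\<lambda>k. (xs k 0, ht (L k))) \<longlonglongrightarrow> z"
    proof (rule tendstoI)
      fix e :: real assume "e > 0"
      then have e2: "e / 2 > 0" by simp
      show "\<forall>\<^sub>F k in sequentially. dist (xs k 0, ht (L k)) z < e"
        using tendstoD[OF d0 e2] tendstoD[OF f e2]
      proof eventually_elim
        case (elim k)
        then show ?case using dist_triangle3[of "(xs k 0, ht (L k))" z "f k"] by (simp add: dist_real_def)
      qed
    qed
    have h1: "(\<lambda>k. xs k 0) \<longlonglongrightarrow> fst z" and h2: "(\<lambda>k. ht (L k)) \<longlonglongrightarrow> snd z"
      using tendsto_fst[OF h] tendsto_snd[OF h] by simp_all
    obtain x' l where "x' \<in> tent_core s" "coded x' l" "fst z = x' 0" "snd z = ht l"
      using coded_limit[OF x(1,2) h1 h2] by metis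
    then show ?thesis using draw_horizontal[of x' l] by (metis UN_iff prod.collapse)
  qed
qed

lemma KK_compact: "compact KK"
  using KK_bounded KK_closed compact_eq_bounded_closed by blast

section \<open>The arc component as a line\<close>

text \<open>Parameters at which the drawing passes through a semicircle from one basic arc to
  another.\<close>

definition turns :: "real set" where
  "turns = {\<xi>. \<exists>n. X \<xi> (Suc n) = 1/2}"

lemma T_fibre_finite: "finite {t. T t = y}"
proof (rule finite_subset)
  show "{t. T t = y} \<subseteq> {y / s, 1 - y / s}"
  proof
    fix t assume "t \<in> {t. T t = y}"
    then have "s * t = y \<or> s * (1 - t) = y" by (auto simp: tent_def min_def split: if_splits)
    then show "t \<in> {y / s, 1 - y / s}" using s1 by (auto simp: field_simps)
  qed
qed simp

lemma Tn_fibre_finite: "finite {t. (T ^^ n) t = y}"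
proof (induction n arbitrary: y)
  case (Suc n)
  have "{t. (T ^^ Suc n) t = y} = (\<Union>u\<in>{u. T u = y}. {t. (T ^^ n) t = u})" by auto
  then show ?case using T_fibre_finite Suc by simp
qed simp

lemma uniform_far:
  obtains N where "\<And>\<xi> n. \<bar>\<xi>\<bar> \<le> B \<Longrightarrow> n \<ge> N \<Longrightarrow> X \<xi> n = r + \<sigma> ^ n * \<xi> \<and> X \<xi> (Suc n) \<noteq> 1/2"
proof -
  obtain k where k: "\<bar>B\<bar> / s ^ k < \<delta>0" using small_exists by blast
  have *: "X \<xi> n = r + \<sigma> ^ n * \<xi> \<and> \<bar>\<sigma> ^ n * \<xi>\<bar> < \<delta>0" if "\<bar>\<xi>\<bar> \<le> B" "n \<ge> k" for \<xi> n
  proof -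
    have "\<bar>\<xi>\<bar> / s ^ k \<le> \<bar>B\<bar> / s ^ k" using that s1 by (intro divide_right_mono) auto
    then have "\<bar>\<xi>\<bar> / s ^ k < \<delta>0" using k by linarith
    then have "\<bar>\<xi>\<bar> / s ^ n < \<delta>0" "\<bar>\<xi>\<bar> / s ^ Suc n < \<delta>0" using small_mono that by (metis le_Suc_eq)+
    then show ?thesis using X_far abs_\<sigma> by metis
  qed
  have "X \<xi> (Suc n) \<noteq> 1/2" if "\<bar>\<xi>\<bar> \<le> B" "n \<ge> k" for \<xi> n
    using *[of \<xi> "Suc n"] near_r[of "\<sigma> ^ Suc n * \<xi>"] that by simp
  then show thesis using that * by blast
qed

text \<open>Deep coordinates of bounded parameters stay near \<open>r\<close>, so only finitely many
  coordinates can be 1/2, and each of them only finitely often because the fibres of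
  \<open>T ^^ M\<close> are finite.\<close>

lemma turns_finite: "finite (turns \<inter> {a..b})"
proof -
  define B where "B = \<bar>a\<bar> + \<bar>b\<bar>"
  obtain N where N: "\<And>\<xi> n. \<bar>\<xi>\<bar> \<le> B \<Longrightarrow> n \<ge> N \<Longrightarrow> X \<xi> n = r + \<sigma> ^ n * \<xi> \<and> X \<xi> (Suc n) \<noteq> 1/2"
    by (rule uniform_far[of B]) (rule that, assumption+)
  obtain M where M: "\<bar>B\<bar> / s ^ M < \<delta>0" using small_exists by blast
  have B: "\<bar>\<xi>\<bar> \<le> B" if "\<xi> \<in> {a..b}" for \<xi> using that unfolding B_def by auto
  have fin: "finite {\<xi> \<in> {a..b}. X \<xi> n = 1/2}" for n
  proof (rule inj_on_finite)
    have s0: "\<sigma> \<noteq> 0" using s1 by (simp add: \<sigma>_def)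
    show "inj_on (\<lambda>\<xi>. r + \<sigma> ^ (n + M) * \<xi>) {\<xi> \<in> {a..b}. X \<xi> n = 1/2}" using s0 by (auto simp: inj_on_def)
    show "(\<lambda>\<xi>. r + \<sigma> ^ (n + M) * \<xi>) ` {\<xi> \<in> {a..b}. X \<xi> n = 1/2} \<subseteq> {t. (T ^^ M) t = 1/2}"
    proof clarify
      fix \<xi> assume \<xi>: "\<xi> \<in> {a..b}" "X \<xi> n = 1/2"
      have "\<bar>\<xi>\<bar> / s ^ M \<le> \<bar>B\<bar> / s ^ M" using B[OF \<xi>(1)] s1 by (intro divide_right_mono) auto
      then have "X \<xi> n = (T ^^ M) (r + \<sigma> ^ (n + M) * \<xi>)" using M by (intro X_eval) linarith
      then show "(T ^^ M) (r + \<sigma> ^ (n + M) * \<xi>) = 1/2" using \<xi> by simp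
    qed
    show "finite {t. (T ^^ M) t = 1/2}" by (rule Tn_fibre_finite)
  qed
  have "turns \<inter> {a..b} \<subseteq> (\<Union>n<N. {\<xi> \<in> {a..b}. X \<xi> (Suc n) = 1/2})"
  proof
    fix \<xi> assume "\<xi> \<in> turns \<inter> {a..b}"
    then obtain n where n: "\<xi> \<in> {a..b}" "X \<xi> (Suc n) = 1/2" by (auto simp: turns_def)
    then have "n < N" using N[OF B[OF n(1)], of n] by (meson not_le_imp_less)
    then show "\<xi> \<in> (\<Union>n<N. {\<xi> \<in> {a..b}. X \<xi> (Suc n) = 1/2})" using n by blast
  qed
  then show ?thesis using fin by (meson finite_UN_I finite_lessThan finite_subset)
qed

lemma non_turn_between:
  assumes "a < b"
  obtains c where "a < c" "c < b" "c \<notin> turns"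
proof -
  have "infinite ({a<..<b} - (turns \<inter> {a..b}))" using turns_finite infinite_Ioo[OF assms] by simp
  then have "{a<..<b} - (turns \<inter> {a..b}) \<noteq> {}" by (metis finite.emptyI)
  then obtain c where "c \<in> {a<..<b} - (turns \<inter> {a..b})" by blast
  then show thesis using that[of c] by auto
qed

lemma zero_not_turn: "0 \<notin> turns"
  using d_order by (auto simp: turns_def X_zero)

definition pt :: "real \<Rightarrow> real \<times> real" where
  "pt \<xi> = (X \<xi> 0, ht (\<lambda>n. X \<xi> (Suc n) > 1/2))"

lemma off_turn_code:
  assumes "\<xi> \<notin> turns" shows "coded (X \<xi>) l \<longleftrightarrow> l = (\<lambda>n. X \<xi> (Suc n) > 1/2)"
proof -
  have ne: "X \<xi> (Suc n) \<noteq> 1/2" for n using assms by (auto simp: turns_def)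
  show ?thesis unfolding coded_def using ne side_gt by auto
qed

lemma draw_off_turn: "\<xi> \<notin> turns \<Longrightarrow> draw (X \<xi>) = {pt \<xi>}"
proof -
  assume \<xi>: "\<xi> \<notin> turns"
  then have "\<not> last_hit (X \<xi>) n" for n by (auto simp: turns_def last_hit_def)
  then show ?thesis unfolding draw_def pt_def off_turn_code[OF \<xi>] by auto
qed

text \<open>No coordinate of positive index crosses 1/2 between turns; the two end points inherit
  the code by \<open>coded_limit\<close>.\<close>

lemma constant_code:
  assumes ab: "a < b" and nt: "turns \<inter> {a<..<b} = {}"
  obtains l where "\<And>\<xi>. \<xi> \<in> {a..b} \<Longrightarrow> coded (X \<xi>) l"
proof -
  define m where "m = (a + b) / 2"
  define l where "l n = (X m (Suc n) > 1/2)" for n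
  have m: "m \<in> {a<..<b}" using ab by (simp add: m_def)
  have same: "(X \<xi> (Suc n) > 1/2) = l n" if \<xi>: "\<xi> \<in> {a<..<b}" for \<xi> n
  proof (rule ccontr)
    assume ne: "(X \<xi> (Suc n) > 1/2) \<noteq> l n"
    let ?S = "(\<lambda>\<xi>. X \<xi> (Suc n)) ` {a<..<b}"
    have "connected ?S" by (intro connected_continuous_image continuous_on_subset[OF X_continuous]) auto
    moreover have "X \<xi> (Suc n) \<in> ?S" "X m (Suc n) \<in> ?S" using \<xi> m by auto
    ultimately have "1/2 \<in> ?S" using ne unfolding l_def
      using connectedD_interval[of ?S "X \<xi> (Suc n)" "X m (Suc n)" "1/2"]
        connectedD_interval[of ?S "X m (Suc n)" "X \<xi> (Suc n)" "1/2"] by linarith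
    then obtain \<xi>0 where "\<xi>0 \<in> {a<..<b}" "X \<xi>0 (Suc n) = 1/2" by (metis imageE)
    moreover from this have "\<xi>0 \<in> turns" unfolding turns_def by blast
    ultimately show False using nt by blast
  qed
  have inner: "coded (X \<xi>) l" if "\<xi> \<in> {a<..<b}" for \<xi>
  proof -
    have "\<xi> \<notin> turns" using nt that by blast
    then show ?thesis using off_turn_code same[OF that] by auto
  qed
  have "coded (X \<xi>) l" if "\<xi> \<in> {a..b}" for \<xi>
  proof -
    define u where "u k = \<xi> + (m - \<xi>) / (real k + 2)" for k :: nat
    have uin: "u k \<in> {a<..<b}" for k
    proof -
      define q where "q = 1 / (real k + 2)"
      have q: "0 < q" "q < 1" by (auto simp: q_def)
      have u: "u k = (1 - q) * \<xi> + q * m" by (simp add: u_def q_def left_diff_distrib right_diff_distrib diff_divide_distrib)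
      have "(1 - q) * a \<le> (1 - q) * \<xi>" "(1 - q) * \<xi> \<le> (1 - q) * b" "q * a < q * m" "q * m < q * b"
        using q that m by (auto intro!: mult_left_mono mult_strict_left_mono)
      moreover have "(1 - q) * a + q * a = a" "(1 - q) * b + q * b = b" by (auto simp: algebra_simps)
      ultimately show ?thesis unfolding u by (simp only: greaterThanLessThan_iff) linarith
    qed
    have "(\<lambda>k. (m - \<xi>) / (real k + 2)) \<longlonglongrightarrow> 0"
      using LIMSEQ_ignore_initial_segment[OF lim_const_over_n[of "m - \<xi>"], of 2] by (simp add: add.commute)
    then have "u \<longlonglongrightarrow> \<xi> + 0" unfolding u_def by (intro tendsto_intros)
    then have ul: "u \<longlonglongrightarrow> \<xi>" by simp
    have cl: "(\<lambda>k. X (u k) n) \<longlonglongrightarrow> X \<xi> n" for n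
      using continuous_on_tendsto_compose[OF X_continuous ul] by simp
    obtain x' l' where x': "coded x' l'" "ht l = ht l'" "\<And>n. (\<lambda>k. X (u k) n) \<longlonglongrightarrow> x' n"
      using coded_limit[OF X_core inner[OF uin] cl tendsto_const] by metis
    have "x' = X \<xi>" using LIMSEQ_unique[OF x'(3) cl] by (intro ext)
    then show ?thesis using x' ht_inj by metis
  qed
  then show thesis using that by blast
qed

text \<open>Coordinate N is affine in \<xi> with slope \<sigma>^N, and the branch from there to
  coordinate 0 has slope s^N up to sign. The product is 1 or -1, which is why \<xi> measures arc
  length.\<close>

lemma constant_code_affine:
  assumes ab: "a < b" and l: "\<And>\<xi>. \<xi> \<in> {a..b} \<Longrightarrow> coded (X \<xi>) l"
  obtains \<epsilon> N where "\<epsilon> = sg l N * (-1) ^ N" "\<And>\<xi> \<xi>'. \<xi> \<in> {a..b} \<Longrightarrow> \<xi>' \<in> {a..b} \<Longrightarrow> X \<xi>' 0 - X \<xi> 0 = \<epsilon> * (\<xi>' - \<xi>)" "\<epsilon> = 1 \<or> \<epsilon> = -1"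
proof -
  obtain N where N: "\<And>\<xi> n. \<bar>\<xi>\<bar> \<le> \<bar>a\<bar> + \<bar>b\<bar> \<Longrightarrow> n \<ge> N \<Longrightarrow> X \<xi> n = r + \<sigma> ^ n * \<xi> \<and> X \<xi> (Suc n) \<noteq> 1/2"
    by (rule uniform_far[of "\<bar>a\<bar> + \<bar>b\<bar>"]) (rule that, assumption+)
  define \<epsilon> where "\<epsilon> = sg l N * (-1) ^ N"
  have s\<sigma>: "s ^ N * \<sigma> ^ N = (-1) ^ N" using s1 by (simp add: \<sigma>_def power_mult_distrib[symmetric])
  have "X \<xi>' 0 - X \<xi> 0 = \<epsilon> * (\<xi>' - \<xi>)" if "\<xi> \<in> {a..b}" "\<xi>' \<in> {a..b}" for \<xi> \<xi>'
  proof -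
    have "X \<xi> N = r + \<sigma> ^ N * \<xi>" "X \<xi>' N = r + \<sigma> ^ N * \<xi>'" using N[of \<xi> N] N[of \<xi>' N] that by auto
    then have "X \<xi>' 0 - X \<xi> 0 = sg l N * (s ^ N * \<sigma> ^ N) * (\<xi>' - \<xi>)"
      using coded_diff[OF X_core X_core l[OF that(1)] l[OF that(2)], of N] by (simp add: algebra_simps)
    then show ?thesis by (simp add: s\<sigma> \<epsilon>_def)
  qed
  moreover have "\<epsilon> = 1 \<or> \<epsilon> = -1" using sg_cases[of l N] unfolding \<epsilon>_def by (cases "even N") auto
  ultimately show thesis using that[OF \<epsilon>_def] by blast
qed

lemma segment_arc:
  assumes ab: "a < b" and l: "\<And>\<xi>. \<xi> \<in> {a..b} \<Longrightarrow> coded (X \<xi>) l"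
  obtains g where "arc g" "path_image g = (\<lambda>\<xi>. (X \<xi> 0, ht l)) ` {a..b}" "pathstart g = (X a 0, ht l)" "pathfinish g = (X b 0, ht l)"
proof -
  obtain \<epsilon> N where \<epsilon>: "\<epsilon> = sg l N * (-1) ^ N" "\<And>\<xi> \<xi>'. \<xi> \<in> {a..b} \<Longrightarrow> \<xi>' \<in> {a..b} \<Longrightarrow> X \<xi>' 0 - X \<xi> 0 = \<epsilon> * (\<xi>' - \<xi>)" "\<epsilon> = 1 \<or> \<epsilon> = -1"
    by (rule constant_code_affine[OF ab, of l]) (rule l, assumption, rule that, assumption+)
  let ?f = "\<lambda>\<xi>. (X \<xi> 0, ht l)"
  let ?g = "?f \<circ> linepath a b"
  have im: "linepath a b ` {0..1} = {a..b}" using ab by (metis closed_segment_eq_real_ivl path_image_def path_image_linepath less_imp_le)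
  have "inj_on ?f {a..b}"
  proof (rule inj_onI)
    fix \<xi> \<xi>' assume "\<xi> \<in> {a..b}" "\<xi>' \<in> {a..b}" "?f \<xi> = ?f \<xi>'"
    then have "\<epsilon> * (\<xi>' - \<xi>) = 0" using \<epsilon>(2)[of \<xi> \<xi>'] by simp
    then show "\<xi> = \<xi>'" using \<epsilon>(3) by auto
  qed
  moreover have "continuous_on {a..b} ?f" by (intro continuous_intros continuous_on_subset[OF X_continuous]) auto
  moreover have "continuous_on {0..1} (linepath a b)" "inj_on (linepath a b) {0..1}"
    using arc_linepath[of a b] ab by (auto simp: arc_def path_def)
  ultimately have "continuous_on {0..1} ?g" "inj_on ?g {0..1}"
    using im by (auto simp del: o_apply intro!: continuous_on_compose comp_inj_on)
  then have "arc ?g" unfolding arc_def path_def by blast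
  moreover have "path_image ?g = ?f ` {a..b}" by (simp only: path_image_compose) (simp only: path_image_def im)
  ultimately show thesis using that[of ?g] by (simp add: pathstart_compose pathfinish_compose)
qed

lemma cap_arc:
  obtains g where "arc g" "path_image g = cap x l n" "pathstart g = (x 0, ht l)" "pathfinish g = (x 0, ht (l(n := \<not> l n)))"
proof -
  define \<rho> where "\<rho> = rad l n"
  define \<tau> where "\<tau> = sg l n"
  define \<omega> where "\<omega> = - ez l (Suc n)"
  have \<rho>: "\<rho> > 0" unfolding \<rho>_def by (rule ht_minus_cn)
  have \<tau>: "\<tau> = 1 \<or> \<tau> = -1" unfolding \<tau>_def by (rule sg_cases)
  have \<omega>: "\<omega> = 1 \<or> \<omega> = -1" using ez_cases[of l "Suc n"] unfolding \<omega>_def by auto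
  define g where "g t = (x 0 + \<tau> * \<rho> * sqrt (1 - (2 * t - 1)^2), cn l n + \<omega> * \<rho> * (2 * t - 1))" for t
  have le: "0 \<le> 1 - (2 * t - 1)^2" if "t \<in> {0..1}" for t :: real
    using that abs_square_le_1[of "2 * t - 1"] by auto
  have "continuous_on {0..1} g" unfolding g_def by (intro continuous_intros)
  moreover have "inj_on g {0..1}" using \<rho> \<omega> by (auto simp: g_def inj_on_def)
  ultimately have "arc g" by (simp add: arc_def path_def)
  moreover have "path_image g = cap x l n"
  proof (intro set_eqI iffI)
    fix q assume "q \<in> path_image g"
    then obtain t where t: "t \<in> {0..1}" "q = g t" by (auto simp: path_image_def)
    have "(\<tau> * \<rho> * sqrt (1 - (2 * t - 1)^2))^2 = \<rho>^2 * (1 - (2 * t - 1)^2)" using \<tau> le[OF t(1)] by (auto simp: power_mult_distrib)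
    moreover have "(\<omega> * \<rho> * (2 * t - 1))^2 = \<rho>^2 * (2 * t - 1)^2" using \<omega> by (auto simp: power_mult_distrib)
    ultimately have "(fst q - x 0)^2 + (snd q - cn l n)^2 = \<rho>^2" unfolding t(2) g_def by (simp add: right_diff_distrib)
    moreover have "\<tau> * (fst q - x 0) = \<rho> * sqrt (1 - (2 * t - 1)^2)" using \<tau> unfolding t(2) g_def by auto
    then have "0 \<le> \<tau> * (fst q - x 0)" using \<rho> le[OF t(1)] by simp
    ultimately show "q \<in> cap x l n" by (simp add: cap_iff \<rho>_def \<tau>_def)
  next
    fix q assume "q \<in> cap x l n"
    then have q: "(fst q - x 0)^2 + (snd q - cn l n)^2 = \<rho>^2" "0 \<le> \<tau> * (fst q - x 0)" by (auto simp: cap_iff \<rho>_def \<tau>_def)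
    define v where "v = \<omega> * (snd q - cn l n) / \<rho>"
    have sv: "snd q = cn l n + \<omega> * \<rho> * v" using \<omega> \<rho> by (auto simp: v_def)
    have v2: "(\<rho> * v)^2 = (snd q - cn l n)^2" using \<omega> \<rho> by (auto simp: v_def power_mult_distrib)
    then have "(\<rho> * v)^2 \<le> \<rho>^2" using q(1) by (metis add.commute le_add_same_cancel1 zero_le_power2)
    then have "\<rho> * \<bar>v\<bar> \<le> \<rho> * 1" using \<rho> by (simp add: abs_le_square_iff[symmetric] abs_mult)
    then have v1: "\<bar>v\<bar> \<le> 1" using \<rho> by (simp only: mult_le_cancel_left_pos)
    have "\<tau>^2 = 1" using \<tau> by auto
    then have "(\<tau> * (fst q - x 0))^2 = (fst q - x 0)^2" by (simp only: power_mult_distrib mult_1)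
    also have "\<dots> = \<rho>^2 - (\<rho> * v)^2" using q(1) v2 by simp
    also have "\<dots> = \<rho>^2 * (1 - v^2)" by (simp add: power_mult_distrib algebra_simps)
    finally have "(\<tau> * (fst q - x 0))^2 = \<rho>^2 * (1 - v^2)" .
    then have "\<tau> * (fst q - x 0) = sqrt (\<rho>^2 * (1 - v^2))" using q(2) by (metis real_sqrt_unique)
    also have "\<dots> = \<rho> * sqrt (1 - v^2)" using \<rho> by (simp add: real_sqrt_mult)
    finally have "fst q = x 0 + \<tau> * \<rho> * sqrt (1 - v^2)" using \<tau> by auto
    moreover have "2 * ((v + 1) / 2) - 1 = v" by (simp add: field_simps)
    ultimately have "q = g ((v + 1) / 2)" using sv unfolding g_def prod_eq_iff fst_conv snd_conv by presburger
    moreover have "(v + 1) / 2 \<in> {0..1}" using v1 by auto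
    ultimately show "q \<in> path_image g" by (auto simp: path_image_def)
  qed
  moreover have "ht l = cn l n - \<omega> * \<rho>" using ht_minus_cn(1)[of l n] by (simp add: \<omega>_def \<rho>_def)
  then have "pathstart g = (x 0, ht l)" "pathfinish g = (x 0, ht (l(n := \<not> l n)))"
    unfolding ht_flip by (auto simp: pathstart_def pathfinish_def g_def)
  ultimately show thesis using that by blast
qed

lemma draw_X_disjoint: "q \<in> draw (X \<xi>) \<Longrightarrow> q \<in> draw (X \<xi>') \<Longrightarrow> \<xi> = \<xi>'"
  using draw_disjoint[OF X_core X_core] X_inj by blast

text \<open>The arc has to run through all of \<open>draw (X \<xi>)\<close>, semicircles included.
  When a and b are not turns, \<open>pt a\<close> and \<open>pt b\<close> are the whole drawing
  there, so that arcs can be joined.\<close>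

definition spans :: "real \<Rightarrow> real \<Rightarrow> (real \<Rightarrow> real \<times> real) \<Rightarrow> bool" where
  "spans a b g \<longleftrightarrow> arc g \<and> path_image g = (\<Union>\<xi>\<in>{a..b}. draw (X \<xi>)) \<and> pathstart g = pt a \<and> pathfinish g = pt b"

lemma spans_join:
  assumes "spans a m g1" "spans m b g2" "a < m" "m < b" "m \<notin> turns"
  shows "spans a b (g1 +++ g2)"
proof -
  have g: "arc g1" "arc g2" "pathfinish g1 = pathstart g2" "pathstart g2 = pt m"
    "path_image g1 = (\<Union>\<xi>\<in>{a..m}. draw (X \<xi>))" "path_image g2 = (\<Union>\<xi>\<in>{m..b}. draw (X \<xi>))"
    using assms(1,2) by (auto simp: spans_def)
  have "path_image g1 \<inter> path_image g2 \<subseteq> {pathstart g2}"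
  proof
    fix q assume "q \<in> path_image g1 \<inter> path_image g2"
    then obtain \<xi> \<xi>' where \<xi>: "\<xi> \<in> {a..m}" "\<xi>' \<in> {m..b}" "q \<in> draw (X \<xi>)" "q \<in> draw (X \<xi>')" using g(5,6) by blast
    then have "\<xi> = m" using draw_X_disjoint[OF \<xi>(3,4)] by auto
    then show "q \<in> {pathstart g2}" using \<xi>(3) draw_off_turn[OF assms(5)] g(4) by auto
  qed
  then have "arc (g1 +++ g2)" using g arc_join by blast
  moreover have "{a..b} = {a..m} \<union> {m..b}" using assms by auto
  then have "path_image (g1 +++ g2) = (\<Union>\<xi>\<in>{a..b}. draw (X \<xi>))" using path_image_join[OF g(3)] g(5,6) by (simp only: UN_Un)
  ultimately show ?thesis using assms(1,2) by (simp add: spans_def)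
qed

lemma coded_pt: "\<xi> \<notin> turns \<Longrightarrow> coded (X \<xi>) l \<Longrightarrow> (X \<xi> 0, ht l) = pt \<xi>"
  using off_turn_code by (simp add: pt_def)

lemma spans_straight:
  assumes ab: "a < b" and nt: "turns \<inter> {a..b} = {}"
  shows "\<exists>g. spans a b g"
proof -
  have "turns \<inter> {a<..<b} = {}" using nt by auto
  from constant_code[OF ab this] obtain l where l: "\<And>\<xi>. \<xi> \<in> {a..b} \<Longrightarrow> coded (X \<xi>) l" by blast
  obtain g where g: "arc g" "path_image g = (\<lambda>\<xi>. (X \<xi> 0, ht l)) ` {a..b}" "pathstart g = (X a 0, ht l)" "pathfinish g = (X b 0, ht l)"
    using segment_arc[OF ab l] .
  have e: "(X \<xi> 0, ht l) = pt \<xi>" "draw (X \<xi>) = {pt \<xi>}" if "\<xi> \<in> {a..b}" for \<xi>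
  proof -
    have "\<xi> \<notin> turns" using that nt by blast
    then show "(X \<xi> 0, ht l) = pt \<xi>" "draw (X \<xi>) = {pt \<xi>}" using coded_pt[OF _ l[OF that]] draw_off_turn by blast+
  qed
  have "path_image g = (\<Union>\<xi>\<in>{a..b}. draw (X \<xi>))" unfolding g(2) using e by auto
  then show ?thesis using g e ab unfolding spans_def by (intro exI[of _ g]) auto
qed

lemma spans_turn:
  assumes ae: "a < e" and eb: "e < b" and nt: "turns \<inter> {a..b} = {e}"
  shows "\<exists>g. spans a b g"
proof -
  have "turns \<inter> {a<..<e} = {}" "turns \<inter> {e<..<b} = {}" using nt ae eb by fastforce+
  then obtain l l' where l: "\<And>\<xi>. \<xi> \<in> {a..e} \<Longrightarrow> coded (X \<xi>) l" and l': "\<And>\<xi>. \<xi> \<in> {e..b} \<Longrightarrow> coded (X \<xi>) l'"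
    using constant_code ae eb by metis
  have le: "coded (X e) l" "coded (X e) l'" using l l' ae eb by auto
  \<comment> \<open>With equal codes coordinate 0 would pass through e with slope 1 or -1, although
    \<open>prefix_bound\<close> makes it extremal there.\<close>
  have "l \<noteq> l'"
  proof
    assume eq: "l = l'"
    then have lab: "coded (X \<xi>) l" if "\<xi> \<in> {a..b}" for \<xi> using l l' that by (cases "\<xi> \<le> e") auto
    have "a < b" using ae eb by simp
    from constant_code_affine[OF this lab] obtain \<epsilon> where \<epsilon>: "\<And>\<xi> \<xi>'. \<xi> \<in> {a..b} \<Longrightarrow> \<xi>' \<in> {a..b} \<Longrightarrow> X \<xi>' 0 - X \<xi> 0 = \<epsilon> * (\<xi>' - \<xi>)" "\<epsilon> = 1 \<or> \<epsilon> = -1" by metis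
    have "e \<in> turns" using nt by blast
    then obtain n where n: "X e (Suc n) = 1/2" by (auto simp: turns_def)
    have "sg l n * (X \<xi> 0 - X e 0) \<le> 0" if "\<xi> \<in> {a..b}" for \<xi>
      using prefix_bound(1)[OF X_core X_core le(1) lab[OF that] _ n] by simp
    from this[of a] this[of b] have "sg l n * \<epsilon> * (a - e) \<le> 0" "sg l n * \<epsilon> * (b - e) \<le> 0"
      using \<epsilon>(1)[of e a] \<epsilon>(1)[of e b] ae eb by (auto simp: mult.assoc)
    moreover have "sg l n * \<epsilon> = 1 \<or> sg l n * \<epsilon> = -1" using \<epsilon>(2) sg_cases[of l n] by auto
    ultimately show False using ae eb by auto
  qed
  then obtain n where n: "l n \<noteq> l' n" by auto
  have lh: "last_hit (X e) m" if "l1 m \<noteq> l2 m" "coded (X e) l1" "coded (X e) l2" for l1 l2 m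
    using flip_last_hit[OF that(2,3,1) X_core] .
  have uniq: "m = n" if "last_hit (X e) m" for m
    using that lh[OF n le] unfolding last_hit_def by (metis linorder_neqE_nat)
  have l'_eq: "l' = l(n := \<not> l n)"
  proof
    fix m show "l' m = (l(n := \<not> l n)) m" using n uniq[of m] lh[of l m l'] le by (cases "m = n") auto
  qed
  have codes: "l1 = l \<or> l1 = l'" if "coded (X e) l1" for l1
  proof (cases "l1 n = l n")
    case True
    then have "l1 = l" using uniq lh[OF _ that le(1)] by (intro ext) metis
    then show ?thesis by simp
  next
    case False
    then have "l1 m = l' m" for m using uniq lh[OF _ that le(2), of m] n by (cases "m = n") auto
    then show ?thesis by blast
  qed
  have cap': "cap (X e) l' n = cap (X e) l n"
    unfolding set_eq_iff cap_iff l'_eq cn_flip rad_flip using sg_cong[of n "l(n := \<not> l n)" l] by simp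
  have dr: "draw (X e) = cap (X e) l n"
  proof
    show "draw (X e) \<subseteq> cap (X e) l n"
    proof
      fix q assume "q \<in> draw (X e)"
      then consider l1 where "q = (X e 0, ht l1)" "coded (X e) l1" | l1 m where "q \<in> cap (X e) l1 m" "coded (X e) l1" "last_hit (X e) m"
        unfolding draw_def by blast
      then show "q \<in> cap (X e) l n"
      proof cases
        case 1
        then show ?thesis using codes ends_on_cap l'_eq by metis
      next
        case 2
        then show ?thesis using codes uniq cap' by metis
      qed
    qed
    show "cap (X e) l n \<subseteq> draw (X e)" using draw_cap[OF le(1) lh[OF n le]] by blast
  qed
  obtain g1 where g1: "arc g1" "path_image g1 = (\<lambda>\<xi>. (X \<xi> 0, ht l)) ` {a..e}" "pathstart g1 = (X a 0, ht l)" "pathfinish g1 = (X e 0, ht l)"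
    using segment_arc[OF ae l] .
  obtain g2 where g2: "arc g2" "path_image g2 = draw (X e)" "pathstart g2 = (X e 0, ht l)" "pathfinish g2 = (X e 0, ht l')"
    using cap_arc[of "X e" l n] unfolding dr l'_eq by blast
  obtain g3 where g3: "arc g3" "path_image g3 = (\<lambda>\<xi>. (X \<xi> 0, ht l')) ` {e..b}" "pathstart g3 = (X e 0, ht l')" "pathfinish g3 = (X b 0, ht l')"
    using segment_arc[OF eb l'] .
  have in1: "(X \<xi> 0, ht l) \<in> draw (X \<xi>)" if "\<xi> \<in> {a..e}" for \<xi> using draw_horizontal[OF l[OF that]] .
  have in3: "(X \<xi> 0, ht l') \<in> draw (X \<xi>)" if "\<xi> \<in> {e..b}" for \<xi> using draw_horizontal[OF l'[OF that]] .
  have "path_image g1 \<inter> path_image g2 \<subseteq> {pathstart g2}"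
  proof
    fix q assume "q \<in> path_image g1 \<inter> path_image g2"
    then obtain \<xi> where \<xi>: "\<xi> \<in> {a..e}" "q = (X \<xi> 0, ht l)" "q \<in> draw (X e)" using g1(2) g2(2) by blast
    then have "\<xi> = e" using draw_X_disjoint[OF _ \<xi>(3)] in1 by blast
    then show "q \<in> {pathstart g2}" using \<xi> g2 by simp
  qed
  then have g12: "arc (g1 +++ g2)" using arc_join g1 g2 by metis
  have pi12: "path_image (g1 +++ g2) = path_image g1 \<union> path_image g2" using g1 g2 by (simp add: path_image_join)
  have "path_image (g1 +++ g2) \<inter> path_image g3 \<subseteq> {pathstart g3}"
  proof
    fix q assume q: "q \<in> path_image (g1 +++ g2) \<inter> path_image g3"
    then obtain \<xi> where \<xi>: "\<xi> \<in> {e..b}" "q = (X \<xi> 0, ht l')" using g3(2) by blast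
    have "e \<in> {a..e}" using ae by simp
    then have "\<exists>\<xi>'\<in>{a..e}. q \<in> draw (X \<xi>')" using q in1 unfolding pi12 g1(2) g2(2) by blast
    then obtain \<xi>' where \<xi>': "\<xi>' \<in> {a..e}" "q \<in> draw (X \<xi>')" by blast
    have "\<xi>' = \<xi>" using draw_X_disjoint[OF \<xi>'(2)] in3[OF \<xi>(1)] \<xi>(2) by blast
    then have "\<xi> = e" using \<xi> \<xi>' by auto
    then show "q \<in> {pathstart g3}" using \<xi> g3 by simp
  qed
  then have g123: "arc ((g1 +++ g2) +++ g3)" using arc_join[OF g12 g3(1)] g2 g3 by simp
  have pts: "(X \<xi> 0, ht l) = pt \<xi>" "draw (X \<xi>) = {pt \<xi>}" if "\<xi> \<in> {a..<e}" for \<xi>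
  proof -
    have "\<xi> \<in> {a..b}" "\<xi> \<noteq> e" "\<xi> \<in> {a..e}" using that eb by auto
    moreover from this have "\<xi> \<notin> turns" using nt by blast
    ultimately show "(X \<xi> 0, ht l) = pt \<xi>" "draw (X \<xi>) = {pt \<xi>}" using coded_pt l draw_off_turn by blast+
  qed
  have pts': "(X \<xi> 0, ht l') = pt \<xi>" "draw (X \<xi>) = {pt \<xi>}" if "\<xi> \<in> {e<..b}" for \<xi>
  proof -
    have "\<xi> \<in> {a..b}" "\<xi> \<noteq> e" "\<xi> \<in> {e..b}" using that ae by auto
    moreover from this have "\<xi> \<notin> turns" using nt by blast
    ultimately show "(X \<xi> 0, ht l') = pt \<xi>" "draw (X \<xi>) = {pt \<xi>}" using coded_pt l' draw_off_turn by blast+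
  qed
  have "path_image ((g1 +++ g2) +++ g3) = (\<lambda>\<xi>. (X \<xi> 0, ht l)) ` {a..e} \<union> draw (X e) \<union> (\<lambda>\<xi>. (X \<xi> 0, ht l')) ` {e..b}"
    using g1 g2 g3 by (simp add: path_image_join)
  also have "\<dots> = (\<Union>\<xi>\<in>{a..b}. draw (X \<xi>))"
  proof
    show "(\<lambda>\<xi>. (X \<xi> 0, ht l)) ` {a..e} \<union> draw (X e) \<union> (\<lambda>\<xi>. (X \<xi> 0, ht l')) ` {e..b} \<subseteq> (\<Union>\<xi>\<in>{a..b}. draw (X \<xi>))"
    proof -
      have "{a..e} \<subseteq> {a..b}" "{e..b} \<subseteq> {a..b}" "e \<in> {a..b}" using ae eb by auto
      then show ?thesis using in1 in3 by blast
    qed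
    show "(\<Union>\<xi>\<in>{a..b}. draw (X \<xi>)) \<subseteq> (\<lambda>\<xi>. (X \<xi> 0, ht l)) ` {a..e} \<union> draw (X e) \<union> (\<lambda>\<xi>. (X \<xi> 0, ht l')) ` {e..b}"
    proof
      fix q assume "q \<in> (\<Union>\<xi>\<in>{a..b}. draw (X \<xi>))"
      then obtain \<xi> where \<xi>: "\<xi> \<in> {a..b}" "q \<in> draw (X \<xi>)" by blast
      consider "\<xi> = e" | "\<xi> \<in> {a..<e}" | "\<xi> \<in> {e<..b}" using \<xi>(1) by fastforce
      then show "q \<in> (\<lambda>\<xi>. (X \<xi> 0, ht l)) ` {a..e} \<union> draw (X e) \<union> (\<lambda>\<xi>. (X \<xi> 0, ht l')) ` {e..b}"
      proof cases
        case 1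
        then show ?thesis using \<xi> by blast
      next
        case 2
        then have "q = (X \<xi> 0, ht l)" using \<xi>(2) pts[OF 2] by simp
        then show ?thesis using 2 by fastforce
      next
        case 3
        then have "q = (X \<xi> 0, ht l')" using \<xi>(2) pts'[OF 3] by simp
        then show ?thesis using 3 by fastforce
      qed
    qed
  qed
  finally have "spans a b ((g1 +++ g2) +++ g3)" unfolding spans_def using g123 g1 g3 pts(1)[of a] pts'(1)[of b] ae eb by simp
  then show ?thesis by blast
qed

text \<open>Two turns can be separated by a parameter that is not a turn, and each half then
  contains fewer turns.\<close>

lemma spans_exists:
  assumes "a < b" "a \<notin> turns" "b \<notin> turns"
  shows "\<exists>g. spans a b g"
  using assms
proof (induction "card (turns \<inter> {a..b})" arbitrary: a b rule: less_induct)
  case less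
  show ?case
  proof (cases "turns \<inter> {a..b} = {}")
    case True
    then show ?thesis using spans_straight less.prems by blast
  next
    case False
    then obtain e where e: "e \<in> turns" "a \<le> e" "e \<le> b" by auto
    then have e': "a < e" "e < b" using less.prems by (metis order_le_less)+
    show ?thesis
    proof (cases "turns \<inter> {a..b} = {e}")
      case True
      then show ?thesis using spans_turn e' by blast
    next
      case False
      have "e \<in> turns \<inter> {a..b}" using e by simp
      then obtain f where f: "f \<in> turns" "f \<noteq> e" "f \<in> {a..b}" using False by blast
      obtain m where m: "min e f < m" "m < max e f" "m \<notin> turns"
        using non_turn_between[of "min e f" "max e f"] f(2) by (metis min_def max_def not_le order_le_less)
      have am: "a < m" "m < b" using m e' f by auto
      have fin: "finite (turns \<inter> {a..b})" by (rule turns_finite)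
      have "max e f \<in> turns \<inter> {a..b} - {a..m}" "min e f \<in> turns \<inter> {a..b} - {m..b}" using e f m by (auto simp: min_def max_def)
      then have "turns \<inter> {a..m} \<subset> turns \<inter> {a..b}" "turns \<inter> {m..b} \<subset> turns \<inter> {a..b}" using am by fastforce+
      then have "card (turns \<inter> {a..m}) < card (turns \<inter> {a..b})" "card (turns \<inter> {m..b}) < card (turns \<inter> {a..b})"
        using psubset_card_mono[OF fin] by blast+
      then obtain g1 g2 where "spans a m g1" "spans m b g2" using less m(3) am by metis
      then show ?thesis using spans_join am m(3) by blast
    qed
  qed
qed

text \<open>Joints for the gluing: non-turns within 1/4 of the integers are increasing and unbounded
  in both directions, and the value 0 at 0 places the fixed point at
  \<open>\<gamma> 0\<close>.\<close>

definition \<tau> :: "int \<Rightarrow> real" where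
  "\<tau> j = (SOME t. t \<notin> turns \<and> (j = 0 \<longrightarrow> t = 0) \<and> of_int j - 1/4 < t \<and> t < of_int j + 1/4)"

lemma \<tau>: "\<tau> j \<notin> turns" "\<tau> 0 = 0" "of_int j - 1/4 < \<tau> j" "\<tau> j < of_int j + 1/4"
proof -
  have *: "\<tau> j \<notin> turns \<and> (j = 0 \<longrightarrow> \<tau> j = 0) \<and> of_int j - 1/4 < \<tau> j \<and> \<tau> j < of_int j + 1/4" for j
    unfolding \<tau>_def
  proof (rule someI_ex)
    show "\<exists>t. t \<notin> turns \<and> (j = 0 \<longrightarrow> t = 0) \<and> of_int j - 1/4 < t \<and> t < of_int j + 1/4"
    proof (cases "j = 0")
      case True
      then show ?thesis using zero_not_turn by (intro exI[of _ 0]) simp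
    next
      case False
      obtain c where "of_int j - 1/4 < c" "c < of_int j + 1/4" "c \<notin> turns"
        using non_turn_between[of "of_int j - 1/4" "of_int j + 1/4"] by auto
      then show ?thesis using False by blast
    qed
  qed
  show "\<tau> j \<notin> turns" "of_int j - 1/4 < \<tau> j" "\<tau> j < of_int j + 1/4" using *[of j] by blast+
  show "\<tau> 0 = 0" using *[of 0] by blast
qed

lemma \<tau>_less: "i < j \<Longrightarrow> \<tau> i < \<tau> j"
proof -
  assume "i < j"
  then have "of_int i + 1 \<le> (of_int j :: real)" by linarith
  then show ?thesis using \<tau>(4)[of i] \<tau>(3)[of j] by linarith
qed

lemma \<tau>_le: "i \<le> j \<Longrightarrow> \<tau> i \<le> \<tau> j"
  using \<tau>_less[of i j] by (cases "i = j") auto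

lemma \<tau>_cell: obtains j where "\<tau> j \<le> \<xi>" "\<xi> \<le> \<tau> (j + 1)"
proof -
  define i where "i = \<lfloor>\<xi>\<rfloor>"
  have i: "of_int i \<le> \<xi>" "\<xi> < of_int i + 1" unfolding i_def by linarith+
  consider "\<xi> < \<tau> i" | "\<tau> i \<le> \<xi>" "\<xi> \<le> \<tau> (i + 1)" | "\<tau> (i + 1) < \<xi>" by linarith
  then show thesis
  proof cases
    case 1
    then show thesis using that[of "i - 1"] \<tau>(4)[of "i - 1"] i by simp
  next
    case 2
    then show thesis by (rule that)
  next
    case 3
    then show thesis using that[of "i + 1"] \<tau>(3)[of "i + 1 + 1"] i by simp
  qed
qed

definition piece :: "int \<Rightarrow> real \<Rightarrow> real \<times> real" where
  "piece j = (SOME g. spans (\<tau> j) (\<tau> (j + 1)) g)"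

lemma piece: "spans (\<tau> j) (\<tau> (j + 1)) (piece j)"
proof -
  have "\<exists>g. spans (\<tau> j) (\<tau> (j + 1)) g" by (intro spans_exists \<tau> \<tau>_less) simp
  then show ?thesis unfolding piece_def by (rule someI_ex)
qed

lemma piece_link: "pathfinish (piece j) = pathstart (piece (j + 1))"
  using piece[of j] piece[of "j + 1"] by (simp add: spans_def)

definition \<gamma> :: "real \<Rightarrow> real \<times> real" where "\<gamma> = chain_path piece"

lemma \<gamma>_piece: "u \<in> {0..1} \<Longrightarrow> \<gamma> (of_int j + u) = piece j u"
  unfolding \<gamma>_def using chain_path_on_cell[of piece, OF piece_link, of "of_int j + u" j] by simp

lemma \<gamma>_floor: "\<gamma> t = piece \<lfloor>t\<rfloor> (frac t)"
  by (simp add: \<gamma>_def chain_path_def)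

lemma \<gamma>_continuous: "continuous_on UNIV \<gamma>"
  unfolding \<gamma>_def using piece by (intro continuous_chain_path piece_link) (auto simp: spans_def arc_imp_path)

lemma \<gamma>_draw:
  obtains \<xi> where "\<gamma> t \<in> draw (X \<xi>)" "\<tau> \<lfloor>t\<rfloor> \<le> \<xi>" "\<xi> \<le> \<tau> (\<lfloor>t\<rfloor> + 1)"
proof -
  have "\<gamma> t \<in> path_image (piece \<lfloor>t\<rfloor>)" unfolding \<gamma>_floor path_image_def
    by (intro imageI) (simp add: frac_ge_0 frac_lt_1 less_imp_le)
  then show thesis using piece[of "\<lfloor>t\<rfloor>"] that unfolding spans_def by auto
qed

lemma \<gamma>_locate:
  assumes "\<gamma> t \<in> draw (X \<xi>)"
  shows "\<tau> \<lfloor>t\<rfloor> \<le> \<xi>" "\<xi> \<le> \<tau> (\<lfloor>t\<rfloor> + 1)"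
proof -
  obtain \<xi>' where \<xi>': "\<gamma> t \<in> draw (X \<xi>')" "\<tau> \<lfloor>t\<rfloor> \<le> \<xi>'" "\<xi>' \<le> \<tau> (\<lfloor>t\<rfloor> + 1)" by (rule \<gamma>_draw)
  have "\<xi> = \<xi>'" using draw_X_disjoint[OF assms \<xi>'(1)] .
  then show "\<tau> \<lfloor>t\<rfloor> \<le> \<xi>" "\<xi> \<le> \<tau> (\<lfloor>t\<rfloor> + 1)" using \<xi>' by simp_all
qed

lemma range_\<gamma>: "range \<gamma> = (\<Union>\<xi>. draw (X \<xi>))"
proof
  show "range \<gamma> \<subseteq> (\<Union>\<xi>. draw (X \<xi>))"
  proof (rule image_subsetI)
    fix t
    obtain \<xi> where "\<gamma> t \<in> draw (X \<xi>)" by (rule \<gamma>_draw)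
    then show "\<gamma> t \<in> (\<Union>\<xi>. draw (X \<xi>))" by blast
  qed
  show "(\<Union>\<xi>. draw (X \<xi>)) \<subseteq> range \<gamma>"
  proof
    fix q assume "q \<in> (\<Union>\<xi>. draw (X \<xi>))"
    then obtain \<xi> where \<xi>: "q \<in> draw (X \<xi>)" by blast
    obtain j where "\<tau> j \<le> \<xi>" "\<xi> \<le> \<tau> (j + 1)" by (rule \<tau>_cell)
    then have "q \<in> path_image (piece j)" using piece[of j] \<xi> unfolding spans_def by auto
    then obtain u where "u \<in> {0..1}" "q = piece j u" by (auto simp: path_image_def)
    then show "q \<in> range \<gamma>" using \<gamma>_piece by (metis rangeI)
  qed
qed

lemma \<gamma>_inj: "inj \<gamma>"
proof -
  have False if eq: "\<gamma> t = \<gamma> t'" and less: "t < t'" for t t'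
  proof -
    obtain \<xi> where \<xi>: "\<gamma> t \<in> draw (X \<xi>)" "\<tau> \<lfloor>t\<rfloor> \<le> \<xi>" "\<xi> \<le> \<tau> (\<lfloor>t\<rfloor> + 1)" by (rule \<gamma>_draw)
    have \<xi>': "\<tau> \<lfloor>t'\<rfloor> \<le> \<xi>" using \<gamma>_locate(1)[of t' \<xi>] \<xi> eq by simp
    have inj: "inj_on (piece j) {0..1}" for j using piece[of j] by (simp add: spans_def arc_def)
    have fr: "frac t \<in> {0..1}" for t :: real using frac_ge_0[of t] frac_lt_1[of t] by auto
    show False
    proof (cases "\<lfloor>t\<rfloor> = \<lfloor>t'\<rfloor>")
      case True
      then have "frac t = frac t'" using eq inj_onD[OF inj[of "\<lfloor>t\<rfloor>"] _ fr fr] unfolding \<gamma>_floor by simp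
      then show ?thesis using True less by (simp add: frac_def)
    next
      case False
      then have "\<lfloor>t\<rfloor> + 1 \<le> \<lfloor>t'\<rfloor>" using less floor_mono[of t t'] by linarith
      then have "\<tau> (\<lfloor>t\<rfloor> + 1) \<le> \<tau> \<lfloor>t'\<rfloor>" by (rule \<tau>_le)
      then have "\<xi> = \<tau> (\<lfloor>t\<rfloor> + 1)" using \<xi> \<xi>' by linarith
      then have "\<gamma> t = pt (\<tau> (\<lfloor>t\<rfloor> + 1))" using \<xi>(1) draw_off_turn[OF \<tau>(1)] by simp
      then have "piece \<lfloor>t\<rfloor> (frac t) = piece \<lfloor>t\<rfloor> 1" using piece[of "\<lfloor>t\<rfloor>"] by (simp add: \<gamma>_floor spans_def pathfinish_def)
      then have "frac t = 1" using inj_onD[OF inj[of "\<lfloor>t\<rfloor>"] _ fr] by simp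
      then show ?thesis using frac_lt_1[of t] by simp
    qed
  qed
  then show ?thesis by (intro injI) (metis linorder_neqE)
qed

lemma \<gamma>_zero: "\<gamma> 0 \<in> draw (X 0)"
proof -
  have "\<gamma> 0 = pathstart (piece 0)" using \<gamma>_piece[of 0 0] by (simp add: pathstart_def)
  then show ?thesis using piece[of 0] draw_off_turn[OF \<tau>(1), of 0] \<tau>(2) by (simp add: spans_def)
qed

text \<open>\<gamma> is not parametrized by \<xi>, but its pieces keep the order of the parameters
  and meet at 0.\<close>

lemma \<gamma>_sign:
  assumes "\<gamma> t \<in> draw (X \<xi>)"
  shows "\<xi> < 0 \<Longrightarrow> t < 0" "0 < \<xi> \<Longrightarrow> 0 < t"
proof -
  note loc = \<gamma>_locate[OF assms]
  show "t < 0" if "\<xi> < 0"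
  proof (rule ccontr)
    assume "\<not> t < 0"
    then have "0 \<le> \<lfloor>t\<rfloor>" by simp
    from \<tau>_le[OF this] show False using loc that \<tau>(2) by simp
  qed
  show "0 < t" if "0 < \<xi>"
  proof (rule ccontr)
    assume n: "\<not> 0 < t"
    have "t \<noteq> 0" using draw_X_disjoint[OF \<gamma>_zero, of \<xi>] assms that by auto
    then have "t < 0" using n by simp
    then have "\<lfloor>t\<rfloor> + 1 \<le> 0" by linarith
    from \<tau>_le[OF this] show False using loc that \<tau>(2) by simp
  qed
qed

lemma KK_range: "range \<gamma> \<subseteq> KK"
  unfolding range_\<gamma> using X_core by blast

lemma draw_X_range: "q \<in> draw (X \<xi>) \<Longrightarrow> q \<in> range \<gamma>"
  unfolding range_\<gamma> by blast

lemma range_\<gamma>_core: "x \<in> tent_core s \<Longrightarrow> q \<in> draw x \<Longrightarrow> q \<in> range \<gamma> \<longleftrightarrow> x \<in> range X"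
  unfolding range_\<gamma> using draw_disjoint[OF _ X_core] by blast

lemma \<gamma>_dense: "KK \<subseteq> closure (\<gamma> ` {a<..})" "KK \<subseteq> closure (\<gamma> ` {..<a})"
proof -
  show "KK \<subseteq> closure (\<gamma> ` {a<..})"
  proof
    fix z assume z: "z \<in> KK"
    show "z \<in> closure (\<gamma> ` {a<..})" unfolding closure_approachable
    proof (intro allI impI)
      fix e :: real assume "e > 0"
      from dense_half[OF z this, of True "\<tau> (\<lfloor>a\<rfloor> + 1)"] obtain \<xi> q where \<xi>: "\<xi> > \<tau> (\<lfloor>a\<rfloor> + 1)" "q \<in> draw (X \<xi>)" "dist q z < e" by auto
      obtain t where t: "q = \<gamma> t" using draw_X_range[OF \<xi>(2)] by blast
      have "a < t"
      proof (rule ccontr)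
        assume "\<not> a < t"
        then have "\<lfloor>t\<rfloor> + 1 \<le> \<lfloor>a\<rfloor> + 1" by (simp add: floor_mono)
        from \<tau>_le[OF this] show False using \<gamma>_locate(2)[of t \<xi>] \<xi> t by simp
      qed
      then show "\<exists>y\<in>\<gamma> ` {a<..}. dist y z < e" using \<xi>(3) t by blast
    qed
  qed
  show "KK \<subseteq> closure (\<gamma> ` {..<a})"
  proof
    fix z assume z: "z \<in> KK"
    show "z \<in> closure (\<gamma> ` {..<a})" unfolding closure_approachable
    proof (intro allI impI)
      fix e :: real assume "e > 0"
      from dense_half[OF z this, of False "\<tau> \<lfloor>a\<rfloor>"] obtain \<xi> q where \<xi>: "\<xi> < \<tau> \<lfloor>a\<rfloor>" "q \<in> draw (X \<xi>)" "dist q z < e" by auto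
      obtain t where t: "q = \<gamma> t" using draw_X_range[OF \<xi>(2)] by blast
      have "t < a"
      proof (rule ccontr)
        assume "\<not> t < a"
        then have "\<lfloor>a\<rfloor> \<le> \<lfloor>t\<rfloor>" by (simp add: floor_mono)
        from \<tau>_le[OF this] show False using \<gamma>_locate(1)[of t \<xi>] \<xi> t by simp
      qed
      then show "\<exists>y\<in>\<gamma> ` {..<a}. dist y z < e" using \<xi>(3) t by blast
    qed
  qed
qed

lemma \<gamma>_codense: "KK \<subseteq> closure (KK - range \<gamma>)"
proof
  fix z assume z: "z \<in> KK"
  show "z \<in> closure (KK - range \<gamma>)" unfolding closure_approachable
  proof (intro allI impI)
    fix e :: real assume "e > 0"
    from codense_draw[OF z this] obtain x q where x: "x \<in> tent_core s" "x \<notin> range X" "q \<in> draw x" "dist q z < e" by blast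
    have "q \<in> KK - range \<gamma>" using range_\<gamma>_core[OF x(1,3)] x by blast
    then show "\<exists>y\<in>KK - range \<gamma>. dist y z < e" using x(4) by blast
  qed
qed

lemma \<gamma>_top: "\<exists>\<eta>>0. \<forall>t. \<bar>t\<bar> < \<eta> \<longrightarrow> snd (\<gamma> t) = 1"
proof -
  define m where "m = min \<delta>0 (3/4)"
  have m: "m > 0" "m \<le> \<delta>0" "m \<le> 3/4" using \<delta>0_pos by (auto simp: m_def)
  have "0 < m" "- m < 0" using m by auto
  then obtain a b where ab: "0 < b" "b < m" "b \<notin> turns" "- m < a" "a < 0" "a \<notin> turns"
    by (metis non_turn_between)
  have t1: "b < \<tau> 1" "\<tau> (-1) < a" using ab m \<tau>(3)[of 1] \<tau>(4)[of "-1"] by auto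
  obtain g1 g2 where g: "spans b (\<tau> 1) g1" "spans (\<tau> (-1)) a g2" using spans_exists t1 ab \<tau>(1) by metis
  \<comment> \<open>Closedness of \<open>C\<close> turns continuity of \<gamma> at 0 into smallness
    of the parameter \<xi>, for which the drawing has height 1.\<close>
  define C where "C = (\<Union>\<xi>\<in>{b..\<tau> 1}. draw (X \<xi>)) \<union> (\<Union>\<xi>\<in>{\<tau> (-1)..a}. draw (X \<xi>))"
  have "C = path_image g1 \<union> path_image g2" using g by (simp add: C_def spans_def)
  moreover have "path g1" "path g2" using g by (auto simp: spans_def arc_imp_path)
  ultimately have C: "closed C" by (simp add: closed_path_image closed_Un)
  have "\<gamma> 0 \<notin> C"
  proof
    assume "\<gamma> 0 \<in> C"
    then obtain \<xi> where "\<gamma> 0 \<in> draw (X \<xi>)" "\<xi> \<noteq> 0" using ab unfolding C_def by force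
    then show False using draw_X_disjoint[OF \<gamma>_zero] by blast
  qed
  moreover have "open (\<gamma> -` (- C))" using C \<gamma>_continuous by (simp add: continuous_on_open_vimage open_Compl)
  ultimately obtain d where d: "d > 0" "\<And>t. \<bar>t\<bar> < d \<Longrightarrow> \<gamma> t \<notin> C"
    unfolding open_dist by (force simp: dist_real_def)
  have "snd (\<gamma> t) = 1" if t: "\<bar>t\<bar> < min d 1" for t
  proof -
    obtain \<xi> where \<xi>: "\<gamma> t \<in> draw (X \<xi>)" "\<tau> \<lfloor>t\<rfloor> \<le> \<xi>" "\<xi> \<le> \<tau> (\<lfloor>t\<rfloor> + 1)" by (rule \<gamma>_draw)
    have "-1 \<le> \<lfloor>t\<rfloor>" "\<lfloor>t\<rfloor> + 1 \<le> 1" using t by linarith+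
    then have "\<tau> (-1) \<le> \<xi>" "\<xi> \<le> \<tau> 1" using \<xi>(2,3) \<tau>_le order_trans by blast+
    moreover have "\<gamma> t \<notin> C" using d t by simp
    ultimately have "a < \<xi>" "\<xi> < b" using \<xi>(1) unfolding C_def by force+
    then have "\<bar>\<xi>\<bar> < \<delta>0" using ab m by linarith
    then show ?thesis using draw_near_fixed_point \<xi>(1) by blast
  qed
  then show ?thesis using d(1) by (intro exI[of _ "min d 1"]) auto
qed

lemma \<gamma>_vertical:
  assumes z: "(x, y) \<in> KK" and w: "w = 1 \<or> w = -1" and e: "e > 0"
    and gap: "\<And>y'. 0 < w * (y' - y) \<Longrightarrow> w * (y' - y) < e \<Longrightarrow> (x, y') \<notin> KK"
  shows "(x, y) \<in> range \<gamma>"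
proof -
  obtain p where p: "p \<in> tent_core s" "(x, y) \<in> draw p" using z by blast
  have "p \<in> range X"
  proof (rule ccontr)
    assume "p \<notin> range X"
    from vertical_accumulation[OF p(1) this p(2) w e] show False using gap by auto
  qed
  then show ?thesis using range_\<gamma>_core[OF p] by blast
qed

lemma \<gamma>_small_cuts:
  assumes z: "z \<in> KK" and e: "e > 0"
  shows "\<exists>g a b. arc g \<and> a < 0 \<and> 0 < b \<and> pathstart g = \<gamma> a \<and> pathfinish g = \<gamma> b \<and>
      path_image g \<inter> KK = {\<gamma> a, \<gamma> b} \<and> path_image g \<subseteq> ball z e \<and> (\<forall>q\<in>path_image g. snd q \<le> 1)"
proof -
  obtain q1 q2 \<xi>1 \<xi>2 where q: "\<xi>1 < 0" "0 < \<xi>2" "q1 \<in> draw (X \<xi>1)" "q2 \<in> draw (X \<xi>2)" "q1 \<noteq> q2"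
    "closed_segment q1 q2 \<inter> KK = {q1, q2}" "closed_segment q1 q2 \<subseteq> ball z e" by (rule small_segment_cut[OF z e])
  obtain a b where ab: "q1 = \<gamma> a" "q2 = \<gamma> b" using draw_X_range q(3,4) by blast
  have "a < 0" "0 < b" using \<gamma>_sign q(1-4) unfolding ab by blast+
  moreover have "snd q \<le> 1" if qs: "q \<in> closed_segment q1 q2" for q
  proof -
    have "convex {q :: real \<times> real. snd q \<le> 1}"
      unfolding convex_def by (auto intro: convex_bound_le)
    moreover have "q1 \<in> {q. snd q \<le> 1}" "q2 \<in> {q. snd q \<le> 1}" using draw_height_le q(3,4) by auto
    ultimately have "closed_segment q1 q2 \<subseteq> {q. snd q \<le> 1}" by (simp add: closed_segment_subset)
    then show ?thesis using qs by blast
  qed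
  ultimately show ?thesis using q(5-7) ab
    by (intro exI[of _ "linepath q1 q2"] exI[of _ a] exI[of _ b]) (simp add: arc_linepath)
qed

section \<open>The drawing as an instance of the planar setting\<close>

lemma phi_R_core: "phi_R s (tent_core s) = KK"
  by (rule phi_R_draw) simp

lemma phi_R_arc_comp: "phi_R s (arc_comp_R s) = range \<gamma>"
proof -
  have "range X \<subseteq> tent_core s" using X_core by blast
  then show ?thesis unfolding arc_comp_R_eq range_\<gamma> by (simp add: phi_R_draw)
qed

lemma dense_line_KK: "dense_line KK \<gamma> 1"
proof
  show "(x, y) \<in> range \<gamma>" if "(x, y) \<in> KK" "0 < e" "\<And>y'. y < y' \<Longrightarrow> y' < y + e \<Longrightarrow> (x, y') \<notin> KK" for x y e
    using that by (intro \<gamma>_vertical[of x y 1 e]) auto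
  show "(x, y) \<in> range \<gamma>" if "(x, y) \<in> KK" "0 < e" "\<And>y'. y - e < y' \<Longrightarrow> y' < y \<Longrightarrow> (x, y') \<notin> KK" for x y e
    using that by (intro \<gamma>_vertical[of x y "-1" e]) auto
  show "snd z \<le> 1" if "z \<in> KK" for z
    using that draw_height_le by blast
  show "z \<in> range \<gamma>" if "z \<in> KK" "snd z = 1" for z
    using that draw_height_top range_\<gamma>_core by blast
qed (fact KK_compact \<gamma>_continuous \<gamma>_inj KK_range \<gamma>_dense \<gamma>_codense \<gamma>_top \<gamma>_small_cuts)+

end

theorem theorem12p1:
  fixes s :: real
  assumes "sqrt 2 < s" and "s < 2"
  shows "fully_accessible (phi_R s (tent_core s)) (phi_R s (arc_comp_R s)) \<and>
         (\<forall>a \<in> phi_R s (tent_core s) - phi_R s (arc_comp_R s).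
            \<not> accessible (phi_R s (tent_core s)) a) \<and>
         (\<exists>!P. simple_dense_canal (phi_R s (tent_core s)) P)"
proof -
  interpret tent_param s using assms by unfold_locales
  interpret line: dense_line "phi_R s (tent_core s)" \<gamma> 1
    unfolding phi_R_core by (rule dense_line_KK)
  show ?thesis
    unfolding phi_R_arc_comp fully_accessible_def
    using line.line_accessible line.not_accessible line.unique_canal by blast
qed

end
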